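(* Let $f\geqslant 1$ be an integer, $q^2=2^{2f+1}$, $r=2^{f+1}$, and let $S={}^2B_2(q^2)$ be the Suzuki group. Let $S\leqslant G\leqslant \mathrm{Aut}(S)$ with $|G:S|=d$. Then the set of irreducible character degrees of $G$ is $$\mathrm{cd}(G)=\{1,\ q^4,\ r(q^2-1)/2\}\cup\{(q^4+1)a,\ (q^2-r+1)(q^2-1)b,\ (q^2+r+1)(q^2-1)c \;:\; a,b,c\mid d\},$$ where $a,b,c$ range over the positive divisors of $d$, with the following exceptions: (i) if $G=\mathrm{Aut}(S)$, then $a\neq 1$; (ii) if $f\equiv 1$ or $2 \pmod 4$ and $G=\mathrm{Aut}(S)$, then $b\neq 1$ and $c\neq 3$; (iii) if $f\equiv 0$ or $3 \pmod 4$ and $G=\mathrm{Aut}(S)$, then $b\neq 3$ and $c\neq 1$. (That is, in each exceptional case the listed values are excluded from the ranges of the parameters $a$, $b$, $c$.)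
   Context: For a finite group $G$, $\mathrm{Irr}(G)$ is the set of ordinary complex irreducible characters of $G$ and $\mathrm{cd}(G)=\{\chi(1)\mid \chi\in\mathrm{Irr}(G)\}$. The Suzuki group ${}^2B_2(q^2)$ with $q^2=2^{2f+1}$ (also denoted $\mathrm{Sz}(2^{2f+1})$) is the simple group of order $(q^4+1)q^4(q^2-1)$; here the symbol $q^2$ denotes the integer $2^{2f+1}$ and $q^4=(q^2)^2$. $S$ is identified with the group of inner automorphisms inside $\mathrm{Aut}(S)$. *)

theory Defs
  imports
    "HOL-Library.Z2"
    "HOL-Algebra.Algebraic_Closure_Type"
    "HOL-Algebra.Generated_Groups"
    "HOL-Algebra.Coset"
    "HOL-Algebra.Bij"
    "Jordan_Normal_Form.Matrix"
    "Jordan_Normal_Form.VS_Connect"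
begin

section \<open>Complex characters of a group\<close>

abbreviation GL :: "'a :: field itself \<Rightarrow> nat \<Rightarrow> 'a mat monoid" where
  "GL ty n \<equiv> units_of (ring_mat ty n ())"

definition complex_rep :: "('g, 'b) monoid_scheme \<Rightarrow> nat \<Rightarrow> ('g \<Rightarrow> complex mat) \<Rightarrow> bool" where
  "complex_rep G n \<rho> \<longleftrightarrow> \<rho> \<in> hom G (GL TYPE(complex) n)"

definition irreducible_rep :: "('g, 'b) monoid_scheme \<Rightarrow> nat \<Rightarrow> ('g \<Rightarrow> complex mat) \<Rightarrow> bool" where
  "irreducible_rep G n \<rho> \<longleftrightarrow>
     complex_rep G n \<rho> \<and> n > 0 \<and>
     (\<forall>W. subspace class_ring W (module_vec TYPE(complex) n) \<and>
          (\<forall>g \<in> carrier G. \<forall>w \<in> W. \<rho> g *\<^sub>v w \<in> W) \<longrightarrow>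
          W = {0\<^sub>v n} \<or> W = carrier_vec n)"

definition mat_trace :: "'a :: comm_monoid_add mat \<Rightarrow> 'a" where
  "mat_trace A = (\<Sum>i<dim_row A. A $$ (i, i))"

text \<open>Characters are restricted to the carrier, so that they are determined by
  their values on the group.\<close>

definition rep_character :: "('g, 'b) monoid_scheme \<Rightarrow> ('g \<Rightarrow> complex mat) \<Rightarrow> 'g \<Rightarrow> complex" where
  "rep_character G \<rho> = (\<lambda>g \<in> carrier G. mat_trace (\<rho> g))"

definition Irr :: "('g, 'b) monoid_scheme \<Rightarrow> ('g \<Rightarrow> complex) set" where
  "Irr G = {rep_character G \<rho> | n \<rho>. irreducible_rep G n \<rho>}"

definition cd :: "('g, 'b) monoid_scheme \<Rightarrow> complex set" where
  "cd G = {\<chi> \<one>\<^bsub>G\<^esub> | \<chi>. \<chi> \<in> Irr G}"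


section \<open>Inner automorphisms and index\<close>

definition Inn :: "('g, 'b) monoid_scheme \<Rightarrow> ('g \<Rightarrow> 'g) set" where
  "Inn G = {\<lambda>h \<in> carrier G. g \<otimes>\<^bsub>G\<^esub> h \<otimes>\<^bsub>G\<^esub> inv\<^bsub>G\<^esub> g | g. g \<in> carrier G}"

definition group_index :: "('g, 'b) monoid_scheme \<Rightarrow> 'g set \<Rightarrow> nat" where
  "group_index G H = card (rcosets\<^bsub>G\<^esub> H)"


section \<open>The Suzuki groups\<close>

text \<open>
  The field with \<open>q\<^sup>2 = 2 ^ (2 * f + 1)\<close> elements is realised inside the algebraic closure of
  the field with two elements, as the set of roots of \<open>X ^ q\<^sup>2 - X\<close>. On it the map
  \<open>x \<mapsto> x ^ 2 ^ (f + 1)\<close> is the automorphism \<open>\<theta>\<close> whose square is \<open>x \<mapsto> x\<^sup>2\<close>,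
  and \<open>x \<mapsto> x ^ 2 ^ f\<close> is its inverse.
\<close>

type_synonym F2bar = "bit alg_closure"

definition suzuki_field :: "nat \<Rightarrow> F2bar set" where
  "suzuki_field f = {x. x ^ (2 ^ (2 * f + 1)) = x}"

definition suzuki_theta :: "nat \<Rightarrow> F2bar \<Rightarrow> F2bar" where
  "suzuki_theta f x = x ^ (2 ^ (f + 1))"

text \<open>
  The generators are those of Suzuki's original matrix group in dimension four:
  the Sylow 2-subgroup of lower unitriangular matrices \<open>S(\<alpha>, \<beta>)\<close>,
  the diagonal torus \<open>M(\<kappa>) = diag (\<zeta>\<^sub>1, \<zeta>\<^sub>2, \<zeta>\<^sub>2\<^sup>-\<^sup>1, \<zeta>\<^sub>1\<^sup>-\<^sup>1)\<close> with
  \<open>\<theta> \<zeta>\<^sub>1 = \<kappa> * \<theta> \<kappa>\<close> and \<open>\<theta> \<zeta>\<^sub>2 = \<kappa>\<close>, that is, \<open>\<zeta>\<^sub>1 = \<kappa> ^ (2 ^ f + 1)\<close> and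
  \<open>\<zeta>\<^sub>2 = \<kappa> ^ 2 ^ f\<close>, and the antidiagonal involution.
\<close>

definition suzuki_unipotent :: "nat \<Rightarrow> F2bar \<Rightarrow> F2bar \<Rightarrow> F2bar mat" where
  "suzuki_unipotent f \<alpha> \<beta> = (let \<theta> = suzuki_theta f in
     mat_of_rows_list 4
       [[1, 0, 0, 0],
        [\<alpha>, 1, 0, 0],
        [\<beta>, \<theta> \<alpha>, 1, 0],
        [\<alpha>\<^sup>2 * \<theta> \<alpha> + \<alpha> * \<beta> + \<theta> \<beta>, \<alpha> * \<theta> \<alpha> + \<beta>, \<alpha>, 1]])"

definition suzuki_torus :: "nat \<Rightarrow> F2bar \<Rightarrow> F2bar mat" where
  "suzuki_torus f \<kappa> = (let \<zeta>1 = \<kappa> ^ (2 ^ f + 1); \<zeta>2 = \<kappa> ^ (2 ^ f) in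
     mat_of_rows_list 4
       [[\<zeta>1, 0, 0, 0],
        [0, \<zeta>2, 0, 0],
        [0, 0, inverse \<zeta>2, 0],
        [0, 0, 0, inverse \<zeta>1]])"

definition suzuki_flip :: "F2bar mat" where
  "suzuki_flip = mat_of_rows_list 4
     [[0, 0, 0, 1],
      [0, 0, 1, 0],
      [0, 1, 0, 0],
      [1, 0, 0, 0]]"

definition suzuki_gens :: "nat \<Rightarrow> F2bar mat set" where
  "suzuki_gens f =
     {suzuki_unipotent f \<alpha> \<beta> | \<alpha> \<beta>. \<alpha> \<in> suzuki_field f \<and> \<beta> \<in> suzuki_field f} \<union>
     {suzuki_torus f \<kappa> | \<kappa>. \<kappa> \<in> suzuki_field f \<and> \<kappa> \<noteq> 0} \<union>
     {suzuki_flip}"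

definition suzuki_group :: "nat \<Rightarrow> F2bar mat monoid" where
  "suzuki_group f =
     (GL TYPE(F2bar) 4)\<lparr>carrier := generate (GL TYPE(F2bar) 4) (suzuki_gens f)\<rparr>"

end

theory Submission
 imports Defs "Jordan_Normal_Form.Spectral_Radius" "HOL-Number_Theory.Number_Theory"
begin

text \<open>
 If \<open>G\<close> is a split extension of \<open>S\<close> by a cyclic group, then an irreducible character \<open>\<chi>\<close> of \<open>S\<close> extends to
 its stabiliser, and all irreducible characters of \<open>G\<close> over \<open>\<chi>\<close> are induced from such extensions. They have
 degree \<open>k \<chi>(1)\<close>, where \<open>k\<close> is the length of the orbit of \<open>\<chi>\<close>. Every automorphism of the Suzuki group is
 inner times a power of the Frobenius map \<open>fr\<close>: after conjugation it fixes \<open>U 0 1\<close>, \<open>U 1 0\<close> and \<open>w\<close>, and then it acts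
 on the centre of the Sylow 2-subgroup as a field automorphism. It remains to find the degrees of the Suzuki
 group and the orbits of \<open>fr\<close>.

 The elements with trace \<open>a \<noteq> 0\<close> form one class, which meets exactly one of three types of cyclic tori, of orders
 \<open>Q - 1\<close>, \<open>Np = Q + R + 1\<close> and \<open>Nm = Q - R + 1\<close>; this follows by counting from a bound on the centralisers,
 obtained from their eigenvalues. A character induced from a torus, minus a combination of characters induced
 from the Sylow 2-subgroup, is up to sign irreducible. Together with the trivial character, the Steinberg
 character and two characters of degree \<open>R (Q - 1) / 2\<close> these are all, since their squared degrees sum to the
 group order.

 On the characters of a torus of order \<open>M\<close>, numbered by \<open>k\<close> modulo \<open>M\<close>, \<open>fr\<close> doubles \<open>k\<close>, and \<open>k\<close> is determined up to
 multiplication by \<open>\<plusminus> 1\<close>, and also by \<open>\<plusminus> Q\<close> for the last two types. Every divisor of \<open>2 f + 1\<close> is an orbit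
 length, except that length \<open>1\<close> does not occur for \<open>M = Q - 1\<close>, and that for the other types length \<open>1\<close> needs
 \<open>5 dvd M\<close> (as \<open>4 = - 1\<close> modulo \<open>5\<close>) and length \<open>3\<close> needs \<open>13 dvd M\<close> (as \<open>64 = - 1\<close> modulo \<open>13\<close>).
\<close>

text \<open>The argument is driven by estimates that leave no slack. The trace fibre over a nonzero
  value contains the class of one explicit matrix, the fibre over zero has at least
  \<open>Q^4\<close> elements, and the resulting lower bounds add up to the group order; in the same
  way upper bounds for the number of traces of each type add up to \<open>Q - 1\<close>, and this
  exactness decides conjugacy inside a torus. The two characters of degree
  \<open>R (Q - 1) / 2\<close> are not constructed directly: they are what remains of a character
  induced from one of degree \<open>R / 2\<close> of the Sylow 2-subgroup after every known
  constituent is removed. The residue of \<open>f\<close> modulo 4 enters through the factorisation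
  of \<open>4^m + 1\<close> into \<open>2^m + 2^(p+1) + 1\<close> and
  \<open>2^m - 2^(p+1) + 1\<close> for \<open>m = 2p + 1\<close>, which decides whether 5 and 13
  divide \<open>Np\<close> or \<open>Nm\<close>. If \<open>G\<close> is not the full automorphism
  group, its outer part is generated by \<open>fr^j\<close> with odd \<open>j >= 3\<close>; orbits
  of \<open>fr\<close> of length \<open>b j\<close> then split into orbits of length
  \<open>b\<close>, and this removes the exceptions. The one case without such an orbit is
  \<open>b = 1\<close>, \<open>j = 3\<close> with 13 not dividing the torus order; then 5 divides it
  and \<open>fr\<close> fixes a character.\<close>

abbreviation (input) iff_ascii (infixr "<->" 25) where "A <-> B == A = B"
notation mult_mat_vec (infixl "*v" 70) and smult_mat (infixl "*m" 70) and smult_vec (infixl "*s" 70)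
abbreviation "I4 == 1\<^sub>m 4"
abbreviation "cmat == carrier_mat"
abbreviation "cvec == carrier_vec"
lemmas amm = assoc_mult_mat and mrl = mat_of_rows_list_def

section \<open>Matrices and invariant subspaces\<close>

lemma mat_trace_mult_comm:
 fixes A B :: "'a :: comm_semiring_1 mat"
 assumes "A : cmat n m" "B : cmat m n"
 shows "mat_trace (A * B) = mat_trace (B * A)"
proof -
 have "mat_trace (A * B) = (\<Sum>i<n. \<Sum>j<m. A $$ (i,j) * B $$ (j,i))"
  using assms by (simp add: mat_trace_def scalar_prod_def atLeast0LessThan)
 also have "... = (\<Sum>j<m. \<Sum>i<n. B $$ (j,i) * A $$ (i,j))"
  by (subst sum.swap) (simp add: mult.commute)
 also have "... = mat_trace (B * A)"
  using assms by (simp add: mat_trace_def scalar_prod_def atLeast0LessThan)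
 finally show ?thesis .
qed

lemma mat_trace_add:
 "A : cmat n n ==> B : cmat n n ==> mat_trace (A + B) = mat_trace A + mat_trace B"
 by (simp add: mat_trace_def sum.distrib)

lemma mat_trace_smult:
 fixes A :: "'a :: comm_semiring_1 mat"
 assumes "A : cmat n n"
 shows "mat_trace (c *m A) = c * mat_trace A"
 using assms by (simp add: mat_trace_def sum_distrib_left)

lemma mat_trace_one [simp]: "mat_trace (1\<^sub>m n :: 'a :: semiring_1 mat) = of_nat n"
 by (simp add: mat_trace_def)

lemma mult_mat_vec_unit_index:
 "(A :: 'a :: semiring_1 mat) : cmat n m ==> j < m ==> i < n ==> (A *v unit_vec m j) $ i = A $$ (i, j)"
 by auto

lemma mat_eq_by_vec:
 fixes A B :: "'a :: semiring_1 mat"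
 assumes "A : cmat n m" "B : cmat n m"
  and "!!v. v : cvec m ==> A *v v = B *v v"
 shows "A = B"
proof (rule eq_matI)
 fix i j assume "i < dim_row B" "j < dim_col B"
 hence ij: "i < n" "j < m" using assms by auto
 have "(A *v unit_vec m j) $ i = (B *v unit_vec m j) $ i" by (simp add: assms(3))
 thus "A $$ (i,j) = B $$ (i,j)"
  using ij assms(1,2) by (simp add: mult_mat_vec_unit_index)
qed (use assms in auto)

text \<open>If \<open>n < m\<close>, padding with zeros makes both matrices square. A one-sided
  inverse of a square matrix is two-sided, but row \<open>n\<close> of \<open>J0\<close> is
  zero.\<close>

lemma left_inverse_dim_le:
 fixes J L :: "'a :: field mat"
 assumes J: "J : cmat n m" and L: "L : cmat m n" and LJ: "L * J = 1\<^sub>m m"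
 shows "m <= n"
proof (rule ccontr)
 assume "~ m <= n"
 hence nm: "n < m" by simp
 define J0 where "J0 = mat m m (%(i,j). if i < n then J $$ (i,j) else 0)"
 define L0 where "L0 = mat m m (%(i,j). if j < n then L $$ (i,j) else 0)"
 have c: "J0 : cmat m m" "L0 : cmat m m" by (auto simp: J0_def L0_def)
 have "L0 * J0 = L * J"
 proof (rule eq_matI)
  fix i j assume "i < dim_row (L * J)" "j < dim_col (L * J)"
  hence ij: "i < m" "j < m" using J L by auto
  have "(L0 * J0) $$ (i,j) = (\<Sum>k<m. if k < n then L $$ (i,k) * J $$ (k,j) else 0)"
   using ij by (auto simp: J0_def L0_def scalar_prod_def atLeast0LessThan intro!: sum.cong)
  also have "... = (\<Sum>k<n. L $$ (i,k) * J $$ (k,j))"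
   using nm by (intro sum.mono_neutral_cong_right) auto
  also have "... = (L * J) $$ (i,j)"
   using ij J L by (simp add: scalar_prod_def atLeast0LessThan)
  finally show "(L0 * J0) $$ (i,j) = (L * J) $$ (i,j)" .
 qed (use J L in \<open>auto simp: J0_def L0_def\<close>)
 hence "J0 * L0 = 1\<^sub>m m"
  using mat_mult_left_right_inverse c LJ by metis
 moreover have "(J0 * L0) $$ (n, n) = 0"
  using nm by (simp add: J0_def L0_def scalar_prod_def)
 ultimately show False using nm by simp
qed

lemma vec_subspace_iff:
 "subspace class_ring W (module_vec TYPE('a :: field) n) <->
  W <= cvec n & 0\<^sub>v n : W & (ALL u:W. ALL v:W. u + v : W) & (ALL c. ALL v:W. c *s v : W)"
proof -
 have "submodule class_ring W (module_vec TYPE('a) n) <->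
  W <= cvec n & 0\<^sub>v n : W & (ALL u:W. ALL v:W. u + v : W) & (ALL c. ALL v:W. c *s v : W)"
  using vec_module[of n, where 'a='a]
  by (auto simp: submodule_def class_ring_simps module_vec_simps)
 thus ?thesis
  using vec_vs[of n, where 'a='a] by (auto simp: subspace_def)
qed

text \<open>A subspace is the range of a matrix with a left inverse: a left-invertible matrix with range
 in \<open>W\<close> and the maximal number of columns exhausts \<open>W\<close>, since otherwise one more column can be added.\<close>

lemma subspace_range:
 fixes W :: "'a :: field vec set"
 assumes sub: "W <= cvec n" "0\<^sub>v n : W"
  and add: "!!u v. u : W ==> v : W ==> u + v : W"
  and smult: "!!c v. v : W ==> c *s v : W"
 obtains m J L where "J : cmat n m" "L : cmat m n" "L * J = 1\<^sub>m m"
  "W = (%x. J *v x) ` cvec m"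
proof -
 define P where "P m <-> (EX J L. J : cmat n m & L : cmat m n & L * J = 1\<^sub>m m &
   (ALL x:cvec m. J *v x : W))" for m
 have "0\<^sub>m n 0 *v x = 0\<^sub>v n" if "x : cvec 0" for x :: "'a vec"
  using that by (intro eq_vecI) (auto simp: scalar_prod_def)
 hence "P 0" unfolding P_def
  using sub by (intro exI[of _ "0\<^sub>m n 0"] exI[of _ "0\<^sub>m 0 n"]) auto
 moreover have "!!m. P m ==> m <= n" unfolding P_def using left_inverse_dim_le by blast
 ultimately obtain m where m: "P m" and max: "!!k. P k ==> k <= m"
  by (metis Nat.ex_has_greatest_nat)
 obtain J L where J: "J : cmat n m" and L: "L : cmat m n" and LJ: "L * J = 1\<^sub>m m"
  and JW: "!!x. x : cvec m ==> J *v x : W"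
  using m unfolding P_def by blast
 have "v : (%x. J *v x) ` cvec m" if v: "v : W" for v
 proof (rule ccontr)
  assume nv: "v ~: (%x. J *v x) ` cvec m"
  have vc: "v : cvec n" using v sub by auto
  have Lv: "L *v v : cvec m" using L vc by simp
  have JLv: "J *v (L *v v) : cvec n" using J Lv by simp
  define u where "u = v - J *v (L *v v)"
  have uc: "u : cvec n" using vc JLv by (auto simp: u_def)
  have "v ~= J *v (L *v v)" using nv Lv by auto
  hence "u ~= 0\<^sub>v n" using vc JLv unfolding u_def
   by (metis add.right_neutral add_diff_cancel_right' carrier_vecD eq_vecI index_minus_vec(1) index_zero_vec(1) right_minus_eq)
  then obtain i where i: "i < n" "u $ i ~= 0"
   using uc by (metis carrier_vecD eq_vecI index_zero_vec)
  have uW: "u : W"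
  proof -
   have "u = v + (-1) *s (J *v (L *v v))"
    using vc J by (intro eq_vecI) (auto simp: u_def)
   thus ?thesis using add smult v JW Lv by metis
  qed
  have Lu: "L *v u = 0\<^sub>v m"
  proof -
   have "L *v (J *v (L *v v)) = (L * J) *v (L *v v)"
    using L J Lv by (metis assoc_mult_mat_vec)
   thus ?thesis unfolding u_def using L J vc Lv LJ
    by (simp add: mult_minus_distrib_mat_vec)
  qed
  define E where "E = J * L"
  have E: "E : cmat n n" using J L by (simp add: E_def)
  \<comment> \<open>The complement of \<open>E\<close> kills the range of \<open>J\<close> and fixes
    \<open>u\<close>; its row \<open>i\<close>, divided by \<open>u $ i\<close>, is therefore the
    missing row of the left inverse.\<close>
  define l where "l = row (1\<^sub>m n - E) i"
  have lc: "l : cvec n" using E i unfolding l_def by (intro row_carrier_vec) auto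
  have EJ: "E * J = J" using J L LJ unfolding E_def by (simp add: assoc_mult_mat)
  have E1: "1\<^sub>m n - E : cmat n n" using E by (rule minus_carrier_mat)
  have "(1\<^sub>m n - E) * J = 0\<^sub>m n m" using J E EJ
   by (subst minus_mult_distrib_mat[where nr=n and n=n and nc=m]) auto
  hence lJ: "l \<bullet> col J j = 0" if "j < m" for j
   using that i J E E1 index_mult_mat(1)[of i "1\<^sub>m n - E" j J] by (simp add: l_def)
  have "(1\<^sub>m n - E) *v u = u - E *v u" using E uc
   by (subst minus_mult_distrib_mat_vec[where nr=n and nc=n]) auto
  moreover have "E *v u = 0\<^sub>v n" unfolding E_def using J L uc Lu
   by (subst assoc_mult_mat_vec[where n\<^sub>1=n and n\<^sub>2=m and n\<^sub>3=n]) (auto intro!: eq_vecI)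
  ultimately have "(1\<^sub>m n - E) *v u = u" using uc by simp
  hence lu: "l \<bullet> u = u $ i" using i E
   by (metis index_minus_mat(2) index_mult_mat_vec l_def carrier_matD(1))
  define J' where "J' = mat n (Suc m) (%(a,b). if b < m then J $$ (a,b) else u $ a)"
  define L' where "L' = mat (Suc m) n (%(a,b). if a < m then L $$ (a,b) else l $ b / u $ i)"
  have J': "J' : cmat n (Suc m)" and L': "L' : cmat (Suc m) n"
   by (auto simp: J'_def L'_def)
  have colJ': "col J' b = (if b < m then col J b else u)" if "b < Suc m" for b
   using that J uc by (intro eq_vecI) (auto simp: J'_def)
  have rowL': "row L' a = (if a < m then row L a else (1 / u $ i) *s l)" if "a < Suc m" for a
   using that L lc by (intro eq_vecI) (auto simp: L'_def)
  have "L' * J' = 1\<^sub>m (Suc m)"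
  proof (rule eq_matI)
   fix a b assume "a < dim_row (1\<^sub>m (Suc m) :: 'a mat)" "b < dim_col (1\<^sub>m (Suc m) :: 'a mat)"
   hence ab: "a < Suc m" "b < Suc m" by auto
   have 1: "(L' * J') $$ (a,b) = row L' a \<bullet> col J' b" using ab J' L' by simp
   have 2: "row L a \<bullet> col J b = 1\<^sub>m m $$ (a,b)" if "a < m" "b < m"
    using that J L LJ by (metis index_mult_mat(1) carrier_matD)
   have 3: "row L a \<bullet> u = 0" if "a < m"
    using that L Lu by (metis index_mult_mat_vec carrier_matD(1) index_zero_vec(1))
   show "(L' * J') $$ (a,b) = 1\<^sub>m (Suc m) $$ (a,b)"
    unfolding 1 using ab 2 3 lJ lu i(2) lc J uc
    by (auto simp: colJ' rowL' less_Suc_eq)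
  qed (use J' L' in auto)
  moreover have "J' *v x : W" if x: "x : cvec (Suc m)" for x
  proof -
   define y where "y = vec m (%k. x $ k)"
   have "J' *v x = J *v y + (x $ m) *s u"
    using J uc x by (intro eq_vecI)
     (auto simp: J'_def y_def scalar_prod_def mult.commute intro!: sum.cong)
   thus ?thesis using add smult JW uW by (simp add: y_def)
  qed
  ultimately have "P (Suc m)" unfolding P_def using J' L' by blast
  thus False using max by fastforce
 qed
 hence "W = (%x. J *v x) ` cvec m" using JW by auto
 thus ?thesis using that J L LJ by blast
qed

section \<open>Representations of finite groups\<close>

locale fin_group = group G for G (structure) +
 assumes fin [simp]: "finite (carrier G)"

lemma GL_carrier:
 "A : carrier (GL TYPE('a :: field) n) <-> A : cmat n n & (EX B:cmat n n. B * A = 1\<^sub>m n & A * B = 1\<^sub>m n)"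
 by (auto simp: units_of_carrier Units_def ring_mat_simps)

lemma GL_mult [simp]: "monoid.mult (GL TYPE('a :: field) n) A B = A * B"
 unfolding units_of_mult unfolding ring_mat_simps by (rule refl)

lemma GL_one [simp]: "monoid.one (GL TYPE('a :: field) n) = 1\<^sub>m n"
 by (simp only: units_of_one ring_mat_simps)

context fin_group
begin

abbreviation "CG == carrier G"

lemma complex_rep_iff:
 "complex_rep G n \<rho> <-> (ALL g:CG. \<rho> g : cmat n n) &
   (ALL g:CG. ALL h:CG. \<rho> (g \<otimes> h) = \<rho> g * \<rho> h) & \<rho> \<one> = 1\<^sub>m n"
proof
 assume *: "complex_rep G n \<rho>"
 hence c: "\<rho> g : carrier (GL TYPE(complex) n)" if "g : CG" for g
  using that by (auto simp: complex_rep_def hom_def)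
 have m: "\<rho> (g \<otimes> h) = \<rho> g * \<rho> h" if "g : CG" "h : CG" for g h
  using that * by (auto simp: complex_rep_def hom_def)
 obtain B where B: "\<rho> \<one> : cmat n n" "B : cmat n n" "B * \<rho> \<one> = 1\<^sub>m n"
  using c[OF one_closed] unfolding GL_carrier by blast
 have "\<rho> \<one> = (B * \<rho> \<one>) * \<rho> \<one>" by (simp only: B(3) left_mult_one_mat[OF B(1)])
 also have "... = B * (\<rho> \<one> * \<rho> \<one>)" using B(1,2) by (simp add: assoc_mult_mat)
 also have "... = 1\<^sub>m n" using m[of \<one> \<one>] B by simp
 finally show "(ALL g:CG. \<rho> g : cmat n n) &
   (ALL g:CG. ALL h:CG. \<rho> (g \<otimes> h) = \<rho> g * \<rho> h) & \<rho> \<one> = 1\<^sub>m n"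
  using m c unfolding GL_carrier by auto
next
 assume *: "(ALL g:CG. \<rho> g : cmat n n) &
   (ALL g:CG. ALL h:CG. \<rho> (g \<otimes> h) = \<rho> g * \<rho> h) & \<rho> \<one> = 1\<^sub>m n"
 have "\<rho> g : carrier (GL TYPE(complex) n)" if g: "g : CG" for g
  unfolding GL_carrier
 proof (intro conjI bexI[of _ "\<rho> (inv g)"])
  show "\<rho> (inv g) * \<rho> g = 1\<^sub>m n" "\<rho> g * \<rho> (inv g) = 1\<^sub>m n"
   using * g by (metis inv_closed l_inv, metis inv_closed r_inv)
 qed (use * g in auto)
 thus "complex_rep G n \<rho>" using * by (auto simp: complex_rep_def hom_def)
qed

lemma rep_mat [intro]: "complex_rep G n \<rho> ==> g : CG ==> \<rho> g : cmat n n"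
 and rep_mult: "complex_rep G n \<rho> ==> g : CG ==> h : CG ==> \<rho> (g \<otimes> h) = \<rho> g * \<rho> h"
 and rep_one: "complex_rep G n \<rho> ==> \<rho> \<one> = 1\<^sub>m n"
 by (auto simp: complex_rep_iff)

lemma rep_inv:
 assumes "complex_rep G n \<rho>" "g : CG"
 shows "\<rho> (inv g) * \<rho> g = 1\<^sub>m n" "\<rho> g * \<rho> (inv g) = 1\<^sub>m n"
 using assms by (metis rep_mult rep_one inv_closed l_inv, metis rep_mult rep_one inv_closed r_inv)

lemma irr_rep: "irreducible_rep G n \<rho> ==> complex_rep G n \<rho>"
 by (simp add: irreducible_rep_def)

lemma irr_rep_pos: "irreducible_rep G n \<rho> ==> 0 < n"
 by (simp add: irreducible_rep_def)

lemma irr_subspace: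
 assumes "irreducible_rep G n \<rho>" "W <= cvec n" "0\<^sub>v n : W"
  and "!!u v. u : W ==> v : W ==> u + v : W" "!!c v. v : W ==> c *s v : W"
  and "!!g w. g : CG ==> w : W ==> \<rho> g *v w : W"
 shows "W = {0\<^sub>v n} | W = cvec n"
proof -
 have "subspace class_ring W (module_vec TYPE(complex) n)"
  unfolding vec_subspace_iff by (intro conjI ballI allI) (fact assms(2-5) | rule assms(4,5), assumption+)+
 moreover have "ALL g:CG. ALL w:W. \<rho> g *v w : W" using assms(6) by blast
 ultimately show ?thesis using assms(1) unfolding irreducible_rep_def by (elim conjE allE[of _ W]) iprover
qed

text \<open>Hypothesis \<open>E\<close> allows the projection \<open>J * L\<close> to be inserted
  between two factors. An invariant range of the projection gives this from the right factor, an
  invariant kernel from the left one, so subrepresentations and quotients are both covered.\<close>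

lemma compress_rep:
 assumes rep: "complex_rep G n \<rho>" and J: "J : cmat n m" and L: "L : cmat m n" and LJ: "L * J = 1\<^sub>m m"
  and E: "!!g h. g : CG ==> h : CG ==> (L * \<rho> g) * (J * L) * (\<rho> h * J) = (L * \<rho> g) * (\<rho> h * J)"
 shows "complex_rep G m (%g. L * (\<rho> g * J))"
 unfolding complex_rep_iff
proof (intro conjI ballI)
 fix g h assume g: "g : CG" and h: "h : CG"
 note c = rep_mat[OF rep g] rep_mat[OF rep h]
 have "L * (\<rho> (g \<otimes> h) * J) = (L * \<rho> g) * (\<rho> h * J)" using c J L
  by (simp add: rep_mult[OF rep g h] amm[of _ n n _ n _ m] amm[of _ m n _ n _ m])
 also have "... = (L * (\<rho> g * J)) * (L * (\<rho> h * J))" unfolding E[OF g h, symmetric] using c J L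
  by (simp add: amm[of _ m n _ n _ m] amm[of _ n m _ n _ m] amm[of _ n n _ m _ m] amm[of _ m n _ m _ m])
 finally show "L * (\<rho> (g \<otimes> h) * J) = (L * (\<rho> g * J)) * (L * (\<rho> h * J))" .
qed (use rep_mat[OF rep] rep_one[OF rep] J L LJ in auto)

text \<open>Since only traces are compared, a composition series suffices and Maschke's averaging is
  avoided: any projection \<open>E\<close> onto the invariant subspace will do, and compressing to
  its kernel gives the quotient representation.\<close>

lemma rep_complement:
 assumes rep: "complex_rep G n \<rho>"
  and J: "J : cmat n m" and L: "L : cmat m n" and LJ: "L * J = 1\<^sub>m m"
  and inv: "!!g. g : CG ==> EX B:cmat m m. \<rho> g * J = J * B"
 obtains A k D where "complex_rep G m A" "complex_rep G k D"
  "!!g. g : CG ==> mat_trace (\<rho> g) = mat_trace (A g) + mat_trace (D g)"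
proof -
 define E where "E = J * L"
 have E: "E : cmat n n" using J L by (simp add: E_def)
 have EJ: "E * J = J" using J L LJ unfolding E_def by (simp add: assoc_mult_mat)
 have LE: "L * E = L" using J L LJ unfolding E_def by (simp flip: assoc_mult_mat)
 define W2 where "W2 = {v : cvec n. E *v v = 0\<^sub>v n}"
 have "W2 <= cvec n" "0\<^sub>v n : W2"
  "!!u v. u : W2 ==> v : W2 ==> u + v : W2" "!!c v. v : W2 ==> c *s v : W2"
  using E by (auto simp: W2_def mult_add_distrib_mat_vec mult_mat_vec intro!: eq_vecI)
 then obtain k J2 L2 where J2: "J2 : cmat n k" and L2: "L2 : cmat k n" and LJ2: "L2 * J2 = 1\<^sub>m k"
  and WJ2: "W2 = (%x. J2 *v x) ` cvec k"
  by (rule subspace_range)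
 define K where "K = L2 * (1\<^sub>m n - E)"
 have E1: "1\<^sub>m n - E : cmat n n" using E by (rule minus_carrier_mat)
 have K: "K : cmat k n" using L2 E1 by (simp add: K_def)
 have EJ2: "E * J2 = 0\<^sub>m n k"
 proof (rule mat_eq_by_vec)
  fix v :: "complex vec" assume v: "v : cvec k"
  hence "J2 *v v : W2" using WJ2 by auto
  thus "E * J2 *v v = 0\<^sub>m n k *v v"
   using E J2 v unfolding W2_def by (auto intro!: eq_vecI simp: assoc_mult_mat_vec)
 qed (use E J2 in auto)
 have "(1\<^sub>m n - E) * J = 0\<^sub>m n m" using J E EJ
  by (subst minus_mult_distrib_mat[where nr=n and n=n and nc=m]) auto
 hence KJ: "K * J = 0\<^sub>m k m" unfolding K_def using L2 E1 J by (simp add: amm[of _ k n _ n _ m])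
 have KJ2: "K * J2 = 1\<^sub>m k"
 proof -
  have "(1\<^sub>m n - E) * J2 = J2" using J2 E EJ2
   by (subst minus_mult_distrib_mat[where nr=n and n=n and nc=k]) (auto intro!: eq_matI)
  thus ?thesis unfolding K_def using L2 E1 J2 LJ2 by (simp add: amm[of _ k n _ n _ k])
 qed
 have J2K: "J2 * K = 1\<^sub>m n - E"
 proof (rule mat_eq_by_vec)
  fix v :: "complex vec" assume v: "v : cvec n"
  have vE: "(1\<^sub>m n - E) *v v = v - E *v v" using E v
   by (subst minus_mult_distrib_mat_vec[where nr=n and nc=n]) auto
  have "E *v (E *v v) = E *v v"
  proof -
   have "E *v (E *v v) = (E * E) *v v" using E v by simp
   moreover have "E * E = E" unfolding E_def using J L LE[unfolded E_def] by (simp add: amm[of _ n m _ n _ n])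
   ultimately show ?thesis by simp
  qed
  hence "(1\<^sub>m n - E) *v v : W2" unfolding W2_def vE using E v
   by (auto simp: mult_minus_distrib_mat_vec)
  then obtain y where y: "y : cvec k" "(1\<^sub>m n - E) *v v = J2 *v y" using WJ2 by auto
  have "K *v v = L2 *v (J2 *v y)" unfolding K_def using L2 E1 v y(2)
   by (subst assoc_mult_mat_vec) auto
  also have "... = (L2 * J2) *v y" using L2 J2 y by simp
  also have "... = y" using LJ2 y by simp
  finally show "J2 * K *v v = (1\<^sub>m n - E) *v v" using J2 K v y by simp
 qed (use J2 K E1 in auto)
 have JLJK: "J * L + J2 * K = 1\<^sub>m n"
  unfolding J2K E_def[symmetric] using E by (intro eq_matI) auto
 define A where "A g = L * (\<rho> g * J)" for g
 define D where "D g = K * (\<rho> g * J2)" for g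
 note c = rep_mat[OF rep]
 have repA: "complex_rep G m A" unfolding A_def
 proof (rule compress_rep[OF rep J L LJ])
  fix g h assume g: "g : CG" and h: "h : CG"
  obtain B where B: "B : cmat m m" "\<rho> h * J = J * B" using inv[OF h] by blast
  have "E * (\<rho> h * J) = (E * J) * B" unfolding B(2) using E J B(1) by (intro amm[symmetric]) auto
  moreover have "(L * \<rho> g) * E * (\<rho> h * J) = (L * \<rho> g) * (E * (\<rho> h * J))"
   by (rule amm[of _ m n _ n _ m]) (use c[OF g] c[OF h] J L E in auto)
  ultimately show "(L * \<rho> g) * (J * L) * (\<rho> h * J) = (L * \<rho> g) * (\<rho> h * J)" unfolding E_def[symmetric] EJ B(2) by simp
 qed
 \<comment> \<open>The range of \<open>\<rho> g * E\<close> lies in that of \<open>J\<close>, which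
   \<open>K\<close> kills; so \<open>K * \<rho> g\<close> does not see the difference between
   \<open>J2 * K\<close> and the identity.\<close>
 have KE: "(K * \<rho> g) * (J2 * K) = K * \<rho> g" if g: "g : CG" for g
 proof -
  obtain B where B: "B : cmat m m" "\<rho> g * J = J * B" using inv[OF g] by blast
  have "(K * \<rho> g) * E = K * ((\<rho> g * J) * L)" unfolding E_def using K c[OF g] J L
   by (simp add: amm[of _ k n _ n _ n] amm[of _ n n _ m _ n])
  also have "... = (K * J) * (B * L)" unfolding B(2) using K J L B(1)
   by (simp add: amm[of _ n m _ m _ n] amm[of _ k n _ m _ n])
  finally have "(K * \<rho> g) * E = 0\<^sub>m k n" unfolding KJ using B L by simp
  thus ?thesis unfolding J2K using K c[OF g] E by (subst mult_minus_distrib_mat[of _ k n _ n]) auto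
 qed
 have repD: "complex_rep G k D" unfolding D_def
  by (rule compress_rep[OF rep J2 K KJ2]) (simp add: KE)
 have tr: "mat_trace (\<rho> g) = mat_trace (A g) + mat_trace (D g)" if g: "g : CG" for g
 proof -
  have "\<rho> g = \<rho> g * (J * L + J2 * K)" using JLJK c[OF g] by simp
  also have "... = (\<rho> g * J) * L + (\<rho> g * J2) * K" using c[OF g] J L J2 K
   by (simp add: mult_add_distrib_mat[of _ n n _ n] amm[of _ n n _ m _ n] amm[of _ n n _ k _ n])
  finally have "mat_trace (\<rho> g) = mat_trace ((\<rho> g * J) * L) + mat_trace ((\<rho> g * J2) * K)"
   using mat_trace_add[of "\<rho> g * J * L" n "\<rho> g * J2 * K"] c[OF g] J L J2 K by simp
  moreover have "mat_trace ((\<rho> g * J) * L) = mat_trace (A g)" unfolding A_def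
   by (rule mat_trace_mult_comm[of _ n m]) (use c[OF g] J L in auto)
  moreover have "mat_trace ((\<rho> g * J2) * K) = mat_trace (D g)" unfolding D_def
   by (rule mat_trace_mult_comm[of _ n k]) (use c[OF g] J2 K in auto)
  ultimately show ?thesis by simp
 qed
 show ?thesis by (rule that[of A k D]) (fact repA repD tr)+
qed

lemma rep_block:
 assumes rep: "complex_rep G n \<rho>" and n: "0 < n" and red: "~ irreducible_rep G n \<rho>"
 obtains m k A D where "m < n" "k < n" "complex_rep G m A" "complex_rep G k D"
  "!!g. g : CG ==> mat_trace (\<rho> g) = mat_trace (A g) + mat_trace (D g)"
proof -
 obtain W where sub: "subspace class_ring W (module_vec TYPE(complex) n)"
  and inv0: "ALL g:CG. ALL w:W. \<rho> g *v w : W" and WW: "~ (W = {0\<^sub>v n} | W = cvec n)"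
  using red rep n unfolding irreducible_rep_def by auto
 have W: "W <= cvec n" "0\<^sub>v n : W"
  "!!u v. u : W ==> v : W ==> u + v : W" "!!c v. v : W ==> c *s v : W"
  using sub unfolding vec_subspace_iff by simp_all
 have inv: "!!g w. g : CG ==> w : W ==> \<rho> g *v w : W"
  and W0: "W ~= {0\<^sub>v n}" and Wn: "W ~= cvec n" using inv0 WW by simp_all
 obtain m J L where J: "J : cmat n m" and L: "L : cmat m n" and LJ: "L * J = 1\<^sub>m m"
  and WJ: "W = (%x. J *v x) ` cvec m"
  using subspace_range[OF W] by metis
 have "EX B:cmat m m. \<rho> g * J = J * B" if g: "g : CG" for g
 proof (intro bexI mat_eq_by_vec)
  note c = rep_mat[OF rep g]
  fix x :: "complex vec" assume x: "x : cvec m"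
  have "\<rho> g *v (J *v x) : W" using inv g WJ x by auto
  then obtain y where y: "y : cvec m" "\<rho> g *v (J *v x) = J *v y" using WJ by auto
  have "(L * (\<rho> g * J)) *v x = L *v (\<rho> g *v (J *v x))" using L c J x
   by (subst assoc_mult_mat_vec[of _ m n _ m]) auto
  also have "... = (L * J) *v y" unfolding y(2) using L J y by simp
  also have "... = y" using LJ y by simp
  finally show "\<rho> g * J *v x = J * (L * (\<rho> g * J)) *v x"
   using c J L x y by (subst (2) assoc_mult_mat_vec[of _ n m _ m]) auto
 qed (use rep_mat[OF rep g] J L in auto)
 then obtain A k D where repA: "complex_rep G m A" and repD: "complex_rep G k D"
  and tr: "!!g. g : CG ==> mat_trace (\<rho> g) = mat_trace (A g) + mat_trace (D g)"
  using rep_complement[OF rep J L LJ] by metis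
 have "of_nat n = (of_nat m + of_nat k :: complex)"
  using tr[OF one_closed] unfolding rep_one[OF rep] rep_one[OF repA] rep_one[OF repD] by simp
 hence nmk: "n = m + k" by (metis of_nat_add of_nat_eq_iff)
 have "m ~= 0"
 proof
  assume m: "m = 0"
  have "J *v x = 0\<^sub>v n" if "x : cvec m" for x
   using that J m by (intro eq_vecI) (auto simp: scalar_prod_def)
  hence "W <= {0\<^sub>v n}" using WJ by auto
  thus False using W0 W(2) by auto
 qed
 moreover have "k ~= 0"
 proof
  assume k: "k = 0"
  hence mn: "m = n" using nmk by simp
  have JL1: "J * L = 1\<^sub>m n"
   by (rule mat_mult_left_right_inverse) (use L J LJ mn in auto)
  have "v : W" if v: "v : cvec n" for v
  proof -
   have "v = J *v (L *v v)" using assoc_mult_mat_vec[OF J L v] v by (simp add: JL1)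
   moreover have "L *v v : cvec m" using L v by simp
   ultimately show ?thesis using WJ by blast
  qed
  thus False using Wn W(1) by auto
 qed
 ultimately have "m < n" "k < n" using nmk by simp_all
 thus ?thesis by (rule that) (fact repA repD tr)+
qed

end

section \<open>Irreducible characters\<close>

text \<open>A bilinear form, with \<open>h (inv g)\<close> where the Hermitian product has the
  conjugate of \<open>h g\<close>. Both agree for a character \<open>h\<close>, and no unitary
  structure is needed.\<close>

definition cip :: "('g, 'b) monoid_scheme => ('g => complex) => ('g => complex) => complex" where
 "cip G f h = (SUM g:carrier G. f g * h (inv\<^bsub>G\<^esub> g)) / of_nat (card (carrier G))"

definition class_fun :: "('g, 'b) monoid_scheme => ('g => complex) => bool" where
 "class_fun G f <-> (ALL x:carrier G. ALL y:carrier G. f (x \<otimes>\<^bsub>G\<^esub> y) = f (y \<otimes>\<^bsub>G\<^esub> x))"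

lemma zero_mat_mult_vec: "v : cvec n ==> 0\<^sub>m m n *v v = (0\<^sub>v m :: 'a :: semiring_1 vec)"
 by (intro eq_vecI) auto

context fin_group
begin

lemma card_pos: "0 < card (CG)"
 using fin one_closed card_gt_0_iff by blast

lemma carrier_ne [simp]: "CG ~= {}"
 using one_closed by blast

lemma card_ne0: "(of_nat (card (CG)) :: complex) ~= 0"
 using card_pos by (metis of_nat_eq_0_iff less_irrefl)

lemma sum_mult_left: "h : CG ==> (SUM g:CG. f (h \<otimes> g)) = (SUM g:CG. f g)"
 by (rule sum.reindex_bij_witness[of _ "%g. inv h \<otimes> g" "%g. h \<otimes> g"]) (auto simp: m_assoc[symmetric])

lemma sum_mult_right: "h : CG ==> (SUM g:CG. f (g \<otimes> h)) = (SUM g:CG. f g)"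
 by (rule sum.reindex_bij_witness[of _ "%g. g \<otimes> inv h" "%g. g \<otimes> h"]) (auto simp: m_assoc)

lemma sum_inv: "(SUM g:CG. f (inv g)) = (SUM g:CG. f g)"
 by (rule sum.reindex_bij_witness[of _ "%g. inv g" "%g. inv g"]) auto

lemma sum_conj: "h : CG ==> (SUM g:CG. f (h \<otimes> g \<otimes> inv h)) = (SUM g:CG. f g)"
 using sum_mult_left[of h "%g. f (g \<otimes> inv h)"] sum_mult_right[of "inv h" f] by simp

lemma cip_sym: "cip G f h = cip G h f"
 using sum_inv[of "%g. f g * h (inv g)"] by (simp add: cip_def mult.commute)

lemma class_fun_conj:
 assumes "class_fun G f" "x : CG" "h : CG"
 shows "f (h \<otimes> x \<otimes> inv h) = f x"
proof -
 have "f (h \<otimes> (x \<otimes> inv h)) = f ((x \<otimes> inv h) \<otimes> h)"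
  using assms unfolding class_fun_def by simp
 thus ?thesis using assms by (simp add: m_assoc)
qed

lemma class_fun_trace: "complex_rep G n \<rho> ==> class_fun G (%g. mat_trace (\<rho> g))"
 by (auto simp: class_fun_def rep_mult intro!: mat_trace_mult_comm[of _ n n])

lemma Irr_iff: "\<chi> : Irr G <-> (EX n \<rho>. irreducible_rep G n \<rho> & \<chi> = (\<lambda>g\<in>CG. mat_trace (\<rho> g)))"
 by (auto simp: Irr_def rep_character_def)

lemma char_decomp:
 "complex_rep G n \<rho> ==> EX xs. set xs <= Irr G & (ALL g:CG. mat_trace (\<rho> g) = (\<Sum>\<chi>\<leftarrow>xs. \<chi> g))"
proof (induction n arbitrary: \<rho> rule: less_induct)
 case (less n)
 consider "n = 0" | "irreducible_rep G n \<rho>" | "0 < n" "~ irreducible_rep G n \<rho>" by auto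
 thus ?case
 proof cases
  case 1
  hence "mat_trace (\<rho> g) = 0" if "g : CG" for g
   using rep_mat[OF less.prems that] by (simp add: mat_trace_def)
  thus ?thesis by (intro exI[of _ "[]"]) simp
 next
  case 2
  thus ?thesis by (intro exI[of _ "[\<lambda>g\<in>CG. mat_trace (\<rho> g)]"]) (auto simp: Irr_iff)
 next
  case 3
  from rep_block[OF less.prems 3] obtain m k A D where m: "m < n" "k < n"
   and A: "complex_rep G m A" and D: "complex_rep G k D"
   and tr: "!!g. g : CG ==> mat_trace (\<rho> g) = mat_trace (A g) + mat_trace (D g)" by metis
  obtain xs ys where "set xs <= Irr G" "ALL g:CG. mat_trace (A g) = (\<Sum>\<chi>\<leftarrow>xs. \<chi> g)"
   "set ys <= Irr G" "ALL g:CG. mat_trace (D g) = (\<Sum>\<chi>\<leftarrow>ys. \<chi> g)"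
   using less.IH[OF m(1) A] less.IH[OF m(2) D] by blast
  thus ?thesis using tr by (intro exI[of _ "xs @ ys"]) auto
 qed
qed

lemma schur_iso:
 assumes \<rho>: "irreducible_rep G n \<rho>" and \<sigma>: "irreducible_rep G m \<sigma>" and T: "T : cmat m n"
  and comm: "!!g. g : CG ==> \<sigma> g * T = T * \<rho> g" and T0: "T ~= 0\<^sub>m m n"
 obtains R where "R : cmat n m" "T * R = 1\<^sub>m m" "R * T = 1\<^sub>m n"
proof -
 note c = rep_mat[OF irr_rep[OF \<rho>]] rep_mat[OF irr_rep[OF \<sigma>]]
 have cv: "\<sigma> g *v (T *v v) = T *v (\<rho> g *v v)" if "g : CG" "v : cvec n" for g v
  using assoc_mult_mat_vec[OF c(2)[OF that(1)] T that(2)] assoc_mult_mat_vec[OF T c(1)[OF that(1)] that(2)]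
   comm[OF that(1)] by simp
 define N where "N = {v : cvec n. T *v v = 0\<^sub>v m}"
 have z: "T *v 0\<^sub>v n = 0\<^sub>v m" using T by (intro eq_vecI) auto
 have \<sigma>z: "\<sigma> g *v 0\<^sub>v m = 0\<^sub>v m" if "g : CG" for g using c(2)[OF that] by (intro eq_vecI) auto
 have "N = {0\<^sub>v n} | N = cvec n"
 proof (rule irr_subspace[OF \<rho>])
  fix g w assume g: "g : CG" "w : N"
  hence "\<rho> g *v w : cvec n" using c(1)[of g] by (auto simp: N_def)
  thus "\<rho> g *v w : N" using g cv[of g w, symmetric] \<sigma>z by (auto simp: N_def)
 qed (use T z in \<open>auto simp: N_def mult_add_distrib_mat_vec mult_mat_vec\<close>)
 moreover have "N ~= cvec n"
 proof
  assume "N = cvec n"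
  hence "T *v v = 0\<^sub>v m" if "v : cvec n" for v using that unfolding N_def by blast
  hence "T = 0\<^sub>m m n" by (intro mat_eq_by_vec[OF T]) (auto simp: zero_mat_mult_vec)
  thus False using T0 by simp
 qed
 ultimately have N: "N = {0\<^sub>v n}" by simp
 define I where "I = (%v. T *v v) ` cvec n"
 have "I = {0\<^sub>v m} | I = cvec m"
 proof (rule irr_subspace[OF \<sigma>])
  show "0\<^sub>v m : I" unfolding I_def using z by (metis image_eqI zero_carrier_vec)
  fix u v assume "u : I" "v : I"
  then obtain u' v' where "u' : cvec n" "v' : cvec n" "u = T *v u'" "v = T *v v'" by (auto simp: I_def)
  thus "u + v : I" unfolding I_def using T
   by (intro image_eqI[of _ _ "u' + v'"]) (auto simp: mult_add_distrib_mat_vec)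
 next
  fix a v assume "v : I"
  then obtain v' where "v' : cvec n" "v = T *v v'" by (auto simp: I_def)
  thus "a *s v : I" unfolding I_def using T
   by (intro image_eqI[of _ _ "a *s v'"]) (auto simp: mult_mat_vec)
 next
  fix g w assume g: "g : CG" and "w : I"
  then obtain v' where "v' : cvec n" "w = T *v v'" by (auto simp: I_def)
  thus "\<sigma> g *v w : I" unfolding I_def using cv[OF g] c(1)[OF g]
   by (intro image_eqI[of _ _ "\<rho> g *v v'"]) auto
 qed (use T in \<open>auto simp: I_def\<close>)
 moreover have "I ~= {0\<^sub>v m}"
 proof
  assume "I = {0\<^sub>v m}"
  hence "T *v v = 0\<^sub>v m" if "v : cvec n" for v using that unfolding I_def by blast
  hence "T = 0\<^sub>m m n" by (intro mat_eq_by_vec[OF T]) (auto simp: zero_mat_mult_vec)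
  thus False using T0 by simp
 qed
 ultimately have I: "I = cvec m" by simp
 have "EX r. ALL j<m. r j : cvec n & T *v r j = unit_vec m j"
 proof -
  have "unit_vec m j : I" for j unfolding I by simp
  thus ?thesis unfolding I_def image_iff by metis
 qed
 then obtain r where r: "!!j. j < m ==> r j : cvec n" "!!j. j < m ==> T *v r j = unit_vec m j" by blast
 define R where "R = mat n m (%(i,j). r j $ i)"
 have R: "R : cmat n m" by (simp add: R_def)
 have colR: "col R j = r j" if "j < m" for j using r(1)[OF that] that by (intro eq_vecI) (auto simp: R_def)
 have TR: "T * R = 1\<^sub>m m"
 proof (rule eq_matI)
  fix i j assume "i < dim_row (1\<^sub>m m :: complex mat)" "j < dim_col (1\<^sub>m m :: complex mat)"
  hence ij: "i < m" "j < m" by auto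
  have "(T * R) $$ (i,j) = (T *v r j) $ i" using ij T R by (simp add: colR)
  thus "(T * R) $$ (i,j) = 1\<^sub>m m $$ (i,j)" using r(2)[OF ij(2)] ij by simp
 qed (use T R in auto)
 have RT: "R * T = 1\<^sub>m n"
 proof (rule mat_eq_by_vec)
  fix v :: "complex vec" assume v: "v : cvec n"
  have RTv: "R *v (T *v v) : cvec n" using R T v by simp
  have "T *v (R *v (T *v v)) = (T * R) *v (T *v v)" using T R v by simp
  also have "... = T *v v" unfolding TR using T v by simp
  finally have "R *v (T *v v) - v : N" unfolding N_def using T v RTv
   by (simp add: mult_minus_distrib_mat_vec)
  hence *: "R *v (T *v v) - v = 0\<^sub>v n" using N by simp
  have "R *v (T *v v) = v"
  proof (rule eq_vecI)
   fix i assume "i < dim_vec v"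
   thus "(R *v (T *v v)) $ i = v $ i"
    using arg_cong[OF *, of "%w. vec_index w i"] v RTv by simp
  qed (use v RTv R in auto)
  thus "R * T *v v = 1\<^sub>m n *v v" using R T v by simp
 qed (use R T in auto)
 show ?thesis using that[OF R TR RT] .
qed

text \<open>For an eigenvalue \<open>c\<close> the matrix \<open>T - c\<close> still commutes with
  the representation but has a kernel, so by \<open>schur_iso\<close> it vanishes.\<close>

lemma schur_scalar:
 assumes \<rho>: "irreducible_rep G n \<rho>" and T: "T : cmat n n"
  and comm: "!!g. g : CG ==> \<rho> g * T = T * \<rho> g"
 obtains c where "T = c *m 1\<^sub>m n"
proof -
 obtain c where "c : spectrum T" using spectrum_non_empty[OF T] irr_rep_pos[OF \<rho>] by auto
 then obtain v where v: "v : cvec n" "v ~= 0\<^sub>v n" "T *v v = c *s v"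
  using T by (auto simp: spectrum_def eigenvalue_def eigenvector_def)
 define U where "U = T - c *m 1\<^sub>m n"
 have U: "U : cmat n n" using T by (auto simp: U_def intro!: minus_carrier_mat)
 have cv: "(c *m 1\<^sub>m n) *v v = c *s v"
  using v(1) by (intro eq_vecI) auto
 have Uv: "U *v v = 0\<^sub>v n" unfolding U_def using T v
  by (subst minus_mult_distrib_mat_vec[where nr=n and nc=n]) (auto simp: cv)
 have cU: "\<rho> g * U = U * \<rho> g" if g: "g : CG" for g
 proof -
  note c = rep_mat[OF irr_rep[OF \<rho>] g]
  show ?thesis unfolding U_def using c T comm[OF g]
   by (simp add: mult_minus_distrib_mat[of _ n n _ n] minus_mult_distrib_mat[of _ n n _ _ n]
     mult_smult_distrib[of _ n n _ n] mult_smult_assoc_mat[of _ n n _ n])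
 qed
 have "U = 0\<^sub>m n n"
 proof (rule ccontr)
  assume "U ~= 0\<^sub>m n n"
  from schur_iso[OF \<rho> \<rho> U cU this] obtain R where R: "R : cmat n n" "R * U = 1\<^sub>m n" by metis
  have "v = R *v (U *v v)" using R U v(1) assoc_mult_mat_vec[OF R(1) U v(1)] by simp
  also have "... = 0\<^sub>v n" unfolding Uv using R by (intro eq_vecI) auto
  finally show False using v(2) by simp
 qed
 hence "T = c *m 1\<^sub>m n"
 proof -
  have "T $$ (i,j) = (c *m 1\<^sub>m n) $$ (i,j)" if "i < n" "j < n" for i j
   using arg_cong[OF \<open>U = 0\<^sub>m n n\<close>, of "%M. M $$ (i,j)"] that T by (simp add: U_def)
  thus ?thesis using T by (intro eq_matI) auto
 qed
 thus ?thesis by (rule that)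
qed

end

context fin_group
begin

lemma cip_add: "cip G (%g. f g + f' g) h = cip G f h + cip G f' h"
 by (simp add: cip_def sum.distrib distrib_right add_divide_distrib)

lemma cip_diff: "cip G (%g. f g - f' g) h = cip G f h - cip G f' h"
 by (simp add: cip_def sum_subtractf left_diff_distrib diff_divide_distrib)

lemma cip_scale: "cip G (%g. c * f g) h = c * cip G f h"
 by (simp add: cip_def sum_distrib_left mult.assoc)

lemma cip_add2: "cip G h (%g. f g + f' g) = cip G h f + cip G h f'"
 by (simp add: cip_def sum.distrib distrib_left add_divide_distrib)

lemma cip_diff2: "cip G h (%g. f g - f' g) = cip G h f - cip G h f'"
 by (simp add: cip_def sum_subtractf right_diff_distrib diff_divide_distrib)

lemma cip_scale2: "cip G h (%g. c * f g) = c * cip G h f"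
 by (simp add: cip_def sum_distrib_left mult.left_commute)

lemma cip_sum: "cip G (%g. SUM i:I. f i g) h = (SUM i:I. cip G (f i) h)"
 unfolding cip_def by (simp add: sum_distrib_right sum_divide_distrib[symmetric] sum.swap[of _ "CG" I])

lemma cip_sum2: "cip G h (%g. SUM i:I. f i g) = (SUM i:I. cip G h (f i))"
 unfolding cip_def by (simp add: sum_distrib_left sum_divide_distrib[symmetric] sum.swap[of _ "CG" I])

lemma cip_sum_list: "cip G (%g. \<Sum>x\<leftarrow>xs. f x g) h = (\<Sum>x\<leftarrow>xs. cip G (f x) h)"
proof (induction xs)
 case Nil thus ?case by (simp add: cip_def)
next
 case (Cons a xs) thus ?case by (simp add: cip_add)
qed

lemma cip_cong:
 "(!!g. g : CG ==> f g = f' g) ==> (!!g. g : CG ==> h g = h' g) ==> cip G f h = cip G f' h'"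
 by (simp add: cip_def cong: sum.cong)

text \<open>The sum over the group of \<open>\<sigma> g * X * \<rho> (inv g)\<close>, with
  \<open>X\<close> the matrix unit at \<open>(a, b)\<close>. It intertwines the two representations,
  and its own entries at \<open>(a, b)\<close>, summed over \<open>a\<close> and \<open>b\<close>,
  give the inner product of the characters times the group order.\<close>

definition avg_mat :: "nat => nat => ('a => complex mat) => ('a => complex mat) => nat => nat => complex mat" where
 "avg_mat m n \<sigma> \<rho> a b = mat m n (%(i,j). SUM g:CG. \<sigma> g $$ (i,a) * \<rho> (inv g) $$ (b,j))"

lemma avg_mat_comm:
 assumes \<sigma>: "complex_rep G m \<sigma>" and \<rho>: "complex_rep G n \<rho>" and a: "a < m" and b: "b < n" and h: "h : CG"
 shows "\<sigma> h * avg_mat m n \<sigma> \<rho> a b = avg_mat m n \<sigma> \<rho> a b * \<rho> h"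
proof (rule eq_matI)
 note c = rep_mat[OF \<sigma>] rep_mat[OF \<rho>]
 fix i j assume "i < dim_row (avg_mat m n \<sigma> \<rho> a b * \<rho> h)" "j < dim_col (avg_mat m n \<sigma> \<rho> a b * \<rho> h)"
 hence ij: "i < m" "j < n" using c(2)[OF h] by (auto simp: avg_mat_def)
 have "(\<sigma> h * avg_mat m n \<sigma> \<rho> a b) $$ (i,j) =
   (\<Sum>k<m. \<sigma> h $$ (i,k) * (SUM g:CG. \<sigma> g $$ (k,a) * \<rho> (inv g) $$ (b,j)))"
  using c(1)[OF h] ij by (simp add: avg_mat_def scalar_prod_def atLeast0LessThan)
 also have "... = (SUM g:CG. (\<Sum>k<m. \<sigma> h $$ (i,k) * \<sigma> g $$ (k,a)) * \<rho> (inv g) $$ (b,j))"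
  by (simp add: sum_distrib_left sum_distrib_right mult.assoc sum.swap[of _ "{..<m}"])
 also have "... = (SUM g:CG. \<sigma> (h \<otimes> g) $$ (i,a) * \<rho> (inv g) $$ (b,j))"
  using h ij a by (intro sum.cong refl) (simp add: rep_mult[OF \<sigma>] scalar_prod_def atLeast0LessThan carrier_matD[OF c(1)])
 also have "... = (SUM g:CG. \<sigma> (h \<otimes> g) $$ (i,a) * \<rho> (inv (h \<otimes> g) \<otimes> h) $$ (b,j))"
  using h by (intro sum.cong refl) (simp add: inv_mult_group m_assoc)
 also have "... = (SUM g:CG. \<sigma> g $$ (i,a) * \<rho> (inv g \<otimes> h) $$ (b,j))"
  by (rule sum_mult_left[OF h])
 also have "... = (SUM g:CG. \<sigma> g $$ (i,a) * (\<Sum>k<n. \<rho> (inv g) $$ (b,k) * \<rho> h $$ (k,j)))"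
  using h ij b by (intro sum.cong refl) (simp add: rep_mult[OF \<rho>] scalar_prod_def atLeast0LessThan carrier_matD[OF c(2)])
 also have "... = (\<Sum>k<n. (SUM g:CG. \<sigma> g $$ (i,a) * \<rho> (inv g) $$ (b,k)) * \<rho> h $$ (k,j))"
  by (simp add: sum_distrib_left sum_distrib_right mult.assoc sum.swap[of _ "{..<n}"])
 also have "... = (avg_mat m n \<sigma> \<rho> a b * \<rho> h) $$ (i,j)"
  using c(2)[OF h] ij by (simp add: avg_mat_def scalar_prod_def atLeast0LessThan)
 finally show "(\<sigma> h * avg_mat m n \<sigma> \<rho> a b) $$ (i,j) = (avg_mat m n \<sigma> \<rho> a b * \<rho> h) $$ (i,j)" .
qed (use rep_mat[OF \<sigma> h] rep_mat[OF \<rho> h] in \<open>auto simp: avg_mat_def\<close>)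

lemma cip_trace:
 assumes \<sigma>: "complex_rep G m \<sigma>" and \<rho>: "complex_rep G n \<rho>"
 shows "cip G (%g. mat_trace (\<sigma> g)) (%g. mat_trace (\<rho> g)) =
   (\<Sum>i<m. \<Sum>j<n. avg_mat m n \<sigma> \<rho> i j $$ (i,j)) / of_nat (card (CG))"
proof -
 note c = carrier_matD(1)[OF rep_mat[OF \<sigma>]] carrier_matD(1)[OF rep_mat[OF \<rho>]]
 have "(SUM g:CG. mat_trace (\<sigma> g) * mat_trace (\<rho> (inv g))) =
   (SUM g:CG. \<Sum>i<m. \<Sum>j<n. \<sigma> g $$ (i,i) * \<rho> (inv g) $$ (j,j))"
  by (intro sum.cong refl) (simp add: mat_trace_def c sum_product)
 also have "... = (\<Sum>i<m. SUM g:CG. \<Sum>j<n. \<sigma> g $$ (i,i) * \<rho> (inv g) $$ (j,j))"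
  by (rule sum.swap)
 also have "... = (\<Sum>i<m. \<Sum>j<n. SUM g:CG. \<sigma> g $$ (i,i) * \<rho> (inv g) $$ (j,j))"
  by (intro sum.cong refl, rule sum.swap)
 also have "... = (\<Sum>i<m. \<Sum>j<n. avg_mat m n \<sigma> \<rho> i j $$ (i,j))"
  by (intro sum.cong refl) (simp add: avg_mat_def)
 finally show ?thesis by (simp add: cip_def)
qed

lemma cip_irr_self:
 assumes \<rho>: "irreducible_rep G n \<rho>"
 shows "cip G (%g. mat_trace (\<rho> g)) (%g. mat_trace (\<rho> g)) = 1"
proof -
 note rep = irr_rep[OF \<rho>]
 note c = rep_mat[OF rep]
 have n: "0 < n" by (rule irr_rep_pos[OF \<rho>])
 have "avg_mat n n \<rho> \<rho> a b $$ (a,b) = (if a = b then of_nat (card (CG)) / of_nat n else 0)"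
  if ab: "a < n" "b < n" for a b
 proof -
  have "avg_mat n n \<rho> \<rho> a b : cmat n n" by (simp add: avg_mat_def)
  from schur_scalar[OF \<rho> this avg_mat_comm[OF rep rep ab]]
  obtain k where k: "avg_mat n n \<rho> \<rho> a b = k *m 1\<^sub>m n" .
  \<comment> \<open>By Schur's lemma the average is a scalar matrix; its trace collapses to the sum
    of the \<open>(b, a)\<close> entries of \<open>\<rho> (inv g) * \<rho> g\<close>.\<close>
  have "k * of_nat n = mat_trace (avg_mat n n \<rho> \<rho> a b)" unfolding k
   by (subst mat_trace_smult[of _ n]) auto
  also have "... = (\<Sum>i<n. SUM g:CG. \<rho> g $$ (i,a) * \<rho> (inv g) $$ (b,i))"
   by (simp add: mat_trace_def avg_mat_def)
  also have "... = (SUM g:CG. \<Sum>i<n. \<rho> (inv g) $$ (b,i) * \<rho> g $$ (i,a))"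
   by (subst sum.swap) (simp add: mult.commute)
  also have "... = (SUM g:CG. (\<rho> (inv g) * \<rho> g) $$ (b,a))"
   using ab by (intro sum.cong refl) (simp add: scalar_prod_def atLeast0LessThan carrier_matD[OF c])
  also have "... = (SUM g:CG. if a = b then 1 else 0)"
   using ab by (intro sum.cong refl) (simp add: rep_inv(1)[OF rep])
  finally have "k * of_nat n = (if a = b then of_nat (card (CG)) else 0)" by simp
  hence "k = (if a = b then of_nat (card (CG)) / of_nat n else 0)"
   using n by (auto simp: field_simps split: if_splits)
  thus ?thesis unfolding k using ab by auto
 qed
 hence "(\<Sum>i<n. \<Sum>j<n. avg_mat n n \<rho> \<rho> i j $$ (i,j)) =
   (\<Sum>i<n. \<Sum>j<n. if i = j then of_nat (card (CG)) / of_nat n else 0)"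
  by (intro sum.cong refl) auto
 also have "... = of_nat (card (CG))" using n by simp
 finally show ?thesis unfolding cip_trace[OF rep rep] by simp
qed

lemma cip_eq_0_or_iso:
 assumes \<rho>: "irreducible_rep G n \<rho>" and \<sigma>: "irreducible_rep G m \<sigma>"
  and ne: "cip G (%g. mat_trace (\<sigma> g)) (%g. mat_trace (\<rho> g)) ~= 0"
 obtains T R where "T : cmat m n" "R : cmat n m" "T * R = 1\<^sub>m m" "R * T = 1\<^sub>m n"
  "!!g. g : CG ==> \<sigma> g * T = T * \<rho> g"
proof -
 have "EX i<m. EX j<n. avg_mat m n \<sigma> \<rho> i j ~= 0\<^sub>m m n"
 proof (rule ccontr)
  assume "~ ?thesis"
  hence "(\<Sum>i<m. \<Sum>j<n. avg_mat m n \<sigma> \<rho> i j $$ (i,j)) = 0"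
   by (intro sum.neutral ballI) auto
  thus False using ne cip_trace[OF irr_rep[OF \<sigma>] irr_rep[OF \<rho>]] by simp
 qed
 then obtain i j where ij: "i < m" "j < n" "avg_mat m n \<sigma> \<rho> i j ~= 0\<^sub>m m n" by blast
 define T where "T = avg_mat m n \<sigma> \<rho> i j"
 have T: "T : cmat m n" by (simp add: T_def avg_mat_def)
 have comm: "!!g. g : CG ==> \<sigma> g * T = T * \<rho> g"
  unfolding T_def by (rule avg_mat_comm[OF irr_rep[OF \<sigma>] irr_rep[OF \<rho>] ij(1,2)])
 obtain R where "R : cmat n m" "T * R = 1\<^sub>m m" "R * T = 1\<^sub>m n"
  using schur_iso[OF \<rho> \<sigma> T comm] ij(3) unfolding T_def by metis
 thus ?thesis using that[OF T] comm by metis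
qed

lemma iso_trace:
 assumes \<rho>: "complex_rep G n \<rho>" and \<sigma>: "complex_rep G m \<sigma>"
  and T: "T : cmat m n" and R: "R : cmat n m" and RT: "R * T = 1\<^sub>m n"
  and TR: "T * R = 1\<^sub>m m" and comm: "\<sigma> g * T = T * \<rho> g" and g: "g : CG"
 shows "mat_trace (\<sigma> g) = mat_trace (\<rho> g)"
proof -
 note c = rep_mat[OF \<rho> g] rep_mat[OF \<sigma> g]
 have "\<sigma> g = (\<sigma> g * T) * R" using c T R TR by (simp add: amm[of _ m m _ n _ m])
 hence "mat_trace (\<sigma> g) = mat_trace ((\<sigma> g * T) * R)" by simp
 also have "... = mat_trace (T * (\<rho> g * R))" unfolding comm using c T R
  by (simp add: amm[of _ m n _ n _ m])
 also have "... = mat_trace ((\<rho> g * R) * T)"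
  by (rule mat_trace_mult_comm[of _ m n]) (use c T R in auto)
 also have "(\<rho> g * R) * T = \<rho> g" using c T R RT by (simp add: amm[of _ n n _ m _ n])
 finally show ?thesis .
qed

lemma irr_orth:
 assumes "\<chi> : Irr G" "\<psi> : Irr G"
 shows "cip G \<chi> \<psi> = (if \<chi> = \<psi> then 1 else 0)"
proof -
 obtain m \<sigma> where \<sigma>: "irreducible_rep G m \<sigma>" and \<chi>: "\<chi> = (\<lambda>g\<in>CG. mat_trace (\<sigma> g))"
  using assms(1) Irr_iff by blast
 obtain n \<rho> where \<rho>: "irreducible_rep G n \<rho>" and \<psi>: "\<psi> = (\<lambda>g\<in>CG. mat_trace (\<rho> g))"
  using assms(2) Irr_iff by blast
 have eq: "cip G \<chi> \<psi> = cip G (%g. mat_trace (\<sigma> g)) (%g. mat_trace (\<rho> g))"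
  by (rule cip_cong) (auto simp: \<chi> \<psi>)
 show ?thesis
 proof (cases "\<chi> = \<psi>")
  case True
  hence "cip G \<chi> \<psi> = cip G \<psi> \<psi>" by simp
  also have "... = cip G (%g. mat_trace (\<rho> g)) (%g. mat_trace (\<rho> g))"
   by (rule cip_cong) (auto simp: \<psi>)
  finally show ?thesis using True cip_irr_self[OF \<rho>] by simp
 next
  case False
  have "cip G \<chi> \<psi> = 0"
  proof (rule ccontr)
   assume "cip G \<chi> \<psi> ~= 0"
   then obtain T R where TR: "T : cmat m n" "R : cmat n m" "T * R = 1\<^sub>m m" "R * T = 1\<^sub>m n"
    "!!g. g : CG ==> \<sigma> g * T = T * \<rho> g" using cip_eq_0_or_iso[OF \<rho> \<sigma>] eq by metis
   hence "mat_trace (\<sigma> g) = mat_trace (\<rho> g)" if "g : CG" for g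
    using iso_trace[OF irr_rep[OF \<rho>] irr_rep[OF \<sigma>]] that by blast
   hence "\<chi> = \<psi>" unfolding \<chi> \<psi> by (auto simp: restrict_def)
   thus False using False by simp
  qed
  thus ?thesis using False by simp
 qed
qed

lemma regular_rep: "EX \<rho>. complex_rep G (card (CG)) \<rho> &
  (ALL g:CG. mat_trace (\<rho> g) = (if g = \<one> then of_nat (card (CG)) else 0))"
proof -
 define n where "n = card (CG)"
 obtain e where e: "bij_betw e {0..<n} (CG)" unfolding n_def using ex_bij_betw_nat_finite[OF fin] by blast
 have ec: "e i : CG" if "i < n" for i using e that by (auto simp: bij_betw_def)
 have einj: "e i = e j <-> i = j" if "i < n" "j < n" for i j
  using e that by (auto simp: bij_betw_def inj_on_def)
 define \<rho> where "\<rho> g = (mat n n (%(i,j). if e i = g \<otimes> e j then 1 else 0) :: complex mat)" for g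
 have "complex_rep G n \<rho>" unfolding complex_rep_iff
 proof (intro conjI ballI)
  fix g h assume g: "g : CG" and h: "h : CG"
  show "\<rho> (g \<otimes> h) = \<rho> g * \<rho> h"
  proof (rule eq_matI)
   fix i j assume "i < dim_row (\<rho> g * \<rho> h)" "j < dim_col (\<rho> g * \<rho> h)"
   hence ij: "i < n" "j < n" by (auto simp: \<rho>_def)
   have "h \<otimes> e j : CG" using h ec ij by simp
   hence "h \<otimes> e j : e ` {0..<n}" using bij_betw_imp_surj_on[OF e] by simp
   then obtain k where k: "k < n" "e k = h \<otimes> e j" by auto
   have "(\<rho> g * \<rho> h) $$ (i,j) = (\<Sum>l<n. (if e i = g \<otimes> e l then 1 else 0) * (if e l = h \<otimes> e j then 1 else 0))"
    using ij by (simp add: \<rho>_def scalar_prod_def atLeast0LessThan)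
   also have "... = (\<Sum>l<n. if l = k then (if e i = g \<otimes> e l then 1 else 0) else 0)"
    using k(1) einj by (intro sum.cong refl) (auto simp flip: k(2))
   also have "... = (if e i = g \<otimes> e k then 1 else 0)" using k(1) by simp
   also have "... = \<rho> (g \<otimes> h) $$ (i,j)" using ij g h ec k by (simp add: \<rho>_def m_assoc)
   finally show "\<rho> (g \<otimes> h) $$ (i,j) = (\<rho> g * \<rho> h) $$ (i,j)" by simp
  qed (auto simp: \<rho>_def)
 next
  show "\<rho> \<one> = 1\<^sub>m n" by (rule eq_matI) (auto simp: \<rho>_def ec einj)
 qed (auto simp: \<rho>_def)
 moreover have "mat_trace (\<rho> g) = (if g = \<one> then of_nat n else 0)" if g: "g : CG" for g
 proof -
  have "e i = g \<otimes> e i <-> g = \<one>" if "i < n" for i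
   using r_cancel_one'[of "e i" g] g ec[OF that] by auto
  thus ?thesis by (simp add: mat_trace_def \<rho>_def)
 qed
 ultimately show ?thesis unfolding n_def by blast
qed

text \<open>For each irreducible representation the sum of \<open>f g * \<rho> (inv g)\<close> is a
  scalar matrix of trace zero, hence zero. By \<open>char_decomp\<close> the corresponding sum for
  the regular character vanishes as well, and this one recovers \<open>f x\<close>.\<close>

lemma class_fun_orth_zero:
 assumes f: "class_fun G f" and orth: "!!\<chi>. \<chi> : Irr G ==> cip G f \<chi> = 0" and x: "x : CG"
 shows "f x = 0"
proof -
 have irr: "(SUM g:CG. f g * \<chi> (inv g \<otimes> x)) = 0" if \<chi>: "\<chi> : Irr G" for \<chi>
 proof -
  obtain n \<rho> where \<rho>: "irreducible_rep G n \<rho>" and \<chi>_def: "\<chi> = (\<lambda>g\<in>CG. mat_trace (\<rho> g))"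
   using \<chi> Irr_iff by blast
  note rep = irr_rep[OF \<rho>] note c = rep_mat[OF rep]
  define A where "A = mat n n (%(i,j). SUM g:CG. f g * \<rho> (inv g) $$ (i,j))"
  have A: "A : cmat n n" by (simp add: A_def)
  have AL: "(\<Sum>k<n. A $$ (i,k) * \<rho> h $$ (k,j)) = (SUM g:CG. f g * \<rho> (inv g \<otimes> h) $$ (i,j))"
   if "h : CG" "i < n" "j < n" for h i j
  proof -
   have "(\<Sum>k<n. A $$ (i,k) * \<rho> h $$ (k,j)) = (\<Sum>k<n. SUM g:CG. f g * (\<rho> (inv g) $$ (i,k) * \<rho> h $$ (k,j)))"
    using that by (simp add: A_def sum_distrib_right mult.assoc)
   also have "... = (SUM g:CG. f g * (\<Sum>k<n. \<rho> (inv g) $$ (i,k) * \<rho> h $$ (k,j)))"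
    by (subst sum.swap) (simp add: sum_distrib_left)
   also have "... = (SUM g:CG. f g * \<rho> (inv g \<otimes> h) $$ (i,j))"
    using that by (intro sum.cong refl)
     (simp add: rep_mult[OF rep] scalar_prod_def atLeast0LessThan carrier_matD[OF c])
   finally show ?thesis .
  qed
  have "\<rho> h * A = A * \<rho> h" if h: "h : CG" for h
  proof (rule eq_matI)
   fix i j assume "i < dim_row (A * \<rho> h)" "j < dim_col (A * \<rho> h)"
   hence ij: "i < n" "j < n" using c[OF h] A by auto
   have "(\<rho> h * A) $$ (i,j) = (\<Sum>k<n. SUM g:CG. f g * (\<rho> h $$ (i,k) * \<rho> (inv g) $$ (k,j)))"
    using ij c[OF h] by (simp add: A_def scalar_prod_def atLeast0LessThan sum_distrib_left mult.left_commute)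
   also have "... = (SUM g:CG. f g * (\<Sum>k<n. \<rho> h $$ (i,k) * \<rho> (inv g) $$ (k,j)))"
    by (subst sum.swap) (simp add: sum_distrib_left)
   also have "... = (SUM g:CG. f g * \<rho> (h \<otimes> inv g) $$ (i,j))"
    using h ij by (intro sum.cong refl)
     (simp add: rep_mult[OF rep] scalar_prod_def atLeast0LessThan carrier_matD[OF c])
   also have "... = (SUM g:CG. f (h \<otimes> g \<otimes> inv h) * \<rho> (inv (h \<otimes> g \<otimes> inv h) \<otimes> h) $$ (i,j))"
   proof (intro sum.cong refl)
    fix g assume g: "g : CG"
    have "inv (h \<otimes> g \<otimes> inv h) \<otimes> h = h \<otimes> inv g" using g h by (simp add: inv_mult_group m_assoc)
    thus "f g * \<rho> (h \<otimes> inv g) $$ (i,j) = f (h \<otimes> g \<otimes> inv h) * \<rho> (inv (h \<otimes> g \<otimes> inv h) \<otimes> h) $$ (i,j)"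
     using class_fun_conj[OF f g h] by simp
   qed
   also have "... = (SUM g:CG. f g * \<rho> (inv g \<otimes> h) $$ (i,j))"
    by (rule sum_conj[OF h])
   also have "... = (A * \<rho> h) $$ (i,j)"
    using AL[OF h ij] ij c[OF h] A by (simp add: scalar_prod_def atLeast0LessThan)
   finally show "(\<rho> h * A) $$ (i,j) = (A * \<rho> h) $$ (i,j)" .
  qed (use c[OF h] A in auto)
  then obtain k where k: "A = k *m 1\<^sub>m n" using schur_scalar[OF \<rho> A] by metis
  have "k * of_nat n = mat_trace A" unfolding k by (subst mat_trace_smult[of _ n]) auto
  also have "... = (SUM g:CG. f g * mat_trace (\<rho> (inv g)))"
   unfolding mat_trace_def by (simp add: A_def sum.swap[of _ "{..<n}"] sum_distrib_left carrier_matD[OF c])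
  also have "... = cip G f \<chi> * of_nat (card (CG))"
   by (simp add: cip_def \<chi>_def)
  also have "... = 0" using orth[OF \<chi>] by simp
  finally have "k = 0" using irr_rep_pos[OF \<rho>] by simp
  hence A0: "A $$ (i,j) = 0" if "i < n" "j < n" for i j unfolding k using that by simp
  have "(SUM g:CG. f g * \<chi> (inv g \<otimes> x)) = (SUM g:CG. \<Sum>i<n. f g * \<rho> (inv g \<otimes> x) $$ (i,i))"
   using x by (intro sum.cong refl) (simp add: \<chi>_def mat_trace_def sum_distrib_left carrier_matD[OF c])
  also have "... = (\<Sum>i<n. \<Sum>k<n. A $$ (i,k) * \<rho> x $$ (k,i))"
   by (subst sum.swap) (intro sum.cong refl, simp add: AL[OF x])
  also have "... = 0" by (simp add: A0)
  finally show ?thesis .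
 qed
 obtain \<rho> where \<rho>: "complex_rep G (card (CG)) \<rho>"
  and tr: "!!g. g : CG ==> mat_trace (\<rho> g) = (if g = \<one> then of_nat (card (CG)) else 0)"
  using regular_rep by blast
 obtain xs where xs: "set xs <= Irr G" "!!g. g : CG ==> mat_trace (\<rho> g) = (\<Sum>\<chi>\<leftarrow>xs. \<chi> g)"
  using char_decomp[OF \<rho>] by blast
 have "of_nat (card (CG)) * f x = (SUM g:CG. f g * mat_trace (\<rho> (inv g \<otimes> x)))"
 proof -
  have "inv g \<otimes> x = \<one> <-> g = x" if "g : CG" for g
   using that x by (metis inv_closed inv_equality inv_inv l_inv)
  hence "(SUM g:CG. f g * mat_trace (\<rho> (inv g \<otimes> x))) =
    (SUM g:CG. if g = x then f g * of_nat (card (CG)) else 0)"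
   using x by (intro sum.cong refl) (simp add: tr)
  thus ?thesis using x by simp
 qed
 also have "... = (SUM g:CG. \<Sum>\<chi>\<leftarrow>xs. f g * \<chi> (inv g \<otimes> x))"
  using x by (intro sum.cong refl) (simp add: xs(2) sum_list_const_mult)
 also have "... = (\<Sum>\<chi>\<leftarrow>xs. SUM g:CG. f g * \<chi> (inv g \<otimes> x))"
  by (induction xs) (simp_all add: sum.distrib)
 also have "... = 0"
  using xs(1) irr by (intro sum_list_neutral) auto
 finally show ?thesis using card_ne0 by (metis mult_eq_0_iff)
qed

end

section \<open>Generalized characters and induction\<close>

text \<open>Generalized characters, encoded by integral multiplicities; for a class function this is
  the same as being an integer combination of irreducible characters.\<close>

definition vchar :: "('g, 'b) monoid_scheme => ('g => complex) => bool" where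
 "vchar G f <-> class_fun G f & (ALL \<chi>:Irr G. cip G f \<chi> : \<int>)"

text \<open>Summing over all \<open>s\<close> and dividing by the order of \<open>H\<close> replaces
  a choice of coset representatives.\<close>

definition ind :: "('g, 'b) monoid_scheme => 'g set => ('g => complex) => 'g => complex" where
 "ind G H a x = (SUM s:carrier G. if s \<otimes>\<^bsub>G\<^esub> x \<otimes>\<^bsub>G\<^esub> inv\<^bsub>G\<^esub> s : H
   then a (s \<otimes>\<^bsub>G\<^esub> x \<otimes>\<^bsub>G\<^esub> inv\<^bsub>G\<^esub> s) else 0) / of_nat (card H)"

context fin_group
begin

lemma class_fun_Irr: "\<chi> : Irr G ==> class_fun G \<chi>"
 using class_fun_trace irr_rep by (fastforce simp: Irr_iff class_fun_def)

lemma Irr_one: "\<chi> : Irr G ==> EX n>0. \<chi> \<one> = of_nat n"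
 by (auto simp: Irr_iff rep_one[OF irr_rep] intro: irr_rep_pos)

lemma Irr_extensional: "\<chi> : Irr G ==> \<chi> : extensional (CG)"
 by (auto simp: Irr_iff)

definition delta :: "'a => complex" where
 "delta g = (if g = \<one> then of_nat (card (CG)) else 0)"

lemma cip_delta: "cip G delta f = f \<one>"
proof -
 have "(SUM g:CG. delta g * f (inv g)) = (SUM g:CG. if g = \<one> then of_nat (card (CG)) * f \<one> else 0)"
  by (intro sum.cong refl) (auto simp: delta_def)
 thus ?thesis using card_ne0 by (simp add: cip_def)
qed

lemma finite_Irr [simp]: "finite (Irr G)"
proof -
 obtain \<rho> where \<rho>: "complex_rep G (card (CG)) \<rho>"
  and tr: "!!g. g : CG ==> mat_trace (\<rho> g) = (if g = \<one> then of_nat (card (CG)) else 0)"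
  using regular_rep by blast
 obtain xs where xs: "set xs <= Irr G" "!!g. g : CG ==> mat_trace (\<rho> g) = (\<Sum>\<chi>\<leftarrow>xs. \<chi> g)"
  using char_decomp[OF \<rho>] by blast
 \<comment> \<open>The regular character contains \<open>\<chi>\<close> with multiplicity
   \<open>\<chi> \<one>\<close>, which is not zero, so \<open>\<chi>\<close> occurs in the
   decomposition.\<close>
 have "\<chi> : set xs" if \<chi>: "\<chi> : Irr G" for \<chi>
 proof (rule ccontr)
  assume n: "\<chi> ~: set xs"
  have "\<chi> \<one> = cip G (%g. \<Sum>\<chi>\<leftarrow>xs. \<chi> g) \<chi>"
   unfolding cip_delta[symmetric] by (rule cip_cong) (auto simp: delta_def tr simp flip: xs(2))
  also have "... = (\<Sum>\<psi>\<leftarrow>xs. cip G \<psi> \<chi>)" by (rule cip_sum_list)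
  also have "... = 0" using n xs(1) \<chi> by (intro sum_list_neutral) (auto simp: irr_orth)
  finally show False using Irr_one[OF \<chi>] by auto
 qed
 thus ?thesis using finite_subset[of "Irr G" "set xs"] by auto
qed

lemma irr_expansion:
 assumes f: "class_fun G f" and g: "g : CG"
 shows "f g = (SUM \<chi>:Irr G. cip G f \<chi> * \<chi> g)"
proof -
 define h where "h x = f x - (SUM \<chi>:Irr G. cip G f \<chi> * \<chi> x)" for x
 have "class_fun G h" using f class_fun_Irr unfolding class_fun_def h_def
  by (auto intro!: arg_cong2[where f="(-)"] sum.cong)
 moreover have "cip G h \<psi> = 0" if "\<psi> : Irr G" for \<psi>
 proof -
  have "cip G (%x. SUM \<chi>:Irr G. cip G f \<chi> * \<chi> x) \<psi> = (SUM \<chi>:Irr G. cip G f \<chi> * (if \<chi> = \<psi> then 1 else 0))"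
   unfolding cip_sum cip_scale using that by (intro sum.cong refl) (simp add: irr_orth)
  also have "... = (SUM \<chi>:Irr G. if \<chi> = \<psi> then cip G f \<chi> else 0)" by (intro sum.cong refl) simp
  also have "... = cip G f \<psi>" using that by simp
  finally show ?thesis unfolding h_def cip_diff by simp
 qed
 ultimately have "h g = 0" using class_fun_orth_zero g by blast
 thus ?thesis by (simp add: h_def)
qed

lemma parseval:
 assumes f: "class_fun G f"
 shows "cip G f h = (SUM \<chi>:Irr G. cip G f \<chi> * cip G h \<chi>)"
proof -
 have "cip G f h = cip G (%g. SUM \<chi>:Irr G. cip G f \<chi> * \<chi> g) h"
  by (rule cip_cong) (auto intro: irr_expansion[OF f])
 thus ?thesis unfolding cip_sum cip_scale by (simp add: cip_sym[of h])
qed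

lemma sum_squares: "(SUM \<chi>:Irr G. \<chi> \<one> * \<chi> \<one>) = of_nat (card (CG))"
proof -
 have "class_fun G delta" unfolding class_fun_def delta_def
  by (metis inv_equality l_inv inv_comm)
 from parseval[OF this, of delta] show ?thesis unfolding cip_delta by (simp add: delta_def)
qed

text \<open>The way in which a list of characters is shown to be complete: the squared degrees
  outside \<open>Y\<close> are positive, and they sum to zero.\<close>

lemma Irr_eqI:
 assumes X: "Y <= Irr G" and s: "(SUM \<chi>:Y. \<chi> \<one> * \<chi> \<one>) = of_nat (card (CG))"
 shows "Irr G = Y"
proof (rule ccontr)
 assume "Irr G ~= Y"
 then obtain \<psi> where \<psi>: "\<psi> : Irr G - Y" using X by auto
 have "(SUM \<chi>:Irr G - Y. \<chi> \<one> * \<chi> \<one>) = 0"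
  using sum_squares s sum.subset_diff[OF X finite_Irr, of "%\<chi>. \<chi> \<one> * \<chi> \<one>"] by simp
 hence "Re (SUM \<chi>:Irr G - Y. \<chi> \<one> * \<chi> \<one>) = 0" by simp
 hence "(SUM \<chi>:Irr G - Y. Re (\<chi> \<one> * \<chi> \<one>)) = 0" by simp
 moreover have "Re (\<chi> \<one> * \<chi> \<one>) > 0" if \<chi>: "\<chi> : Irr G" for \<chi>
 proof -
  obtain n where "n > 0" "\<chi> \<one> = of_nat n" using Irr_one[OF \<chi>] by blast
  thus ?thesis by simp
 qed
 hence "0 < (SUM \<chi>:Irr G - Y. Re (\<chi> \<one> * \<chi> \<one>))"
  using \<psi> by (intro sum_pos2[where i=\<psi>]) (auto intro: less_imp_le)
 ultimately show False by simp
qed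

text \<open>Integers whose squares sum to \<open>1\<close> are all zero except for a single
  \<open>1\<close> or \<open>-1\<close>, and the degree decides the sign.\<close>

lemma vchar_norm1:
 assumes f: "vchar G f" and n: "cip G f f = 1" and pos: "f \<one> = of_nat k"
 shows "restrict f (CG) : Irr G"
proof -
 have cf: "class_fun G f" using f by (simp add: vchar_def)
 have "ALL \<chi>:Irr G. EX a::int. cip G f \<chi> = of_int a" using f by (auto simp: vchar_def elim: Ints_cases)
 then obtain a :: "('a => complex) => int" where a: "!!\<chi>. \<chi> : Irr G ==> cip G f \<chi> = of_int (a \<chi>)" by metis
 have "of_int (SUM \<chi>:Irr G. a \<chi> * a \<chi>) = (of_int 1 :: complex)"
  using parseval[OF cf, of f] n a by simp
 hence s: "(SUM \<chi>:Irr G. a \<chi> * a \<chi>) = 1" by (simp only: of_int_eq_iff)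
 have "EX \<psi>:Irr G. a \<psi> ~= 0"
 proof (rule ccontr)
  assume "~ ?thesis"
  hence "(SUM \<chi>:Irr G. a \<chi> * a \<chi>) = 0" by (intro sum.neutral) auto
  thus False using s by simp
 qed
 then obtain \<psi> where \<psi>: "\<psi> : Irr G" "a \<psi> ~= 0" by blast
 have s2: "(SUM \<chi>:Irr G - {\<psi>}. a \<chi> * a \<chi>) + a \<psi> * a \<psi> = 1"
  using s \<psi> sum.remove[OF finite_Irr \<psi>(1), of "%\<chi>. a \<chi> * a \<chi>"] by simp
 have p: "(SUM \<chi>:Irr G - {\<psi>}. a \<chi> * a \<chi>) \<ge> 0" by (intro sum_nonneg) simp
 have "a \<psi> * a \<psi> > 0" using \<psi>(2) by (auto simp: zero_less_mult_iff linorder_neq_iff)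
 hence 0: "(SUM \<chi>:Irr G - {\<psi>}. a \<chi> * a \<chi>) = 0" and 1: "a \<psi> * a \<psi> = 1" using s2 p by linarith+
 have z: "a \<chi> = 0" if "\<chi> : Irr G" "\<chi> ~= \<psi>" for \<chi>
  using sum_nonneg_eq_0_iff[of "Irr G - {\<psi>}" "%\<chi>. a \<chi> * a \<chi>"] 0 that by simp
 have e: "f g = of_int (a \<psi>) * \<psi> g" if "g : CG" for g
 proof -
  have "f g = (SUM \<chi>:Irr G. if \<chi> = \<psi> then of_int (a \<psi>) * \<psi> g else 0)"
   unfolding irr_expansion[OF cf that] using a z by (intro sum.cong refl) auto
  thus ?thesis using \<psi> by simp
 qed
 obtain m where m: "m > 0" "\<psi> \<one> = of_nat m" using Irr_one[OF \<psi>(1)] by blast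
 have "a \<psi> = 1"
 proof (rule ccontr)
  assume "a \<psi> ~= 1"
  hence "a \<psi> = -1" using 1 by (simp add: zmult_eq_1_iff)
  hence "of_nat k + of_nat m = (0::complex)" using e[OF one_closed] pos m by simp
  thus False using m(1) by (metis of_nat_add of_nat_eq_0_iff add_is_0 less_irrefl)
 qed
 hence "restrict f (CG) = \<psi>"
  using e Irr_extensional[OF \<psi>(1)] by (intro extensionalityI[of _ "CG"]) auto
 thus ?thesis using \<psi>(1) by simp
qed

lemma rep_vchar:
 assumes \<rho>: "complex_rep G n \<rho>"
 shows "vchar G (%g. mat_trace (\<rho> g))"
proof -
 obtain xs where xs: "set xs <= Irr G" "!!g. g : CG ==> mat_trace (\<rho> g) = (\<Sum>\<chi>\<leftarrow>xs. \<chi> g)"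
  using char_decomp[OF \<rho>] by blast
 have "cip G (%g. mat_trace (\<rho> g)) \<chi> : \<int>" if "\<chi> : Irr G" for \<chi>
 proof -
  have "cip G (%g. mat_trace (\<rho> g)) \<chi> = cip G (%g. \<Sum>\<chi>\<leftarrow>xs. \<chi> g) \<chi>"
   by (rule cip_cong) (auto simp: xs(2))
  also have "... = (\<Sum>\<psi>\<leftarrow>xs. cip G \<psi> \<chi>)" by (rule cip_sum_list)
  also have "... : \<int>" using xs(1) that
   by (induction xs) (auto simp: irr_orth intro!: Ints_add)
  finally show ?thesis .
 qed
 thus ?thesis using class_fun_trace[OF \<rho>] by (simp add: vchar_def)
qed

lemma linear_rep:
 assumes "!!x y. x : CG ==> y : CG ==> l (x \<otimes> y) = l x * l y" "l \<one> = 1"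
 shows "complex_rep G 1 (%g. mat 1 1 (%_. l g))"
 unfolding complex_rep_iff using assms by (auto simp: scalar_prod_def intro!: eq_matI)

lemma linear_vchar:
 assumes "!!x y. x : CG ==> y : CG ==> l (x \<otimes> y) = l x * l y" "l \<one> = 1"
 shows "vchar G l"
 using rep_vchar[OF linear_rep[of l]] assms by (simp add: mat_trace_def)

lemma vchar_Irr: "\<chi> : Irr G ==> vchar G \<chi>"
 by (auto simp: vchar_def class_fun_Irr irr_orth)

lemma vchar_add: "vchar G f ==> vchar G h ==> vchar G (%g. f g + h g)"
 by (auto simp: vchar_def class_fun_def cip_add)

lemma vchar_diff: "vchar G f ==> vchar G h ==> vchar G (%g. f g - h g)"
 by (auto simp: vchar_def class_fun_def cip_diff)

lemma vchar_scale: "vchar G f ==> c : \<int> ==> vchar G (%g. c * f g)"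
 by (auto simp: vchar_def class_fun_def cip_scale)

lemma vchar_sum: "(!!i. i : I ==> vchar G (f i)) ==> vchar G (%g. SUM i:I. f i g)"
 by (auto simp: vchar_def class_fun_def cip_sum intro!: Ints_sum sum.cong)

lemma sub_fin_group: "subgroup H G ==> fin_group (G(|carrier := H|))"
 by (auto simp: fin_group_def fin_group_axioms_def subgroup_imp_group intro: finite_subset[OF subgroup.subset fin])

lemma sub_cip: "subgroup H G ==> cip (G(|carrier := H|)) f h = (SUM x:H. f x * h (inv x)) / of_nat (card H)"
 by (simp add: cip_def m_inv_consistent)

lemma sub_rep: "subgroup H G ==> complex_rep G n \<rho> ==> complex_rep (G(|carrier := H|)) n \<rho>"
 using subgroup.mem_carrier[of H G]
 by (auto simp: fin_group.complex_rep_iff[OF sub_fin_group] complex_rep_iff)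

lemma sub_Irr_decomp:
 assumes H: "subgroup H G" and \<chi>: "\<chi> : Irr G"
 shows "EX xs. set xs <= Irr (G(|carrier := H|)) & (ALL h:H. \<chi> h = (\<Sum>\<psi>\<leftarrow>xs. \<psi> h))"
proof -
 obtain n \<rho> where \<rho>: "irreducible_rep G n \<rho>" "\<chi> = (\<lambda>g\<in>CG. mat_trace (\<rho> g))" using \<chi> Irr_iff by blast
 show ?thesis
  using fin_group.char_decomp[OF sub_fin_group[OF H] sub_rep[OF H irr_rep[OF \<rho>(1)]]] subgroup.mem_carrier[OF H] \<rho>(2)
  by auto
qed

lemma mult_inv_cancel: "x : CG ==> z : CG ==> x \<otimes> (inv x \<otimes> z) = z"
 and inv_mult_cancel: "x : CG ==> z : CG ==> inv x \<otimes> (x \<otimes> z) = z"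
 by (simp_all flip: m_assoc)

lemma class_fun_ind: "class_fun G (ind G H a)"
 unfolding class_fun_def
proof (intro ballI)
 fix x y assume x: "x : CG" and y: "y : CG"
 let ?F = "%z. if z : H then a z else 0"
 have "(SUM s:CG. ?F (s \<otimes> (x \<otimes> y) \<otimes> inv s)) = (SUM s:CG. ?F ((s \<otimes> x) \<otimes> (y \<otimes> x) \<otimes> inv (s \<otimes> x)))"
  using x y by (intro sum.cong refl) (simp add: m_assoc inv_mult_group mult_inv_cancel)
 also have "... = (SUM s:CG. ?F (s \<otimes> (y \<otimes> x) \<otimes> inv s))"
  by (rule sum_mult_right[OF x])
 finally show "ind G H a (x \<otimes> y) = ind G H a (y \<otimes> x)" by (simp add: ind_def)
qed

lemma frobenius:
 assumes H: "subgroup H G" and f: "class_fun G f"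
 shows "cip G (ind G H a) f = cip (G(|carrier := H|)) a f"
proof -
 let ?F = "%z. if z : H then a z else 0"
 have inner: "(SUM x:CG. ?F (s \<otimes> x \<otimes> inv s) * f (inv x)) = (SUM x:H. a x * f (inv x))" if s: "s : CG" for s
 proof -
  have "(SUM x:CG. ?F (s \<otimes> x \<otimes> inv s) * f (inv x)) = (SUM x:CG. ?F (s \<otimes> x \<otimes> inv s) * f (inv (s \<otimes> x \<otimes> inv s)))"
  proof (intro sum.cong refl arg_cong2[where f="(*)"])
   fix x assume x: "x : CG"
   have "inv (s \<otimes> x \<otimes> inv s) = s \<otimes> inv x \<otimes> inv s" using s x by (simp add: inv_mult_group m_assoc)
   thus "f (inv x) = f (inv (s \<otimes> x \<otimes> inv s))" using class_fun_conj[OF f inv_closed[OF x] s] by simp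
  qed
  also have "... = (SUM x:CG. ?F x * f (inv x))" by (rule sum_conj[OF s])
  also have "... = (SUM x:H. a x * f (inv x))"
   using subgroup.subset[OF H] by (intro sum.mono_neutral_cong_right) auto
  finally show ?thesis .
 qed
 have "(SUM x:CG. ind G H a x * f (inv x)) =
   (SUM x:CG. SUM s:CG. ?F (s \<otimes> x \<otimes> inv s) * f (inv x) / of_nat (card H))"
  by (simp add: ind_def sum_divide_distrib sum_distrib_right)
 also have "... = (SUM s:CG. (SUM x:CG. ?F (s \<otimes> x \<otimes> inv s) * f (inv x)) / of_nat (card H))"
  by (subst sum.swap) (simp add: sum_divide_distrib)
 also have "... = of_nat (card (CG)) * ((SUM x:H. a x * f (inv x)) / of_nat (card H))"
  by (simp add: inner)
 finally show ?thesis unfolding sub_cip[OF H] using card_ne0 by (simp add: cip_def)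
qed

lemma vchar_ind:
 assumes H: "subgroup H G" and a: "vchar (G(|carrier := H|)) a"
 shows "vchar G (ind G H a)"
 unfolding vchar_def
proof (intro conjI ballI)
 interpret H: fin_group "G(|carrier := H|)" by (rule sub_fin_group[OF H])
 fix \<chi> assume \<chi>: "\<chi> : Irr G"
 obtain xs where xs: "set xs <= Irr (G(|carrier := H|))" "!!h. h : H ==> \<chi> h = (\<Sum>\<psi>\<leftarrow>xs. \<psi> h)"
  using sub_Irr_decomp[OF H \<chi>] by blast
 have "cip G (ind G H a) \<chi> = cip (G(|carrier := H|)) a \<chi>" by (rule frobenius[OF H class_fun_Irr[OF \<chi>]])
 also have "... = cip (G(|carrier := H|)) (%h. \<Sum>\<psi>\<leftarrow>xs. \<psi> h) a"
  by (subst H.cip_sym, rule H.cip_cong) (auto simp: xs(2))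
 also have "... = (\<Sum>\<psi>\<leftarrow>xs. cip (G(|carrier := H|)) \<psi> a)" by (rule H.cip_sum_list)
 also have "... : \<int>" using xs(1) a
  by (induction xs) (auto simp: vchar_def H.cip_sym[of _ a] intro!: Ints_add)
 finally show "cip G (ind G H a) \<chi> : \<int>" .
qed (rule class_fun_ind)

lemma ind_one: "subgroup H G ==> ind G H a \<one> = of_nat (card (CG)) * a \<one> / of_nat (card H)"
 by (simp add: ind_def subgroup.one_closed)

text \<open>Mackey's formula with a sum over all group elements instead of double coset
  representatives; this is the convenient form when the Bruhat cells are explicit.\<close>

lemma mackey:
 assumes H: "subgroup H G"
 shows "cip G (ind G H a) (ind G K b) =
  (SUM s:CG. SUM h:H. if s \<otimes> h \<otimes> inv s : K then a (inv h) * b (s \<otimes> h \<otimes> inv s) else 0) / (of_nat (card H) * of_nat (card K))"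
proof -
 interpret H: fin_group "G(|carrier := H|)" by (rule sub_fin_group[OF H])
 have "cip G (ind G H a) (ind G K b) = cip (G(|carrier := H|)) (ind G K b) a"
  using frobenius[OF H class_fun_ind] H.cip_sym by metis
 also have "... = (SUM h:H. SUM s:CG. (if s \<otimes> h \<otimes> inv s : K then b (s \<otimes> h \<otimes> inv s) * a (inv h) else 0) / of_nat (card K)) / of_nat (card H)"
  unfolding sub_cip[OF H] ind_def by (auto simp: sum_distrib_right sum_divide_distrib intro!: sum.cong arg_cong2[where f="(/)"])
 also have "... = (SUM s:CG. SUM h:H. (if s \<otimes> h \<otimes> inv s : K then b (s \<otimes> h \<otimes> inv s) * a (inv h) else 0) / of_nat (card K)) / of_nat (card H)"
  by (subst sum.swap) simp
 finally show ?thesis by (simp add: sum_divide_distrib[symmetric] mult.commute cong: if_cong)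
qed

lemma same_char_intertwiner:
 assumes \<rho>: "irreducible_rep G n \<rho>" and \<sigma>: "irreducible_rep G m \<sigma>"
  and eq: "!!g. g : CG ==> mat_trace (\<rho> g) = mat_trace (\<sigma> g)"
 obtains T R where "T : cmat m n" "R : cmat n m" "T * R = 1\<^sub>m m" "R * T = 1\<^sub>m n"
  "!!g. g : CG ==> \<sigma> g * T = T * \<rho> g"
proof -
 have "cip G (%g. mat_trace (\<sigma> g)) (%g. mat_trace (\<rho> g)) = cip G (%g. mat_trace (\<rho> g)) (%g. mat_trace (\<rho> g))"
  by (rule cip_cong) (auto simp: eq)
 hence "cip G (%g. mat_trace (\<sigma> g)) (%g. mat_trace (\<rho> g)) ~= 0" using cip_irr_self[OF \<rho>] by simp
 from cip_eq_0_or_iso[OF \<rho> \<sigma> this] show ?thesis using that by metis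
qed

end

section \<open>Roots of unity\<close>

definition rt :: "nat => int => complex" where
 "rt N k = cis (2 * pi * of_int k / of_nat N)"

lemma rt_0 [simp]: "rt N 0 = 1" by (simp add: rt_def)

lemma rt_add: "rt N (a + b) = rt N a * rt N b"
 by (simp add: rt_def cis_mult add_divide_distrib ring_distribs)

lemma rt_nonzero [simp]: "rt N a ~= 0" by (simp add: rt_def)

lemma rt_power: "rt N a ^ j = rt N (a * int j)"
 by (induction j) (simp_all add: rt_add ring_distribs)

lemma rt_eq_1_iff: "0 < N ==> rt N k = 1 <-> int N dvd k"
proof
 assume N: "0 < N" and "rt N k = 1"
 hence "cos (2 * pi * of_int k / of_nat N) = 1" by (simp add: rt_def complex_eq_iff)
 then obtain z :: int where z: "2 * pi * of_int k / of_nat N = of_int z * 2 * pi"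
  unfolding cos_one_2pi_int by auto
 hence "(of_int k :: real) = of_int (z * int N)" using N by (simp add: field_simps)
 hence "k = z * int N" by (simp only: of_int_eq_iff)
 thus "int N dvd k" by simp
next
 assume N: "0 < N" and "int N dvd k"
 then obtain z where "k = int N * z" by (auto elim: dvdE)
 hence "2 * pi * of_int k / of_nat N = 2 * pi * of_int z" using N by (simp add: field_simps)
 thus "rt N k = 1" by (simp add: rt_def cis_multiple_2pi)
qed

lemma rt_eq_iff: "0 < N ==> rt N a = rt N b <-> [a = b] (mod int N)"
proof -
 assume N: "0 < N"
 have "rt N a = rt N b <-> rt N (a - b) = 1"
  using rt_add[of N "a - b" b] by (auto simp: field_simps)
 thus ?thesis using rt_eq_1_iff[OF N] by (simp add: cong_iff_dvd_diff)
qed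

lemma rt_sum:
 assumes N: "0 < N"
 shows "(\<Sum>j<N. rt N (k * int j)) = (if int N dvd k then of_nat N else 0)"
proof -
 have *: "(\<Sum>j<N. rt N (k * int j)) = (\<Sum>j<N. rt N k ^ j)" by (simp add: rt_power)
 have "rt N k ^ N = 1" using rt_eq_1_iff[OF N, of "k * int N"] by (simp add: rt_power)
 thus ?thesis unfolding * using rt_eq_1_iff[OF N, of k]
  by (auto simp: geometric_sum)
qed

section \<open>Extensions by a cyclic group\<close>

lemma pow_mat_plus: "A : cmat n n ==> A ^\<^sub>m i * A ^\<^sub>m j = A ^\<^sub>m (i + j)"
proof (induction j)
 case (Suc j)
 have "A ^\<^sub>m i * (A ^\<^sub>m j * A) = (A ^\<^sub>m i * A ^\<^sub>m j) * A"
  using Suc.prems by (intro amm[symmetric, of _ n n _ n _ n]) auto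
 thus ?case using Suc by simp
qed simp

lemma pow_mat_smult: "(A :: 'a :: comm_semiring_1 mat) : cmat n n ==> (a *m A) ^\<^sub>m i = a ^ i *m A ^\<^sub>m i"
proof (induction i)
 case (Suc i)
 have c: "A ^\<^sub>m i : cmat n n" using Suc.prems by simp
 show ?case using Suc mult_smult_distrib[OF smult_carrier_mat[OF c] Suc.prems] mult_smult_assoc_mat[OF c Suc.prems]
  by (intro eq_matI) (auto simp: mult_ac)
qed (intro eq_matI, auto)

context fin_group
begin

lemma finite_subgroupI:
 assumes "I <= CG" "\<one> : I" "!!g h. g : I ==> h : I ==> g \<otimes> h : I"
 shows "subgroup I G"
proof (rule subgroupI)
 fix g assume g: "g : I"
 hence gc: "g : CG" using assms by auto
 have "g [^] (i::nat) : I" for i using g assms by (induction i) auto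
 moreover have "inv g = g [^] (Coset.order G - 1)"
 proof (rule inv_equality[symmetric, THEN sym])
  have "g [^] (Coset.order G - 1) \<otimes> g = g [^] Suc (Coset.order G - 1)" by simp
  also have "Suc (Coset.order G - 1) = Coset.order G" using card_pos by (simp add: Coset.order_def)
  finally show "g [^] (Coset.order G - 1) \<otimes> g = \<one>" using gc by (simp add: pow_order_eq_1)
 qed (use gc in auto)
 ultimately show "inv g : I" by simp
qed (use assms in auto)

lemma irr_comp:
 assumes \<tau>: "irreducible_rep G m \<tau>" and H: "fin_group H" and \<phi>: "\<phi> : hom H G" "\<phi> ` carrier H = CG"
 shows "irreducible_rep H m (%s. \<tau> (\<phi> s))"
proof -
 interpret H: fin_group H by (rule H)
 interpret \<phi>: group_hom H G \<phi> by unfold_locales (rule \<phi>(1))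
 have "complex_rep H m (%s. \<tau> (\<phi> s))"
  using irr_rep[OF \<tau>] unfolding H.complex_rep_iff complex_rep_iff by auto
 moreover have "(ALL g:carrier H. ALL w:W. \<tau> (\<phi> g) *v w : W) ==> ALL g:CG. ALL w:W. \<tau> g *v w : W" for W
  using \<phi>(2) by (metis imageE)
 ultimately show ?thesis using \<tau> unfolding irreducible_rep_def by simp
qed

end

text \<open>A split extension of \<open>S\<close> by a cyclic group of order \<open>d\<close>
  generated by \<open>x\<close>, given through its normal form: \<open>uniq\<close> and
  \<open>surj\<close> say that each element is \<open>\<iota> s \<otimes> x [^] i\<close> for
  exactly one \<open>s\<close> and one \<open>i < d\<close>. The map \<open>\<sigma>\<close> is
  conjugation by \<open>x\<close>, transported to \<open>S\<close>.\<close>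

locale cyc_ext = fin_group G + S: fin_group S for G (structure) and S +
 fixes \<iota> x \<sigma> d
 assumes d0: "0 < d"
  and iota: "\<iota> : hom S G"
  and xG [simp]: "x : carrier G"
  and xd: "x [^] (d::nat) = \<one>"
  and sigma [simp]: "s : carrier S ==> \<sigma> s : carrier S"
  and conj: "s : carrier S ==> x \<otimes> \<iota> s = \<iota> (\<sigma> s) \<otimes> x"
  and uniq: "s : carrier S ==> s' : carrier S ==> i < d ==> j < d ==>
   \<iota> s \<otimes> x [^] i = \<iota> s' \<otimes> x [^] j ==> s = s' & i = j"
  and surj: "g : carrier G ==> EX s:carrier S. EX i<d. g = \<iota> s \<otimes> x [^] i"
begin

lemma iota_closed [simp]: "s : carrier S ==> \<iota> s : CG"
 using iota by (auto simp: hom_def)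

lemma iota_mult: "s : carrier S ==> t : carrier S ==> \<iota> (s \<otimes>\<^bsub>S\<^esub> t) = \<iota> s \<otimes> \<iota> t"
 using iota by (auto simp: hom_def)

lemma iota_hom: "group_hom S G \<iota>"
 by (simp add: group_hom_def group_hom_axioms_def iota S.group_axioms group_axioms)

lemma iota_one: "\<iota> \<one>\<^bsub>S\<^esub> = \<one>"
 by (rule group_hom.hom_one[OF iota_hom])

lemma iota_inv: "s : carrier S ==> \<iota> (inv\<^bsub>S\<^esub> s) = inv (\<iota> s)"
 by (rule group_hom.hom_inv[OF iota_hom])

lemma iota_inj: "s : carrier S ==> t : carrier S ==> \<iota> s = \<iota> t ==> s = t"
 using uniq[of s t 0 0] d0 by simp

lemma sigma_pow [simp]: "s : carrier S ==> (\<sigma> ^^ i) s : carrier S"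
 by (induction i) auto

lemma conj_pow: "s : carrier S ==> x [^] i \<otimes> \<iota> s = \<iota> ((\<sigma> ^^ i) s) \<otimes> x [^] i"
proof (induction i)
 case (Suc i)
 have xi: "x [^] Suc i = x \<otimes> x [^] i" by (rule nat_pow_Suc2[OF xG])
 have "x [^] Suc i \<otimes> \<iota> s = x \<otimes> (x [^] i \<otimes> \<iota> s)" unfolding xi using Suc.prems by (simp add: m_assoc)
 also have "... = (x \<otimes> \<iota> ((\<sigma> ^^ i) s)) \<otimes> x [^] i" using Suc by (simp add: m_assoc)
 also have "... = \<iota> ((\<sigma> ^^ Suc i) s) \<otimes> x [^] Suc i" unfolding xi using Suc.prems by (simp add: conj m_assoc)
 finally show ?case .
qed simp

lemma sigma_d: "s : carrier S ==> (\<sigma> ^^ d) s = s"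
 using conj_pow[of s d] by (auto simp: xd intro: iota_inj)

lemma sigma_mult: "s : carrier S ==> t : carrier S ==> \<sigma> (s \<otimes>\<^bsub>S\<^esub> t) = \<sigma> s \<otimes>\<^bsub>S\<^esub> \<sigma> t"
proof -
 assume s: "s : carrier S" and t: "t : carrier S"
 have "\<iota> (\<sigma> (s \<otimes>\<^bsub>S\<^esub> t)) \<otimes> x = (x \<otimes> \<iota> s) \<otimes> \<iota> t" using s t by (simp add: conj[symmetric] iota_mult m_assoc)
 also have "... = \<iota> (\<sigma> s) \<otimes> (x \<otimes> \<iota> t)" using s t by (simp add: conj m_assoc)
 also have "... = \<iota> (\<sigma> s \<otimes>\<^bsub>S\<^esub> \<sigma> t) \<otimes> x" using s t by (simp add: conj m_assoc iota_mult)
 finally show ?thesis using s t by (simp add: iota_inj)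
qed

lemma sigma_pow_mult: "s : carrier S ==> t : carrier S ==> (\<sigma> ^^ i) (s \<otimes>\<^bsub>S\<^esub> t) = (\<sigma> ^^ i) s \<otimes>\<^bsub>S\<^esub> (\<sigma> ^^ i) t"
 by (induction i) (auto simp: sigma_mult)

lemma sigma_dmult: "s : carrier S ==> (\<sigma> ^^ (d * j)) s = s"
 by (induction j) (simp_all add: funpow_add sigma_d)

lemma sigma_pow_surj: "t : carrier S ==> EX s:carrier S. (\<sigma> ^^ i) s = t"
proof -
 assume t: "t : carrier S"
 have "i <= d * i" using d0 by simp
 hence "(\<sigma> ^^ i) ((\<sigma> ^^ (d * i - i)) t) = t"
  using sigma_dmult[OF t, of i] by (metis funpow_add comp_apply le_add_diff_inverse)
 thus ?thesis using t by (intro bexI[of _ "(\<sigma> ^^ (d * i - i)) t"]) auto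
qed

lemma card_G: "card (CG) = card (carrier S) * d"
proof -
 have "bij_betw (%(s,i). \<iota> s \<otimes> x [^] (i::nat)) (carrier S \<times> {..<d}) (CG)"
  unfolding bij_betw_def inj_on_def using uniq surj by (fastforce simp: image_iff)
 thus ?thesis using bij_betw_same_card by (fastforce simp: card_cartesian_product)
qed

text \<open>The length of the orbit of \<open>\<chi>\<close> under \<open>\<sigma>\<close>.\<close>

definition per :: "('c => complex) => nat" where
 "per \<chi> = (LEAST k. 0 < k & (ALL s:carrier S. \<chi> ((\<sigma> ^^ k) s) = \<chi> s))"

lemma per: "0 < per \<chi>" "s : carrier S ==> \<chi> ((\<sigma> ^^ per \<chi>) s) = \<chi> s"
 using LeastI[of "%k. 0 < k & (ALL s:carrier S. \<chi> ((\<sigma> ^^ k) s) = \<chi> s)" d] d0 sigma_d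
 unfolding per_def by auto

lemma per_le: "0 < k ==> (!!s. s : carrier S ==> \<chi> ((\<sigma> ^^ k) s) = \<chi> s) ==> per \<chi> <= k"
 unfolding per_def by (rule Least_le) auto

lemma per_mult: "s : carrier S ==> \<chi> ((\<sigma> ^^ (per \<chi> * j)) s) = \<chi> s"
 by (induction j arbitrary: s) (simp_all add: funpow_add per)

lemma per_dvd:
 assumes k: "!!s. s : carrier S ==> \<chi> ((\<sigma> ^^ k) s) = \<chi> s"
 shows "per \<chi> dvd k"
proof (rule ccontr)
 assume nd: "~ per \<chi> dvd k"
 define r where "r = k mod per \<chi>"
 have r: "0 < r" "r < per \<chi>" using nd per(1) by (auto simp: r_def mod_greater_zero_iff_not_dvd)
 have "\<chi> ((\<sigma> ^^ r) s) = \<chi> s" if s: "s : carrier S" for s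
 proof -
  have "\<chi> s = \<chi> ((\<sigma> ^^ k) s)" using k s by simp
  also have "k = per \<chi> * (k div per \<chi>) + r" by (simp add: r_def)
  finally have "\<chi> s = \<chi> ((\<sigma> ^^ (per \<chi> * (k div per \<chi>))) ((\<sigma> ^^ r) s))"
   by (simp add: funpow_add)
  thus ?thesis using per_mult[of "(\<sigma> ^^ r) s" \<chi> "k div per \<chi>"] s by simp
 qed
 thus False using per_le[of r \<chi>] r by simp
qed

lemma per_dvd_d: "per \<chi> dvd d"
 by (rule per_dvd) (simp add: sigma_d)

lemma sigma_hom: "(\<sigma> ^^ i) : hom S S" "(\<sigma> ^^ i) ` carrier S = carrier S"
proof -
 show "(\<sigma> ^^ i) : hom S S" by (simp add: hom_def sigma_pow_mult)
 show "(\<sigma> ^^ i) ` carrier S = carrier S" using sigma_pow_surj[of _ i] by (metis (no_types, lifting) image_subset_iff sigma_pow subset_antisym subsetI image_iff)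
qed

end

section \<open>Clifford theory over one irreducible character of \<open>S\<close>\<close>

locale cyc_char = cyc_ext +
 fixes \<tau> m \<chi> k e
 assumes \<tau>: "irreducible_rep S m \<tau>" and \<chi>_def: "\<chi> = (\<lambda>s\<in>carrier S. mat_trace (\<tau> s))"
  and k_def: "k = per \<chi>" and e: "d = k * e"
begin

lemma e0: "0 < e" using d0 e by auto

lemma k0: "0 < k" unfolding k_def by (rule per)

lemma c\<tau>: "s : carrier S ==> \<tau> s : cmat m m"
 by (rule S.rep_mat[OF S.irr_rep[OF \<tau>]])

text \<open>The inertia group of \<open>\<chi>\<close>, of index \<open>k\<close> in
  \<open>G\<close>.\<close>

definition "TT = {\<iota> s \<otimes> x [^] (k * i) | s i. s : carrier S}"

lemma TTI: "s : carrier S ==> \<iota> s \<otimes> x [^] (k * i) : TT" by (auto simp: TT_def)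

lemma x_mod: "x [^] (k * i) = x [^] (k * (i mod e))"
proof -
 have "k * i = k * (i mod e) + k * e * (i div e)" by (simp only: mult.assoc mod_mult_div_eq flip: distrib_left)
 hence "x [^] (k * i) = x [^] (k * (i mod e)) \<otimes> (x [^] d) [^] (i div e)"
  unfolding e nat_pow_pow[OF xG] nat_pow_mult[OF xG] by (simp only:)
 thus ?thesis by (simp add: xd)
qed

lemma TT_eq:
 assumes "s : carrier S" "t : carrier S" "\<iota> s \<otimes> x [^] (k * i) = \<iota> t \<otimes> x [^] (k * j)"
 shows "s = t" "i mod e = j mod e"
 using uniq[OF assms(1,2), of "k * (i mod e)" "k * (j mod e)"] assms(3) x_mod[of i] x_mod[of j] e0 k0 by (auto simp: e)

lemma TT_mult: "s : carrier S ==> t : carrier S ==> (\<iota> s \<otimes> x [^] (k * i)) \<otimes> (\<iota> t \<otimes> x [^] (k * j)) =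
 \<iota> (s \<otimes>\<^bsub>S\<^esub> (\<sigma> ^^ (k * i)) t) \<otimes> x [^] (k * (i + j))"
proof -
 assume s: "s : carrier S" and t: "t : carrier S"
 have "(\<iota> s \<otimes> x [^] (k * i)) \<otimes> (\<iota> t \<otimes> x [^] (k * j)) = \<iota> s \<otimes> (x [^] (k * i) \<otimes> \<iota> t) \<otimes> x [^] (k * j)" using s t by (simp add: m_assoc)
 thus ?thesis using s t by (simp add: conj_pow iota_mult m_assoc nat_pow_mult ring_distribs)
qed

lemma iota_TT: "s : carrier S ==> \<iota> s : TT" using TTI[of s 0] by simp

lemma TT_sub: "subgroup TT G"
 by (rule finite_subgroupI) (auto simp: TT_def TT_mult iota_TT[of "\<one>\<^bsub>S\<^esub>", unfolded iota_one TT_def, simplified] intro!: TTI[unfolded TT_def, simplified])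

abbreviation "TG == G(|carrier := TT|)"

sublocale T: fin_group TG by (rule sub_fin_group[OF TT_sub])

lemma TT_bij: "bij_betw (%(s,i). \<iota> s \<otimes> x [^] (k * i)) (carrier S \<times> {..<e}) TT"
proof (rule bij_betwI')
 fix p q assume "p : carrier S \<times> {..<e}" "q : carrier S \<times> {..<e}"
 thus "(case p of (s, i) => \<iota> s \<otimes> x [^] (k * i)) = (case q of (s, i) => \<iota> s \<otimes> x [^] (k * i)) <-> p = q"
  using TT_eq[of "fst p" "fst q" "snd p" "snd q"] by auto
next
 fix t assume "t : TT"
 then obtain s i where "s : carrier S" "t = \<iota> s \<otimes> x [^] (k * i)" by (auto simp: TT_def)
 thus "EX p:carrier S \<times> {..<e}. t = (case p of (s, i) => \<iota> s \<otimes> x [^] (k * i))"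
  using e0 x_mod[of i] by (intro bexI[of _ "(s, i mod e)"]) auto
next
 fix p assume "p : carrier S \<times> {..<e}"
 thus "(case p of (s, i) => \<iota> s \<otimes> x [^] (k * i)) : TT"
  using TTI[of "fst p" "snd p"] by (cases p) simp
qed

lemma sum_TT: "(SUM t:TT. h t) = (SUM s:carrier S. \<Sum>i<e. h (\<iota> s \<otimes> x [^] (k * i)))"
 unfolding sum.cartesian_product sum.reindex_bij_betw[OF TT_bij, symmetric] by (simp add: case_prod_unfold)

lemma card_TT: "card TT = card (carrier S) * e"
 using bij_betw_same_card[OF TT_bij] by (simp add: card_cartesian_product)

lemma TT_normal: "g : CG ==> t : TT ==> g \<otimes> t \<otimes> inv g : TT"
proof -
 assume "g : CG" and t: "t : TT"
 then obtain u j where g: "u : carrier S" "g = \<iota> u \<otimes> x [^] (j::nat)" using surj[of g] by blast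
 obtain s i where t: "s : carrier S" "t = \<iota> s \<otimes> x [^] (k * i)" using t unfolding TT_def by blast
 have "g \<otimes> t \<otimes> inv g = \<iota> u \<otimes> (x [^] j \<otimes> \<iota> s) \<otimes> x [^] (k * i) \<otimes> (inv (x [^] j) \<otimes> inv (\<iota> u))"
  using g t by (simp add: m_assoc inv_mult_group)
 also have "... = \<iota> u \<otimes> \<iota> ((\<sigma> ^^ j) s) \<otimes> (x [^] j \<otimes> x [^] (k * i) \<otimes> inv (x [^] j)) \<otimes> inv (\<iota> u)"
  using g t by (simp add: conj_pow m_assoc)
 also have "x [^] j \<otimes> x [^] (k * i) = x [^] (k * i) \<otimes> x [^] j" by (simp add: nat_pow_mult add.commute)
 finally have "g \<otimes> t \<otimes> inv g = (\<iota> u \<otimes> x [^] (k * 0)) \<otimes> (\<iota> ((\<sigma> ^^ j) s) \<otimes> x [^] (k * i)) \<otimes> inv (\<iota> u)"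
  using g t by (simp add: m_assoc)
 thus ?thesis using g(1) t(1) TTI[of u 0] TTI[of "(\<sigma> ^^ j) s" i] subgroup.m_inv_closed[OF TT_sub iota_TT]
  by (simp add: subgroup.m_closed[OF TT_sub])
qed

lemma conj_TT:
 assumes g: "g : CG"
 shows "(%t. g \<otimes> t \<otimes> inv g) : hom TG TG" "(%t. g \<otimes> t \<otimes> inv g) ` TT = TT"
proof -
 have c: "t : TT ==> t : CG" for t using subgroup.mem_carrier[OF TT_sub] .
 show "(%t. g \<otimes> t \<otimes> inv g) : hom TG TG"
  using TT_normal[OF g] g by (auto simp: hom_def m_assoc inv_mult_cancel c subgroup.m_closed[OF TT_sub])
 have "t : (%t. g \<otimes> t \<otimes> inv g) ` TT" if "t : TT" for t
  using TT_normal[of "inv g" t] that g c[OF that] by (intro image_eqI[of _ _ "inv g \<otimes> t \<otimes> g"]) (simp_all add: m_assoc mult_inv_cancel)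
 thus "(%t. g \<otimes> t \<otimes> inv g) ` TT = TT" using TT_normal[OF g] by blast
qed

text \<open>The candidate extension of \<open>\<tau>\<close> to the inertia group, with
  \<open>M\<close> as the image of \<open>x [^] k\<close>. The description is unambiguous once the
  \<open>e\<close>-th power of \<open>M\<close> is the identity (\<open>rho_eq\<close>).\<close>

definition rho :: "complex mat => 'a => complex mat" where
 "rho M g = (THE A. EX s:carrier S. EX i. g = \<iota> s \<otimes> x [^] (k * i) & A = \<tau> s * M ^\<^sub>m i)"

lemma M_comm:
 assumes M: "M : cmat m m" and Mc: "ALL s:carrier S. \<tau> ((\<sigma> ^^ k) s) * M = M * \<tau> s"
 shows "s : carrier S ==> \<tau> ((\<sigma> ^^ (k * i)) s) * M ^\<^sub>m i = M ^\<^sub>m i * \<tau> s"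
proof (induction i arbitrary: s)
 case 0 thus ?case using c\<tau>[OF 0] M by simp
next
 case (Suc i)
 have "\<tau> ((\<sigma> ^^ (k * Suc i)) s) * M ^\<^sub>m Suc i = (\<tau> ((\<sigma> ^^ (k * i)) ((\<sigma> ^^ k) s)) * M ^\<^sub>m i) * M"
  using c\<tau>[of "(\<sigma> ^^ (k * i)) ((\<sigma> ^^ k) s)"] M pow_carrier_mat[OF M, of i] Suc.prems
  by (simp add: funpow_add add.commute[of k] amm[of _ m m _ m _ m])
 also have "... = M ^\<^sub>m i * (\<tau> ((\<sigma> ^^ k) s) * M)"
  using Suc c\<tau>[of "(\<sigma> ^^ k) s"] M pow_carrier_mat[OF M, of i] by (simp add: amm[of _ m m _ m _ m])
 also have "... = M ^\<^sub>m Suc i * \<tau> s"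
  using Suc.prems c\<tau>[of s] M pow_carrier_mat[OF M, of i] by (simp add: Mc amm[of _ m m _ m _ m])
 finally show ?case .
qed

context
 fixes M
 assumes M: "M : cmat m m" and Mc: "ALL s:carrier S. \<tau> ((\<sigma> ^^ k) s) * M = M * \<tau> s" and Me: "M ^\<^sub>m e = 1\<^sub>m m"
begin

lemma M_pow: "M ^\<^sub>m i : cmat m m" using M by simp

lemma M_mod: "M ^\<^sub>m i = M ^\<^sub>m (i mod e)"
proof -
 have "M ^\<^sub>m (e * q) = 1\<^sub>m m" for q
  by (induction q) (use M pow_mat_plus[OF M, of e] in \<open>simp_all add: Me flip: pow_mat_plus[OF M]\<close>)
 thus ?thesis using pow_mat_plus[OF M, of "e * (i div e)" "i mod e"] left_mult_one_mat[OF M_pow, of "i mod e"] by simp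
qed

lemma rho_eq: "s : carrier S ==> rho M (\<iota> s \<otimes> x [^] (k * i)) = \<tau> s * M ^\<^sub>m i"
 unfolding rho_def
proof (rule the_equality)
 fix A assume s: "s : carrier S" and "EX t:carrier S. EX j. \<iota> s \<otimes> x [^] (k * i) = \<iota> t \<otimes> x [^] (k * j) & A = \<tau> t * M ^\<^sub>m j"
 then obtain t j where t: "t : carrier S" "\<iota> s \<otimes> x [^] (k * i) = \<iota> t \<otimes> x [^] (k * j)" "A = \<tau> t * M ^\<^sub>m j" by blast
 thus "A = \<tau> s * M ^\<^sub>m i" using TT_eq[OF s t(1,2)] M_mod[of i] M_mod[of j] by simp
qed blast

lemma rho_iota: "s : carrier S ==> rho M (\<iota> s) = \<tau> s"
 using rho_eq[of s 0] c\<tau>[of s] M by simp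

lemma rho_irr: "irreducible_rep TG m (rho M)"
proof -
 have "rho M (g \<otimes> h) = rho M g * rho M h" if gT: "g : TT" and hT: "h : TT" for g h
 proof -
  obtain s i where g: "s : carrier S" "g = \<iota> s \<otimes> x [^] (k * i)" using gT unfolding TT_def by blast
  obtain t j where h: "t : carrier S" "h = \<iota> t \<otimes> x [^] (k * j)" using hT unfolding TT_def by blast
  let ?t = "(\<sigma> ^^ (k * i)) t"
  note c = c\<tau>[OF g(1)] c\<tau>[OF h(1)] c\<tau>[of ?t] M_pow[of i] M_pow[of j] h(1)
  have "rho M (g \<otimes> h) = \<tau> (s \<otimes>\<^bsub>S\<^esub> ?t) * M ^\<^sub>m (i + j)"
   unfolding g(2) h(2) TT_mult[OF g(1) h(1)] by (rule rho_eq) (use g h in simp)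
  also have "... = \<tau> s * \<tau> ?t * (M ^\<^sub>m i * M ^\<^sub>m j)"
   unfolding pow_mat_plus[OF M] S.rep_mult[OF S.irr_rep[OF \<tau>] g(1) sigma_pow[OF h(1)]] ..
  also have "... = \<tau> s * (\<tau> ?t * M ^\<^sub>m i) * M ^\<^sub>m j" using c by (simp add: amm[of _ m m _ m _ m])
  also have "\<tau> ?t * M ^\<^sub>m i = M ^\<^sub>m i * \<tau> t" by (rule M_comm[OF M Mc h(1)])
  also have "\<tau> s * (M ^\<^sub>m i * \<tau> t) * M ^\<^sub>m j = rho M g * rho M h" unfolding g(2) h(2) rho_eq[OF g(1)] rho_eq[OF h(1)] using c by (simp add: amm[of _ m m _ m _ m])
  finally show ?thesis .
 qed
 moreover have "rho M g : cmat m m" if "g : TT" for g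
  using that c\<tau> M_pow rho_eq unfolding TT_def by (auto intro!: mult_carrier_mat)
 moreover have "rho M \<one> = 1\<^sub>m m" using rho_iota[of "\<one>\<^bsub>S\<^esub>"] S.rep_one[OF S.irr_rep[OF \<tau>]] by (simp add: iota_one)
 ultimately have rep: "complex_rep TG m (rho M)" unfolding T.complex_rep_iff by simp
 have "ALL s:carrier S. ALL w:W. \<tau> s *v w : W" if "ALL g:TT. ALL w:W. rho M g *v w : W" for W
  using that iota_TT rho_iota by metis
 thus ?thesis using \<tau> rep unfolding irreducible_rep_def by simp
qed

abbreviation "aT == %g. mat_trace (rho M g)"

text \<open>The conjugate by \<open>g\<close> of the extended character is again irreducible, so
  only equality matters. Restricted to \<open>S\<close>, equality makes the exponent of
  \<open>x\<close> in \<open>g\<close> a multiple of the period of \<open>\<chi>\<close>.\<close>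

lemma aT_norm: "g : CG ==> cip TG (%t. aT (g \<otimes> t \<otimes> inv g)) aT = (if g : TT then 1 else 0)"
proof -
 assume g: "g : CG"
 let ?h = "%t. g \<otimes> t \<otimes> inv g"
 define \<alpha> \<beta> where "\<alpha> = (\<lambda>t\<in>TT. aT (?h t))" and "\<beta> = (\<lambda>t\<in>TT. aT t)"
 have "irreducible_rep TG m (%t. rho M (?h t))"
  by (rule T.irr_comp[OF rho_irr T.fin_group_axioms]) (use conj_TT[OF g] in auto)
 hence I: "\<alpha> : Irr TG" "\<beta> : Irr TG" unfolding T.Irr_iff \<alpha>_def \<beta>_def using rho_irr by auto
 have cf: "aT (h \<otimes> t \<otimes> inv h) = aT t" if "h : TT" "t : TT" for h t
  using T.class_fun_conj[OF T.class_fun_trace[OF T.irr_rep[OF rho_irr]], of t h] that m_inv_consistent[OF TT_sub that(1)] by simp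
 have "\<alpha> = \<beta> <-> g : TT"
 proof
  show "\<alpha> = \<beta>" if "g : TT" using cf[OF that] by (auto simp: \<alpha>_def \<beta>_def)
  assume eq: "\<alpha> = \<beta>"
  obtain u j where u: "u : carrier S" "g = \<iota> u \<otimes> x [^] (j::nat)" using surj[OF g] by blast
  have "\<chi> ((\<sigma> ^^ j) s) = \<chi> s" if s: "s : carrier S" for s
  proof -
   have "?h (\<iota> s) = \<iota> u \<otimes> (x [^] j \<otimes> \<iota> s) \<otimes> (inv (x [^] j) \<otimes> inv (\<iota> u))" using u s by (simp add: m_assoc inv_mult_group)
   also have "... = \<iota> u \<otimes> \<iota> ((\<sigma> ^^ j) s) \<otimes> inv (\<iota> u)" using u s by (simp add: conj_pow m_assoc mult_inv_cancel)
   finally have "aT (?h (\<iota> s)) = aT (\<iota> ((\<sigma> ^^ j) s))" using cf iota_TT u(1) s by simp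
   moreover have "aT (?h (\<iota> s)) = aT (\<iota> s)" using fun_cong[OF eq, of "\<iota> s"] iota_TT[OF s] by (simp add: \<alpha>_def \<beta>_def)
   ultimately show ?thesis using s by (simp add: rho_iota \<chi>_def)
  qed
  hence "k dvd j" unfolding k_def by (rule per_dvd)
  thus "g : TT" using u TTI by (auto elim!: dvdE)
 qed
 hence "cip TG \<alpha> \<beta> = (if g : TT then 1 else 0)" using T.irr_orth[OF I] by simp
 moreover have "cip TG (%t. aT (?h t)) aT = cip TG \<alpha> \<beta>" by (rule T.cip_cong) (auto simp: \<alpha>_def \<beta>_def)
 ultimately show ?thesis by simp
qed

definition "fM = ind G TT aT"

lemma fM_one: "fM \<one> = of_nat (k * m)"
proof -
 have "aT \<one> = of_nat m" using T.rep_one[OF T.irr_rep[OF rho_irr]] by simp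
 hence "fM \<one> * (of_nat (card (carrier S)) * of_nat e) = of_nat (k * m) * (of_nat (card (carrier S)) * of_nat e)"
  unfolding fM_def ind_one[OF TT_sub] card_TT card_G using S.card_ne0 e0 by (simp add: e field_simps)
 thus ?thesis using S.card_ne0 e0 by simp
qed

text \<open>As \<open>TT\<close> is normal, the induced character restricted to \<open>TT\<close> is
  an average of conjugates, of which by \<open>aT_norm\<close> exactly the terms with
  \<open>g\<close> in \<open>TT\<close> contribute.\<close>

lemma fM_irr: "restrict fM (CG) : Irr G"
proof (rule vchar_norm1[of fM "k * m", OF _ _ fM_one])
 show v: "vchar G fM" unfolding fM_def by (rule vchar_ind[OF TT_sub T.rep_vchar[OF T.irr_rep[OF rho_irr]]])
 have "cip G fM fM = cip TG fM aT" unfolding fM_def frobenius[OF TT_sub class_fun_ind] by (rule T.cip_sym)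
 also have "... = cip TG (%t. SUM g:CG. (1 / of_nat (card TT)) * aT (g \<otimes> t \<otimes> inv g)) aT"
  by (rule T.cip_cong) (auto simp: fM_def ind_def TT_normal sum_divide_distrib)
 also have "... = (SUM g:CG. (1 / of_nat (card TT)) * (if g : TT then 1 else 0))"
  unfolding T.cip_sum T.cip_scale by (intro sum.cong refl) (simp add: aT_norm)
 also have "... = of_nat (card (CG Int TT)) / of_nat (card TT)"
  by (simp add: sum.inter_restrict[symmetric] flip: sum_divide_distrib)
 also have "CG Int TT = TT" using subgroup.subset[OF TT_sub] by blast
 finally show "cip G fM fM = 1" using T.card_ne0 by simp
qed

end

text \<open>A matrix \<open>P\<close> carrying \<open>\<tau>\<close> to its twist by
  \<open>\<sigma> ^^ k\<close> exists because the characters agree. As \<open>\<sigma> ^^ d\<close>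
  is trivial and \<open>d = k * e\<close>, the \<open>e\<close>-th power of \<open>P\<close>
  commutes with \<open>\<tau>\<close>, so it is a nonzero scalar, and dividing \<open>P\<close> by
  an \<open>e\<close>-th root of it gives \<open>M\<close>.\<close>

lemma intertwiner: "EX M:cmat m m. (ALL s:carrier S. \<tau> ((\<sigma> ^^ k) s) * M = M * \<tau> s) & M ^\<^sub>m e = 1\<^sub>m m"
proof -
 have "mat_trace (\<tau> s) = mat_trace (\<tau> ((\<sigma> ^^ k) s))" if "s : carrier S" for s
  using per(2)[OF that, of \<chi>] that by (simp add: \<chi>_def k_def)
 from S.same_char_intertwiner[OF \<tau> S.irr_comp[OF \<tau> S.fin_group_axioms sigma_hom] this]
 obtain P R where P: "P : cmat m m" and R: "R : cmat m m" and PR: "P * R = 1\<^sub>m m"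
  and Pc: "ALL s:carrier S. \<tau> ((\<sigma> ^^ k) s) * P = P * \<tau> s" by metis
 have Pm: "P ^\<^sub>m i : cmat m m" for i using P by simp
 have "\<tau> s * P ^\<^sub>m e = P ^\<^sub>m e * \<tau> s" if "s : carrier S" for s
  using M_comm[OF P Pc that, of e] sigma_d[OF that] by (simp flip: e)
 then obtain c where c: "P ^\<^sub>m e = c *m 1\<^sub>m m" using S.schur_scalar[OF \<tau> Pm] by metis
 have inv: "P ^\<^sub>m i * R ^\<^sub>m i = 1\<^sub>m m" for i
 proof (induction i)
  case (Suc i)
  have "R ^\<^sub>m Suc i = R * R ^\<^sub>m i" using pow_mat_plus[OF R, of 1 i] R by simp
  hence "P ^\<^sub>m Suc i * R ^\<^sub>m Suc i = P ^\<^sub>m i * (P * (R * R ^\<^sub>m i))"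
   using P Pm[of i] R by (simp add: amm[of _ m m _ m _ m])
  also have "... = P ^\<^sub>m i * ((P * R) * R ^\<^sub>m i)" using P R by (simp add: amm[of _ m m _ m _ m])
  finally show ?case unfolding PR using Suc R by simp
 qed (use P R in simp)
 have "c ~= 0"
 proof
  assume "c = 0"
  hence "P ^\<^sub>m e = 0\<^sub>m m m" unfolding c by (intro eq_matI) auto
  hence "(1\<^sub>m m :: complex mat) = 0\<^sub>m m m" using inv[of e] left_mult_zero_mat[OF pow_carrier_mat[OF R], of m e] by simp
  hence "1\<^sub>m m $$ (0,0) = (0\<^sub>m m m :: complex mat) $$ (0,0)" by simp
  thus False using S.irr_rep_pos[OF \<tau>] by simp
 qed
 hence "card {z. z ^ e = c} ~= 0" using card_nth_roots[of c e] e0 by simp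
 then obtain \<gamma> where \<gamma>: "\<gamma> ^ e = c" by fastforce
 hence "\<gamma> ~= 0" using \<open>c ~= 0\<close> e0 by auto
 note \<gamma> = \<gamma> this
 have "(1 / \<gamma> *m P) ^\<^sub>m e = 1\<^sub>m m" unfolding pow_mat_smult[OF P] c using \<gamma> by (intro eq_matI) (auto simp: field_simps)
 moreover have "\<tau> ((\<sigma> ^^ k) s) * (1 / \<gamma> *m P) = (1 / \<gamma> *m P) * \<tau> s" if "s : carrier S" for s
  using Pc[rule_format, OF that] c\<tau>[OF that] c\<tau>[of "(\<sigma> ^^ k) s"] that P by (simp add: mult_smult_distrib[of _ m m _ m] mult_smult_assoc_mat[of _ m m _ m])
 ultimately show ?thesis using P by (intro bexI[of _ "1 / \<gamma> *m P"]) auto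
qed

text \<open>Summed over the \<open>e\<close> extensions of \<open>\<tau>\<close> to \<open>TT\<close>, the induced characters give the one induced
 from \<open>S\<close>; hence an irreducible character of \<open>G\<close> lying over \<open>\<chi>\<close> is one of them.\<close>
lemma cyc_char_main:
 "EX \<phi>:Irr G. \<phi> \<one> = of_nat (k * m)"
 "\<phi> : Irr G ==> cip S \<chi> (%s. \<phi> (\<iota> s)) ~= 0 ==> \<phi> \<one> = of_nat (k * m)"
proof -
 obtain M where M: "M : cmat m m" "ALL s:carrier S. \<tau> ((\<sigma> ^^ k) s) * M = M * \<tau> s" "M ^\<^sub>m e = 1\<^sub>m m"
  using intertwiner by blast
 show "EX \<phi>:Irr G. \<phi> \<one> = of_nat (k * m)" using fM_irr[OF M] fM_one[OF M] by (intro bexI[of _ "restrict (fM M) (CG)"]) auto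
 assume \<phi>: "\<phi> : Irr G" and ne: "cip S \<chi> (%s. \<phi> (\<iota> s)) ~= 0"
 \<comment> \<open>The other extensions differ from this one by a linear character of the cyclic
   group \<open>TT\<close> modulo \<open>S\<close>, that is by an \<open>e\<close>-th root of
   unity.\<close>
 define N where "N j = rt e (int j) *m M" for j
 have Np: "N j ^\<^sub>m i = rt e (int i * int j) *m M ^\<^sub>m i" for i j
  unfolding N_def pow_mat_smult[OF M(1)] rt_power by (simp add: mult.commute)
 have N: "N j : cmat m m" "ALL s:carrier S. \<tau> ((\<sigma> ^^ k) s) * N j = N j * \<tau> s" "N j ^\<^sub>m e = 1\<^sub>m m" for j
 proof -
  show "N j : cmat m m" using M(1) by (simp add: N_def)
  show "ALL s:carrier S. \<tau> ((\<sigma> ^^ k) s) * N j = N j * \<tau> s" unfolding N_def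
  proof
   fix s assume s: "s : carrier S"
   thus "\<tau> ((\<sigma> ^^ k) s) * (rt e (int j) *m M) = rt e (int j) *m M * \<tau> s"
    using M(1) M(2) c\<tau>[OF s] c\<tau>[of "(\<sigma> ^^ k) s"] by (simp add: mult_smult_distrib[of _ m m _ m] mult_smult_assoc_mat[of _ m m _ m])
  qed
  have "rt e (int e * int j) = 1" using rt_eq_1_iff[OF e0] by simp
  thus "N j ^\<^sub>m e = 1\<^sub>m m" unfolding Np M(3) by (intro eq_matI) auto
 qed
 have tr: "mat_trace (rho (N j) (\<iota> s \<otimes> x [^] (k * i))) = rt e (int i * int j) * mat_trace (\<tau> s * M ^\<^sub>m i)" if "s : carrier S" for s i j
  unfolding rho_eq[OF N that] Np mult_smult_distrib[OF c\<tau>[OF that] pow_carrier_mat[OF M(1)]]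
  by (rule mat_trace_smult[of _ m]) (use c\<tau>[OF that] M(1) in simp)
 have "(\<Sum>j<e. cip G (fM (N j)) \<phi>) = (\<Sum>j<e. cip TG (%g. mat_trace (rho (N j) g)) \<phi>)"
  using class_fun_Irr[OF \<phi>] by (simp add: fM_def[OF N] frobenius[OF TT_sub])
 also have "... = (SUM s:carrier S. \<Sum>i<e. (\<Sum>j<e. rt e (int i * int j)) * mat_trace (\<tau> s * M ^\<^sub>m i) * \<phi> (inv (\<iota> s \<otimes> x [^] (k * i)))) / of_nat (card TT)"
  unfolding T.cip_sum[symmetric] unfolding sub_cip[OF TT_sub] sum_TT sum_distrib_right by (simp add: tr)
 also have "... = (SUM s:carrier S. of_nat e * (mat_trace (\<tau> s) * \<phi> (inv (\<iota> s)))) / of_nat (card TT)"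
 proof (intro arg_cong2[where f = "(/)"] sum.cong refl)
  fix s assume s: "s : carrier S"
  \<comment> \<open>Summing over all extensions kills every coset of \<open>S\<close> except
    \<open>i = 0\<close>.\<close>
  have "(\<Sum>i<e. (\<Sum>j<e. rt e (int i * int j)) * mat_trace (\<tau> s * M ^\<^sub>m i) * \<phi> (inv (\<iota> s \<otimes> x [^] (k * i)))) =
   (\<Sum>i<e. if i = 0 then of_nat e * mat_trace (\<tau> s * M ^\<^sub>m i) * \<phi> (inv (\<iota> s \<otimes> x [^] (k * i))) else 0)"
   unfolding rt_sum[OF e0] by (intro sum.cong refl) (auto dest: zdvd_imp_le)
  also have "... = of_nat e * (mat_trace (\<tau> s) * \<phi> (inv (\<iota> s)))" using e0 s c\<tau>[OF s] M(1) by (simp add: sum.delta)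
  finally show "(\<Sum>i<e. (\<Sum>j<e. rt e (int i * int j)) * mat_trace (\<tau> s * M ^\<^sub>m i) * \<phi> (inv (\<iota> s \<otimes> x [^] (k * i)))) =
   of_nat e * (mat_trace (\<tau> s) * \<phi> (inv (\<iota> s)))" .
 qed
 also have "... = cip S \<chi> (%s. \<phi> (\<iota> s))"
  unfolding cip_def card_TT sum_distrib_left[symmetric] using e0 by (simp add: \<chi>_def iota_inv)
 finally obtain j where j: "cip G (fM (N j)) \<phi> ~= 0" using ne by (metis (no_types, lifting) sum.neutral)
 have "cip G (restrict (fM (N j)) (CG)) \<phi> = cip G (fM (N j)) \<phi>" by (rule cip_cong) auto
 hence "\<phi> = restrict (fM (N j)) (CG)" using j irr_orth[OF fM_irr[OF N] \<phi>] by (metis (full_types))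
 thus "\<phi> \<one> = of_nat (k * m)" using fM_one[OF N] by simp
qed

end

context cyc_ext
begin

text \<open>Every irreducible character of \<open>G\<close> lies over some \<open>\<chi>\<close>,
  since its restriction to \<open>S\<close> is not zero at the identity; both inclusions then follow
  from \<open>cyc_char_main\<close>.\<close>

theorem cd_cyc: "cd G = {of_nat (per \<chi>) * \<chi> \<one>\<^bsub>S\<^esub> | \<chi>. \<chi> : Irr S}"
proof -
 have main: "(EX \<phi>:Irr G. \<phi> \<one> = of_nat (per \<chi>) * \<chi> \<one>\<^bsub>S\<^esub>) &
   (ALL \<phi>:Irr G. cip S \<chi> (%s. \<phi> (\<iota> s)) ~= 0 --> \<phi> \<one> = of_nat (per \<chi>) * \<chi> \<one>\<^bsub>S\<^esub>)" if \<chi>: "\<chi> : Irr S" for \<chi>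
 proof -
  obtain m \<tau> where \<tau>: "irreducible_rep S m \<tau>" "\<chi> = (\<lambda>s\<in>carrier S. mat_trace (\<tau> s))" using \<chi> unfolding S.Irr_iff by blast
  obtain e where "d = per \<chi> * e" using per_dvd_d[of \<chi>] unfolding dvd_def by blast
  hence c: "cyc_char G S \<iota> x \<sigma> d \<tau> m \<chi> (per \<chi>) e"
   using cyc_ext_axioms \<tau> by (simp add: cyc_char_def cyc_char_axioms_def)
  have "\<chi> \<one>\<^bsub>S\<^esub> = of_nat m" using S.rep_one[OF S.irr_rep[OF \<tau>(1)]] by (simp add: \<tau>(2))
  thus ?thesis using cyc_char.cyc_char_main[OF c] by simp
 qed
 have ex: "EX \<chi>:Irr S. cip S \<chi> (%s. \<phi> (\<iota> s)) ~= 0" if \<phi>: "\<phi> : Irr G" for \<phi>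
 proof (rule ccontr)
  assume "~ ?thesis"
  moreover have "class_fun S (%s. \<phi> (\<iota> s))" using class_fun_Irr[OF \<phi>] by (simp add: class_fun_def iota_mult)
  ultimately have "\<phi> (\<iota> \<one>\<^bsub>S\<^esub>) = 0" using S.class_fun_orth_zero[of "%s. \<phi> (\<iota> s)" "\<one>\<^bsub>S\<^esub>"] S.cip_sym by fastforce
  thus False using Irr_one[OF \<phi>] by (auto simp: iota_one)
 qed
 have "EX \<chi>:Irr S. \<phi> \<one> = of_nat (per \<chi>) * \<chi> \<one>\<^bsub>S\<^esub>" if \<phi>: "\<phi> : Irr G" for \<phi>
 proof -
  obtain \<chi> where "\<chi> : Irr S" "cip S \<chi> (%s. \<phi> (\<iota> s)) ~= 0" using ex[OF \<phi>] by blast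
  thus ?thesis using main[of \<chi>] \<phi> by blast
 qed
 moreover have "EX \<phi>:Irr G. of_nat (per \<chi>) * \<chi> \<one>\<^bsub>S\<^esub> = \<phi> \<one>" if "\<chi> : Irr S" for \<chi> using main[OF that] by metis
 ultimately show ?thesis unfolding cd_def by blast
qed

end

section \<open>The algebraic closure of the field with two elements\<close>

lemma two_eq_0: "(2 :: F2bar) = 0"
proof -
 have "(2 :: F2bar) = to_ac (1 + 1)" unfolding to_ac_add to_ac_1 by simp
 also have "(1 + 1 :: bit) = 0" by simp
 finally show ?thesis by simp
qed

lemma add_self [simp]: "(x :: F2bar) + x = 0"
 using mult_2[of x] by (simp add: two_eq_0)

lemma add_self_left [simp]: "(x :: F2bar) + (x + y) = y"
 by (simp flip: add.assoc)

lemma minus_eq [simp]: "- (x :: F2bar) = x"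
 by (metis add_self add_eq_0_iff)

lemma diff_eq_add [simp]: "(x :: F2bar) - y = x + y"
 by (metis minus_eq diff_conv_add_uminus)

lemma add_eq_0_iff_eq: "(x :: F2bar) + y = 0 <-> x = y"
 by (metis add_self add_self_left add.right_neutral)

lemma of_nat_odd_ne0: "odd n ==> (of_nat n :: F2bar) = 1"
 by (elim oddE) (simp add: two_eq_0)

lemma frob_add: "((x :: F2bar) + y) ^ (2 ^ n) = x ^ (2 ^ n) + y ^ (2 ^ n)"
proof (induction n)
 case (Suc n)
 have "(x + y) ^ (2 ^ Suc n) = ((x + y) ^ (2 ^ n))\<^sup>2" by (simp add: power_mult mult.commute flip: power_mult)
 also have "... = (x ^ (2 ^ n))\<^sup>2 + (y ^ (2 ^ n))\<^sup>2"
  unfolding Suc by (simp add: power2_sum two_eq_0)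
 finally show ?case by (simp add: power_mult mult.commute flip: power_mult)
qed simp

lemma frob_inj: "(x :: F2bar) ^ (2 ^ n) = y ^ (2 ^ n) ==> x = y"
proof -
 assume "x ^ (2 ^ n) = y ^ (2 ^ n)"
 hence "(x + y) ^ (2 ^ n) = 0" by (simp add: frob_add)
 thus "x = y" by (simp add: add_eq_0_iff_eq)
qed

text \<open>For odd \<open>N\<close> the derivative of \<open>X^N + 1\<close> is
  \<open>X^(N - 1)\<close>, which has no root in common with it; so the polynomial splits into
  distinct linear factors.\<close>

lemma card_roots_of_unity:
 assumes N: "odd N"
 shows "finite {x :: F2bar. x ^ N = 1}" "card {x :: F2bar. x ^ N = 1} = N"
proof -
 have N0: "0 < N" using N by (simp add: odd_pos)
 define p :: "F2bar poly" where "p = monom 1 N + 1"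
 have p1: "poly p x = x ^ N + 1" for x by (simp add: p_def poly_monom)
 have d: "degree p = N" unfolding p_def using N0 by (subst degree_add_eq_left) (auto simp: degree_monom_eq)
 hence p0: "p ~= 0" using N0 by auto
 have roots: "{x. poly p x = 0} = {x. x ^ N = 1}" by (simp add: p1 add_eq_0_iff_eq)
 show fin: "finite {x :: F2bar. x ^ N = 1}" using poly_roots_finite[OF p0] by (simp add: roots)
 obtain A where A: "size A = degree p" "p = smult (lead_coeff p) (\<Prod>x\<in>#A. [:-x, 1:])"
  using alg_closed_imp_factorization[OF p0] by blast
 have set: "set_mset A = {x. poly p x = 0}"
 proof -
  have "poly p x = 0 <-> x :# A" for x
   using p0 by (subst A(2)) (auto simp: poly_prod_mset prod_mset_zero_iff image_iff add_eq_0_iff_eq)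
  thus ?thesis by auto
 qed
 have "count A a = 1" if a: "a :# A" for a
 proof (rule ccontr)
  assume "count A a ~= 1"
  moreover have "count A a > 0" using a by simp
  ultimately have "2 <= count A a" by linarith
  hence "{#a, a#} <=# A" by (auto simp: subseteq_mset_def)
  then obtain B where B: "A = {#a, a#} + B" by (metis mset_subset_eq_exists_conv)
  have "p = [:-a, 1:] * ([:-a, 1:] * smult (lead_coeff p) (\<Prod>x\<in>#B. [:-x, 1:]))"
   by (subst A(2)) (simp add: B)
  then obtain q where q: "p = [:-a, 1:] * ([:-a, 1:] * q)" by blast
  define l where "l = [:-a, 1:]"
  have "poly l a = 0" by (simp add: l_def)
  hence "poly (pderiv p) a = 0" unfolding q l_def[symmetric] by (simp add: pderiv_mult)
  moreover have "pderiv p = monom (of_nat N) (N - 1)" by (simp add: p_def pderiv_add pderiv_monom)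
  ultimately have "a ^ (N - 1) = 0" using N by (simp add: poly_monom of_nat_odd_ne0)
  hence "a = 0" by simp
  moreover have "a ^ N = 1" using a set roots by auto
  ultimately show False using N0 by (simp add: power_0_left)
 qed
 hence "A = mset_set (set_mset A)"
  by (intro multiset_eqI) (auto simp: count_mset_set' not_in_iff)
 hence "card (set_mset A) = size A" by (metis size_mset_set)
 thus "card {x :: F2bar. x ^ N = 1} = N" using A(1) d set roots by simp
qed

text \<open>Primitive roots of unity: for a prime power \<open>p ^ a\<close> dividing \<open>N\<close> take a suitable power of an
 element which is not an \<open>(N / p)\<close>-th root of unity, then multiply elements of coprime orders.\<close>

lemma primitive_root_exists:
 assumes "odd N"
 shows "EX \<zeta> :: F2bar. ALL i. \<zeta> ^ i = 1 <-> N dvd i"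
 using assms
proof (induction N rule: less_induct)
 case (less N)
 show ?case
 proof (cases "N = 1")
  case True
  thus ?thesis by (intro exI[of _ 1]) auto
 next
  case False
  then obtain p where p: "prime p" "p dvd N" using prime_factor_nat by blast
  have N0: "0 < N" using less.prems by (simp add: odd_pos)
  define a where "a = multiplicity p N"
  obtain m where m: "N = p ^ a * m" "~ p dvd m"
   using multiplicity_decompose'[of N p] p N0 unfolding a_def by (metis not_prime_unit not_gr_zero)
  have a0: "0 < a" unfolding a_def using p N0 by (simp add: prime_multiplicity_gt_zero_iff)
  have "p ^ a > 1" using p(1) a0 by (metis one_less_power prime_gt_1_nat)
  moreover have "0 < m" using m(1) N0 by (cases m) auto
  ultimately have "m < N" using m(1) n_less_m_mult_n[of m "p ^ a"] by simp
  moreover have "odd m" using less.prems m(1) by auto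
  ultimately obtain y :: F2bar where y: "!!i. y ^ i = 1 <-> m dvd i" using less.IH by blast
  define M where "M = p ^ a"
  obtain b where b: "a = Suc b" using a0 by (cases a) auto
  have oddM: "odd M" using less.prems m(1) by (auto simp: M_def)
  have oddM': "odd (p ^ b)" using oddM by (auto simp: M_def b)
  have "p ^ b < M" unfolding M_def b using prime_gt_1_nat[OF p(1)] by simp
  hence "card {x :: F2bar. x ^ (p ^ b) = 1} < card {x :: F2bar. x ^ M = 1}"
   unfolding card_roots_of_unity(2)[OF oddM] card_roots_of_unity(2)[OF oddM'] .
  hence "~ {x :: F2bar. x ^ M = 1} <= {x. x ^ (p ^ b) = 1}"
   using card_mono[OF card_roots_of_unity(1)[OF oddM']] by (meson not_le)
  then obtain x :: F2bar where x: "x ^ M = 1" "x ^ (p ^ b) ~= 1" by blast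
  \<comment> \<open>The order of \<open>x\<close> divides the prime power
    \<open>M = p ^ Suc b\<close> but not \<open>p ^ b\<close>, hence it is \<open>M\<close>.\<close>
  have xi: "M dvd i" if "x ^ i = 1" for i
  proof -
   have "x ^ gcd i M = 1"
   proof (cases "i = 0")
    case False
    then obtain u v where "u * i = v * M + gcd i M" using bezout_nat by (metis mult.commute)
    hence "x ^ (u * i) = x ^ (v * M) * x ^ gcd i M" by (simp add: power_add)
    thus ?thesis using that x(1) by (simp add: power_mult mult.commute[of u] mult.commute[of v])
   qed (use x in simp)
   moreover obtain c where c: "c <= a" "gcd i M = p ^ c"
    using divides_primepow_nat[OF p(1), of "gcd i M" a] unfolding M_def by auto
   moreover have "c = a"
   proof (rule ccontr)
    assume "c ~= a"
    hence "p ^ c dvd p ^ b" using c(1) b by (simp add: le_imp_power_dvd)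
    then obtain k where "p ^ b = p ^ c * k" by (elim dvdE)
    hence "x ^ (p ^ b) = 1" using calculation(1) c(2) by (simp add: power_mult)
    thus False using x(2) by simp
   qed
   ultimately show ?thesis by (metis M_def gcd_dvd1)
  qed
  have cop: "coprime M m" unfolding M_def using p(1) m(2) by (simp add: prime_imp_coprime_nat)
  have NM: "N = M * m" using m(1) by (simp add: M_def)
  have "(x * y) ^ i = 1 <-> N dvd i" for i
  proof
   assume *: "(x * y) ^ i = 1"
   have "(x * y) ^ (i * m) = x ^ (i * m) * (y ^ m) ^ i" by (simp add: power_mult_distrib mult.commute flip: power_mult)
   hence "x ^ (i * m) = 1" using * y[of m] by (simp add: power_mult)
   hence 1: "M dvd i" using xi cop coprime_dvd_mult_left_iff by blast
   have "(x * y) ^ (i * M) = (x ^ M) ^ i * y ^ (i * M)" by (simp add: power_mult_distrib mult.commute flip: power_mult)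
   hence "y ^ (i * M) = 1" using * x(1) by (simp add: power_mult)
   hence "m dvd i" using y cop by (simp add: coprime_dvd_mult_left_iff coprime_commute)
   thus "N dvd i" unfolding NM using 1 cop by (simp add: divides_mult)
  next
   assume "N dvd i"
   hence "m dvd i" "M dvd i" unfolding NM using dvd_mult_left dvd_mult_right by blast+
   hence "y ^ i = 1" "x ^ i = 1" using y x(1) by (blast, auto simp: power_mult elim: dvdE)
   thus "(x * y) ^ i = 1" by (simp add: power_mult_distrib)
  qed
  thus ?thesis by blast
 qed
qed

lemma primitive_root:
 assumes N: "odd N" and \<zeta>: "!!i. (\<zeta> :: F2bar) ^ i = 1 <-> N dvd i" and x: "x ^ N = 1"
 shows "EX i<N. x = \<zeta> ^ i"
proof -
 have N0: "0 < N" using N by (simp add: odd_pos)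
 have \<zeta>0: "\<zeta> ~= 0" using \<zeta>[of N] N0 by (auto simp: power_0_left)
 have "inj_on (%i. \<zeta> ^ i) {..<N}"
 proof (rule linorder_inj_onI)
  fix i j assume ij: "i < j" "i : {..<N}" "j : {..<N}"
  show "\<zeta> ^ i ~= \<zeta> ^ j"
  proof
   assume "\<zeta> ^ i = \<zeta> ^ j"
   also have "\<zeta> ^ j = \<zeta> ^ i * \<zeta> ^ (j - i)" using ij(1) by (simp flip: power_add)
   finally have "\<zeta> ^ (j - i) = 1" using \<zeta>0 by simp
   hence "N dvd j - i" using \<zeta> by simp
   thus False using ij by (auto dest!: dvd_imp_le)
  qed
 qed auto
 hence "card ((%i. \<zeta> ^ i) ` {..<N}) = card {x :: F2bar. x ^ N = 1}"
  using card_roots_of_unity(2)[OF N] by (simp add: card_image)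
 moreover have "(%i. \<zeta> ^ i) ` {..<N} <= {x. x ^ N = 1}"
  using \<zeta>[of N] by (auto simp: mult.commute[of _ N] power_mult simp flip: power_mult) (simp add: power_mult)
 ultimately have "(%i. \<zeta> ^ i) ` {..<N} = {x. x ^ N = 1}"
  using card_subset_eq[OF card_roots_of_unity(1)[OF N]] by blast
 thus ?thesis using x by blast
qed

section \<open>Suzuki's matrices\<close>

abbreviation m4 :: "'a list list => 'a mat" where "m4 == mat_of_rows_list 4"

lemma less_4_cases: "i < (4::nat) <-> i = 0 | i = 1 | i = 2 | i = 3"
 by auto

lemma m4_index:
 "length xs = 4 ==> i < 4 ==> j < 4 ==> m4 xs $$ (i, j) = xs ! i ! j"
 by (simp add: mrl)

lemma m4_carrier: "length xs = 4 ==> m4 xs : cmat 4 4"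
 by (simp add: mrl)

lemma mat4_eqI: "A : cmat 4 4 ==> B : cmat 4 4 ==>
 (!!i j. i : {0, 1, 2, 3} ==> j : {0, 1, 2, 3} ==> A $$ (i, j) = B $$ (i, j)) ==> A = B"
 by (rule eq_matI) (auto simp: less_4_cases)

text \<open>Together with \<open>m4_eq_iff\<close> this turns a matrix identity into sixteen
  polynomial identities.\<close>

lemma m4_mult: "m4 [[a, b, c, d], [e, f, g, h], [i, j, k, l], [m, n, p, q]] *
 m4 [[a', b', c', d'], [e', f', g', h'], [i', j', k', l'], [m', n', p', q']] =
 m4 [[a * a' + b * e' + c * i' + d * m', a * b' + b * f' + c * j' + d * n', a * c' + b * g' + c * k' + d * p', a * d' + b * h' + c * l' + d * q'], [e * a' + f * e' + g * i' + h * m', e * b' + f * f' + g * j' + h * n', e * c' + f * g' + g * k' + h * p', e * d' + f * h' + g * l' + h * q'], [i * a' + j * e' + k * i' + l * m', i * b' + j * f' + k * j' + l * n', i * c' + j * g' + k * k' + l * p', i * d' + j * h' + k * l' + l * q'], [m * a' + n * e' + p * i' + q * m', m * b' + n * f' + p * j' + q * n', m * c' + n * g' + p * k' + q * p', m * d' + n * h' + p * l' + q * q']]" for a :: "'a :: comm_semiring_1"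
 by (rule mat4_eqI) (auto simp: mrl scalar_prod_def numeral_eq_Suc atLeast0_lessThan_Suc ac_simps)

lemma m4_eq_iff:
 "m4 [[a, b, c, d], [e, f, g, h], [i, j, k, l], [m, n, p, q]] =
  m4 [[a', b', c', d'], [e', f', g', h'], [i', j', k', l'], [m', n', p', q']] <-> a = a' & b = b' & c = c' & d = d' & e = e' & f = f' & g = g' & h = h' & i = i' & j = j' & k = k' & l = l' & m = m' & n = n' & p = p' & q = q'"
 (is "?L = ?R <-> ?P")
proof
 assume eq: "?L = ?R"
 have "ALL i:{0, 1, 2, 3}. ALL j:{0, 1, 2, 3}. ?L $$ (i, j) = ?R $$ (i, j)" by (simp only: eq) simp
 thus ?P by (simp add: m4_index)
qed simp

lemma m4_one: "I4 = m4 [[1, 0, 0, 0], [0, 1, 0, 0], [0, 0, 1, 0], [0, 0, 0, 1]]"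
 by (rule mat4_eqI) (auto simp: mrl)

section \<open>The field \<open>F\<close> and its automorphism \<open>th\<close>\<close>

locale suzuki =
 fixes f :: nat
 assumes f1: "1 <= f"
begin

text \<open>The integer written \<open>q^2\<close> in the theorem; \<open>R\<close> is its
  \<open>r\<close>, so that \<open>R^2 = 2 Q\<close>.\<close>

definition Q :: nat where "Q = 2 ^ (2 * f + 1)"
definition R :: nat where "R = 2 ^ (f + 1)"

abbreviation "F == suzuki_field f"
abbreviation "th == suzuki_theta f"
abbreviation "U == suzuki_unipotent f"
abbreviation "T == suzuki_torus f"
abbreviation "w == suzuki_flip"

lemma RR: "R * R = 2 * Q"
 by (simp add: R_def Q_def flip: power_add power_Suc)

lemma R_ge: "4 <= R"
 using f1 power_increasing[of 2 "f + 1" "2::nat"] by (simp add: R_def)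

lemma Q_ge: "8 <= Q"
 using f1 power_increasing[of 3 "2 * f + 1" "2::nat"] by (simp add: Q_def)

lemma R_le: "2 * R <= Q"
proof -
 have "2 * R = 2 ^ (f + 2)" by (simp add: R_def)
 also have "... <= Q" unfolding Q_def using f1 by (intro power_increasing) auto
 finally show ?thesis .
qed

lemma F_iff: "x : F <-> x ^ Q = x"
 by (simp add: suzuki_field_def Q_def)

lemma th_def: "th x = x ^ R"
 by (simp add: suzuki_theta_def R_def)

lemma th_add [simp]: "th (x + y) = th x + th y"
 unfolding suzuki_theta_def by (rule frob_add)

lemma th_mult [simp]: "th (x * y) = th x * th y"
 and th_power [simp]: "th (x ^ n) = th x ^ n"
 and th_inverse [simp]: "th (inverse x) = inverse (th x)"
 and th_divide [simp]: "th (x / y) = th x / th y"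
 by (simp_all add: th_def power_mult_distrib power_inverse power_divide mult.commute[of n] flip: power_mult)

lemma th_0 [simp]: "th 0 = 0" and th_1 [simp]: "th 1 = 1"
 using R_ge by (simp_all add: th_def power_0_left)

lemma th_eq_0 [simp]: "th x = 0 <-> x = 0"
 using R_ge by (simp add: th_def)

lemma th_inj: "th x = th y <-> x = y"
 using frob_inj[of x "f + 1" y] by (auto simp: suzuki_theta_def)

lemma F_0 [simp]: "0 : F" and F_1 [simp]: "1 : F"
 using Q_ge by (simp_all add: F_iff power_0_left)

lemma F_add [simp]: "x : F ==> y : F ==> x + y : F"
 unfolding suzuki_field_def mem_Collect_eq by (simp only: frob_add)

lemma F_mult [simp]: "x : F ==> y : F ==> x * y : F"
 and F_power [simp]: "x : F ==> x ^ n : F"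
 and F_inverse [simp]: "x : F ==> inverse x : F"
 and F_divide [simp]: "x : F ==> y : F ==> x / y : F"
 by (simp_all add: F_iff power_mult_distrib power_inverse power_divide mult.commute[of n] flip: power_mult)
  (simp_all add: power_mult)

lemma F_th [simp]: "x : F ==> th x : F"
 by (simp add: th_def)

lemma th_th: "x : F ==> th (th x) = x * x"
proof -
 assume x: "x : F"
 have "th (th x) = (x ^ Q) ^ 2" by (simp add: th_def RR mult.commute[of 2] flip: power_mult)
 thus ?thesis using x by (simp add: F_iff power2_eq_square)
qed

definition thi :: "F2bar => F2bar" where "thi x = x ^ (2 ^ f)"

lemma th_thi: "x : F ==> th (thi x) = x"
proof -
 have "(2::nat) ^ f * 2 ^ (f + 1) = 2 ^ (2 * f + 1)" unfolding power_add[symmetric] by (simp add: mult_2)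
 hence "x ^ (2 ^ f * 2 ^ (f + 1)) = x ^ (2 ^ (2 * f + 1))" for x :: F2bar by (rule arg_cong)
 thus "x : F ==> th (thi x) = x"
  unfolding suzuki_field_def suzuki_theta_def thi_def mem_Collect_eq power_mult[symmetric] by metis
qed

lemma F_thi [simp]: "x : F ==> thi x : F"
 by (simp add: thi_def)

lemma thi_th: "x : F ==> thi (th x) = x"
 using th_thi[of "th x"] th_inj by simp

lemma thi_sq: "x : F ==> th x = thi x * thi x"
 using th_th[of "thi x"] th_thi by simp

text \<open>If \<open>z * th z = 1\<close>, applying \<open>th\<close> gives
  \<open>z * (z * th z) = 1\<close>, because \<open>th (th z) = z * z\<close>; so
  \<open>z = 1\<close>. The map matters since \<open>T k\<close> acts on the central coordinate of a
  unipotent element by division by \<open>k * th k\<close>.\<close>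

lemma mult_th_inj: "x : F ==> y : F ==> x * th x = y * th y ==> x = y"
proof -
 assume x: "x : F" and y: "y : F" and eq: "x * th x = y * th y"
 show "x = y"
 proof (cases "y = 0")
  case False
  define z where "z = x / y"
  have z: "z : F" "z * th z = 1" using x y eq False by (simp_all add: z_def field_simps)
  have "th (z * th z) = 1" using z by simp
  hence "z * (z * th z) = 1" using z(1) by (simp add: th_th mult_ac)
  hence "z = 1" using z(2) by simp
  thus ?thesis using False by (simp add: z_def)
 qed (use eq in auto)
qed

lemma mult_th_surj: "x : F ==> x ~= 0 ==> EX k:F. k ~= 0 & k * th k = x"
 by (intro bexI[of _ "th x / x"]) (auto simp: th_th)

lemma odd_Q1: "odd (Q - 1)"
 using Q_ge by (simp add: Q_def)

lemma F_minus_0: "x ~= 0 ==> x : F <-> x ^ (Q - 1) = 1"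
proof -
 assume x: "x ~= 0"
 have "x ^ Q = x * x ^ (Q - 1)" using Q_ge by (simp flip: power_Suc)
 thus ?thesis using x by (simp add: F_iff)
qed

lemma card_F: "card F = Q" and finite_F [simp]: "finite F"
proof -
 have F: "F = insert 0 {x. x ^ (Q - 1) = 1}"
 proof -
  have "x ~= 0" if "x ^ (Q - 1) = 1" for x :: F2bar
   using that Q_ge by (cases "x = 0") (auto simp: power_0_left)
  thus ?thesis using F_minus_0 F_0 by blast
 qed
 show "finite F" unfolding F using card_roots_of_unity[OF odd_Q1] by simp
 have "(0::F2bar) ~: {x. x ^ (Q - 1) = 1}" using Q_ge by (simp add: power_0_left)
 thus "card F = Q" unfolding F using card_roots_of_unity[OF odd_Q1] Q_ge by simp
qed

section \<open>The generators and their relations\<close>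

definition N :: "F2bar => F2bar => F2bar" where
 "N a b = a * a * th a + a * b + th b"

lemma U_m4: "U a b = m4 [[1, 0, 0, 0], [a, 1, 0, 0], [b, th a, 1, 0], [N a b, a * th a + b, a, 1]]"
 by (simp add: suzuki_unipotent_def N_def Let_def power2_eq_square)

lemma T_m4: "T k = m4 [[k * thi k, 0, 0, 0], [0, thi k, 0, 0], [0, 0, inverse (thi k), 0], [0, 0, 0, inverse (k * thi k)]]"
 by (simp add: suzuki_torus_def thi_def Let_def)

lemma w_m4: "w = m4 [[0, 0, 0, 1], [0, 0, 1, 0], [0, 1, 0, 0], [1, 0, 0, 0]]"
 by (simp add: suzuki_flip_def)

lemma thi_eq_0 [simp]: "thi x = 0 <-> x = 0"
 by (simp add: thi_def)

lemma thi_mult: "thi (x * y) = thi x * thi y"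
 by (simp add: thi_def power_mult_distrib)

lemma thi_inverse: "thi (inverse x) = inverse (thi x)"
 by (simp add: thi_def power_inverse)

lemma U_mat [simp]: "U a b : cmat 4 4" and T_mat [simp]: "T k : cmat 4 4" and w_mat [simp]: "w : cmat 4 4"
 by (simp_all add: U_m4 T_m4 w_m4 m4_carrier)

lemma ww: "w * w = I4"
 by (simp add: w_m4 m4_mult m4_one)

lemma U00: "U 0 0 = I4"
 by (simp add: U_m4 m4_one N_def)

lemma T1: "T 1 = I4"
 by (simp add: T_m4 m4_one thi_def)

lemma U_mult: "a : F ==> b : F ==> c : F ==> d : F ==> U a b * U c d = U (a + c) (b + d + c * th a)"
 by (simp add: U_m4 m4_mult m4_eq_iff N_def th_th algebra_simps)

lemma T_mult: "T k * T l = T (k * l)"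
 by (simp add: T_m4 m4_mult m4_eq_iff thi_mult mult_ac)

lemma T_U: "k : F ==> k ~= 0 ==> a : F ==> b : F ==> T k * U a b = U (a / k) (b / (k * th k)) * T k"
 by (simp add: U_m4 T_m4 m4_mult m4_eq_iff N_def thi_sq[of k] th_thi[of k] field_simps)

lemma w_T: "k ~= 0 ==> w * T k = T (inverse k) * w"
 by (simp add: w_m4 T_m4 m4_mult m4_eq_iff thi_inverse)

lemma N_th: "a : F ==> b : F ==> th (N a b) = a * a * th a * th a + th a * th b + b * b"
 by (simp add: N_def th_th mult_ac)

lemma N_F [simp]: "a : F ==> b : F ==> N a b : F"
 by (simp add: N_def)

text \<open>For \<open>a ~= 0\<close> the substitution \<open>b = a * th a * c\<close> leaves
  \<open>1 + c + th c = 0\<close>; applying \<open>th\<close> gives \<open>c * c = c\<close>, so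
  that \<open>th c = c\<close>, a contradiction. This anisotropy puts every
  \<open>w * U a b * w\<close> with nontrivial \<open>U a b\<close> into the big cell.\<close>

lemma N_eq_0: "a : F ==> b : F ==> N a b = 0 <-> a = 0 & b = 0"
proof
 assume a: "a : F" and b: "b : F" and 0: "N a b = 0"
 show "a = 0 & b = 0"
 proof (cases "a = 0")
  case False
  define c where "c = b / (a * th a)"
  have c: "c : F" using a b by (simp add: c_def)
  have b': "b = a * th a * c" using False by (simp add: c_def)
  have "a * a * th a * (1 + c + th c) = 0" using 0 a unfolding N_def b' by (simp add: th_th algebra_simps)
  hence 1: "1 + c + th c = 0" using False by simp
  hence 2: "th c = 1 + c" by (metis add_eq_0_iff_eq add.commute)
  have "th (th c) = c" unfolding 2 by (simp add: 2)
  hence "c * c = c" using c by (simp add: th_th)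
  hence "c = 0 | c = 1" by simp
  thus ?thesis using 2 by auto
 qed (use 0 in \<open>auto simp: N_def\<close>)
qed (simp add: N_def)

text \<open>The one relation between the generators that is not monomial. The entry
  \<open>N a b\<close> of \<open>U a b\<close> moves to the upper right corner of
  \<open>w * U a b * w\<close>; dividing the other entries of the last column and of the first row
  by it yields the coordinates of the two unipotent factors.\<close>

lemma wUw:
 assumes a: "a : F" and b: "b : F" and n0: "~ (a = 0 & b = 0)"
 defines "n == N a b"
 shows "w * U a b * w = U (b / n) (a / n) * (w * T (th n / (n * n))) *
  U ((a * th a + b) / n) (a / n + (a * th a + b) / n * (th ((a * th a + b) / n)))"
proof -
 have n: "n : F" "n ~= 0" using a b n0 by (auto simp: n_def N_eq_0)
 have tn: "th n = a * a * th a * th a + th a * th b + b * b" unfolding n_def by (rule N_th[OF a b])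
 define k where "k = th n / (n * n)"
 have z: "thi k = n / th n"
 proof -
  have "th (n / th n) = k" using n by (simp add: k_def th_th)
  thus ?thesis using n thi_th[of "n / th n"] by simp
 qed
 have kz: "k * thi k = inverse n" using n unfolding z by (simp add: k_def field_simps)
 have T: "T (th n / (n * n)) = m4 [[inverse n, 0, 0, 0], [0, n / th n, 0, 0], [0, 0, th n / n, 0], [0, 0, 0, n]]"
  unfolding k_def[symmetric] T_m4 kz unfolding z by simp
 have nd: "n = a * a * th a + a * b + th b" by (simp add: n_def N_def)
 have n1: "N (b / n) (a / n) = 1 / n"
 proof -
  have "b * b * th b + a * b * th n + th a * (n * n) = n * th n"
   unfolding tn by (simp add: nd algebra_simps)
  thus ?thesis using n by (simp add: N_def field_simps)
 qed
 define e where "e = a * th a + b"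
 define y where "y = e / n"
 have yF: "y : F" using a b n by (simp add: y_def e_def)
 have y1: "y * th y + (a / n + y * th y) = a / n" by (simp add: add.left_commute)
 have ty: "th y = (th a * (a * a) + th b) / th n" unfolding y_def e_def using a by (simp add: th_th)
 have n2: "N y (a / n + y * th y) = 1 / n"
 proof -
  have 1: "N y (a / n + y * th y) = y * (a / n) + th a / th n + th y * (y * y)"
   using yF by (simp add: N_def th_th algebra_simps)
  have 2: "e * a * th n + th a * n * n + (th a * (a * a) + th b) * e * e = n * th n"
   unfolding tn e_def by (simp add: nd algebra_simps)
  have te: "th e = th a * (a * a) + th b" using a by (simp add: e_def th_th)
  have "y * (a / n) + th a / th n + th y * (y * y) = (e * a * th n + th a * n * n + th e * e * e) / (n * n * th n)"
   using n by (simp add: y_def field_simps)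
  also have "... = 1 / n" unfolding te 2 using n by simp
  finally show ?thesis unfolding 1 .
 qed
 show ?thesis unfolding T e_def[symmetric] y_def[symmetric] U_m4 w_m4 n1 n2 y1 th_divide unfolding ty y_def
  by (simp add: m4_mult m4_eq_iff n field_simps) (simp add: tn, simp add: nd e_def N_def th_th a b algebra_simps)
qed

section \<open>The Bruhat decomposition and the order of the group\<close>

definition Sz :: "F2bar mat monoid" where "Sz = suzuki_group f"
abbreviation "Cz == carrier Sz"
abbreviation "iv == m_inv Sz"

definition tor :: "F2bar set" where "tor = F - {0}"

text \<open>The Borel subgroup; together with the cell \<open>big\<close> it makes up the Bruhat
  decomposition.\<close>

definition Bs :: "F2bar mat set" where
 "Bs = {U a b * T k | a b k. a : F & b : F & k : tor}"

definition big :: "F2bar mat set" where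
 "big = {U a b * (T k * (w * U c d)) | a b k c d. a : F & b : F & k : tor & c : F & d : F}"

lemma torD: "k : tor ==> k : F" "k : tor ==> k ~= 0"
 by (auto simp: tor_def)

lemma tor_simps [simp]: "1 : tor" "k : tor ==> l : tor ==> k * l : tor" "k : tor ==> inverse k : tor"
 "k : tor ==> l : tor ==> k / l : tor"
 by (auto simp: tor_def)

lemma as4 [simp]: "x : cmat 4 4 ==> y : cmat 4 4 ==> z : cmat 4 4 ==> (x * y) * z = x * (y * z)"
 by (rule assoc_mult_mat)

lemma mc4 [simp]: "x : cmat 4 4 ==> y : cmat 4 4 ==> x * y : cmat 4 4"
 by simp

lemma one4 [simp]:
 fixes x :: "F2bar mat"
 assumes "x : cmat 4 4"
 shows "I4 * x = x" "x * I4 = x"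
 by (rule left_mult_one_mat[OF assms], rule right_mult_one_mat[OF assms])

lemma U_inv: "a : F ==> b : F ==> U a b * U a (b + a * th a) = I4"
 "a : F ==> b : F ==> U a (b + a * th a) * U a b = I4"
 by (simp_all add: U_mult U00[symmetric] two_eq_0)

lemma T_inv: "k ~= 0 ==> T k * T (inverse k) = I4" "k ~= 0 ==> T (inverse k) * T k = I4"
 by (simp_all add: T_mult T1)

lemma U_T: "k : tor ==> a : F ==> b : F ==> U a b * T k = T k * U (a * k) (b * (k * th k))"
 using torD[of k] by (simp add: T_U)

lemma mult_left_cong: "x * y = z ==> x : cmat 4 4 ==> y : cmat 4 4 ==> v : cmat 4 4 ==> x * (y * v) = z * v"
 by (metis as4)

lemma ww': "v : cmat 4 4 ==> w * (w * v) = v"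
 by (simp add: mult_left_cong[OF ww])

lemma UU': "a : F ==> b : F ==> c : F ==> d : F ==> v : cmat 4 4 ==>
 U a b * (U c d * v) = U (a + c) (b + d + c * th a) * v"
 by (rule mult_left_cong[OF U_mult]) auto

lemma TT': "v : cmat 4 4 ==> T k * (T l * v) = T (k * l) * v"
 by (rule mult_left_cong[OF T_mult]) auto

lemma TU': "k : tor ==> a : F ==> b : F ==> v : cmat 4 4 ==> T k * (U a b * v) = U (a / k) (b / (k * th k)) * (T k * v)"
 using mult_left_cong[OF T_U[OF torD]] by simp

lemma wT': "k : tor ==> v : cmat 4 4 ==> w * (T k * v) = T (inverse k) * (w * v)"
 using mult_left_cong[OF w_T[OF torD(2)]] by simp

lemma BsI: "a : F ==> b : F ==> k : tor ==> U a b * T k : Bs"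
 unfolding Bs_def by blast

lemma bigI: "a : F ==> b : F ==> k : tor ==> c : F ==> d : F ==> U a b * (T k * (w * U c d)) : big"
 unfolding big_def by blast

lemma Bs_mat: "x : Bs ==> x : cmat 4 4" and big_mat: "x : big ==> x : cmat 4 4"
 by (auto simp: Bs_def big_def)

lemma U_left: "a : F ==> b : F ==> x : Bs ==> U a b * x : Bs"
 "a : F ==> b : F ==> x : big ==> U a b * x : big"
proof -
 assume k: "a : F" "b : F" and x: "x : Bs"
 then obtain c d l where "c : F" "d : F" "l : tor" "x = U c d * T l" by (auto simp: Bs_def)
 thus "U a b * x : Bs" using k by (simp add: UU' BsI)
next
 assume k: "a : F" "b : F" and x: "x : big"
 then obtain a' b' l c d where "a' : F" "b' : F" "l : tor" "c : F" "d : F" "x = U a' b' * (T l * (w * U c d))" by (auto simp: big_def)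
 thus "U a b * x : big" using k by (simp add: UU' bigI)
qed

lemma T_left: "k : tor ==> x : Bs ==> T k * x : Bs" "k : tor ==> x : big ==> T k * x : big"
proof -
 assume k: "k : tor" and x: "x : Bs"
 then obtain a b l where "a : F" "b : F" "l : tor" "x = U a b * T l" by (auto simp: Bs_def)
 thus "T k * x : Bs" using k by (simp add: TU' T_mult BsI torD)
next
 assume k: "k : tor" and x: "x : big"
 then obtain a b l c d where "a : F" "b : F" "l : tor" "c : F" "d : F" "x = U a b * (T l * (w * U c d))" by (auto simp: big_def)
 thus "T k * x : big" using k by (simp add: TU' TT' bigI torD)
qed

lemma w_left_Bs: "x : Bs ==> w * x : big"
proof -
 assume x: "x : Bs"
 then obtain a b k where *: "a : F" "b : F" "k : tor" "x = U a b * T k" by (auto simp: Bs_def)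
 hence "w * x = T (inverse k) * (w * U (a * k) (b * (k * th k)))" by (simp add: U_T wT')
 also have "... = U 0 0 * (T (inverse k) * (w * U (a * k) (b * (k * th k))))" by (simp add: U00)
 also have "... : big" using * torD by (intro bigI) auto
 finally show ?thesis .
qed

text \<open>Moving the torus part across \<open>w\<close> leaves a factor
  \<open>w * U a b * w\<close>, which is either the identity or has the normal form given by
  \<open>wUw\<close>.\<close>

lemma w_left_big: "x : big ==> w * x : Bs Un big"
proof -
 assume x: "x : big"
 then obtain a b k c d where *: "a : F" "b : F" "k : tor" "c : F" "d : F" "x = U a b * (T k * (w * U c d))"
  by (auto simp: big_def)
 note k = torD[OF *(3)]
 have Tw: "T k * (w * U c d) = w * (T (inverse k) * U c d)" using * k by (simp add: wT')
 show ?thesis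
 proof (cases "a = 0 & b = 0")
  case True
  hence "w * x = T (inverse k) * (U c d)" using * by (simp add: U00 Tw ww')
  also have "... = U (c / inverse k) (d / (inverse k * th (inverse k))) * T (inverse k)"
   using * k by (simp add: T_U)
  also have "... : Bs" using * k by (intro BsI) auto
  finally show ?thesis by simp
 next
  case False
  let ?n = "N a b" let ?y = "(a * th a + b) / ?n" let ?z = "a / ?n + ?y * th ?y"
  define l where "l = th ?n / (?n * ?n)"
  have n: "?n : F" "?n ~= 0" using * False by (auto simp: N_eq_0)
  have l: "l : tor" using n by (simp add: l_def tor_def)
  have y: "?y : F" "?z : F" using * n by auto
  have "w * x = (w * U a b * w) * (T (inverse k) * U c d)" unfolding *(6) Tw by simp
  also have "... = U (b / ?n) (a / ?n) * (w * (T l * (U ?y ?z * (T (inverse k) * U c d))))"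
   unfolding wUw[OF *(1,2) False] l_def by simp
  also have "... = U (b / ?n) (a / ?n) * (w * (T l * (T (inverse k) * (U (?y * inverse k) (?z * (inverse k * th (inverse k))) * U c d))))"
   using mult_left_cong[OF U_T[of "inverse k" ?y ?z], of "U c d"] * y by simp
  also have "... = U (b / ?n) (a / ?n) * (T (inverse (l * inverse k)) * (w * (U (?y * inverse k) (?z * (inverse k * th (inverse k))) * U c d)))"
   using l *(3) by (simp add: TT' wT')
  also have "... : big" using * n y l k by (subst U_mult) (auto intro!: bigI)
  finally show ?thesis by simp
 qed
qed

lemma closed_mult:
 assumes "x : Bs Un big" "y : Bs Un big"
 shows "x * y : Bs Un big"
proof -
 have y: "y : cmat 4 4" using assms(2) Bs_mat big_mat by auto
 have U: "U a b * z : Bs Un big" if "a : F" "b : F" "z : Bs Un big" for a b z using that U_left by auto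
 have T: "T k * z : Bs Un big" if "k : tor" "z : Bs Un big" for k z using that T_left by auto
 have w: "w * z : Bs Un big" if "z : Bs Un big" for z using that w_left_Bs w_left_big by auto
 consider a b k where "a : F" "b : F" "k : tor" "x = U a b * T k"
  | a b k c d where "a : F" "b : F" "k : tor" "c : F" "d : F" "x = U a b * (T k * (w * U c d))"
  using assms(1) by (auto simp: Bs_def big_def)
 thus ?thesis
 proof cases
  case 1
  thus ?thesis using y U[OF 1(1,2) T[OF 1(3) assms(2)]] by simp
 next
  case 2
  thus ?thesis using y U[OF 2(1,2) T[OF 2(3) w[OF U[OF 2(4,5) assms(2)]]]] by simp
 qed
qed

abbreviation "GL4 == GL TYPE(F2bar) 4"

lemma group_GL4: "group GL4"
proof -
 interpret ring "ring_mat TYPE(F2bar) 4 ()" by (rule ring_mat)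
 show ?thesis by (rule units_group)
qed

lemma GL4_inverse: "x : cmat 4 4 ==> y : cmat 4 4 ==> x * y = I4 ==> y * x = I4 ==>
  x : carrier GL4 & inv\<^bsub>GL4\<^esub> x = y"
proof -
 assume *: "x : cmat 4 4" "y : cmat 4 4" "x * y = I4" "y * x = I4"
 hence c: "x : carrier GL4" "y : carrier GL4" unfolding GL_carrier by blast+
 have "inv\<^bsub>GL4\<^esub> x = y" by (rule group.inv_equality[OF group_GL4]) (use * c in simp_all)
 thus ?thesis using c by simp
qed

lemma gens_iff: "g : suzuki_gens f <-> (EX a:F. EX b:F. g = U a b) | (EX k:tor. g = T k) | g = w"
 by (auto simp: suzuki_gens_def tor_def)

lemma gens_inv: "g : suzuki_gens f ==> g : carrier GL4 & inv\<^bsub>GL4\<^esub> g : suzuki_gens f"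
 unfolding gens_iff
proof (elim disjE bexE)
 fix a b assume *: "a : F" "b : F" "g = U a b"
 have "g : carrier GL4 & inv\<^bsub>GL4\<^esub> g = U a (b + a * th a)" unfolding *(3)
  by (rule GL4_inverse) (use U_inv * in auto)
 thus "g : carrier GL4 & ((EX a:F. EX b:F. inv\<^bsub>GL4\<^esub> g = U a b) | (EX k:tor. inv\<^bsub>GL4\<^esub> g = T k) | inv\<^bsub>GL4\<^esub> g = w)"
  using * by (intro conjI disjI1 bexI[of _ a] bexI[of _ "b + a * th a"]) auto
next
 fix k assume *: "k : tor" "g = T k"
 have "g : carrier GL4 & inv\<^bsub>GL4\<^esub> g = T (inverse k)" unfolding *(2)
  by (rule GL4_inverse) (use T_inv torD[OF *(1)] in auto)
 thus "g : carrier GL4 & ((EX a:F. EX b:F. inv\<^bsub>GL4\<^esub> g = U a b) | (EX k:tor. inv\<^bsub>GL4\<^esub> g = T k) | inv\<^bsub>GL4\<^esub> g = w)"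
  using * by auto
next
 assume *: "g = w"
 have "g : carrier GL4 & inv\<^bsub>GL4\<^esub> g = w" unfolding *
  by (rule GL4_inverse) (use ww in auto)
 thus "g : carrier GL4 & ((EX a:F. EX b:F. inv\<^bsub>GL4\<^esub> g = U a b) | (EX k:tor. inv\<^bsub>GL4\<^esub> g = T k) | inv\<^bsub>GL4\<^esub> g = w)"
  using * by auto
qed

lemma gens_sub: "g : suzuki_gens f ==> g : Bs Un big"
 unfolding gens_iff
proof (elim disjE bexE)
 fix a b assume *: "a : F" "b : F" "g = U a b"
 hence "g = U a b * T 1" by (simp add: T1)
 thus ?thesis using * BsI[of a b 1] by simp
next
 fix k assume *: "k : tor" "g = T k"
 hence "g = U 0 0 * T k" by (simp add: U00)
 thus ?thesis using * BsI[of 0 0 k] by simp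
next
 assume "g = w"
 hence "g = U 0 0 * (T 1 * (w * U 0 0))" by (simp add: U00 T1)
 thus ?thesis using bigI[of 0 0 1 0 0] by simp
qed

lemma Sz_mult [simp]: "monoid.mult Sz x y = x * y" and Sz_one [simp]: "one Sz = I4"
 by (simp_all add: Sz_def suzuki_group_def)

text \<open>The two cells contain the generators, the inverse of a generator is a generator, and
  \<open>closed_mult\<close> handles products; so the generated group does not leave their
  union.\<close>

lemma Sz_carrier: "Cz = Bs Un big"
proof (intro equalityI subsetI)
 fix x assume "x : Cz"
 hence "x : generate GL4 (suzuki_gens f)" by (simp add: Sz_def suzuki_group_def)
 thus "x : Bs Un big"
 proof (induction rule: generate.induct)
  case one
  have "I4 = U 0 0 * T 1" by (simp add: U00 T1)
  thus ?case using BsI[of 0 0 1] by simp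
 next
  case (incl h) thus ?case by (rule gens_sub)
 next
  case (inv h) thus ?case using gens_inv gens_sub by blast
 next
  case (eng h1 h2) thus ?case using closed_mult by simp
 qed
next
 fix x assume x: "x : Bs Un big"
 let ?g = "generate GL4 (suzuki_gens f)"
 have m: "g * h : ?g" if "g : ?g" "h : ?g" for g h using generate.eng[OF that] by simp
 have U: "U a b : ?g" if "a : F" "b : F" for a b by (rule generate.incl) (use that in \<open>auto simp: gens_iff\<close>)
 have T: "T k : ?g" if "k : tor" for k by (rule generate.incl) (use that in \<open>auto simp: gens_iff\<close>)
 have w: "w : ?g" by (rule generate.incl) (auto simp: gens_iff)
 from x have "x : ?g" unfolding Bs_def big_def by (auto intro!: m U T w)
 thus "x : Cz" by (simp add: Sz_def suzuki_group_def)
qed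

lemma Bs_entries:
 "(U a b * T k) $$ (0, 3) = 0" "(U a b * T k) $$ (0, 0) = k * thi k"
 "(U a b * T k) $$ (1, 0) = a * (k * thi k)" "(U a b * T k) $$ (2, 0) = b * (k * thi k)"
 by (simp_all add: U_m4 T_m4 m4_mult m4_index)

lemma big_entries:
 "(U a b * (T k * (w * U c d))) $$ (0, 3) = k * thi k" "(U a b * (T k * (w * U c d))) $$ (1, 3) = a * (k * thi k)"
 "(U a b * (T k * (w * U c d))) $$ (2, 3) = b * (k * thi k)" "(U a b * (T k * (w * U c d))) $$ (0, 2) = k * thi k * c"
 "(U a b * (T k * (w * U c d))) $$ (0, 1) = k * thi k * (c * th c + d)"
 by (simp_all add: U_m4 T_m4 w_m4 m4_mult m4_index)

lemma z1_inj: "k : tor ==> l : tor ==> k * thi k = l * thi l ==> k = l"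
proof -
 assume k: "k : tor" and l: "l : tor" and eq: "k * thi k = l * thi l"
 have "th (k * thi k) = th (l * thi l)" unfolding eq ..
 hence "k * th k = l * th l" using torD[OF k] torD[OF l] by (simp add: th_thi mult.commute)
 thus "k = l" using mult_th_inj torD k l by blast
qed

lemma Bs_inj: "k : tor ==> l : tor ==> U a b * T k = U c d * T l ==> a = c & b = d & k = l"
proof -
 assume k: "k : tor" and l: "l : tor" and eq: "U a b * T k = U c d * T l"
 have "k * thi k = l * thi l" using Bs_entries(2) eq by metis
 hence kl: "k = l" using z1_inj k l by blast
 have "a * (k * thi k) = c * (l * thi l)" "b * (k * thi k) = d * (l * thi l)" using Bs_entries(3,4) eq by metis+
 thus ?thesis using torD[OF l] by (simp add: kl)
qed

lemma big_inj:
 assumes k: "k : tor" "k' : tor"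
  and eq: "U a b * (T k * (w * U c d)) = U a' b' * (T k' * (w * U c' d'))"
 shows "a = a' & b = b' & k = k' & c = c' & d = d'"
proof -
 have "k * thi k = k' * thi k'" using big_entries(1) eq by metis
 hence kk: "k = k'" using z1_inj k by blast
 have "a * (k * thi k) = a' * (k' * thi k')" "b * (k * thi k) = b' * (k' * thi k')"
  "k * thi k * c = k' * thi k' * c'" "k * thi k * (c * th c + d) = k' * thi k' * (c' * th c' + d')"
  using big_entries(2-5) eq by metis+
 thus ?thesis using torD[OF k(2)] by (auto simp: kk)
qed

lemma Bs_big_disj: "Bs Int big = {}"
proof -
 have "x $$ (0, 3) = 0" if "x : Bs" for x using that Bs_entries(1) by (auto simp: Bs_def)
 moreover have "x $$ (0, 3) ~= 0" if "x : big" for x using that torD by (auto simp: big_def big_entries)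
 ultimately show ?thesis by blast
qed

lemma finite_tor [simp]: "finite tor" and card_tor: "card tor = Q - 1"
 using card_F by (simp_all add: tor_def)

lemma card_Bs: "finite Bs" "card Bs = Q * Q * (Q - 1)"
proof -
 have im: "Bs = (%(a,b,k). U a b * T k) ` (F \<times> F \<times> tor)" by (auto simp: Bs_def image_iff) blast+
 thus "finite Bs" by simp
 have "inj_on (%(a,b,k). U a b * T k) (F \<times> F \<times> tor)" using Bs_inj by (fastforce simp: inj_on_def)
 thus "card Bs = Q * Q * (Q - 1)" unfolding im by (simp add: card_image card_cartesian_product card_F card_tor)
qed

lemma card_big: "finite big" "card big = Q * Q * (Q - 1) * (Q * Q)"
proof -
 have im: "big = (%(a,b,k,c,d). U a b * (T k * (w * U c d))) ` (F \<times> F \<times> tor \<times> F \<times> F)" by (auto simp: big_def image_iff) blast+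
 thus "finite big" by simp
 have "inj_on (%(a,b,k,c,d). U a b * (T k * (w * U c d))) (F \<times> F \<times> tor \<times> F \<times> F)" using big_inj by (fastforce simp: inj_on_def)
 thus "card big = Q * Q * (Q - 1) * (Q * Q)" unfolding im by (simp add: card_image card_cartesian_product card_F card_tor)
qed

lemma card_Sz: "card (Cz) = Q * Q * (Q - 1) * (Q * Q + 1)"
 unfolding Sz_carrier using card_Un_disjoint[OF card_Bs(1) card_big(1) Bs_big_disj] card_Bs card_big by (simp add: algebra_simps)

lemma group_Sz: "group Sz"
proof -
 have "suzuki_gens f <= carrier GL4" using gens_inv by blast
 hence "subgroup (generate GL4 (suzuki_gens f)) GL4" by (rule group.generate_is_subgroup[OF group_GL4])
 thus ?thesis unfolding Sz_def suzuki_group_def by (rule subgroup.subgroup_is_group[OF _ group_GL4])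
qed

lemma fin_group_Sz: "fin_group Sz"
 using group_Sz card_Bs card_big by (simp add: fin_group_def fin_group_axioms_def Sz_carrier)

sublocale Sz: fin_group Sz
 by (rule fin_group_Sz)

lemma Sz_mat [simp]: "x : Cz ==> x : cmat 4 4"
 using Bs_mat big_mat by (auto simp: Sz_carrier)

lemma U_Sz [simp]: "a : F ==> b : F ==> U a b : Cz"
 and T_Sz [simp]: "k : tor ==> T k : Cz" and w_Sz [simp]: "w : Cz"
proof -
 have g: "g : suzuki_gens f ==> g : Cz" for g using gens_sub Sz_carrier by blast
 show "a : F ==> b : F ==> U a b : Cz" "k : tor ==> T k : Cz" "w : Cz"
  by (rule g, unfold gens_iff, blast)+
qed

lemma Sz_closed [simp]: "x : Cz ==> y : Cz ==> x * y : Cz"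
 using Sz.m_closed by simp

lemma Sz_one_closed [simp]: "I4 : Cz"
 using Sz.one_closed by simp

lemma Sz_inv [simp]: "x : Cz ==> x * iv x = I4" "x : Cz ==> iv x * x = I4"
 using Sz.r_inv Sz.l_inv by simp_all

lemma Sz_invI: "x : Cz ==> y : Cz ==> y * x = I4 ==> iv x = y"
 using Sz.inv_equality by simp

lemma inv_U: "a : F ==> b : F ==> iv (U a b) = U a (b + a * th a)"
 by (rule Sz_invI) (auto simp: U_inv)

lemma inv_T: "k : tor ==> iv (T k) = T (inverse k)"
 by (rule Sz_invI) (auto simp: T_inv torD)

lemma inv_w: "iv w = w"
 by (rule Sz_invI) (auto simp: ww)

end

lemma m4_add: "m4 [[a, b, c, d], [e, f, g, h], [i, j, k, l], [m, n, p, q]] + m4 [[a', b', c', d'], [e', f', g', h'], [i', j', k', l'], [m', n', p', q']] =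
 m4 [[a + a', b + b', c + c', d + d'], [e + e', f + f', g + g', h + h'], [i + i', j + j', k + k', l + l'], [m + m', n + n', p + p', q + q']]"
 by (rule mat4_eqI) (auto simp: mrl)

lemma m4_smult: "x *m m4 [[a, b, c, d], [e, f, g, h], [i, j, k, l], [m, n, p, q]] =
 m4 [[x * a, x * b, x * c, x * d], [x * e, x * f, x * g, x * h], [x * i, x * j, x * k, x * l], [x * m, x * n, x * p, x * q]]"
 by (rule mat4_eqI) (auto simp: mrl)

lemma m4_trace: "mat_trace (m4 [[a, b, c, d], [e, f, g, h], [i, j, k, l], [m, n, p, q]]) = a + f + k + q"
 by (simp add: mat_trace_def mrl numeral_eq_Suc lessThan_Suc ac_simps)

section \<open>The Sylow 2-subgroup and its conjugates\<close>

context suzuki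
begin

definition Us :: "F2bar mat set" where "Us = {U a b | a b. a : F & b : F}"

lemma UsI: "a : F ==> b : F ==> U a b : Us"
 unfolding Us_def by blast

lemma U_inj: "U a b = U c d <-> a = c & b = d"
 using Bs_inj[of 1 1 a b c d] by (auto simp: T1)

lemma Us_Bs: "u : Us ==> u : Bs"
 using BsI[of _ _ 1] by (auto simp: Us_def T1)

lemma Us_Sz: "u : Us ==> u : Cz"
 by (auto simp: Us_def)

lemma T_Bs: "k : tor ==> T k : Bs"
 using BsI[of 0 0 k] by (simp add: U00)

lemma Bs_Sz: "x : Bs ==> x : Cz" and big_Sz: "x : big ==> x : Cz"
 by (auto simp: Sz_carrier)

lemma Bs_mult: "x : Bs ==> y : Bs ==> x * y : Bs"
proof -
 assume x: "x : Bs" and y: "y : Bs"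
 then obtain a b k where "a : F" "b : F" "k : tor" "x = U a b * T k" by (auto simp: Bs_def)
 thus ?thesis using U_left(1)[of a b "T k * y"] T_left(1)[of k y] y Bs_mat[OF y] by simp
qed

lemma Bs_subgroup: "subgroup Bs Sz"
proof (rule Sz.finite_subgroupI)
 show "\<one>\<^bsub>Sz\<^esub> : Bs" using T_Bs[of 1] by (simp add: T1)
qed (auto simp: Bs_Sz Bs_mult)

lemma Us_mult: "x : Us ==> y : Us ==> x * y : Us"
proof -
 assume "x : Us" "y : Us"
 then obtain a b c d where "a : F" "b : F" "c : F" "d : F" "x = U a b" "y = U c d" unfolding Us_def by blast
 thus ?thesis by (simp add: U_mult UsI)
qed

lemma Us_subgroup: "subgroup Us Sz"
proof (rule Sz.finite_subgroupI)
 show "\<one>\<^bsub>Sz\<^esub> : Us" using UsI[of 0 0] by (simp add: U00)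
qed (auto simp: Us_Sz Us_mult)

lemma card_Us: "finite Us" "card Us = Q * Q"
proof -
 have im: "Us = (%(a,b). U a b) ` (F \<times> F)" by (auto simp: Us_def image_iff)
 thus "finite Us" by simp
 have "inj_on (%(a,b). U a b) (F \<times> F)" using U_inj by (fastforce simp: inj_on_def)
 thus "card Us = Q * Q" unfolding im by (simp add: card_image card_cartesian_product card_F)
qed

lemma sum_Us: "(SUM u:Us. h u) = (SUM a:F. SUM b:F. h (U a b))"
proof -
 have im: "Us = (%(a,b). U a b) ` (F \<times> F)" by (auto simp: Us_def image_iff)
 have "inj_on (%(a,b). U a b) (F \<times> F)" using U_inj by (fastforce simp: inj_on_def)
 thus ?thesis unfolding im by (simp add: sum.reindex sum.cartesian_product case_prod_unfold)
qed

lemma T_conj_U: "k : tor ==> a : F ==> b : F ==> T k * U a b * iv (T k) = U (a / k) (b / (k * th k))"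
 by (simp add: inv_T TU' T_inv torD)

lemma U_conj_U: "a : F ==> b : F ==> c : F ==> d : F ==>
  U c d * U a b * iv (U c d) = U a (b + a * th c + c * th a)"
 by (simp add: inv_U U_mult UU' U_inj algebra_simps)

lemma Bs_conj_Us: "s : Bs ==> u : Us ==> s * u * iv s : Us"
proof -
 assume s: "s : Bs" and u: "u : Us"
 obtain c d k where s': "c : F" "d : F" "k : tor" "s = U c d * T k" using s by (auto simp: Bs_def)
 obtain a b where u': "a : F" "b : F" "u = U a b" using u by (auto simp: Us_def)
 have "iv s = iv (T k) * iv (U c d)"
  using Sz.inv_mult_group[of "U c d" "T k"] s' by simp
 hence "s * u * iv s = U c d * (T k * u * iv (T k)) * iv (U c d)"
  using s' u' by simp
 also have "... : Us" using s' u' torD[OF s'(3)] by (simp add: T_conj_U U_conj_U UsI del: as4)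
 finally show ?thesis .
qed

lemma w_conj_Us: "u : Us ==> u ~= I4 ==> w * u * w : big"
proof -
 assume u: "u : Us" "u ~= I4"
 then obtain a b where u': "a : F" "b : F" "u = U a b" by (auto simp: Us_def)
 have n0: "~ (a = 0 & b = 0)" using u u' by (auto simp: U00)
 define l where "l = th (N a b) / (N a b * N a b)"
 have n: "N a b : F" "N a b ~= 0" using u' n0 by (auto simp: N_eq_0)
 have l: "l : tor" using n by (simp add: l_def tor_def)
 have "w * (T l * U ((a * th a + b) / N a b) (a / N a b + (a * th a + b) / N a b * th ((a * th a + b) / N a b))) =
   T (inverse l) * (w * U ((a * th a + b) / N a b) (a / N a b + (a * th a + b) / N a b * th ((a * th a + b) / N a b)))"
  by (rule wT'[OF l]) simp
 hence "w * u * w = U (b / N a b) (a / N a b) * (T (inverse l) *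
   (w * U ((a * th a + b) / N a b) (a / N a b + (a * th a + b) / N a b * th ((a * th a + b) / N a b))))"
  using wUw[OF u'(1,2) n0] unfolding u'(3) l_def[symmetric] by simp
 also have "... : big" using u' n l by (intro bigI) auto
 finally show ?thesis .
qed

lemma big_decomp: "s : big ==> EX b:Bs. EX u:Us. s = b * w * u"
proof -
 assume "s : big"
 then obtain a b k c d where *: "a : F" "b : F" "k : tor" "c : F" "d : F" "s = U a b * (T k * (w * U c d))"
  by (auto simp: big_def)
 show ?thesis by (rule bexI[of _ "U a b * T k"], rule bexI[of _ "U c d"]) (use * BsI UsI in auto)
qed

text \<open>Writing \<open>s\<close> as \<open>b * w * v\<close>, one absorbs \<open>v\<close> into
  \<open>u\<close> and \<open>b\<close> into \<open>Bs\<close>, which reduces the claim to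
  \<open>w_conj_Us\<close>. In particular distinct conjugates of \<open>Us\<close> meet
  trivially.\<close>

lemma TI:
 assumes s: "s : big" and u: "u : Us" and su: "s * u * iv s : Bs"
 shows "u = I4"
proof (rule ccontr)
 assume u1: "u ~= I4"
 obtain b v where b: "b : Bs" and v: "v : Us" and s': "s = b * w * v" using big_decomp[OF s] by blast
 note c = Bs_Sz[OF b] Us_Sz[OF v] Us_Sz[OF u]
 define u' where "u' = v * u * iv v"
 have u': "u' : Us" unfolding u'_def by (rule Bs_conj_Us[OF Us_Bs[OF v] u])
 have "u = iv v * u' * v" using c Sz.inv_mult_cancel by (simp add: u'_def Sz_mult[symmetric] Sz.m_assoc del: Sz_mult)
 hence "u' ~= I4" using u1 c by auto
 hence big: "w * u' * w : big" by (rule w_conj_Us[OF u'])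
 have "iv s = iv v * (w * iv b)"
  unfolding s' using c Sz.inv_mult_group[of "b * w" v] Sz.inv_mult_group[of b w] by (simp add: inv_w)
 hence "s * u * iv s = b * (w * u' * w) * iv b"
  unfolding s' u'_def using c by simp
 hence "iv b * (s * u * iv s) * b = w * u' * w"
  using c Us_Sz[OF u'] Sz.inv_mult_cancel[of b] by (simp add: Sz_mult[symmetric] Sz.m_assoc del: Sz_mult)
 moreover have "iv b * (s * u * iv s) * b : Bs"
  using su b Bs_mult subgroup.m_inv_closed[OF Bs_subgroup b] by blast
 ultimately show False using big Bs_big_disj by auto
qed

section \<open>Eigenvalues of group elements\<close>

abbreviation "tr == mat_trace :: F2bar mat => F2bar"

lemma tr_conj: "s : Cz ==> x : Cz ==> tr (s * x * iv s) = tr x"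
proof -
 assume s: "s : Cz" and x: "x : Cz"
 have "tr (s * (x * iv s)) = tr ((x * iv s) * s)"
  by (rule mat_trace_mult_comm[of _ 4 4]) (use s x in auto)
 thus ?thesis using s x by simp
qed

lemma tr_U: "tr (U a b) = 0"
 by (simp add: U_m4 m4_trace)

lemma tr_wU: "tr (w * U a b) = N a b + th a"
 by (simp add: U_m4 w_m4 m4_mult m4_trace)

text \<open>An element of trace \<open>a\<close> has the characteristic polynomial with coefficients
  \<open>1\<close>, \<open>a\<close>, \<open>th a\<close>, \<open>a\<close>, \<open>1\<close>.
  Divided by the square of the variable \<open>\<xi>\<close> it becomes \<open>q a y\<close> with
  \<open>y = \<xi> + inverse \<xi>\<close>.\<close>

definition q :: "F2bar => F2bar => F2bar" where "q a y = y * y + a * y + th a"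

lemma smult_vec_eq_0:
 fixes v :: "'b :: field vec"
 assumes "c *s v = 0\<^sub>v n" "v : cvec n" "v ~= 0\<^sub>v n"
 shows "c = 0"
proof -
 obtain i where i: "i < n" "vec_index v i ~= 0" using assms(2,3) by (metis carrier_vecD eq_vecI index_zero_vec)
 have "vec_index (c *s v) i = 0" unfolding assms(1) using i by simp
 thus ?thesis using i assms(2) by simp
qed

lemma smult_mat_vec:
 fixes v :: "'b :: field vec"
 assumes "A : cmat n n" "v : cvec n"
 shows "(c *m A) *v v = c *s (A *v v)"
 using assms by (intro eq_vecI) auto

definition eigP :: "F2bar mat => bool" where
 "eigP x <-> tr x : F & (ALL \<xi> v. v : cvec 4 & v ~= 0\<^sub>v 4 & x *v v = \<xi> *s v -->
   \<xi> ~= 0 & q (tr x) (\<xi> + inverse \<xi>) = 0)"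

text \<open>The Cayley-Hamilton relation divided by the square of \<open>x\<close>, where
  \<open>x'\<close> is the inverse of \<open>x\<close>. Applied to an eigenvector it gives the
  equation \<open>q\<close>, without any determinant.\<close>

lemma wU_identity:
 assumes a: "a : F" and b: "b : F"
 defines "x == w * U a b" and "x' == U a (b + a * th a) * w" and "t == N a b + th a"
 shows "x * x + (t *m x + (th t *m I4 + (t *m x' + x' * x'))) = 0\<^sub>m 4 4"
proof -
 have z: "0\<^sub>m 4 4 = (m4 [[0,0,0,0],[0,0,0,0],[0,0,0,0],[0,0,0,0]] :: F2bar mat)"
  by (rule mat4_eqI) (auto simp: mrl)
 show ?thesis unfolding x_def x'_def t_def z m4_one U_m4 w_m4
  by (simp add: m4_mult m4_add m4_smult m4_eq_iff N_def th_th a b algebra_simps)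
qed

lemma tor_sqrt: "k : tor ==> EX l:tor. l * l = k"
proof -
 assume k: "k : tor"
 have "thi (th k) = k" using thi_th torD[OF k] by simp
 have "th k = thi k * thi k" using thi_sq torD[OF k] by simp
 have "k = thi (th k)" using thi_th torD[OF k] by simp
 also have "... = thi (thi k * thi k)" using thi_sq torD[OF k] by simp
 also have "... = thi (thi k) * thi (thi k)" by (rule thi_mult)
 finally show ?thesis using torD[OF k] by (intro bexI[of _ "thi (thi k)"]) (auto simp: tor_def)
qed

lemma conj_conj: "s : Cz ==> t : Cz ==> x : Cz ==>
 t * (s * x * iv s) * iv t = (t * s) * x * iv (t * s)"
 using Sz.inv_mult_group[of t s] by simp

text \<open>Conjugation moves the left unipotent factor to the right end; then a torus element
  \<open>T l\<close> with \<open>l * l = inverse k\<close> removes the torus factor, because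
  \<open>w\<close> inverts the torus.\<close>

lemma big_conj_wU: "x : big ==> EX s:Cz. EX a:F. EX b:F. s * x * iv s = w * U a b"
proof -
 assume "x : big"
 then obtain a b k c d where *: "a : F" "b : F" "k : tor" "c : F" "d : F" "x = U a b * (T k * (w * U c d))"
  by (auto simp: big_def)
 obtain l where l: "l : tor" "l * l = inverse k" using tor_sqrt[of "inverse k"] *(3) by auto
 note k = torD[OF *(3)] torD[OF l(1)]
 define c' where "c' = c + a"
 define d' where "d' = d + b + a * th c"
 have cd: "c' : F" "d' : F" "U c d * U a b = U c' d'" using * by (simp_all add: c'_def d'_def U_mult)
 define s where "s = iv (U a b)"
 have s: "s : Cz" "iv s = U a b" using * by (simp_all add: s_def)
 have xs: "x : Cz" using * by simp
 have "s * x = (s * U a b) * (T k * (w * U c d))" unfolding *(6) using * s by simp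
 also have "... = T k * (w * U c d)" unfolding s_def using * by simp
 finally have "s * x * iv s = T k * (w * (U c d * U a b))" unfolding s(2) by simp
 hence x1: "s * x * iv s = T k * (w * U c' d')" unfolding cd(3) .
 have "T l * (T k * (w * U c' d')) * iv (T l) = T (l * k) * (w * (T (inverse l) * U (c' * inverse l) (d' * (inverse l * th (inverse l)))))"
  using cd l by (simp add: TT' U_T inv_T)
 also have "... = T (l * k * l) * (w * U (c' * inverse l) (d' * (inverse l * th (inverse l))))"
  using l by (simp add: wT' TT')
 also have "l * k * l = 1" using l(2) k by (simp add: field_simps)
 finally have "T l * (s * x * iv s) * iv (T l) = w * U (c' * inverse l) (d' * (inverse l * th (inverse l)))"
  unfolding x1 by (simp add: T1)
 hence "(T l * s) * x * iv (T l * s) = w * U (c' * inverse l) (d' * (inverse l * th (inverse l)))"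
  using conj_conj[OF s(1) T_Sz[OF l(1)] xs] by simp
 thus ?thesis using s l cd k by (intro bexI[of _ "T l * s"] bexI[of _ "c' * inverse l"] bexI[of _ "d' * (inverse l * th (inverse l))"]) auto
qed

text \<open>An element of \<open>Bs\<close> with nontrivial unipotent part is moved into the big
  cell by \<open>w\<close>. A nontrivial torus element acquires a unipotent part on conjugation by
  \<open>U 1 0\<close>.\<close>

lemma conj_big: "x : Cz ==> x ~= I4 ==> EX s:Cz. s * x * iv s : big"
proof -
 assume x: "x : Cz" and x1: "x ~= I4"
 have A: "EX s:Cz. s * z * iv s : big" if z: "a : F" "b : F" "k : tor" "z = U a b * T k" "~ (a = 0 & b = 0)" for z a b k
 proof (intro bexI[of _ w])
  have "U a b ~= I4" using z(5) U_inj[of a b 0 0] by (auto simp: U00)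
  hence "w * U a b * w : big" using w_conj_Us UsI z by blast
  then obtain a' b' k' c' d' where *: "a' : F" "b' : F" "k' : tor" "c' : F" "d' : F"
   "w * U a b * w = U a' b' * (T k' * (w * U c' d'))" by (auto simp: big_def)
  have "w * z * iv w = (w * U a b * w) * (w * T k * w)"
   unfolding inv_w z(4) by (simp add: ww')
  also have "w * T k * w = T (inverse k)" using w_T[of k] torD[OF z(3)] ww by simp
  also have "(w * U a b * w) * T (inverse k) = U a' b' * (T k' * (w * (U c' d' * T (inverse k))))"
   unfolding * by simp
  also have "... = U a' b' * (T k' * (w * (T (inverse k) * U (c' * inverse k) (d' * (inverse k * th (inverse k))))))"
   using * z by (simp add: U_T)
  also have "... = U a' b' * (T (k' * k) * (w * U (c' * inverse k) (d' * (inverse k * th (inverse k)))))"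
   using * z by (simp add: wT' TT')
  also have "... : big" using * z torD[OF z(3)] by (intro bigI) auto
  finally show "w * z * iv w : big" .
 qed simp
 from x consider "x : big" | "x : Bs" by (auto simp: Sz_carrier)
 thus ?thesis
 proof cases
  case 1 thus ?thesis using x by (intro bexI[of _ "I4"]) (auto simp: Sz.inv_one[simplified])
 next
  case 2
  then obtain a b k where z: "a : F" "b : F" "k : tor" "x = U a b * T k" by (auto simp: Bs_def)
  show ?thesis
  proof (cases "a = 0 & b = 0")
   case False thus ?thesis using A[OF z False] by blast
  next
   case True
   hence xk: "x = T k" using z by (simp add: U00)
   have k1: "k ~= 1" using x1 xk by (auto simp: T1)
   note k = torD[OF z(3)]
   have "U 1 0 * x * iv (U 1 0) = U 1 0 * (T k * U 1 1)"
    unfolding xk by (simp add: inv_U)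
   also have "... = U (1 + 1 / k) (1 / (k * th k) + 1 / k) * T k"
    using k by (simp add: T_U UU')
   finally have e: "U 1 0 * x * iv (U 1 0) = U (1 + 1 / k) (1 / (k * th k) + 1 / k) * T k" .
   have "1 + 1 / k ~= 0" using k1 k by (simp add: add_eq_0_iff_eq)
   then obtain s where s: "s : Cz" "s * (U 1 0 * x * iv (U 1 0)) * iv s : big"
    using A[OF _ _ z(3) e] k by auto
   thus ?thesis using conj_conj[of "U 1 0" s x] x by (intro bexI[of _ "s * U 1 0"]) auto
  qed
 qed
qed

lemma eigP_wU: "a : F ==> b : F ==> eigP (w * U a b)"
 unfolding eigP_def
proof (intro conjI allI impI)
 assume a: "a : F" and b: "b : F"
 define x where "x = w * U a b"
 define x' where "x' = U a (b + a * th a) * w"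
 define t where "t = N a b + th a"
 have tx: "tr (w * U a b) = t" by (simp add: tr_wU t_def)
 thus "tr (w * U a b) : F" using a b by (simp add: t_def)
 have xm: "x : cmat 4 4" "x' : cmat 4 4" by (simp_all add: x_def x'_def)
 have x'x: "x' * x = I4" using U_inv(2)[OF a b] by (simp add: x_def x'_def ww')
 fix \<xi> v
 assume v': "v : cvec 4 & v ~= 0\<^sub>v 4 & w * U a b *v v = \<xi> *s v"
 hence v: "v : cvec 4" "v ~= 0\<^sub>v 4" "x *v v = \<xi> *s v" by (simp_all add: x_def)
 have *: "x' *v (x *v v) = v" using xm v x'x by (metis assoc_mult_mat_vec one_mult_mat_vec)
 have *: "\<xi> *s (x' *v v) = v" using * unfolding v(3) using xm v by (simp add: mult_mat_vec)
 have \<xi>: "\<xi> ~= 0"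
 proof
  assume "\<xi> = 0"
  hence "v = 0 *s (x' *v v)" using * by simp
  also have "... = 0\<^sub>v 4" using xm v by (intro eq_vecI) auto
  finally show False using v by simp
 qed
 have x'v: "x' *v v = inverse \<xi> *s v"
 proof -
  have "inverse \<xi> *s (\<xi> *s (x' *v v)) = x' *v v" using \<xi> by (simp add: smult_smult_assoc)
  thus ?thesis unfolding * by simp
 qed
 let ?M = "x * x + (t *m x + (th t *m I4 + (t *m x' + x' * x')))"
 have M0: "?M = 0\<^sub>m 4 4" unfolding x_def x'_def t_def by (rule wU_identity[OF a b])
 have "?M *v v = (\<xi> * \<xi> + (t * \<xi> + (th t + (t * inverse \<xi> + inverse \<xi> * inverse \<xi>)))) *s v"
  using xm v x'v
  by (simp add: add_mult_distrib_mat_vec[of _ 4 4] smult_mat_vec[of _ 4] mult_mat_vec add_smult_distrib_vec smult_smult_assoc)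
 hence "(\<xi> * \<xi> + (t * \<xi> + (th t + (t * inverse \<xi> + inverse \<xi> * inverse \<xi>)))) *s v = 0\<^sub>v 4"
  unfolding M0 using v by (simp add: zero_mat_mult_vec)
 hence "\<xi> * \<xi> + (t * \<xi> + (th t + (t * inverse \<xi> + inverse \<xi> * inverse \<xi>))) = 0"
  using v(1,2) smult_vec_eq_0 by blast
 hence "q t (\<xi> + inverse \<xi>) = 0" using \<xi> by (simp add: q_def algebra_simps)
 thus "\<xi> ~= 0" "q (tr (w * U a b)) (\<xi> + inverse \<xi>) = 0" using \<xi> tx by simp_all
qed

lemma eigP_conj: "s : Cz ==> x : Cz ==> eigP (s * x * iv s) ==> eigP x"
proof -
 assume sx: "s : Cz" "x : Cz" and e: "eigP (s * x * iv s)"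
 have "\<xi> ~= 0 & q (tr x) (\<xi> + inverse \<xi>) = 0"
  if v: "v : cvec 4 & v ~= 0\<^sub>v 4 & x *v v = \<xi> *s v" for \<xi> v
 proof -
 note 2 = sx e v
 have si: "iv s * s = I4" "iv s : Cz" using 2 by auto
 have c: "s : cmat 4 4" "x : cmat 4 4" "iv s : cmat 4 4" using 2 si by auto
 have isv: "iv s *v (s *v v) = v" using c 2 si(1) by (metis assoc_mult_mat_vec one_mult_mat_vec)
 have "s *v v ~= 0\<^sub>v 4"
 proof
  assume "s *v v = 0\<^sub>v 4"
  hence "v = 0\<^sub>v 4" using isv c by (auto intro!: eq_vecI)
  thus False using 2 by simp
 qed
 moreover have sv: "s *v v : cvec 4" using c 2 by (intro mult_mat_vec_carrier[of _ 4 4]) auto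
 moreover have "s * x * iv s *v (s *v v) = \<xi> *s (s *v v)"
 proof -
  have "s * x * iv s *v (s *v v) = s *v (x *v (iv s *v (s *v v)))"
   using c sv by (simp add: assoc_mult_mat_vec[of _ 4 4 _ 4])
  thus ?thesis unfolding isv using c 2 by (simp add: mult_mat_vec)
 qed
 ultimately have "\<xi> ~= 0 & q (tr (s * x * iv s)) (\<xi> + inverse \<xi>) = 0" using e unfolding eigP_def by blast
 thus ?thesis using tr_conj[OF sx] by simp
 qed
 thus "eigP x" using e tr_conj[OF sx] unfolding eigP_def by simp
qed

lemma eigP_one: "eigP (I4)"
 unfolding eigP_def
proof (intro conjI allI impI)
 have t: "tr (I4) = 0" using tr_U[of 0 0] by (simp add: U00)
 thus "tr (I4) : F" by (simp del: mat_trace_one)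
 fix \<xi> v assume v: "v : cvec 4 & v ~= 0\<^sub>v 4 & I4 *v v = \<xi> *s (v :: F2bar vec)"
 then obtain i where i: "i < 4" "v $ i ~= 0" by (metis carrier_vecD eq_vecI index_zero_vec)
 have "v = I4 *v v" using v by (intro one_mult_mat_vec[symmetric]) auto
 hence "v = \<xi> *s v" using v by metis
 hence "vec_index v i = vec_index (\<xi> *s v) i" by (rule arg_cong)
 also have "... = \<xi> * vec_index v i" using i v by (intro index_smult_vec) auto
 finally have "\<xi> = 1" using i by simp
 thus "\<xi> ~= 0" "q (tr (I4)) (\<xi> + inverse \<xi>) = 0" by (simp_all add: q_def t del: mat_trace_one)
qed

lemma eigP: "x : Cz ==> eigP x"
proof (cases "x = I4")
 case False
 assume x: "x : Cz"
 obtain s where s: "s : Cz" "s * x * iv s : big" using conj_big[OF x False] by blast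
 obtain t a b where t: "t : Cz" "a : F" "b : F" "t * (s * x * iv s) * iv t = w * U a b"
  using big_conj_wU[OF s(2)] by blast
 have "eigP (t * (s * x * iv s) * iv t)" unfolding t(4) by (rule eigP_wU[OF t(2,3)])
 hence "eigP (s * x * iv s)" by (rule eigP_conj[OF t(1) big_Sz[OF s(2)]])
 thus ?thesis by (rule eigP_conj[OF s(1) x])
qed (simp add: eigP_one)

end

section \<open>Traces and conjugacy classes\<close>

lemma inverse_sum_eq_iff:
 fixes z u :: F2bar
 assumes "z ~= 0" "u ~= 0"
 shows "z + inverse z = u + inverse u <-> u = z | u = inverse z"
proof
 assume eq: "z + inverse z = u + inverse u"
 have "(z + u) * (z * u + 1) = z * u * ((z + inverse z) + (u + inverse u))"
  using assms by (simp add: algebra_simps)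
 also have "... = 0" unfolding eq by simp
 finally have "z = u | z * u = 1" by (auto simp: add_eq_0_iff_eq)
 thus "u = z | u = inverse z" using assms by (auto simp: field_simps)
next
 assume "u = z | u = inverse z"
 thus "z + inverse z = u + inverse u" by (auto simp: add.commute)
qed

lemma inverse_sum_eq_0: "(z :: F2bar) ~= 0 ==> z + inverse z = 0 <-> z = 1"
 using inverse_sum_eq_iff[of z 1] by auto

lemma sq_inj: "(x :: F2bar) * x = y * y <-> x = y"
 using frob_inj[of x 1 y] by (auto simp: power2_eq_square)

lemma quad_root: "EX y :: F2bar. y * y + a * y + c = 0"
proof -
 have "degree [:c, a, 1:] > 0" by simp
 then obtain y where "poly [:c, a, 1:] y = 0" using alg_closed_imp_poly_has_root by blast
 thus ?thesis by (intro exI[of _ y]) (simp add: algebra_simps)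
qed

context suzuki
begin

text \<open>The possible eigenvalues of an element of trace \<open>a\<close>; there are four of them
  when \<open>a\<close> is not zero.\<close>

definition Ra :: "F2bar => F2bar set" where "Ra a = {z. z ~= 0 & q a (z + inverse z) = 0}"

lemma Ra_roots:
 assumes a: "a : tor"
 obtains z1 z2 where "z1 ~= 0" "z2 ~= 0" "z1 ~= 1" "z2 ~= 1" "z2 ~= z1" "z2 ~= inverse z1"
  "Ra a = {z1, inverse z1, z2, inverse z2}"
  "(z1 + inverse z1) + (z2 + inverse z2) = a" "(z1 + inverse z1) * (z2 + inverse z2) = th a"
proof -
 obtain y where y: "y * y + a * y + th a = 0" using quad_root by blast
 define s where "s = a + y"
 have sum: "y + s = a" by (simp add: s_def add.left_commute)
 have prod: "y * s = th a" using y by (simp add: s_def algebra_simps add_eq_0_iff_eq)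
 have ta: "th a ~= 0" using torD[OF a] by simp
 have ex: "EX z. z ~= 0 & z + inverse z = c" for c :: F2bar
 proof -
  obtain z where z: "z * z + c * z + 1 = 0" using quad_root by blast
  hence "z ~= 0" by auto
  moreover have "z * z + 1 = c * z" by (subst add_eq_0_iff_eq[symmetric]) (use z in \<open>simp add: add_ac\<close>)
  hence "z + inverse z = c" using \<open>z ~= 0\<close> by (simp add: field_simps)
  ultimately show ?thesis by blast
 qed
 obtain z1 z2 where z: "z1 ~= 0" "z1 + inverse z1 = y" "z2 ~= 0" "z2 + inverse z2 = s" using ex by metis
 have ys: "y ~= s" using sum torD[OF a] by auto
 have "q a c = (c + y) * (c + s)" for c
 proof -
  have "q a c = c * c + (y + s) * c + y * s" by (simp add: q_def sum prod)
  thus ?thesis by (simp add: algebra_simps)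
 qed
 hence "Ra a = {u. u ~= 0 & (u + inverse u = z1 + inverse z1 | u + inverse u = z2 + inverse z2)}"
  unfolding Ra_def z by (auto simp: add_eq_0_iff_eq)
 also have "... = {z1, inverse z1, z2, inverse z2}"
  using inverse_sum_eq_iff[OF z(1)] inverse_sum_eq_iff[OF z(3)] z by (auto simp: eq_commute[of "_ + _" "z1 + _"] eq_commute[of "_ + _" "z2 + _"])
 finally have R: "Ra a = {z1, inverse z1, z2, inverse z2}" .
 have "y ~= 0" "s ~= 0" using prod ta by auto
 hence "z1 ~= 1" "z2 ~= 1" using z by auto
 moreover have "z2 ~= z1" "z2 ~= inverse z1" using ys z inverse_sum_eq_iff[OF z(1,3)] by auto
 ultimately show ?thesis using that z R sum prod by simp
qed

lemma Ra_ne1: "a : tor ==> z : Ra a ==> z ~= 1 & z ~= 0"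
 using torD by (auto simp: Ra_def q_def)

lemma card_Ra: "a : tor ==> finite (Ra a) & card (Ra a) = 4"
proof -
 assume a: "a : tor"
 obtain z1 z2 where z: "z1 ~= 0" "z2 ~= 0" "z1 ~= 1" "z2 ~= 1" "z2 ~= z1" "z2 ~= inverse z1"
  "Ra a = {z1, inverse z1, z2, inverse z2}" using Ra_roots[OF a] by metis
 have i: "inverse u ~= u" if "u ~= 0" "u ~= 1" for u :: F2bar
 proof
  assume "inverse u = u"
  hence "u * u = 1" using that by (simp add: field_simps)
  thus False using that sq_inj[of u 1] by simp
 qed
 have "inverse z1 ~= inverse z2" "inverse z2 ~= z1" using z by auto
 thus ?thesis unfolding z(7) using z i[of z1] i[of z2] by auto
qed

section \<open>The three types of nonzero traces\<close>

definition Np :: nat where "Np = Q + R + 1"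
definition Nm :: nat where "Nm = Q + 1 - R"

text \<open>The trace as a function of one eigenvalue \<open>z\<close>. In the split torus the
  eigenvalues are \<open>z\<close>, the power \<open>z ^ (R - 1)\<close> and their inverses; for the
  two other types \<open>z ^ Q\<close> takes the place of \<open>z ^ (R - 1)\<close>, which gives
  \<open>t1\<close>.\<close>

definition t0 :: "F2bar => F2bar" where "t0 z = z + inverse z + (z ^ (R - 1) + inverse (z ^ (R - 1)))"
definition t1 :: "F2bar => F2bar" where "t1 z = z + inverse z + (z ^ Q + inverse (z ^ Q))"

definition TorN :: "nat => F2bar set" where
 "TorN M = {a : tor. EX z. z ^ M = 1 & z ~= 1 & a = t1 z & Ra a = {z, inverse z, z ^ Q, inverse (z ^ Q)}}"

definition Tor0 :: "F2bar set" where
 "Tor0 = {a : tor. (EX z. z ^ (Q - 1) = 1 & z ~= 1 & a = t0 z) & (ALL z:Ra a. z ^ (Q - 1) = 1)}"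

lemma pow_RR: "z ^ (R * R) = u * u <-> z ^ Q = (u :: F2bar)"
 using sq_inj[of "z ^ Q" u] by (simp add: RR mult.commute[of 2] power_mult power2_eq_square)

lemma pow_Q1: "z ~= 0 ==> z ^ Q = z ==> z ^ (Q - 1) = (1 :: F2bar)"
proof -
 assume z: "z ~= 0" "z ^ Q = z"
 have "z ^ Q = z * z ^ (Q - 1)" using Q_ge by (simp flip: power_Suc)
 thus ?thesis using z by simp
qed

lemma pow_R1: "z ~= 0 ==> z ^ (R - 1) = (z ^ R) / (z :: F2bar)"
proof -
 assume z: "z ~= 0"
 have "z ^ R = z * z ^ (R - 1)" using R_ge by (simp flip: power_Suc)
 thus ?thesis using z by simp
qed

text \<open>Applying \<open>th\<close>, which is the power \<open>R\<close>, to the quadratic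
  equation of \<open>s1\<close> shows that \<open>th s1\<close> is a root of a quadratic polynomial
  whose roots have sum \<open>th a\<close> and product \<open>a * a\<close>. These roots are
  \<open>A z3\<close> and \<open>A (inverse z3)\<close>, so \<open>z1 ^ R\<close> is
  \<open>z1 * z2\<close> up to inversion; likewise \<open>z2 ^ R\<close> is \<open>z1 / z2\<close>
  up to inversion. The four choices of signs give the three types.\<close>

lemma types: assumes a: "a : tor" shows "a : Tor0 | a : TorN Np | a : TorN Nm"
proof -
 obtain z1 z3 where z: "z1 ~= 0" "z3 ~= 0" "z1 ~= 1" "z3 ~= 1" "z3 ~= z1" "z3 ~= inverse z1"
  and Ra3: "Ra a = {z1, inverse z1, z3, inverse z3}"
  and s3: "(z1 + inverse z1) + (z3 + inverse z3) = a" and p3: "(z1 + inverse z1) * (z3 + inverse z3) = th a"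
  using Ra_roots[OF a] by metis
 define s1 where "s1 = z1 + inverse z1"
 define A where "A z = z1 * z + inverse (z1 * z)" for z
 have AA: "A u + A (inverse u) = (z1 + inverse z1) * (u + inverse u)"
  "A u * A (inverse u) = ((z1 + inverse z1) + (u + inverse u)) * ((z1 + inverse z1) + (u + inverse u))" if "u ~= 0" for u
 proof -
  define x y where "x = inverse z1" and "y = inverse u"
  have xy: "z1 * x = 1" "u * y = 1" "x * z1 = 1" "y * u = 1" using z that by (simp_all add: x_def y_def)
  have xy': "z1 * (x * v) = v" "u * (y * v) = v" "x * (z1 * v) = v" "y * (u * v) = v" for v
   using xy by (simp_all flip: mult.assoc)
  have A: "A u = z1 * u + x * y" "A (inverse u) = z1 * y + x * u" by (simp_all add: A_def x_def y_def)
  show "A u + A (inverse u) = (z1 + inverse z1) * (u + inverse u)"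
   unfolding A unfolding x_def[symmetric] y_def[symmetric] by (simp add: algebra_simps)
  have p: "A u * A (inverse u) = z1 * z1 + (x * x + (u * u + y * y))"
  proof -
   have "A u * A (inverse u) = z1 * z1 * (u * y) + (u * u * (z1 * x) + (y * y * (x * z1) + x * x * (u * y)))"
    unfolding A by (simp add: algebra_simps)
   thus ?thesis unfolding xy by (simp add: add_ac)
  qed
  show "A u * A (inverse u) = ((z1 + inverse z1) + (u + inverse u)) * ((z1 + inverse z1) + (u + inverse u))"
   unfolding p unfolding x_def[symmetric] y_def[symmetric] by (simp add: algebra_simps xy xy')
 qed
 have "th s1 * th s1 + th a * th s1 + a * a = 0"
 proof -
  have "z1 : Ra a" unfolding Ra3 by simp
  hence "q a s1 = 0" unfolding Ra_def s1_def by simp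
  hence "th (s1 * s1 + a * s1 + th a) = 0" unfolding q_def by simp
  thus ?thesis using torD[OF a] by (simp add: th_th)
 qed
 hence "th s1 * th s1 + (A z3 + A (inverse z3)) * th s1 + A z3 * A (inverse z3) = 0"
  unfolding AA[OF z(2)] s3 p3 .
 hence "(th s1 + A z3) * (th s1 + A (inverse z3)) = 0" by (simp add: algebra_simps)
 hence "th s1 = A z3 | th s1 = A (inverse z3)" by (auto simp: add_eq_0_iff_eq)
 then obtain z2 where z2: "z2 = z3 | z2 = inverse z3" and ts1: "th s1 = A z2" by blast
 have z2': "z2 ~= 0" "z2 ~= 1" using z z2 by auto
 have Ra: "Ra a = {z1, inverse z1, z2, inverse z2}" unfolding Ra3 using z2 by auto
 have s: "(z1 + inverse z1) + (z2 + inverse z2) = a" using z2 s3 by (auto simp: add.commute)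
 have p: "(z1 + inverse z1) * (z2 + inverse z2) = th a" using z2 p3 by (auto simp: add.commute)
 define s2 where "s2 = z2 + inverse z2"
 have "th s1 + th s2 = th a" unfolding th_add[symmetric] s1_def s2_def s ..
 also have "... = th s1 + A (inverse z2)" unfolding ts1 AA[OF z2'(1)] p ..
 finally have ts2: "th s2 = z1 / z2 + inverse (z1 / z2)" by (simp add: A_def divide_inverse)
 have z1R: "z1 ^ R = z1 * z2 | z1 ^ R = inverse (z1 * z2)"
 proof -
  have "z1 * z2 + inverse (z1 * z2) = z1 ^ R + inverse (z1 ^ R)"
   using ts1 by (simp add: A_def s1_def th_def[symmetric])
  thus ?thesis using inverse_sum_eq_iff[of "z1 * z2" "z1 ^ R"] z z2' by simp
 qed
 have z2R: "z2 ^ R = z1 / z2 | z2 ^ R = inverse (z1 / z2)"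
 proof -
  have "z1 / z2 + inverse (z1 / z2) = z2 ^ R + inverse (z2 ^ R)"
   using ts2 by (simp add: s2_def th_def[symmetric])
  thus ?thesis using inverse_sum_eq_iff[of "z1 / z2" "z2 ^ R"] z z2' by simp
 qed
 have Tor0I: "a : Tor0" if "z1 ^ (Q - 1) = 1" "z2 ^ (Q - 1) = 1" "u ~= 1" "u ^ (Q - 1) = 1" "a = t0 u" for u
 proof -
  have "ALL z:Ra a. z ^ (Q - 1) = 1" unfolding Ra using that(1,2) by (simp add: power_inverse)
  thus ?thesis unfolding Tor0_def using a that by blast
 qed
 have TorNI: "a : TorN M" if "z1 ^ M = 1" "z1 ^ Q = z2" for M
 proof -
  have "a = t1 z1" by (simp only: t1_def that s)
  moreover have "Ra a = {z1, inverse z1, z1 ^ Q, inverse (z1 ^ Q)}" unfolding that(2) by (rule Ra)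
  ultimately show ?thesis unfolding TorN_def using a that z(3) by blast
 qed
 have QQ: "v ^ (R * R) = (v ^ R) ^ R" for v :: F2bar by (rule power_mult)
 \<comment> \<open>With equal signs, raising to the power \<open>R\<close> twice squares both
   eigenvalues, so they lie in \<open>F\<close>; with different signs it sends \<open>z1\<close> to
   \<open>z2 * z2\<close>, and as \<open>R^2 = 2 Q\<close> this means
   \<open>z1 ^ Q = z2\<close>.\<close>
 consider (pp) "z1 ^ R = z1 * z2" "z2 ^ R = z1 / z2" | (pm) "z1 ^ R = z1 * z2" "z2 ^ R = inverse (z1 / z2)"
  | (mp) "z1 ^ R = inverse (z1 * z2)" "z2 ^ R = z1 / z2" | (mm) "z1 ^ R = inverse (z1 * z2)" "z2 ^ R = inverse (z1 / z2)"
  using z1R z2R by blast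
 thus ?thesis
 proof cases
  case pp
  have "z1 ^ (R * R) = z1 * z1" "z2 ^ (R * R) = z2 * z2"
   unfolding QQ pp power_mult_distrib power_divide using z(1) z2'(1) by simp_all
  hence Q: "z1 ^ (Q - 1) = 1" "z2 ^ (Q - 1) = 1" using pow_RR pow_Q1 z(1) z2'(1) by blast+
  have "z1 ^ (R - 1) = z2" unfolding pow_R1[OF z(1)] pp using z(1) by simp
  hence "a = t0 z1" by (simp only: t0_def s)
  thus ?thesis using Tor0I[OF Q z(3) Q(1)] by blast
 next
  case mm
  have "z1 ^ (R * R) = z1 * z1" "z2 ^ (R * R) = z2 * z2"
   unfolding QQ mm power_mult_distrib power_divide power_inverse using z(1) z2'(1) by (simp_all add: field_simps)
  hence Q: "z1 ^ (Q - 1) = 1" "z2 ^ (Q - 1) = 1" using pow_RR pow_Q1 z(1) z2'(1) by blast+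
  have "z2 ^ (R - 1) = inverse z1" unfolding pow_R1[OF z2'(1)] mm using z(1) z2'(1) by (simp add: field_simps)
  hence "t0 z2 = (z2 + inverse z2) + (inverse z1 + z1)" by (simp only: t0_def inverse_inverse_eq)
  hence "a = t0 z2" using s by (simp only: add.commute)
  thus ?thesis using Tor0I[OF Q z2'(2) Q(2)] by blast
 next
  case pm
  have "z1 ^ (R * R) = z2 * z2" unfolding QQ pm power_mult_distrib using z(1) z2'(1) by simp
  hence Q: "z1 ^ Q = z2" using pow_RR by blast
  have "z1 ^ Nm * z1 ^ R = z1 ^ (Q + 1)" using R_le by (simp add: Nm_def flip: power_add)
  also have "... = z1 ^ R" using Q pm(1) by simp
  finally have "z1 ^ Nm = 1" using z by simp
  thus ?thesis using TorNI Q by blast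
 next
  case mp
  have "z1 ^ (R * R) = z2 * z2" unfolding QQ mp power_mult_distrib power_inverse using z(1) z2'(1) by (simp add: field_simps)
  hence Q: "z1 ^ Q = z2" using pow_RR by blast
  have "z1 ^ Np = z1 ^ Q * z1 ^ R * z1" by (simp add: Np_def power_add)
  also have "... = 1" unfolding Q mp(1) using z(1) z2'(1) by (simp add: field_simps)
  finally have "z1 ^ Np = 1" .
  thus ?thesis using TorNI Q by blast
 qed
qed

end

lemma pow_coprime_eq_1:
 fixes z :: "'a :: field"
 assumes "z ^ m = 1" "z ^ n = 1" "coprime m n" "0 < m"
 shows "z = 1"
proof -
 obtain x y where "x * m - y * n = gcd m n" "y * n <= x * m" using bezout_nat[of m n] assms(4) by (metis add_diff_cancel_left' le_add1 mult.commute not_gr_zero)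
 hence e: "x * m = y * n + 1" using assms(3) by simp
 have "z ^ (x * m) = 1" using assms(1) by (simp add: mult.commute[of x] power_mult)
 moreover have "z ^ (y * n + 1) = z" using assms(2) by (simp add: mult.commute[of y] power_mult)
 ultimately show ?thesis unfolding e by simp
qed

context suzuki
begin

lemma NpNm: "Np * Nm = Q * Q + 1"
proof -
 have "int Np * int Nm = (int Q + int R + 1) * (int Q + 1 - int R)"
  using R_le by (simp add: Np_def Nm_def of_nat_diff algebra_simps)
 also have "... = int Q * int Q + 1 + (2 * int Q - int R * int R)" by (simp add: algebra_simps)
 also have "int R * int R = 2 * int Q" using RR by (metis of_nat_mult of_nat_numeral)
 finally show ?thesis by (metis add.right_neutral cancel_comm_monoid_add_class.diff_cancel of_nat_1 of_nat_add of_nat_eq_iff of_nat_mult)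
qed

lemma even_QR: "even Q" "even R" by (auto simp: Q_def R_def)

lemma odd_N: "odd Np" "odd Nm" using even_QR R_le by (auto simp: Np_def Nm_def)

lemma Nm_add: "Nm + R = Q + 1" using R_le by (simp add: Nm_def)

lemma coprime_NpNm: "coprime Np Nm"
proof (rule coprimeI)
 fix c assume c: "c dvd Np" "c dvd Nm"
 have "c dvd Np - Nm" using c by (rule dvd_diff_nat)
 also have "Np - Nm = 2 * R" using R_le by (simp add: Np_def Nm_def)
 also have "2 * R = 2 ^ (f + 2)" by (simp add: R_def)
 finally have "c dvd 2 ^ (f + 2)" .
 then obtain k where k: "c = 2 ^ k" using divides_primepow_nat[OF two_is_prime_nat, of c "f + 2"] by blast
 have "odd c" using c odd_N by (metis dvd_trans)
 thus "is_unit c" using k by (cases k) auto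
qed

lemma coprime_Q1_N: "coprime (Q - 1) Np" "coprime (Q - 1) Nm"
proof -
 have "coprime (Q - 1) (Np * Nm)"
 proof (rule coprimeI)
  fix c assume c: "c dvd Q - 1" "c dvd Np * Nm"
  have "Q * Q + 1 = (Q - 1) * (Q + 1) + 2" using Q_ge by (simp add: algebra_simps)
  hence "c dvd 2" using c unfolding NpNm by (metis dvd_add_right_iff dvd_mult2)
  hence "c = 1 | c = 2" by (metis dvd_imp_le le_antisym less_2_cases_iff linorder_not_less not_gr_zero dvd_0_left_iff numeral_2_eq_2 zero_less_Suc zero_neq_numeral One_nat_def)
  moreover have "c ~= 2" using c(1) odd_Q1 by auto
  ultimately show "is_unit c" by auto
 qed
 thus "coprime (Q - 1) Np" "coprime (Q - 1) Nm" by simp_all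
qed

text \<open>The orders of the three types of tori. They are odd and pairwise coprime, which is what
  separates the types.\<close>

definition Ms :: "nat set" where "Ms = {Q - 1, Np, Nm}"

lemma Ms_pos: "M : Ms ==> 1 < M & odd M"
 using odd_Q1 odd_N Q_ge R_ge R_le by (auto simp: Ms_def Np_def Nm_def)

lemma Ms_coprime: "M : Ms ==> M' : Ms ==> M ~= M' ==> coprime M M'"
 using coprime_NpNm coprime_Q1_N by (auto simp: Ms_def coprime_commute)

text \<open>A coarser description of the types than \<open>Tor0\<close> and \<open>TorN\<close>. It
  loses nothing (\<open>Tor_eq\<close>), because the coarse types are disjoint and the fine ones
  already cover all nonzero traces.\<close>

definition Ty :: "nat => F2bar set" where "Ty M = {a : tor. ALL z:Ra a. z ^ M = 1}"

lemma TorN_Ty: "TorN M <= Ty M" and Tor0_Ty: "Tor0 <= Ty (Q - 1)"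
proof -
 have c: "(z ^ Q) ^ M = (z ^ M) ^ Q" for z :: F2bar by (simp add: mult.commute flip: power_mult)
 show "TorN M <= Ty M" unfolding TorN_def Ty_def by (auto simp: power_inverse c)
 show "Tor0 <= Ty (Q - 1)" unfolding Ty_def Tor0_def by auto
qed

lemma Ra_ne: "a : tor ==> EX z. z : Ra a"
 using card_Ra[of a] by (metis all_not_in_conv card.empty zero_neq_numeral)

lemma Ty_disj: "M : Ms ==> M' : Ms ==> a : Ty M ==> a : Ty M' ==> M = M'"
proof (rule ccontr)
 assume *: "M : Ms" "M' : Ms" "a : Ty M" "a : Ty M'" "M ~= M'"
 hence a: "a : tor" by (simp add: Ty_def)
 obtain z where z: "z : Ra a" using Ra_ne[OF a] by blast
 hence "z ^ M = 1" "z ^ M' = 1" using * by (auto simp: Ty_def)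
 hence "z = 1" using pow_coprime_eq_1 Ms_coprime[OF *(1,2,5)] Ms_pos[OF *(1)] by fastforce
 thus False using Ra_ne1[OF a z] by simp
qed

lemma Ty_cover: "a : tor ==> EX M:Ms. a : Ty M"
 using types TorN_Ty Tor0_Ty unfolding Ms_def by blast

section \<open>Centralisers of elements of nonzero trace\<close>

definition ga :: "F2bar => F2bar mat" where "ga a = w * U 0 (thi a)"

lemma ga_Sz [simp]: "a : F ==> ga a : Cz" by (simp add: ga_def)

text \<open>The parameter of \<open>ga\<close> is chosen with \<open>N 0 (thi a) = a\<close>, so
  that \<open>ga a\<close> is a representative of the trace \<open>a\<close>.\<close>

lemma tr_ga: "a : F ==> tr (ga a) = a"
 by (simp add: ga_def tr_wU N_def th_thi)

lemma ga_m4: "a : F ==> ga a = m4 [[a, thi a, 0, 1], [thi a, 0, 1, 0], [0, 1, 0, 0], [1, 0, 0, 0]]"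
proof -
 assume a: "a : F"
 have "N 0 (thi a) = a" using a by (simp add: N_def th_thi)
 thus ?thesis by (simp add: ga_def U_m4 w_m4 m4_mult)
qed

text \<open>An eigenvector of \<open>ga a\<close> for the eigenvalue \<open>z\<close>
  (\<open>ga_vz\<close>), scaled so that its entries are polynomials in \<open>z\<close>. Its last
  entry is not zero for \<open>z ~= 1\<close>, and \<open>ev\<close> reads off there how a commuting
  matrix acts.\<close>

definition vz :: "F2bar => F2bar => F2bar vec" where
 "vz a z = vec_of_list [z * (z * z + 1), thi a * (z * z), thi a * z, z * z + 1]"

definition ev :: "F2bar => F2bar => F2bar mat => F2bar" where
 "ev a z x = vec_index (x *v vz a z) 3 / (z * z + 1)"

definition Ce :: "F2bar => F2bar mat set" where
 "Ce a = {x : Cz. x * ga a = ga a * x}"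

lemma vz_carrier [simp]: "vz a z : cvec 4"
 by (rule carrier_vecI) (simp add: vz_def)

lemma vz_index: "vec_index (vz a z) 0 = z * (z * z + 1)" "vec_index (vz a z) 1 = thi a * (z * z)"
 "vec_index (vz a z) 2 = thi a * z" "vec_index (vz a z) 3 = z * z + 1"
 unfolding vz_def vec_of_list_index by simp_all

lemma dim_vz [simp]: "dim_vec (vz a z) = 4"
 using vz_carrier carrier_vecD by blast

lemma mat4_vec: "A : cmat 4 4 ==> v : cvec 4 ==> i < 4 ==>
 vec_index (A *v v) i = A $$ (i,0) * vec_index v 0 + A $$ (i,1) * vec_index v 1 + A $$ (i,2) * vec_index v 2 + A $$ (i,3) * vec_index v 3"
 by (simp add: scalar_prod_def numeral_eq_Suc)

lemma vec4_eqI: "u : cvec 4 ==> v : cvec 4 ==> vec_index u 0 = vec_index v 0 ==> vec_index u 1 = vec_index v 1 ==>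
 vec_index u 2 = vec_index v 2 ==> vec_index u 3 = vec_index v 3 ==> u = v"
 by (rule eq_vecI) (auto simp: less_4_cases)

lemma ga_vec: "a : F ==> v : cvec 4 ==>
 vec_index (ga a *v v) 0 = a * vec_index v 0 + thi a * vec_index v 1 + vec_index v 3 &
 vec_index (ga a *v v) 1 = thi a * vec_index v 0 + vec_index v 2 &
 vec_index (ga a *v v) 2 = vec_index v 1 & vec_index (ga a *v v) 3 = vec_index v 0"
 by (simp add: mat4_vec[of "ga a"]) (simp add: ga_m4 m4_index)

lemma zz1: "z ~= 1 ==> z * z + 1 ~= (0 :: F2bar)"
 using sq_inj[of z 1] by (auto simp: add_eq_0_iff_eq)

lemma ga_vz:
 assumes a: "a : tor" and z: "z : Ra a"
 shows "ga a *v vz a z = z *s vz a z"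
proof (rule vec4_eqI)
 note aF = torD(1)[OF a]
 have z0: "z ~= 0" using Ra_ne1[OF a z] by simp
 have "q a (z + inverse z) * (z * z) = 0" using z by (simp add: Ra_def)
 moreover have "q a (z + inverse z) * (z * z) = a * (z * (z * z + 1)) + thi a * (thi a * (z * z)) + (z * z + 1) + z * (z * (z * z + 1))"
  using z0 aF by (simp add: q_def thi_sq algebra_simps)
 ultimately have e: "a * (z * (z * z + 1)) + thi a * (thi a * (z * z)) + (z * z + 1) = z * (z * (z * z + 1))"
  by (simp only: add_eq_0_iff_eq)
 have s: "vec_index (z *s vz a z) i = z * vec_index (vz a z) i" if "i < 4" for i
  using that by simp
 show "vec_index (ga a *v vz a z) 0 = vec_index (z *s vz a z) 0"
  using ga_vec[OF aF vz_carrier[of a z]] e by (simp add: s vz_index[unfolded One_nat_def])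
 show "vec_index (ga a *v vz a z) 1 = vec_index (z *s vz a z) 1"
  using ga_vec[OF aF vz_carrier[of a z]] by (simp add: s vz_index[unfolded One_nat_def] algebra_simps)
 show "vec_index (ga a *v vz a z) 2 = vec_index (z *s vz a z) 2"
  using ga_vec[OF aF vz_carrier[of a z]] by (simp add: s vz_index[unfolded One_nat_def] algebra_simps)
 show "vec_index (ga a *v vz a z) 3 = vec_index (z *s vz a z) 3"
  using ga_vec[OF aF vz_carrier[of a z]] by (simp add: s vz_index algebra_simps)
qed (use a in \<open>auto simp: torD intro: mult_mat_vec_carrier[of _ 4 4]\<close>)

text \<open>The eigenspaces are lines, so whatever commutes with \<open>ga a\<close> acts on each of
  them by a scalar.\<close>

lemma ga_eigenspace:
 assumes a: "a : tor" and z: "z : Ra a" and v: "v : cvec 4" and e: "ga a *v v = z *s v"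
 shows "v = (vec_index v 3 / (z * z + 1)) *s vz a z"
proof -
 note aF = torD(1)[OF a]
 have z1: "z * z + 1 ~= 0" using Ra_ne1[OF a z] zz1 by blast
 have s: "vec_index (ga a *v v) i = z * vec_index v i" if "i < 4" for i
  unfolding e using that v by simp
 have 0: "vec_index v 0 = z * vec_index v 3" and 1: "vec_index v 1 = z * vec_index v 2"
  using ga_vec[OF aF v] s by auto
 have "thi a * vec_index v 0 + vec_index v 2 = z * vec_index v 1" using ga_vec[OF aF v] s by auto
 hence "thi a * vec_index v 0 + (vec_index v 2 + z * z * vec_index v 2) = 0" unfolding 1
  by (simp add: add_ac mult_ac flip: add.assoc)
 hence "thi a * vec_index v 0 = vec_index v 2 + z * z * vec_index v 2" by (simp only: add_eq_0_iff_eq)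
 hence 2: "vec_index v 2 * (z * z + 1) = thi a * (z * vec_index v 3)" unfolding 0 by (simp add: algebra_simps)
 have i: "vec_index (c *s vz a z) i = c * vec_index (vz a z) i" if "i < 4" for i c
  using that by simp
 have v2: "vec_index v 2 = thi a * (z * vec_index v 3) / (z * z + 1)" using 2 z1 by (simp add: field_simps)
 show ?thesis
 proof (rule vec4_eqI)
  show "vec_index v 0 = vec_index ((vec_index v 3 / (z * z + 1)) *s vz a z) 0"
   using z1 0 by (simp add: i vz_index field_simps)
  show "vec_index v 1 = vec_index ((vec_index v 3 / (z * z + 1)) *s vz a z) 1"
   unfolding 1 v2 using z1 by (simp add: i vz_index[unfolded One_nat_def])
  show "vec_index v 2 = vec_index ((vec_index v 3 / (z * z + 1)) *s vz a z) 2"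
   unfolding v2 using z1 by (simp add: i vz_index)
  show "vec_index v 3 = vec_index ((vec_index v 3 / (z * z + 1)) *s vz a z) 3"
   using z1 by (simp add: i vz_index)
 qed (use v in auto)
qed

lemma Ce_ev:
 assumes a: "a : tor" and z: "z : Ra a" and x: "x : Ce a"
 shows "x *v vz a z = ev a z x *s vz a z"
proof -
 have xm: "x : cmat 4 4" "ga a : cmat 4 4" using x torD(1)[OF a] by (auto simp: Ce_def)
 have "ga a *v (x *v vz a z) = (ga a * x) *v vz a z" using xm by (simp add: assoc_mult_mat_vec[of _ 4 4 _ 4])
 also have "ga a * x = x * ga a" using x by (simp add: Ce_def)
 also have "x * ga a *v vz a z = x *v (ga a *v vz a z)" using xm by (simp add: assoc_mult_mat_vec[of _ 4 4 _ 4])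
 also have "... = z *s (x *v vz a z)" unfolding ga_vz[OF a z] using xm by (simp add: mult_mat_vec)
 finally show ?thesis unfolding ev_def by (rule ga_eigenspace[OF a z, rotated]) (use xm in \<open>auto intro: mult_mat_vec_carrier[of _ 4 4]\<close>)
qed

lemma vz_ne0: "z ~= 1 ==> vz a z ~= 0\<^sub>v 4"
proof
 assume z: "z ~= 1" and "vz a z = 0\<^sub>v 4"
 hence "vec_index (vz a z) 3 = 0" by simp
 thus False using zz1[OF z] by (simp add: vz_index)
qed

lemma Ce_ev_q:
 assumes a: "a : tor" and z: "z : Ra a" and x: "x : Ce a"
 shows "ev a z x ~= 0 & q (tr x) (ev a z x + inverse (ev a z x)) = 0" "tr x : F"
proof -
 have "eigP x" using eigP x by (simp add: Ce_def)
 thus "ev a z x ~= 0 & q (tr x) (ev a z x + inverse (ev a z x)) = 0" "tr x : F"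
  unfolding eigP_def using Ce_ev[OF assms] vz_ne0 Ra_ne1[OF a z] vz_carrier by blast+
qed

lemma ev_smult: "z ~= 1 ==> x *v vz a z = c *s vz a z ==> ev a z x = c"
 using zz1[of z] by (simp add: ev_def vz_index)

lemma ev_mult:
 assumes a: "a : tor" and z: "z : Ra a" and x: "x : Ce a" and y: "y : Ce a"
 shows "ev a z (x * y) = ev a z x * ev a z y"
proof (rule ev_smult)
 have m: "x : cmat 4 4" "y : cmat 4 4" using x y by (auto simp: Ce_def)
 have "x * y *v vz a z = x *v (ev a z y *s vz a z)"
  unfolding Ce_ev[OF a z y, symmetric] using m by (simp add: assoc_mult_mat_vec[of _ 4 4 _ 4])
 also have "... = ev a z y *s (x *v vz a z)" using m by (simp add: mult_mat_vec)
 finally show "x * y *v vz a z = (ev a z x * ev a z y) *s vz a z"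
  unfolding Ce_ev[OF a z x] by (simp add: smult_smult_assoc mult.commute)
qed (use Ra_ne1[OF a z] in simp)

lemma ev_one: "z ~= 1 ==> ev a z (I4) = 1"
 by (rule ev_smult) auto

lemma ev_ga: "a : tor ==> z : Ra a ==> ev a z (ga a) = z"
 by (rule ev_smult) (use Ra_ne1 ga_vz in auto)

lemma ga_Ce: "a : tor ==> ga a : Ce a" by (simp add: Ce_def torD)

lemma Ce_mult: "a : tor ==> x : Ce a ==> y : Ce a ==> x * y : Ce a"
proof -
 assume *: "a : tor" "x : Ce a" "y : Ce a"
 have m: "ga a : cmat 4 4" "x : cmat 4 4" "y : cmat 4 4" using * by (auto simp: Ce_def torD)
 have "x * y * ga a = x * (ga a * y)" using * m by (simp add: Ce_def)
 also have "... = (x * ga a) * y" using as4[OF m(2,1,3)] by simp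
 also have "... = (ga a * x) * y" using * by (simp add: Ce_def)
 also have "... = ga a * (x * y)" using as4[OF m] .
 finally show ?thesis using * by (simp add: Ce_def)
qed

lemma Ce_subgroup: "a : tor ==> subgroup (Ce a) Sz"
 by (rule Sz.finite_subgroupI) (auto simp: Ce_mult, auto simp: Ce_def torD)

lemma ev_tr0: "a : tor ==> z : Ra a ==> x : Ce a ==> ev a z x = 1 <-> tr x = 0"
proof -
 assume *: "a : tor" "z : Ra a" "x : Ce a"
 note q = Ce_ev_q(1)[OF *]
 show ?thesis
 proof
  assume "ev a z x = 1"
  thus "tr x = 0" using q by (simp add: q_def)
 next
  assume "tr x = 0"
  thus "ev a z x = 1" using q inverse_sum_eq_0[of "ev a z x"] by (simp add: q_def)
 qed
qed

text \<open>The eigenvalue \<open>1\<close> forces trace zero by \<open>ev_tr0\<close>, and then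
  \<open>x\<close> has the eigenvalue \<open>1\<close> on all four vectors \<open>vz a u\<close>. A
  row of \<open>x\<close> minus the identity, applied to \<open>vz a u\<close>, is a polynomial of
  degree at most three in \<open>u\<close>; having four roots, it vanishes.\<close>

lemma ev_eq_1:
 assumes a: "a : tor" and z: "z : Ra a" and x: "x : Ce a" and 1: "ev a z x = 1"
 shows "x = I4"
proof (rule eq_matI)
 have xm: "x : cmat 4 4" using x by (auto simp: Ce_def)
 have thia: "thi a ~= 0" using torD[OF a] by simp
 fix i j :: nat assume ij: "i < dim_row (I4 :: F2bar mat)" "j < dim_col (I4 :: F2bar mat)"
 hence i: "i < 4" and j: "j < 4" by simp_all
 define r where "r k = x $$ (i, k) + (I4 :: F2bar mat) $$ (i, k)" for k
 define p where "p = [:r 3, r 0 + r 2 * thi a, r 1 * thi a + r 3, r 0:]"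
 have "poly p u = 0" if u: "u : Ra a" for u
 proof -
  have "ev a u x = 1" using ev_tr0[OF a z x] ev_tr0[OF a u x] 1 by simp
  hence "x *v vz a u = I4 *v vz a u" using Ce_ev[OF a u x] by simp
  hence "vec_index (x *v vz a u) i = vec_index (I4 *v vz a u) i" by (rule arg_cong)
  hence "vec_index (x *v vz a u) i + vec_index (I4 *v vz a u) i = 0" by simp
  thus ?thesis
   unfolding mat4_vec[OF xm vz_carrier i] mat4_vec[OF one_carrier_mat vz_carrier i] vz_index p_def r_def
   by (simp add: algebra_simps)
 qed
 hence sub: "Ra a <= {u. poly p u = 0}" by blast
 have "p = 0"
 proof (rule ccontr)
  assume p: "p ~= 0"
  have "card (Ra a) <= card {u. poly p u = 0}" using sub poly_roots_finite[OF p] by (rule card_mono[rotated])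
  also have "... <= degree p" using p by (rule card_poly_roots_bound)
  also have "... <= 3" by (simp add: p_def)
  finally show False using card_Ra[OF a] by simp
 qed
 hence "r 3 = 0" "r 0 = 0" "r 2 = 0" "r 1 = 0" using thia by (auto simp: p_def)
 hence "r j = 0" using j unfolding less_4_cases by auto
 thus "x $$ (i, j) = I4 $$ (i, j)" by (simp only: r_def add_eq_0_iff_eq)
qed (use x in \<open>auto simp: Ce_def dest: Sz_mat\<close>)

lemma ev_inj: "a : tor ==> z : Ra a ==> inj_on (ev a z) (Ce a)"
proof (rule inj_onI)
 fix x y assume *: "a : tor" "z : Ra a" "x : Ce a" "y : Ce a" and e: "ev a z x = ev a z y"
 have c: "x : Cz" "y : Cz" using * by (auto simp: Ce_def)
 have iy: "iv y : Ce a" using * subgroup.m_inv_closed[OF Ce_subgroup] by auto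
 have "ev a z (x * iv y) = ev a z y * ev a z (iv y)" using ev_mult[OF *(1,2,3) iy] e by simp
 also have "... = 1" using ev_mult[OF *(1,2,4) iy] c ev_one Ra_ne1[OF *(1,2)] by simp
 finally have "x * iv y = I4" by (rule ev_eq_1[OF *(1,2) Ce_mult[OF *(1,3) iy]])
 hence "x * iv y * y = y" using c by simp
 thus "x = y" using c by simp
qed

lemma Ce_tr: "a : tor ==> x : Ce a ==> x ~= I4 ==> tr x : tor"
 using Ra_ne[of a] ev_tr0 ev_eq_1 Ce_ev_q(2) unfolding tor_def by blast

lemma ev_Ra: "a : tor ==> z : Ra a ==> x : Ce a ==> ev a z x : Ra (tr x)"
 using Ce_ev_q(1) by (simp add: Ra_def)

text \<open>Each eigenvalue \<open>e\<close> is an \<open>M'\<close>-th root of unity for some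
  \<open>M'\<close> in \<open>Ms\<close>. If \<open>M'\<close> is not \<open>M\<close>, the same
  fact for \<open>e * z\<close>, which is the eigenvalue of \<open>x * ga a\<close>, and the
  coprimality of the orders leave only \<open>e = 1\<close>, since \<open>z = 1\<close> is
  excluded.\<close>

lemma ev_type:
 assumes M: "M : Ms" and a: "a : Ty M" and z: "z : Ra a" and x: "x : Ce a"
 shows "ev a z x ^ M = 1"
proof -
 have at: "a : tor" using a by (simp add: Ty_def)
 have zM: "z ^ M = 1" using a z by (simp add: Ty_def)
 define e where "e = ev a z x"
 have ex: "EX M':Ms. ev a z y ^ M' = 1" if "y : Ce a" for y
 proof (cases "y = I4")
  case True
  thus ?thesis using ev_one Ra_ne1[OF at z] M by auto
 next
  case False
  hence "tr y : tor" using Ce_tr at that by blast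
  thus ?thesis using Ty_cover[of "tr y"] ev_Ra[OF at z that] by (auto simp: Ty_def)
 qed
 obtain M' where M': "M' : Ms" "e ^ M' = 1" using ex[OF x] unfolding e_def by blast
 obtain M'' where M'': "M'' : Ms" "(e * z) ^ M'' = 1"
  using ex[OF Ce_mult[OF at x ga_Ce[OF at]]] unfolding e_def ev_mult[OF at z x ga_Ce[OF at]] ev_ga[OF at z] by blast
 have z1: "z ~= 1" using Ra_ne1[OF at z] by simp
 show ?thesis unfolding e_def[symmetric]
 proof (cases "M' = M")
  case True thus "e ^ M = 1" using M' by simp
 next
  case ne: False
  have p: "(e * z) ^ (M'' * k) = 1" for k using M''(2) by (simp add: power_mult)
  have "e = 1"
  proof (cases "M'' = M'")
   case True
   hence "z ^ M' = 1" using M'(2) M''(2) by (simp add: power_mult_distrib)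
   hence "z = 1" using pow_coprime_eq_1[OF _ zM Ms_coprime[OF M'(1) M ne]] Ms_pos[OF M'(1)] by simp
   thus ?thesis using z1 by simp
  next
   case False
   have "z ^ (M'' * M) = (z ^ M) ^ M''" by (simp add: mult.commute flip: power_mult)
   hence "e ^ (M'' * M) = 1" using p[of M] zM by (simp add: power_mult_distrib)
   moreover have "coprime M' (M'' * M)" using Ms_coprime M M' M'' ne False by (auto simp: coprime_mult_right_iff)
   ultimately show ?thesis using pow_coprime_eq_1[OF M'(2)] Ms_pos[OF M'(1)] by simp
  qed
  thus "e ^ M = 1" by simp
 qed
qed

lemma card_Ce_le:
 assumes M: "M : Ms" and a: "a : Ty M"
 shows "card (Ce a) <= M"
proof -
 have at: "a : tor" using a by (simp add: Ty_def)
 obtain z where z: "z : Ra a" using Ra_ne[OF at] by blast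
 have odd: "odd M" using Ms_pos[OF M] by simp
 have "card (Ce a) = card (ev a z ` Ce a)" using ev_inj[OF at z] by (simp add: card_image)
 also have "... <= card {x :: F2bar. x ^ M = 1}"
  using ev_type[OF M a z] card_roots_of_unity(1)[OF odd] by (intro card_mono) auto
 finally show ?thesis unfolding card_roots_of_unity(2)[OF odd] .
qed

end

section \<open>Counting elements by their trace\<close>

lemma card_fibres_ge:
 assumes Z: "finite Z" and A: "finite A" and k: "!!a. a : A ==> k <= card {z : Z. h z = a}"
 shows "k * card A <= card Z"
proof -
 have "k * card A = (SUM a:A. k)" by simp
 also have "... <= (SUM a:A. card {z : Z. h z = a})" by (intro sum_mono k)
 also have "... = card (\<Union>a\<in>A. {z : Z. h z = a})"
  by (rule card_UN_disjoint[symmetric]) (use Z A in auto)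
 also have "... <= card Z" by (rule card_mono) (use Z in auto)
 finally show ?thesis .
qed

context fin_group
begin

lemma card_conj_fibre:
 assumes g: "g : CG" and y: "y : (%s. s \<otimes> g \<otimes> inv s) ` CG"
 shows "card {s : CG. s \<otimes> g \<otimes> inv s = y} = card {x : CG. x \<otimes> g = g \<otimes> x}"
proof -
 let ?c = "%s. s \<otimes> g \<otimes> inv s" and ?C = "{x : CG. x \<otimes> g = g \<otimes> x}"
 obtain t where t: "t : CG" "y = t \<otimes> g \<otimes> inv t" using y by blast
 have "bij_betw (%x. t \<otimes> x) ?C {s : CG. ?c s = y}"
 proof (rule bij_betw_byWitness[where f' = "%s. inv t \<otimes> s"])
  show "ALL a:?C. inv t \<otimes> (t \<otimes> a) = a" using t inv_mult_cancel by auto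
  show "ALL s:{s : CG. ?c s = y}. t \<otimes> (inv t \<otimes> s) = s" using t mult_inv_cancel by auto
  show "(%x. t \<otimes> x) ` ?C <= {s : CG. ?c s = y}"
  proof (intro subsetI, elim imageE)
   fix s x assume "s = t \<otimes> x" "x : ?C"
   hence s: "s = t \<otimes> x" "x : CG" "x \<otimes> g = g \<otimes> x" by auto
   have "?c s = t \<otimes> (x \<otimes> g \<otimes> inv x) \<otimes> inv t" unfolding s(1) using s(2) t g by (simp add: inv_mult_group m_assoc)
   also have "x \<otimes> g \<otimes> inv x = g" unfolding s(3) using s g by (simp add: m_assoc)
   finally show "s : {s : CG. ?c s = y}" using s t by simp
  qed
  show "(%s. inv t \<otimes> s) ` {s : CG. ?c s = y} <= ?C"
  proof (intro subsetI, elim imageE)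
   fix x s assume "x = inv t \<otimes> s" "s : {s : CG. ?c s = y}"
   hence s: "x = inv t \<otimes> s" "s : CG" "s \<otimes> g \<otimes> inv s = t \<otimes> g \<otimes> inv t" using t by auto
   have "s \<otimes> g = (s \<otimes> g \<otimes> inv s) \<otimes> s" using s(2) g by (simp add: m_assoc)
   also have "... = t \<otimes> (g \<otimes> (inv t \<otimes> s))" unfolding s(3) using s(2) t g by (simp add: m_assoc)
   finally have "inv t \<otimes> (s \<otimes> g) = g \<otimes> (inv t \<otimes> s)" using s(2) t(1) g inv_mult_cancel by simp
   hence "inv t \<otimes> s \<otimes> g = g \<otimes> (inv t \<otimes> s)" using s(2) t(1) g by (simp add: m_assoc)
   thus "x : ?C" using s t by simp
  qed
 qed
 thus ?thesis by (simp only: bij_betw_same_card)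
qed

lemma card_conj_class:
 assumes g: "g : CG"
 shows "card ((%s. s \<otimes> g \<otimes> inv s) ` CG) * card {x : CG. x \<otimes> g = g \<otimes> x} = card (CG)"
proof -
 let ?c = "%s. s \<otimes> g \<otimes> inv s" and ?C = "{x : CG. x \<otimes> g = g \<otimes> x}"
 have "card (CG) = (SUM y:?c ` CG. card {s : CG. ?c s = y})"
  using sum.image_gen[OF fin, of "%_. 1::nat" ?c] by simp
 also have "... = (SUM y:?c ` CG. card ?C)" using card_conj_fibre[OF g] by (intro sum.cong) auto
 finally show ?thesis by simp
qed

end

context suzuki
begin

text \<open>The group \<open>Us\<close> and its conjugates by \<open>v * w\<close> with
  \<open>v\<close> in \<open>Us\<close> are \<open>Q^2 + 1\<close> subgroups of order
  \<open>Q^2\<close> which meet trivially by \<open>TI\<close>, and all their elements have trace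
  zero.\<close>

lemma card_trace0: "Q * Q * (Q * Q) <= card {x : Cz. tr x = 0}"
proof -
 define V where "V = (Us - {I4}) \<times> Us"
 define c where "c = (%(u, v). (v * w) * u * iv (v * w))"
 have VE: "u : Us & u ~= I4 & v : Us & u : Cz & v : Cz" if "(u, v) : V" for u v
  using that Us_Sz by (auto simp: V_def)
 have cE: "c (u, v) = v * (w * u * w) * iv v" if "u : Cz" "v : Cz" for u v
  using that conj_conj[of w v u] by (simp add: c_def inv_w)
 have Usinv: "iv v : Us" if "v : Us" for v using subgroup.m_inv_closed[OF Us_subgroup that] .
 have cnot: "c p ~: Us" if "p : V" for p
 proof
  obtain u v where p: "p = (u, v)" by (cases p)
  note uv = VE[OF that[unfolded p]]
  assume "c p : Us"
  hence "iv v * c p * iv (iv v) : Bs" using Bs_conj_Us Us_Bs Usinv uv by blast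
  also have "iv v * c p * iv (iv v) = w * u * w"
   unfolding p using uv cE conj_conj[of v "iv v" "w * u * w"] by (simp add: Sz.inv_one[simplified])
  finally show False using w_conj_Us uv Bs_big_disj by blast
 qed
 have cinj: "inj_on c V"
 proof (rule inj_onI)
  fix p p' assume pp: "p : V" "p' : V" "c p = c p'"
  obtain u v u' v' where p: "p = (u, v)" "p' = (u', v')" by (cases p, cases p')
  note uv = VE[OF pp(1)[unfolded p]] VE[OF pp(2)[unfolded p]]
  define s where "s = iv v' * v"
  have s: "s : Us" "s : Cz" using uv Usinv Us_mult Us_Sz by (auto simp: s_def)
  define t where "t = iv (v' * w) * (v * w)"
  have t: "t = w * s * w" using uv Sz.inv_mult_group[of v' w] by (simp add: t_def s_def inv_w)
  have "t * u * iv t = iv (v' * w) * c p * iv (iv (v' * w))"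
   unfolding t_def p c_def using uv conj_conj[of "v * w" "iv (v' * w)" u] by simp
  also have "... = u'" unfolding pp(3) unfolding p c_def using uv conj_conj[of "v' * w" "iv (v' * w)" u'] by (simp add: Sz.inv_one[simplified])
  finally have tu: "t * u * iv t = u'" .
  have s1: "s = I4"
  proof (rule ccontr)
   assume "s ~= I4"
   hence "t : big" unfolding t using w_conj_Us s by blast
   thus False using TI[of t u] tu uv Us_Bs by auto
  qed
  hence "v' * s = v'" using uv by simp
  moreover have "v' * s = v" unfolding s_def using uv Sz.mult_inv_cancel[of v' v] by simp
  moreover have "t = I4" unfolding t s1 by (simp add: ww)
  hence "u = u'" using tu uv by (simp add: Sz.inv_one[simplified])
  ultimately show "p = p'" unfolding p by simp
 qed
 have tr0: "tr (c p) = 0" "c p : Cz" if "p : V" for p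
 proof -
  obtain u v where p: "p = (u, v)" by (cases p)
  note uv = VE[OF that[unfolded p]]
  have "tr u = 0" using uv by (auto simp: Us_def tr_U)
  thus "tr (c p) = 0" "c p : Cz" unfolding p c_def using tr_conj[of "v * w" u] uv by auto
 qed
 have fV: "finite V" and cV: "card V = (Q * Q - 1) * (Q * Q)"
  using card_Us UsI[of 0 0] by (auto simp: V_def U00 card_cartesian_product)
 have "Q * Q * (Q * Q) = Q * Q + card V" using Q_ge unfolding cV by (simp add: algebra_simps)
 also have "... = card (Us Un c ` V)"
  using card_Us fV cinj cnot by (subst card_Un_disjoint) (auto simp: card_image)
 also have "... <= card {x : Cz. tr x = 0}"
  by (rule card_mono) (use tr0 Us_Sz tr_U in \<open>auto simp: Us_def\<close>)
 finally show ?thesis .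
qed

lemma card_Tor0: "2 * card Tor0 <= Q - 2"
proof -
 define Z where "Z = {z :: F2bar. z ^ (Q - 1) = 1} - {1}"
 have Z: "finite Z" "card Z = Q - 2" using card_roots_of_unity[OF odd_Q1] by (auto simp: Z_def)
 have "2 <= card {z : Z. t0 z = a}" if a: "a : Tor0" for a
 proof -
  obtain z where z: "z ^ (Q - 1) = 1" "z ~= 1" "a = t0 z" using a unfolding Tor0_def by blast
  have z0: "z ~= 0" using z Q_ge by (auto simp: power_0_left)
  have "inverse z ~= z"
  proof
   assume "inverse z = z"
   hence "z * z = 1" using z0 by (simp add: field_simps)
   thus False using z sq_inj[of z 1] by simp
  qed
  moreover have "t0 (inverse z) = t0 z" by (simp add: t0_def power_inverse add_ac)
  hence "{z, inverse z} <= {z : Z. t0 z = a}" using z by (auto simp: Z_def power_inverse)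
  ultimately show ?thesis using card_mono[of "{z : Z. t0 z = a}" "{z, inverse z}"] Z(1) by simp
 qed
 moreover have "finite Tor0" using finite_tor by (rule finite_subset[rotated]) (auto simp: Tor0_def)
 ultimately show ?thesis using card_fibres_ge[OF Z(1), of Tor0 2 t0] Z(2) by simp
qed

lemma card_TorN: "M : {Np, Nm} ==> 4 * card (TorN M) <= M - 1"
proof -
 assume M: "M : {Np, Nm}"
 hence oddM: "odd M" and dvd: "M dvd Q * Q + 1" using odd_N unfolding NpNm[symmetric] by auto
 define Z where "Z = {z :: F2bar. z ^ M = 1} - {1}"
 have Z: "finite Z" "card Z = M - 1" using card_roots_of_unity[OF oddM] by (auto simp: Z_def)
 have "4 <= card {z : Z. t1 z = a}" if a: "a : TorN M" for a
 proof -
  obtain z where z: "z ^ M = 1" "z ~= 1" "a = t1 z" "Ra a = {z, inverse z, z ^ Q, inverse (z ^ Q)}" and at: "a : tor"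
   using a unfolding TorN_def by blast
  obtain k where "Q * Q + 1 = M * k" using dvd by (elim dvdE)
  hence "z ^ (Q * Q + 1) = 1" using z(1) by (simp only: power_mult power_one)
  hence "z * (z ^ Q) ^ Q = 1" by (simp add: power_mult)
  hence zQQ: "(z ^ Q) ^ Q = inverse z" using inverse_unique by metis
  have tQ: "t1 (z ^ Q) = t1 z" by (simp add: t1_def zQQ add_ac)
  have ti: "t1 (inverse u) = t1 u" for u by (simp add: t1_def power_inverse add_ac)
  have c: "(z ^ Q) ^ M = 1" using z(1) by (simp add: mult.commute power_mult flip: power_mult) (simp add: power_mult)
  have "Ra a <= {z : Z. t1 z = a}" unfolding z(4) using z(1,3) Ra_ne1[OF at] z(4)
   by (auto simp: Z_def power_inverse c tQ ti)
  thus ?thesis using card_Ra[OF at] card_mono[of "{z : Z. t1 z = a}" "Ra a"] Z(1) by simp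
 qed
 moreover have "finite (TorN M)" using finite_tor by (rule finite_subset[rotated]) (auto simp: TorN_def)
 ultimately show ?thesis using card_fibres_ge[OF Z(1), of "TorN M" 4 t1] Z(2) by simp
qed

lemma Tor_eq: "Ty (Q - 1) = Tor0" "Ty Np = TorN Np" "Ty Nm = TorN Nm"
proof -
 have ne: "Q - 1 ~= Np" "Q - 1 ~= Nm" "Np ~= Nm" using R_ge R_le by (auto simp: Np_def Nm_def)
 have M: "Q - 1 : Ms" "Np : Ms" "Nm : Ms" by (auto simp: Ms_def)
 have *: "a : tor" "a : Tor0 | a : TorN Np | a : TorN Nm" if "a : Ty M" for a M
  using that types by (auto simp: Ty_def)
 have d: "a ~: Ty (Q - 1) | a ~: Ty Np" "a ~: Ty (Q - 1) | a ~: Ty Nm" "a ~: Ty Np | a ~: Ty Nm" for a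
  using Ty_disj M ne by blast+
 show "Ty (Q - 1) = Tor0" "Ty Np = TorN Np" "Ty Nm = TorN Nm"
  using * d TorN_Ty[of Np] TorN_Ty[of Nm] Tor0_Ty by blast+
qed

text \<open>The fibres of \<open>t0\<close> have at least two elements and those of
  \<open>t1\<close> at least four, which bounds the number of traces of each type. The bounds add up
  to \<open>Q - 1\<close>, the number of nonzero traces, so all of them are attained.\<close>

lemma card_Ty: "2 * card (Ty (Q - 1)) = Q - 2" "4 * card (Ty Np) = Np - 1" "4 * card (Ty Nm) = Nm - 1"
proof -
 have ne: "Q - 1 ~= Np" "Q - 1 ~= Nm" "Np ~= Nm" using R_ge R_le by (auto simp: Np_def Nm_def)
 have M: "Q - 1 : Ms" "Np : Ms" "Nm : Ms" by (auto simp: Ms_def)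
 have tor: "tor = Ty (Q - 1) Un (Ty Np Un Ty Nm)"
  using Ty_cover by (auto simp: Ms_def) (auto simp: Ty_def)
 have fin: "finite (Ty M)" for M using finite_tor by (rule finite_subset[rotated]) (auto simp: Ty_def)
 have "Ty (Q - 1) Int (Ty Np Un Ty Nm) = {}" "Ty Np Int Ty Nm = {}" using Ty_disj M ne by blast+
 hence "Q - 1 = card (Ty (Q - 1)) + (card (Ty Np) + card (Ty Nm))"
  by (subst card_tor[symmetric], subst tor) (simp add: card_Un_disjoint fin del: One_nat_def)
 moreover have "2 * card (Ty (Q - 1)) <= Q - 2" "4 * card (Ty Np) <= Np - 1" "4 * card (Ty Nm) <= Nm - 1"
  unfolding Tor_eq using card_Tor0 card_TorN by auto
 ultimately show "2 * card (Ty (Q - 1)) = Q - 2" "4 * card (Ty Np) = Np - 1" "4 * card (Ty Nm) = Nm - 1"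
  using Q_ge R_le R_ge unfolding Np_def Nm_def by linarith+
qed

text \<open>The class of \<open>ga b\<close> lies in the trace fibre of \<open>b\<close>, and by
  \<open>card_Ce_le\<close> it has at least \<open>S / ty b\<close> elements. Summed over all
  nonzero \<open>b\<close>, with the number of each type from \<open>card_Ty\<close>, these bounds
  give exactly \<open>S\<close> minus the bound \<open>Q^4\<close> of \<open>card_trace0\<close>; so
  no inequality is strict.\<close>

lemma class_count:
 assumes M: "M : Ms" and a: "a : Ty M"
 shows "card (Ce a) = M" "{x : Cz. tr x = a} = (%s. s * ga a * iv s) ` Cz"
proof -
 define S where "S = card (Cz)"
 define fb where "fb b = card {x : Cz. tr x = b}" for b
 define cl where "cl b = (%s. s * ga b * iv s) ` Cz" for b
 define ty where "ty b = (THE M. M : Ms & b : Ty M)" for b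
 have ty: "ty b = M" if "M : Ms" "b : Ty M" for b M
  unfolding ty_def using that Ty_disj by blast
 have fin: "finite (Ty M)" for M using finite_tor by (rule finite_subset[rotated]) (auto simp: Ty_def)
 have ne: "Q - 1 ~= Np" "Q - 1 ~= Nm" "Np ~= Nm" using R_ge R_le by (auto simp: Np_def Nm_def)
 have MM: "Q - 1 : Ms" "Np : Ms" "Nm : Ms" by (auto simp: Ms_def)
 have tor: "tor = Ty (Q - 1) Un (Ty Np Un Ty Nm)"
  using Ty_cover by (auto simp: Ms_def) (auto simp: Ty_def)
 have disj: "Ty (Q - 1) Int (Ty Np Un Ty Nm) = {}" "Ty Np Int Ty Nm = {}" using Ty_disj MM ne by blast+
 have cl: "cl b <= {x : Cz. tr x = b}" "real (card (cl b)) * real (card (Ce b)) = real S"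
  and Ce: "0 < card (Ce b)" "card (Ce b) <= ty b" if b: "b : tor" for b
 proof -
  show "cl b <= {x : Cz. tr x = b}" using torD[OF b] tr_conj tr_ga by (auto simp: cl_def)
  show "real (card (cl b)) * real (card (Ce b)) = real S"
   using Sz.card_conj_class[of "ga b"] torD[OF b] by (simp add: cl_def Ce_def S_def flip: of_nat_mult)
  have "Ce b ~= {}" using ga_Ce[OF b] by blast
  moreover have "finite (Ce b)" by (simp add: Ce_def)
  ultimately show "0 < card (Ce b)" by (simp add: card_gt_0_iff)
  obtain M where "M : Ms" "b : Ty M" using Ty_cover[OF b] by blast
  thus "card (Ce b) <= ty b" using card_Ce_le ty by metis
 qed
 have ge1: "real S / real (ty b) <= real (card (cl b))" and ge2: "card (cl b) <= fb b" if b: "b : tor" for b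
 proof -
  have "real S = real (card (cl b)) * real (card (Ce b))" using cl(2)[OF b] ..
  also have "... <= real (card (cl b)) * real (ty b)" using Ce[OF b] by (intro mult_left_mono) auto
  finally show "real S / real (ty b) <= real (card (cl b))" using Ce[OF b] by (simp add: field_simps)
  show "card (cl b) <= fb b" unfolding fb_def using cl(1)[OF b] by (intro card_mono) auto
 qed
 have SF: "S = (SUM b:F. fb b)"
 proof -
  have "card (Cz) = (SUM b:F. SUM x:{x : Cz. tr x = b}. 1)"
   unfolding card_eq_sum by (rule sum.group[symmetric]) (use eigP in \<open>auto simp: eigP_def\<close>)
  thus ?thesis by (simp add: S_def fb_def)
 qed
 have "S = fb 0 + (SUM b:tor. fb b)" unfolding SF tor_def by (rule sum.remove) auto
 hence S: "real S = real (fb 0) + (SUM b:tor. real (fb b))" by simp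
 have s: "(SUM b:Ty M. real S / real (ty b)) = real (card (Ty M)) * (real S / real M)" if "M : Ms" for M
 proof -
  have "(SUM b:Ty M. real S / real (ty b)) = (SUM b:Ty M. real S / real M)" by (rule sum.cong) (use ty[OF that] in auto)
  thus ?thesis by simp
 qed
 have "(SUM b:tor. real S / real (ty b)) = (SUM b:Ty (Q - 1). real S / real (ty b)) + (SUM b:Ty Np Un Ty Nm. real S / real (ty b))"
  unfolding tor by (rule sum.union_disjoint) (use fin disj in auto)
 also have "(SUM b:Ty Np Un Ty Nm. real S / real (ty b)) = (SUM b:Ty Np. real S / real (ty b)) + (SUM b:Ty Nm. real S / real (ty b))"
  by (rule sum.union_disjoint) (use fin disj in auto)
 also note s[OF MM(1)] also note s[OF MM(2)] also note s[OF MM(3)]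
 also have "real (card (Ty (Q - 1))) = (real Q - 2) / 2"
 proof -
  have "2 * card (Ty (Q - 1)) + 2 = Q" using card_Ty(1) Q_ge by linarith
  hence "real (2 * card (Ty (Q - 1)) + 2) = real Q" by (rule arg_cong)
  thus ?thesis unfolding of_nat_add of_nat_mult by (simp del: One_nat_def)
 qed
 also have "real (card (Ty Np)) = (real Np - 1) / 4"
 proof -
  have "4 * card (Ty Np) + 1 = Np" using card_Ty(2) Ms_pos[OF MM(2)] by linarith
  hence "real (4 * card (Ty Np) + 1) = real Np" by (rule arg_cong)
  thus ?thesis unfolding of_nat_add of_nat_mult by simp
 qed
 also have "real (card (Ty Nm)) = (real Nm - 1) / 4"
 proof -
  have "4 * card (Ty Nm) + 1 = Nm" using card_Ty(3) Ms_pos[OF MM(3)] by linarith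
  hence "real (4 * card (Ty Nm) + 1) = real Nm" by (rule arg_cong)
  thus ?thesis unfolding of_nat_add of_nat_mult by simp
 qed
 \<comment> \<open>Only two properties of the torus orders enter: their product is
   \<open>Q^2 + 1\<close> and their sum is \<open>2 Q + 2\<close>.\<close>
 also have "(real Q - 2) / 2 * (real S / real (Q - 1)) + ((real Np - 1) / 4 * (real S / real Np) + (real Nm - 1) / 4 * (real S / real Nm))
   = real S - real (Q * Q * (Q * Q))"
 proof -
  define x y z u where "x = real Q" and "y = real R" and "z = real Np" and "u = real Nm"
  have x1: "real (Q - 1) = x - 1" using Q_ge by (simp add: x_def)
  have zu: "z * u = x * x + 1" using NpNm unfolding z_def u_def x_def by (metis of_nat_1 of_nat_add of_nat_mult)
  have zpu: "z + u = 2 * x + 2" using R_le unfolding z_def u_def x_def Np_def Nm_def by simp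
  have pos: "z > 0" "u > 0" "x - 1 > 0" using Ms_pos[OF MM(2)] Ms_pos[OF MM(3)] Q_ge by (simp_all add: z_def u_def x_def)
  have SS: "real S = x * x * (x - 1) * (z * u)"
   unfolding S_def card_Sz zu of_nat_mult of_nat_add x1 x_def[symmetric] by simp
  have 1: "(x - 2) / 2 * (x * x * (x - 1) * (z * u) / (x - 1)) = (x - 2) / 2 * (x * x * (z * u))" using pos by simp
  have 2: "(z - 1) / 4 * (x * x * (x - 1) * (z * u) / z) = (z - 1) / 4 * (x * x * (x - 1) * u)" using pos by simp
  have 3: "(u - 1) / 4 * (x * x * (x - 1) * (z * u) / u) = (u - 1) / 4 * (x * x * (x - 1) * z)" using pos by simp
  have 4: "(z - 1) / 4 * (x * x * (x - 1) * u) + (u - 1) / 4 * (x * x * (x - 1) * z) = x * x * (x - 1) / 4 * (2 * (z * u) - (z + u))"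
   by (simp add: field_simps)
  have "(x - 2) / 2 * (x * x * (z * u)) + x * x * (x - 1) / 4 * (2 * (z * u) - (z + u)) = x * x * (x - 1) * (z * u) - x * x * (x * x)"
   unfolding zu zpu by (simp add: field_simps)
  thus ?thesis unfolding x1 x_def[symmetric] z_def[symmetric] u_def[symmetric] of_nat_mult SS 1 2 3 4 .
 qed
 finally have sum: "(SUM b:tor. real S / real (ty b)) = real S - real (Q * Q * (Q * Q))" .
 have f0: "real (Q * Q * (Q * Q)) <= real (fb 0)" unfolding fb_def using card_trace0 of_nat_le_iff by blast
 have "(SUM b:tor. real (fb b) - real S / real (ty b)) <= 0"
  unfolding sum_subtractf sum using S f0 by linarith
 moreover have "0 <= real (fb b) - real S / real (ty b)" if "b : tor" for b
  using ge1[OF that] ge2[OF that] by linarith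
 ultimately have "ALL b:tor. real (fb b) - real S / real (ty b) = 0"
  by (metis (no_types, lifting) finite_tor order_antisym sum_nonneg sum_nonneg_eq_0_iff)
 moreover have at: "a : tor" using a by (simp add: Ty_def)
 ultimately have eq: "real (fb a) = real S / real (ty a)" by simp
 hence c1: "real (card (cl a)) = real S / real (ty a)" using ge1[OF at] ge2[OF at] by linarith
 have "real S > 0" using Sz.card_pos by (simp add: S_def)
 hence "real (card (Ce a)) = real (ty a)" using cl(2)[OF at] unfolding c1 using Ce[OF at] by (simp add: field_simps)
 thus "card (Ce a) = M" using ty[OF M a] by simp
 have "card (cl a) = fb a" using c1 eq by simp
 hence "cl a = {x : Cz. tr x = a}" using cl(1)[OF at] unfolding fb_def by (intro card_subset_eq) auto
 thus "{x : Cz. tr x = a} = (%s. s * ga a * iv s) ` Cz" by (simp add: cl_def)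
qed

end

lemma card_fibres_eq:
 assumes Z: "finite Z" and A: "finite A" and k: "!!a. a : A ==> k <= card {z : Z. h z = a}"
  and eq: "k * card A = card Z"
 shows "z : Z ==> h z : A" "a : A ==> card {z : Z. h z = a} = k"
proof -
 let ?U = "\<Union>a\<in>A. {z : Z. h z = a}"
 have c: "card ?U = (SUM a:A. card {z : Z. h z = a})"
  by (rule card_UN_disjoint) (use Z A in auto)
 have "(SUM a:A. k) <= card ?U" unfolding c by (intro sum_mono k)
 hence ge: "card Z <= card ?U" using eq by (simp add: mult.commute)
 hence U: "?U = Z" using Z by (intro card_seteq) auto
 thus "z : Z ==> h z : A" by blast
 have "(SUM a:A. card {z : Z. h z = a} - k) = 0"
  using c eq U k by (subst sum_subtractf_nat) (auto simp: mult.commute)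
 thus "a : A ==> card {z : Z. h z = a} = k" using A k by (auto simp: le_antisym)
qed

section \<open>The Frobenius map and the exact fibres of the trace functions\<close>

definition fr :: "F2bar mat => F2bar mat" where "fr x = map_mat (%z. z ^ 2) x"

lemma sq_add: "((x :: F2bar) + y)\<^sup>2 = x\<^sup>2 + y\<^sup>2" using frob_add[of x y 1] by simp

lemma sq_sum: "(SUM i:I. g i :: F2bar)\<^sup>2 = (SUM i:I. (g i)\<^sup>2)"
 by (induction I rule: infinite_finite_induct) (auto simp: sq_add)

lemma fr_m4: "fr (m4 [[a, b, c, d], [e, f, g, h], [i, j, k, l], [m, n, p, q]]) =
 m4 [[a\<^sup>2, b\<^sup>2, c\<^sup>2, d\<^sup>2], [e\<^sup>2, f\<^sup>2, g\<^sup>2, h\<^sup>2], [i\<^sup>2, j\<^sup>2, k\<^sup>2, l\<^sup>2], [m\<^sup>2, n\<^sup>2, p\<^sup>2, q\<^sup>2]]"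
 unfolding fr_def by (rule mat4_eqI) (auto simp: mrl)

lemma fr_carrier [simp]: "x : cmat n m ==> fr x : cmat n m"
 by (simp add: fr_def)

lemma fr_mult: "x : cmat n n ==> y : cmat n n ==> fr (x * y) = fr x * fr y"
 unfolding fr_def by (intro eq_matI) (auto simp: scalar_prod_def sq_sum power_mult_distrib)

lemma fr_one: "fr (1\<^sub>m n) = 1\<^sub>m n"
 unfolding fr_def by (intro eq_matI) auto

lemma tr_fr: "x : cmat n n ==> mat_trace (fr x) = (mat_trace x)\<^sup>2"
 unfolding mat_trace_def fr_def by (simp add: sq_sum)

context suzuki
begin

lemma fr_U: "a : F ==> b : F ==> fr (U a b) = U (a\<^sup>2) (b\<^sup>2)"
 unfolding U_m4 fr_m4 by (simp add: m4_eq_iff N_def power2_eq_square algebra_simps)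

lemma fr_T: "fr (T k) = T (k\<^sup>2)"
 unfolding T_m4 fr_m4 by (simp add: m4_eq_iff power_mult_distrib power_inverse thi_mult power2_eq_square)

lemma fr_w: "fr w = w"
 unfolding w_m4 fr_m4 by simp

lemma fr_Sz [simp]: "x : Cz ==> fr x : Cz"
proof -
 have t: "k\<^sup>2 : tor" if "k : tor" for k using that by (auto simp: tor_def)
 assume "x : Cz"
 then consider "x : Bs" | "x : big" by (auto simp: Sz_carrier)
 thus ?thesis
 proof cases
  case 1
  then obtain a b k where *: "a : F" "b : F" "k : tor" "x = U a b * T k" by (auto simp: Bs_def)
  thus ?thesis by (simp add: fr_mult[of _ 4] fr_U fr_T t)
 next
  case 2
  then obtain a b k c d where *: "a : F" "b : F" "k : tor" "c : F" "d : F" "x = U a b * (T k * (w * U c d))"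
   by (auto simp: big_def)
  thus ?thesis by (simp add: fr_mult[of _ 4] fr_U fr_T fr_w t)
 qed
qed

lemma t1_inv:
 assumes M: "M : {Np, Nm}" and z: "z ^ M = 1"
 shows "(z ^ Q) ^ Q = inverse z" "t1 (z ^ Q) = t1 z" "t1 (inverse u) = t1 u"
proof -
 have "M dvd Q * Q + 1" using M unfolding NpNm[symmetric] by auto
 then obtain k where "Q * Q + 1 = M * k" by (elim dvdE)
 hence "z ^ (Q * Q + 1) = 1" using z by (simp only: power_mult power_one)
 hence "z * (z ^ Q) ^ Q = 1" by (simp add: power_mult)
 thus zQQ: "(z ^ Q) ^ Q = inverse z" using inverse_unique by metis
 show "t1 (z ^ Q) = t1 z" by (simp add: t1_def zQQ add_ac)
 show "t1 (inverse u) = t1 u" by (simp add: t1_def power_inverse add_ac)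
qed

text \<open>Because the counts in \<open>card_Ty\<close> are exact, every fibre of \<open>t1\<close>
  has exactly four elements and is the eigenvalue set \<open>Ra\<close> of its trace. Equality of
  traces thus becomes equality of exponents up to the Weyl group.\<close>

lemma t1_fibre:
 assumes M: "M : {Np, Nm}" and z: "z ^ M = 1" "z ~= 1"
 shows "t1 z : TorN M" "Ra (t1 z) = {z, inverse z, z ^ Q, inverse (z ^ Q)}"
  "u ^ M = 1 ==> u ~= 1 ==> t1 u = t1 z <-> u : Ra (t1 z)"
proof -
 from M have oddM: "odd M" using odd_N by auto
 define Z where "Z = {z :: F2bar. z ^ M = 1} - {1}"
 have Z: "finite Z" "card Z = M - 1" using card_roots_of_unity[OF oddM] by (auto simp: Z_def)
 note fin = finite_subset[OF _ finite_tor, of "TorN M"]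
 have finT: "finite (TorN M)" by (rule fin) (auto simp: TorN_def)
 have sub: "Ra a <= {z : Z. t1 z = a}" if a: "a : TorN M" for a
 proof -
  obtain z where z: "z ^ M = 1" "z ~= 1" "a = t1 z" "Ra a = {z, inverse z, z ^ Q, inverse (z ^ Q)}" and at: "a : tor"
   using a unfolding TorN_def by blast
  have c: "(z ^ Q) ^ M = 1" using z(1) by (metis mult.commute power_mult power_one)
  show ?thesis unfolding z(4) using z(1,3) Ra_ne1[OF at] z(4)
   by (auto simp: Z_def power_inverse c t1_inv[OF M z(1)])
 qed
 have tor: "a : tor" if "a : TorN M" for a using that by (simp add: TorN_def)
 have 4: "4 <= card {z : Z. t1 z = a}" if a: "a : TorN M" for a
  using card_Ra[OF tor[OF a]] card_mono[OF _ sub[OF a]] Z(1) by simp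
 have "4 * card (TorN M) = card Z" using card_Ty M unfolding Tor_eq Z(2) by auto
 note fe = card_fibres_eq[OF Z(1) finT 4 this]
 have zZ: "z : Z" using z by (simp add: Z_def)
 show a: "t1 z : TorN M" using fe(1)[OF _ zZ] .
 have fib: "Ra (t1 z) = {u : Z. t1 u = t1 z}"
  by (rule card_subset_eq) (use Z(1) sub[OF a] fe(2)[OF _ a] card_Ra[OF tor[OF a]] in auto)
 thus "u ^ M = 1 ==> u ~= 1 ==> t1 u = t1 z <-> u : Ra (t1 z)" by (auto simp: Z_def)
 obtain v where v: "v ^ M = 1" "Ra (t1 z) = {v, inverse v, v ^ Q, inverse (v ^ Q)}"
  using a unfolding TorN_def by blast
 have "z : Ra (t1 z)" unfolding fib using zZ by simp
 then consider "z = v" | "z = inverse v" | "z = v ^ Q" | "z = inverse (v ^ Q)" unfolding v(2) by blast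
 thus "Ra (t1 z) = {z, inverse z, z ^ Q, inverse (z ^ Q)}"
  unfolding v(2) by cases (auto simp: power_inverse t1_inv(1)[OF M v(1)])
qed

lemma t0_fibre:
 assumes z: "z ^ (Q - 1) = 1" "z ~= 1"
 shows "t0 z : Tor0" "u ^ (Q - 1) = 1 ==> u ~= 1 ==> t0 u = t0 z <-> u = z | u = inverse z"
proof -
 define Z where "Z = {z :: F2bar. z ^ (Q - 1) = 1} - {1}"
 have Z: "finite Z" "card Z = Q - 2" using card_roots_of_unity[OF odd_Q1] by (auto simp: Z_def)
 have 2: "card {z, inverse z} = 2 & {z, inverse z} <= {u : Z. t0 u = t0 z}" if z: "z ^ (Q - 1) = 1" "z ~= 1" for z :: F2bar
 proof -
  have z0: "z ~= 0" using z Q_ge by (auto simp: power_0_left)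
  have "inverse z ~= z"
  proof
   assume "inverse z = z"
   hence "z * z = 1" using z0 by (simp add: field_simps)
   thus False using z sq_inj[of z 1] by simp
  qed
  moreover have "t0 (inverse z) = t0 z" by (simp add: t0_def power_inverse add_ac)
  ultimately show ?thesis using z by (auto simp: Z_def power_inverse)
 qed
 have "2 <= card {z : Z. t0 z = a}" if a: "a : Tor0" for a
 proof -
  obtain z where z: "z ^ (Q - 1) = 1" "z ~= 1" "a = t0 z" using a unfolding Tor0_def by blast
  have "card {z, inverse z} <= card {u : Z. t0 u = t0 z}" using 2[OF z(1,2)] Z(1) by (intro card_mono) auto
  thus ?thesis using 2[OF z(1,2)] z(3) by simp
 qed
 moreover have "finite Tor0" using finite_tor by (rule finite_subset[rotated]) (auto simp: Tor0_def)
 moreover have "2 * card Tor0 = card Z" using card_Ty unfolding Tor_eq Z(2) by simp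
 ultimately have fe: "z : Z ==> t0 z : Tor0" "a : Tor0 ==> card {z : Z. t0 z = a} = 2" for z a
  using card_fibres_eq[OF Z(1), of Tor0 2 t0] by blast+
 show a: "t0 z : Tor0" using fe(1)[of z] z by (simp add: Z_def)
 have "{z, inverse z} = {u : Z. t0 u = t0 z}"
  by (rule card_subset_eq) (use Z(1) 2[OF z] fe(2)[OF a] in auto)
 thus "u ^ (Q - 1) = 1 ==> u ~= 1 ==> t0 u = t0 z <-> u = z | u = inverse z" by (auto simp: Z_def)
qed

end

text \<open>What the character theory needs to know about a cyclic torus \<open>A\<close> of order
  \<open>M\<close>. Here \<open>lg\<close> is a discrete logarithm and \<open>J\<close> is the Weyl
  group, as a set of multipliers of logarithms: by \<open>conjJ\<close> it controls conjugacy, by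
  \<open>J_inj\<close> it acts freely on nonzero logarithms. By \<open>frA\<close> the map
  \<open>fr\<close> doubles logarithms up to conjugacy.\<close>

locale storus = suzuki +
 fixes A :: "F2bar mat set" and M :: nat and lg :: "F2bar mat => nat" and J :: "int set"
 assumes M1: "1 < M"
  and A_sub: "subgroup A Sz"
  and lg_bij: "bij_betw lg A {..<M}"
  and lg_mult: "x : A ==> y : A ==> [int (lg (x * y)) = int (lg x) + int (lg y)] (mod int M)"
  and trA: "x : A ==> x ~= I4 ==> tr x ~= 0"
  and centA: "x : A ==> x ~= I4 ==> card {s : Cz. s * x = x * s} = M"
  and finJ: "finite J"
  and conjJ: "x : A ==> x ~= I4 ==> y : A ==>
   (EX s:Cz. s * x * iv s = y) <-> (EX j:J. [int (lg y) = j * int (lg x)] (mod int M))"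
  and J_inj: "0 < n ==> n < M ==> j : J ==> j' : J ==> [j * int n = j' * int n] (mod int M) ==> j = j'"
  and frA: "x : A ==> EX s:Cz. EX y:A. s * fr x * iv s = y & [int (lg y) = 2 * int (lg x)] (mod int M)"

context suzuki
begin

lemma pow_powi_cong:
 assumes M: "0 < M" and \<zeta>: "!!i. (\<zeta> :: F2bar) ^ i = 1 <-> M dvd i"
 shows "\<zeta> powi m = \<zeta> powi n <-> [m = n] (mod int M)"
proof -
 have z0: "\<zeta> ~= 0" using \<zeta>[of M] M by (auto simp: power_0_left)
 have *: "\<zeta> powi m = 1 <-> int M dvd m" for m
 proof (cases "0 <= m")
  case True
  thus ?thesis using \<zeta>[of "nat m"] by (simp add: power_int_def int_dvd_int_iff[symmetric])
 next
  case False
  hence "\<zeta> powi m = inverse (\<zeta> ^ nat (- m))" by (simp add: power_int_def power_inverse)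
  moreover have "int M dvd m <-> M dvd nat (- m)" using False by (simp add: int_dvd_int_iff[symmetric])
  ultimately show ?thesis using \<zeta>[of "nat (- m)"] by simp
 qed
 have "\<zeta> powi m = \<zeta> powi n <-> \<zeta> powi (m - n) = 1" using z0 by (simp add: power_int_diff)
 thus ?thesis unfolding * by (simp add: cong_iff_dvd_diff)
qed

lemma class_eq:
 assumes x: "x : Cz" "y : Cz" "tr x = tr y" "tr x : tor"
 shows "EX s:Cz. s * x * iv s = y"
proof -
 obtain M where M: "M : Ms" "tr x : Ty M" using Ty_cover x by blast
 note cc = class_count(2)[OF M]
 have "x : {u : Cz. tr u = tr x}" "y : {u : Cz. tr u = tr x}" using x by auto
 then obtain s t where st: "s : Cz" "x = s * ga (tr x) * iv s" "t : Cz" "y = t * ga (tr x) * iv t"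
  unfolding cc by blast
 have g: "ga (tr x) : Cz" using x torD by simp
 define v where "v = iv s"
 have v: "v : Cz" using st by (simp add: v_def)
 have "t * (v * x * iv v) * iv t = (t * v) * x * iv (t * v)" by (rule conj_conj[OF v st(3) x(1)])
 moreover have "v * (s * ga (tr x) * iv s) * iv v = ga (tr x)"
  unfolding conj_conj[OF st(1) v g] using st g by (simp add: v_def Sz.inv_one[simplified])
 hence "v * x * iv v = ga (tr x)" using st(2) by simp
 ultimately have "(t * v) * x * iv (t * v) = y" using st(4) by simp
 thus ?thesis using v st(3) by (intro bexI[of _ "t * v"]) auto
qed

lemma card_centralizer:
 assumes x: "x : Cz" "M : Ms" "tr x : Ty M"
 shows "card {s : Cz. s * x = x * s} = M"
proof -
 define g where "g = ga (tr x)"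
 have t: "tr x : tor" using x by (simp add: Ty_def)
 have g: "g : Cz" "tr g = tr x" using t by (auto simp: g_def torD tr_ga)
 let ?cl = "%x. (%s. s * x * iv s) ` Cz"
 have cl: "?cl y = {u : Cz. tr u = tr x}" if y: "y : Cz" "tr y = tr x" for y
 proof (intro equalityI subsetI)
  fix u assume "u : ?cl y"
  thus "u : {u : Cz. tr u = tr x}" using y tr_conj by auto
 next
  fix u assume "u : {u : Cz. tr u = tr x}"
  thus "u : ?cl y" using class_eq[of y u] y t by auto
 qed
 have "card (?cl x) * card {s : Cz. s * x = x * s} = card (?cl g) * card (Ce (tr x))"
  using Sz.card_conj_class[OF x(1)] Sz.card_conj_class[OF g(1)] by (simp add: Ce_def g_def)
 moreover have "?cl x = ?cl g" using cl x g by simp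
 moreover have "?cl g ~= {}" "finite (?cl g)" by auto
 hence "card (?cl g) ~= 0" by (simp only: card_eq_0_iff) simp
 ultimately show ?thesis using class_count(1)[OF x(2,3)] by simp
qed

text \<open>The map \<open>e\<close> is an eigenvalue, a faithful linear character of
  \<open>A\<close> with values in the \<open>M\<close>-th roots of unity; its logarithm to a
  primitive root is \<open>lg\<close>. Conjugacy is decided by the trace \<open>t (e x)\<close>, and
  \<open>fr x\<close> is conjugate to \<open>x * x\<close> because both have the square of
  \<open>tr x\<close> as trace.\<close>

lemma storusI:
 assumes M: "M : Ms" and A: "subgroup A Sz" and cA: "card A = M"
  and em: "!!x y. x : A ==> y : A ==> e (x * y) = e x * e y"
  and ei: "inj_on e A" and eM: "!!x. x : A ==> e x ^ M = (1 :: F2bar)" and e1: "e (I4) = 1"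
  and tre: "!!x. x : A ==> x ~= I4 ==> tr x = t (e x) & tr x : Ty M"
  and t2: "!!z. t (z\<^sup>2) = (t z)\<^sup>2" and J: "finite J"
  and Jt: "!!u z. u ^ M = 1 ==> z ^ M = 1 ==> u ~= 1 ==> z ~= 1 ==> t u = t z <-> (EX j:J. u = z powi j)"
  and Ji: "!!z :: F2bar. z ^ M = 1 ==> z ~= 1 ==> inj_on (%j. z powi j) J"
  and J1: "!!(z :: F2bar) j. z ^ M = 1 ==> z ~= 1 ==> j : J ==> z powi j ~= 1"
 shows "EX lg. storus f A M lg J"
proof -
 have odd: "odd M" and M0: "0 < M" using Ms_pos[OF M] by auto
 obtain \<zeta> :: F2bar where \<zeta>: "!!i. \<zeta> ^ i = 1 <-> M dvd i" using primitive_root_exists[OF odd] by blast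
 have z0: "\<zeta> ~= 0" using \<zeta>[of M] M0 by (auto simp: power_0_left)
 note pc = pow_powi_cong[OF M0 \<zeta>]
 define lg where "lg x = (SOME i. i < M & e x = \<zeta> ^ i)" for x
 have lg: "lg x < M & e x = \<zeta> ^ lg x" if "x : A" for x
  unfolding lg_def by (rule someI_ex) (use primitive_root[OF odd \<zeta> eM[OF that]] in blast)
 have lgi: "e x = \<zeta> powi int (lg x)" if "x : A" for x using lg[OF that] by simp
 have sub: "x : Cz" if "x : A" for x using subgroup.mem_carrier[OF A that] .
 have Am: "x * y : A" if "x : A" "y : A" for x y using subgroup.m_closed[OF A that] by simp
 have A1: "I4 : A" using subgroup.one_closed[OF A] by simp
 have ne1: "e x ~= 1" if "x : A" "x ~= I4" for x using inj_onD[OF ei _ that(1) A1] e1 that by auto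
 have lgb: "bij_betw lg A {..<M}"
 proof -
  have "inj_on lg A" by (rule inj_onI) (metis lg ei inj_onD)
  moreover have "lg ` A <= {..<M}" using lg by auto
  moreover have "card (lg ` A) = M" using calculation(1) cA by (simp add: card_image)
  ultimately show ?thesis unfolding bij_betw_def by (metis card_lessThan card_subset_eq finite_lessThan)
 qed
 have trt: "tr x : tor" if "x : A" "x ~= I4" for x using tre[OF that] unfolding Ty_def by blast
 have "storus f A M lg J"
 proof (intro storus.intro suzuki_axioms storus_axioms.intro)
  show "1 < M" using Ms_pos[OF M] by simp
  show "subgroup A Sz" by (rule A)
  show "bij_betw lg A {..<M}" by (rule lgb)
  show "[int (lg (x * y)) = int (lg x) + int (lg y)] (mod int M)" if "x : A" "y : A" for x y
  proof -
   have "\<zeta> powi int (lg (x * y)) = e x * e y" using lgi[OF Am[OF that]] em[OF that] by simp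
   also have "... = \<zeta> powi (int (lg x) + int (lg y))" using lgi that z0 by (simp add: power_int_add)
   finally show ?thesis unfolding pc .
  qed
  show "tr x ~= 0" if "x : A" "x ~= I4" for x using trt[OF that] torD by blast
  show "card {s : Cz. s * x = x * s} = M" if "x : A" "x ~= I4" for x
   using card_centralizer[OF sub M] tre that by blast
  show "finite J" by (rule J)
  show "(EX s:Cz. s * x * iv s = y) <-> (EX j:J. [int (lg y) = j * int (lg x)] (mod int M))"
   if x: "x : A" "x ~= I4" and y: "y : A" for x y
  proof -
   have pj: "e x powi j = \<zeta> powi (j * int (lg x))" for j
    unfolding lgi[OF x(1)] by (simp only: power_int_mult[symmetric] mult.commute)
   have ex: "e x ^ M = 1" "e x ~= 1" using eM x ne1 by auto
   have "(EX s:Cz. s * x * iv s = y) <-> (EX j:J. e y = e x powi j)"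
   proof (cases "y = I4")
    case True
    have "tr (I4 :: F2bar mat) = 0" using tr_U[of 0 0] by (simp add: U00)
    hence "~ (EX s:Cz. s * x * iv s = y)"
     using tr_conj[OF _ sub[OF x(1)]] torD(2)[OF trt[OF x]] unfolding True by metis
    moreover have "~ (EX j:J. e y = e x powi j)" using J1[OF ex] e1 unfolding True by metis
    ultimately show ?thesis by simp
   next
    case False
    have "(EX s:Cz. s * x * iv s = y) <-> tr y = tr x"
     using tr_conj[OF _ sub[OF x(1)]] class_eq[OF sub[OF x(1)] sub[OF y] _ trt[OF x]] by metis
    also have "... <-> t (e y) = t (e x)" using tre x y False by simp
    also have "... <-> (EX j:J. e y = e x powi j)" using Jt[OF eM[OF y] ex(1) ne1[OF y False] ex(2)] .
    finally show ?thesis .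
   qed
   thus ?thesis unfolding pj lgi[OF y] pc .
  qed
  show "j = j'" if n: "0 < n" "n < M" "j : J" "j' : J" "[j * int n = j' * int n] (mod int M)" for n j j'
  proof -
   define z where "z = \<zeta> ^ n"
   have z: "z ^ M = 1" "z ~= 1" using n(1,2) \<zeta>[of n] \<zeta>[of "n * M"] by (auto simp: z_def power_mult dest: dvd_imp_le)
   have pz: "z powi i = \<zeta> powi (i * int n)" for i
    unfolding z_def by (simp only: power_int_of_nat[symmetric] power_int_mult[symmetric] mult.commute)
   have "z powi j = z powi j'" unfolding pz pc by (rule n(5))
   thus ?thesis using inj_onD[OF Ji[OF z]] n by blast
  qed
  show "EX s:Cz. EX y:A. s * fr x * iv s = y & [int (lg y) = 2 * int (lg x)] (mod int M)"
   if x: "x : A" for x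
  proof -
   have xx: "x * x : A" "e (x * x) = (e x)\<^sup>2" using Am x em by (auto simp: power2_eq_square)
   have "\<zeta> powi int (lg (x * x)) = \<zeta> powi (2 * int (lg x))"
    unfolding lgi[OF xx(1), symmetric] xx(2) lgi[OF x] by (simp add: mult.commute power_int_mult)
   hence c: "[int (lg (x * x)) = 2 * int (lg x)] (mod int M)" unfolding pc .
   show ?thesis
   proof (cases "x = I4")
    case True
    thus ?thesis using c A1 by (intro bexI[of _ "I4"] bexI[of _ "x * x"]) (auto simp: fr_one Sz.inv_one[simplified])
   next
    case False
    have xm: "x : cmat 4 4" using sub[OF x] by simp
    have "x * x ~= I4"
    proof
     assume "x * x = I4"
     hence "e x * e x = 1" using xx(2) e1 by (simp add: power2_eq_square)
     thus False using sq_inj[of "e x" 1] ne1[OF x False] by simp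
    qed
    hence "tr (x * x) = (t (e x))\<^sup>2" using tre[OF xx(1)] t2 xx(2) by simp
    hence "tr (fr x) = tr (x * x)" using tre[OF x False] by (simp add: tr_fr[OF xm])
    moreover have "tr (fr x) : tor" using trt[OF x False] by (auto simp: tr_fr[OF xm] tor_def)
    ultimately show ?thesis using class_eq[OF fr_Sz[OF sub[OF x]] sub[OF xx(1)]] xx(1) c by blast
   qed
  qed
 qed
 thus ?thesis by blast
qed

end

section \<open>Characters induced from the tori\<close>

context suzuki
begin

lemma inv_ne: "z ~= 1 ==> z ~= 0 ==> inverse z ~= (z :: F2bar)"
proof
 assume "z ~= 1" "z ~= 0" "inverse z = z"
 hence "z * z = 1" by (simp add: field_simps)
 thus False using \<open>z ~= 1\<close> sq_inj[of z 1] by simp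
qed

lemma powi_J: "z powi (1 :: int) = z" "z powi (-1) = inverse z" "z powi int n = z ^ n" "z powi (- int n) = inverse (z ^ n)"
 for z :: F2bar
 by (simp_all add: power_int_minus)

lemma storus_H: "EX lg. storus f (T ` tor) (Q - 1) lg {1, -1}"
proof (rule storusI[where e = "%x. x $$ (0, 0)" and t = t0])
 have M: "Q - 1 : Ms" by (simp add: Ms_def)
 thus "Q - 1 : Ms" .
 have T00: "T k $$ (0, 0) = k * thi k" for k unfolding T_m4 by (simp add: m4_index)
 have Tinj: "inj_on T tor" by (rule inj_onI) (metis T00 z1_inj)
 show "subgroup (T ` tor) Sz"
  by (rule Sz.finite_subgroupI) (auto simp: T_mult T1[symmetric])
 show "card (T ` tor) = Q - 1" using Tinj card_tor by (simp add: card_image)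
 show "(x * y) $$ (0, 0) = x $$ (0, 0) * y $$ (0, 0)" if "x : T ` tor" "y : T ` tor" for x y
  using that by (auto simp: T_mult T00 thi_mult)
 show "inj_on (%x. x $$ (0, 0)) (T ` tor)"
  by (rule inj_onI) (auto simp: T00 dest: z1_inj)
 show p1: "x $$ (0, 0) ^ (Q - 1) = 1" if hx: "x : T ` tor" for x
 proof -
  obtain k where k: "k : tor" "x = T k" using hx by blast
  have "k * thi k : F" "k * thi k ~= 0" using torD[OF k(1)] by auto
  thus ?thesis unfolding k(2) T00 using F_minus_0 by blast
 qed
 show "(I4 :: F2bar mat) $$ (0, 0) = 1" by simp
 show "tr x = t0 (x $$ (0, 0)) & tr x : Ty (Q - 1)" if x: "x : T ` tor" "x ~= I4" for x
 proof -
  obtain k where k: "k : tor" "x = T k" using x by blast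
  define z where "z = k * thi k"
  note kF = torD[OF k(1)]
  have z0: "z ~= 0" using kF by (simp add: z_def)
  have "z ^ R = th z" by (simp add: th_def)
  also have "... = th k * k" using kF by (simp add: z_def th_thi)
  also have "... = z * thi k" using kF by (simp add: z_def thi_sq)
  finally have "z ^ (R - 1) = thi k" unfolding pow_R1[OF z0] using z0 by simp
  hence t: "tr x = t0 z" unfolding k(2) T_m4 m4_trace t0_def z_def by (simp add: add_ac)
  have "z ~= 1"
  proof
   assume "z = 1"
   hence "k = 1" using z1_inj[OF k(1) tor_simps(1)] by (simp add: z_def thi_def)
   thus False using x k by (simp add: T1)
  qed
  moreover have "z ^ (Q - 1) = 1" using p1[OF x(1)] unfolding k(2) T00 z_def .
  ultimately have "t0 z : Ty (Q - 1)" unfolding Tor_eq using t0_fibre(1) by blast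
  thus ?thesis using t unfolding k(2) T00 z_def by simp
 qed
 show "t0 (z\<^sup>2) = (t0 z)\<^sup>2" for z
  unfolding t0_def by (simp add: sq_add power_inverse) (simp add: mult.commute flip: power_mult)
 show "finite {1, -1 :: int}" by simp
 show "t0 u = t0 z <-> (EX j:{1, -1}. u = z powi j)"
  if "u ^ (Q - 1) = 1" "z ^ (Q - 1) = 1" "u ~= 1" "z ~= 1" for u z
  using t0_fibre(2)[OF that(2,4,1,3)] by (simp add: powi_J power_int_minus)
 fix z :: F2bar assume z: "z ^ (Q - 1) = 1" "z ~= 1"
 have z0: "z ~= 0" using z Q_ge by (auto simp: power_0_left)
 show "inj_on (%j. z powi j) {1, -1}" using inv_ne[OF z(2) z0] by (auto simp: power_int_minus)
 show "z powi j ~= 1" if "j : {1, -1}" for j using that z by (auto simp: power_int_minus)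
qed

text \<open>No matrix form of these tori is used: \<open>A\<close> is the centraliser of an element
  \<open>ga a\<close> of the right type, with its action on one eigenvector as \<open>e\<close>. It
  has order \<open>M\<close> by \<open>class_count\<close>.\<close>

lemma storus_N:
 assumes M: "M : {Np, Nm}"
 shows "EX A lg. storus f A M lg {1, -1, int Q, - int Q}"
proof -
 have MM: "M : Ms" using M by (auto simp: Ms_def)
 have Mp: "1 < M" using Ms_pos[OF MM] by simp
 have TyM: "Ty M = TorN M" using M Tor_eq by auto
 have "4 * card (Ty M) = M - 1" using M card_Ty by auto
 hence "card (Ty M) ~= 0" using Mp by linarith
 then obtain a where a: "a : Ty M" by fastforce
 have at: "a : tor" using a by (simp add: Ty_def)
 obtain z where z: "z : Ra a" using Ra_ne[OF at] by blast
 have z1: "z ~= 1" using Ra_ne1[OF at z] by simp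
 define e where "e = ev a z"
 have eM: "e x ^ M = 1" if "x : Ce a" for x using ev_type[OF MM a z that] by (simp add: e_def)
 have ei: "inj_on e (Ce a)" using ev_inj[OF at z] by (simp add: e_def)
 have e1: "e (I4) = 1" using ev_one[OF z1] by (simp add: e_def)
 have C1: "I4 : Ce a" using subgroup.one_closed[OF Ce_subgroup[OF at]] by simp
 have "EX lg. storus f (Ce a) M lg {1, -1, int Q, - int Q}"
 proof (rule storusI[where e = e and t = t1])
  show "M : Ms" by (rule MM)
  show "subgroup (Ce a) Sz" by (rule Ce_subgroup[OF at])
  show "card (Ce a) = M" by (rule class_count[OF MM a])
  show "e (x * y) = e x * e y" if "x : Ce a" "y : Ce a" for x y using ev_mult[OF at z that] by (simp add: e_def)
  show "inj_on e (Ce a)" by (rule ei)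
  show "e x ^ M = 1" if "x : Ce a" for x using eM that .
  show "e (I4) = 1" by (rule e1)
  show "tr x = t1 (e x) & tr x : Ty M" if x: "x : Ce a" "x ~= I4" for x
  proof -
   have trt: "tr x : tor" using Ce_tr[OF at x] .
   have ex: "e x : Ra (tr x)" using ev_Ra[OF at z x(1)] by (simp add: e_def)
   have ex1: "e x ~= 1" using inj_onD[OF ei _ x(1) C1] x(2) e1 by auto
   obtain M' where M': "M' : Ms" "tr x : Ty M'" using Ty_cover[OF trt] by blast
   have "e x ^ M' = 1" using M'(2) ex by (simp add: Ty_def)
   hence "M' = M" using pow_coprime_eq_1[OF _ eM[OF x(1)] Ms_coprime[OF M'(1) MM]] ex1 Ms_pos[OF M'(1)] by force
   hence tM: "tr x : TorN M" using M' TyM by simp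
   then obtain v where v: "v ^ M = 1" "v ~= 1" "tr x = t1 v" unfolding TorN_def by blast
   have "t1 (e x) = t1 v" using t1_fibre(3)[OF M v(1,2) eM[OF x(1)] ex1] ex v(3) by simp
   thus ?thesis using v tM TyM by simp
  qed
  show "t1 (z\<^sup>2) = (t1 z)\<^sup>2" for z
   unfolding t1_def by (simp add: sq_add power_inverse) (simp add: mult.commute flip: power_mult)
  show "finite {1, -1, int Q, - int Q}" by simp
  show "t1 u = t1 z <-> (EX j:{1, -1, int Q, - int Q}. u = z powi j)"
   if "u ^ M = 1" "z ^ M = 1" "u ~= 1" "z ~= 1" for u z
   unfolding t1_fibre(3)[OF M that(2,4,1,3)] t1_fibre(2)[OF M that(2,4)] by (simp add: powi_J power_int_minus)
  fix v :: F2bar assume v: "v ^ M = 1" "v ~= 1"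
  have tv: "t1 v : tor" using t1_fibre(1)[OF M v] by (simp add: TorN_def)
  have "card {v, inverse v, v ^ Q, inverse (v ^ Q)} = 4" "1 ~: {v, inverse v, v ^ Q, inverse (v ^ Q)}"
   using card_Ra[OF tv] Ra_ne1[OF tv] unfolding t1_fibre(2)[OF M v] by auto
  moreover have im: "(%j. v powi j) ` {1, -1, int Q, - int Q} = {v, inverse v, v ^ Q, inverse (v ^ Q)}"
   by (simp add: power_int_minus)
  moreover have "card {1, -1, int Q, - int Q} = 4" using Q_ge by simp
  ultimately show "inj_on (%j. v powi j) {1, -1, int Q, - int Q}" by (intro eq_card_imp_inj_on) auto
  show "v powi j ~= 1" if "j : {1, -1, int Q, - int Q}" for j
   using that im \<open>1 ~: _\<close> by (metis imageI)
 qed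
 thus ?thesis by blast
qed

section \<open>Powers of the Frobenius map\<close>

lemma fr_pow:
 "a : F ==> b : F ==> (fr ^^ n) (U a b) = U (a ^ (2 ^ n)) (b ^ (2 ^ n))"
 "(fr ^^ n) (T k) = T (k ^ (2 ^ n))" "(fr ^^ n) w = w"
 by (induction n) (simp_all add: fr_U fr_T fr_w power_mult[symmetric] mult.commute)

lemma fr_pow_Sz [simp]: "x : Cz ==> (fr ^^ n) x : Cz"
 by (induction n) auto

lemma fr_pow_mult: "x : Cz ==> y : Cz ==> (fr ^^ n) (x * y) = (fr ^^ n) x * (fr ^^ n) y"
 by (induction n) (simp_all add: fr_mult[of _ 4])

lemma fr_pow_D: "x : Cz ==> (fr ^^ (2 * f + 1)) x = x"
proof -
 have F: "a ^ 2 ^ (2 * f + 1) = a" if "a : F" for a using that F_iff[of a] by (simp add: Q_def)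
 assume "x : Cz"
 then consider "x : Bs" | "x : big" by (auto simp: Sz_carrier)
 thus ?thesis
 proof cases
  case 1
  then obtain a b k where *: "a : F" "b : F" "k : tor" "x = U a b * T k" by (auto simp: Bs_def)
  show ?thesis unfolding *(4) using * torD[of k] by (simp add: fr_pow_mult fr_pow F[simplified] del: funpow.simps)
 next
  case 2
  then obtain a b k c d where *: "a : F" "b : F" "k : tor" "c : F" "d : F" "x = U a b * (T k * (w * U c d))"
   by (auto simp: big_def)
  show ?thesis unfolding *(6) using * torD[of k] by (simp add: fr_pow_mult fr_pow F[simplified] del: funpow.simps)
 qed
qed

lemma fr_inv: "x : Cz ==> fr (iv x) = iv (fr x)"
 using fr_mult[of "iv x" 4 x] by (intro Sz_invI[symmetric]) (simp_all add: fr_one)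

lemma fr_conj: "s : Cz ==> x : Cz ==> fr (s * x * iv s) = fr s * fr x * iv (fr s)"
 by (simp add: fr_mult[of _ 4] fr_inv)

end

section \<open>Values and inner products of the characters induced from a torus\<close>

context storus
begin

definition \<theta> :: "int => F2bar mat => complex" where "\<theta> k x = rt M (k * int (lg x))"

definition pt :: "int => F2bar mat" where "pt n = inv_into A lg (nat (n mod int M))"

lemma M0: "0 < M" using M1 by simp

lemma A_Sz: "x : A ==> x : Cz" using subgroup.mem_carrier[OF A_sub] .

lemma A_one [simp]: "I4 : A" using subgroup.one_closed[OF A_sub] by simp

lemma A_inv: "x : A ==> iv x : A" using subgroup.m_inv_closed[OF A_sub] .

lemma finA [simp]: "finite A" using lg_bij bij_betw_finite by blast

lemma cardA: "card A = M" using lg_bij bij_betw_same_card by fastforce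

lemma lg_less: "x : A ==> lg x < M" using lg_bij by (auto simp: bij_betw_def)

lemma pt: "pt n : A" "[int (lg (pt n)) = n] (mod int M)"
proof -
 have "nat (n mod int M) : {..<M}" using M0 by (simp add: nat_less_iff)
 hence *: "nat (n mod int M) : lg ` A" using lg_bij by (simp add: bij_betw_def)
 show "pt n : A" unfolding pt_def by (rule inv_into_into[OF *])
 have "lg (pt n) = nat (n mod int M)" unfolding pt_def by (rule f_inv_into_f[OF *])
 thus "[int (lg (pt n)) = n] (mod int M)" using M0 by (simp add: cong_def)
qed

lemma lg_inj: "x : A ==> y : A ==> [int (lg x) = int (lg y)] (mod int M) ==> x = y"
proof -
 assume *: "x : A" "y : A" "[int (lg x) = int (lg y)] (mod int M)"
 have "lg x = lg y" using *(3) lg_less[OF *(1)] lg_less[OF *(2)] by (simp add: cong_def)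
 thus "x = y" using lg_bij * by (auto simp: bij_betw_def dest: inj_onD)
qed

lemma lg_one: "lg (I4) = 0"
proof -
 have "[int (lg (I4)) = 0] (mod int M)" using lg_mult[OF A_one A_one] by (simp add: cong_iff_dvd_diff)
 thus ?thesis using lg_less[OF A_one] by (simp add: cong_def)
qed

lemma lg_eq_0: "x : A ==> lg x = 0 <-> x = I4"
 using lg_inj[of x "I4"] lg_one by auto

lemma lg_inv: "x : A ==> [int (lg (iv x)) = - int (lg x)] (mod int M)"
 using lg_mult[of x "iv x"] A_inv A_Sz by (simp add: lg_one cong_iff_dvd_diff) (metis dvd_minus_iff minus_add_distrib minus_diff_eq diff_minus_eq_add add.commute uminus_add_conv_diff)

lemma theta_cong: "[int (lg x) = n] (mod int M) ==> \<theta> k x = rt M (k * n)"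
 unfolding \<theta>_def rt_eq_iff[OF M0] by (rule cong_scalar_left)

lemma theta_mult: "x : A ==> y : A ==> \<theta> k (x * y) = \<theta> k x * \<theta> k y"
 unfolding theta_cong[OF lg_mult] by (simp add: \<theta>_def ring_distribs rt_add)

lemma theta_inv: "x : A ==> \<theta> k (iv x) = \<theta> (- k) x"
 by (simp add: theta_cong[OF lg_inv]) (simp add: \<theta>_def)

lemma theta_one [simp]: "\<theta> k (I4) = 1" by (simp add: \<theta>_def lg_one)

lemma theta_vchar: "vchar (Sz(|carrier := A|)) (\<theta> k)"
proof -
 interpret A: fin_group "Sz(|carrier := A|)" by (rule Sz.sub_fin_group[OF A_sub])
 show ?thesis by (rule A.linear_vchar) (simp_all add: theta_mult)
qed

abbreviation "Wc k == ind Sz A (\<theta> k)"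

lemma Wc_vchar: "vchar Sz (Wc k)"
 by (rule Sz.vchar_ind[OF A_sub theta_vchar])

lemma Wc_one: "Wc k (I4) = of_nat (card (Cz)) / of_nat M"
 using Sz.ind_one[OF A_sub, of "\<theta> k"] by (simp add: cardA)

lemma Wc_conj: "s : Cz ==> x : Cz ==> Wc k (s * x * iv s) = Wc k x"
 using Sz.class_fun_conj[OF Sz.class_fun_ind, of x s A "\<theta> k"] by simp

text \<open>Each conjugate of \<open>y\<close> inside \<open>A\<close> arises from exactly
  \<open>M\<close> elements \<open>s\<close>, by the order of the centraliser, and this cancels the
  division by the order of \<open>A\<close>. The conjugates are the elements with logarithm
  \<open>j * lg y\<close>.\<close>

lemma Wc_value:
 assumes y: "y : A" "y ~= I4"
 shows "Wc k y = (SUM j:J. rt M (k * (j * int (lg y))))"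
proof -
 have yS: "y : Cz" using A_Sz y by simp
 let ?c = "%s. s * y * iv s"
 have c: "card {s : Cz. ?c s = y'} = (if EX s:Cz. ?c s = y' then M else 0)" for y'
 proof (cases "EX s:Cz. ?c s = y'")
  case True
  hence "y' : ?c ` Cz" by blast
  thus ?thesis using Sz.card_conj_fibre[OF yS, of y'] centA[OF y] True by simp
 next
  case False
  hence "{s : Cz. ?c s = y'} = {}" by blast
  thus ?thesis using False by simp
 qed
 have l0: "0 < lg y" "lg y < M" using lg_eq_0[OF y(1)] y(2) lg_less[OF y(1)] by auto
 have set: "{y' : A. EX s:Cz. ?c s = y'} = (%j. pt (j * int (lg y))) ` J"
 proof (intro equalityI subsetI)
  fix u assume "u : {y' : A. EX s:Cz. ?c s = y'}"
  then obtain j where j: "u : A" "j : J" "[int (lg u) = j * int (lg y)] (mod int M)" using conjJ[OF y, of u] by blast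
  hence "u = pt (j * int (lg y))" using lg_inj[OF j(1) pt(1)] cong_trans[OF j(3) cong_sym[OF pt(2)]] by blast
  thus "u : (%j. pt (j * int (lg y))) ` J" using j by blast
 next
  fix u assume "u : (%j. pt (j * int (lg y))) ` J"
  thus "u : {y' : A. EX s:Cz. ?c s = y'}" using conjJ[OF y] pt by blast
 qed
 have inj: "inj_on (%j. pt (j * int (lg y))) J"
  by (rule inj_onI) (metis J_inj[OF l0] pt(2) cong_sym cong_trans)
 have "(SUM s:Cz. if ?c s : A then \<theta> k (?c s) else 0) = (SUM s:{s : Cz. ?c s : A}. \<theta> k (?c s))"
  by (simp add: sum.inter_filter)
 also have "... = (SUM y':A. SUM s:{s : {s : Cz. ?c s : A}. ?c s = y'}. \<theta> k (?c s))"
  by (rule sum.group[symmetric]) auto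
 also have "... = (SUM y':A. if EX s:Cz. ?c s = y' then of_nat M * \<theta> k y' else 0)"
 proof (rule sum.cong)
  fix y' assume y': "y' : A"
  have eqs: "{s : {s : Cz. ?c s : A}. ?c s = y'} = {s : Cz. ?c s = y'}" using y' by auto
  have "(SUM s:{s : {s : Cz. ?c s : A}. ?c s = y'}. \<theta> k (?c s)) = (SUM s:{s : Cz. ?c s = y'}. \<theta> k y')"
   by (rule sum.cong[OF eqs]) auto
  also have "... = of_nat (card {s : Cz. ?c s = y'}) * \<theta> k y'" by simp
  also have "... = (if EX s:Cz. ?c s = y' then of_nat M * \<theta> k y' else 0)" unfolding c by simp
  finally show "(SUM s:{s : {s : Cz. ?c s : A}. ?c s = y'}. \<theta> k (?c s)) = (if EX s:Cz. ?c s = y' then of_nat M * \<theta> k y' else 0)" .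
 qed simp
 also have "... = (SUM y':{y' : A. EX s:Cz. ?c s = y'}. of_nat M * \<theta> k y')"
  by (simp add: sum.inter_filter)
 also have "... = (SUM j:J. of_nat M * \<theta> k (pt (j * int (lg y))))"
  unfolding set by (simp add: sum.reindex[OF inj])
 also have "... = of_nat M * (SUM j:J. rt M (k * (j * int (lg y))))"
  unfolding theta_cong[OF pt(2)] by (simp add: sum_distrib_left)
 finally show ?thesis unfolding ind_def cardA Sz_mult using M0 by simp
qed

lemma Wc_zero: "x : Cz ==> ~ (EX s:Cz. s * x * iv s : A) ==> Wc k x = 0"
 unfolding ind_def by (intro divide_eq_0_iff[THEN iffD2] disjI1 sum.neutral) auto

lemma sum_theta: "(SUM x:A. \<theta> k x) = (if int M dvd k then of_nat M else 0)"
proof -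
 have "(SUM x:A. \<theta> k x) = (\<Sum>i<M. rt M (k * int i))"
  unfolding \<theta>_def by (rule sum.reindex_bij_betw[OF lg_bij])
 thus ?thesis using rt_sum[OF M0] by simp
qed

text \<open>By Frobenius reciprocity the product is taken over \<open>A\<close>. There
  \<open>Wc l\<close> is a sum of linear characters over \<open>J\<close>, except at the identity,
  where its value is the index of \<open>A\<close> and not \<open>card J\<close>; the first two
  terms are this correction.\<close>

lemma cip_Wc:
 "cip Sz (Wc k) (Wc l) = of_nat (card (Cz)) / (of_nat M * of_nat M) - of_nat (card J) / of_nat M
  + of_nat (card {j : J. [k = l * j] (mod int M)})"
proof -
 have x: "\<theta> k x * Wc l (iv x) = (if x = I4 then of_nat (card (Cz)) / of_nat M - of_nat (card J) else 0)
   + (SUM j:J. \<theta> (k - l * j) x)" if xA: "x : A" for x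
 proof (cases "x = I4")
  case True
  thus ?thesis by (simp add: Wc_one Sz.inv_one[simplified])
 next
  case False
  have "iv x ~= I4" using False A_Sz[OF xA] Sz.inv_eq_1_iff[of x] by simp
  hence "Wc l (iv x) = (SUM j:J. rt M (l * j * int (lg (iv x))))"
   using Wc_value[OF A_inv[OF xA]] by (simp add: mult.assoc)
  also have "... = (SUM j:J. \<theta> (- (l * j)) x)"
   using theta_inv[OF xA] by (simp add: \<theta>_def)
  finally have "\<theta> k x * Wc l (iv x) = (SUM j:J. \<theta> k x * \<theta> (- (l * j)) x)" by (simp add: sum_distrib_left)
  also have "... = (SUM j:J. \<theta> (k - l * j) x)" by (simp add: \<theta>_def rt_add[symmetric] left_diff_distrib)
  finally show ?thesis using False by simp
 qed
 have "cip Sz (Wc k) (Wc l) = (SUM x:A. \<theta> k x * Wc l (iv x)) / of_nat M"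
  unfolding Sz.frobenius[OF A_sub Sz.class_fun_ind] Sz.sub_cip[OF A_sub] cardA ..
 also have "(SUM x:A. \<theta> k x * Wc l (iv x)) =
   of_nat (card (Cz)) / of_nat M - of_nat (card J) + (SUM j:J. SUM x:A. \<theta> (k - l * j) x)"
  by (subst sum.cong[OF refl x], assumption, subst sum.distrib, subst sum.swap) simp
 also have "(SUM j:J. SUM x:A. \<theta> (k - l * j) x) = of_nat M * of_nat (card {j : J. [k = l * j] (mod int M)})"
  unfolding sum_theta cong_iff_dvd_diff by (simp add: sum.inter_filter[symmetric] finJ)
 finally show ?thesis using M0 by (simp add: field_simps)
qed

lemma Us_ind_tr0: "x : Cz ==> tr x ~= 0 ==> ind Sz Us \<phi> x = 0"
proof -
 assume x: "x : Cz" "tr x ~= 0"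
 have "s * x * iv s ~: Us" if "s : Cz" for s
  using tr_conj[OF that x(1)] x(2) tr_U by (auto simp: Us_def)
 thus ?thesis unfolding ind_def by simp
qed

text \<open>Elements of \<open>A\<close> other than the identity have nonzero trace, and elements
  conjugate into \<open>Us\<close> have trace zero; so only the identity contributes.\<close>

lemma cip_Wc_Us:
 "cip Sz (Wc k) (ind Sz Us \<phi>) = of_nat (card (Cz)) * \<phi> (I4) / (of_nat (Q * Q) * of_nat M)"
proof -
 have x: "\<theta> k x * ind Sz Us \<phi> (iv x) = (if x = I4 then of_nat (card (Cz)) * \<phi> (I4) / of_nat (Q * Q) else 0)"
  if xA: "x : A" for x
 proof (cases "x = I4")
  case True
  thus ?thesis using Sz.ind_one[OF Us_subgroup, of \<phi>] by (simp add: Sz.inv_one[simplified] card_Us)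
 next
  case False
  have "iv x ~= I4" using False A_Sz[OF xA] Sz.inv_eq_1_iff[of x] by simp
  thus ?thesis using Us_ind_tr0 trA[OF A_inv[OF xA]] A_Sz[OF xA] False by simp
 qed
 show ?thesis
  unfolding Sz.frobenius[OF A_sub Sz.class_fun_ind] Sz.sub_cip[OF A_sub] cardA by (subst sum.cong[OF refl x], assumption) simp
qed

lemma Wc_fr: "x : Cz ==> Wc k (fr x) = Wc (2 * k) x"
proof -
 assume x: "x : Cz"
 let ?P = "%x. EX s:Cz. s * x * iv s : A"
 have Pfr: "?P (fr x)" if x: "x : Cz" "?P x" for x
 proof -
  obtain s where s: "s : Cz" "s * x * iv s : A" using x by blast
  obtain t where t: "t : Cz" "t * fr (s * x * iv s) * iv t : A" using frA[OF s(2)] by blast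
  have "(t * fr s) * fr x * iv (t * fr s) : A"
   using t(2) unfolding fr_conj[OF s(1) x(1)] conj_conj[OF fr_Sz[OF s(1)] t(1) fr_Sz[OF x(1)]] .
  thus ?thesis using t(1) s(1) by (intro bexI[of _ "t * fr s"]) auto
 qed
 have Ppow: "?P ((fr ^^ n) x)" if "?P x" "x : Cz" for n x
  using that(1) by (induction n) (auto intro!: Pfr fr_pow_Sz that(2) simp del: as4)
 show ?thesis
 proof (cases "?P x")
  case True
  then obtain s where s: "s : Cz" "s * x * iv s : A" by blast
  define y where "y = s * x * iv s"
  have yA: "y : A" and yS: "y : Cz" using s x by (auto simp: y_def)
  obtain t y2 where t: "t : Cz" "y2 : A" "t * fr y * iv t = y2" "[int (lg y2) = 2 * int (lg y)] (mod int M)"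
   using frA[OF yA] by blast
  have "Wc k (fr x) = Wc k (fr y)" using Wc_conj[of "fr s" "fr x" k] s x by (simp add: y_def fr_conj del: as4)
  also have "... = Wc k y2" using Wc_conj[OF t(1) fr_Sz[OF yS], of k] unfolding t(3) by simp
  also have "... = Wc (2 * k) y"
  proof (cases "y = I4")
   case True
   hence "y2 = I4" using t by (simp add: fr_one)
   thus ?thesis using True by (simp add: Wc_one)
  next
   case False
   have ym: "y : cmat 4 4" using yS by simp
   have "tr y2 = (tr y)\<^sup>2" using tr_conj[OF t(1) fr_Sz[OF yS]] tr_fr[OF ym] unfolding t(3) by simp
   hence "tr y2 ~= 0" using trA[OF yA False] by simp
   moreover have "tr (I4 :: F2bar mat) = 0" using tr_U[of 0 0] by (simp add: U00)
   ultimately have "y2 ~= I4" by metis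
   moreover have "rt M (k * (j * int (lg y2))) = rt M (2 * k * (j * int (lg y)))" for j
    unfolding rt_eq_iff[OF M0] using cong_scalar_left[OF t(4), of "k * j"] by (simp add: mult_ac)
   ultimately show ?thesis using Wc_value[OF t(2)] Wc_value[OF yA False] by simp
  qed
  also have "Wc (2 * k) y = Wc (2 * k) x" unfolding y_def by (rule Wc_conj[OF s(1) x])
  finally show ?thesis .
 next
  case False
  \<comment> \<open>A power of \<open>fr\<close> is inverse to \<open>fr\<close>, so a conjugate of
    \<open>fr x\<close> in \<open>A\<close> would yield one of \<open>x\<close>.\<close>
  have "~ ?P (fr x)"
  proof
   assume "?P (fr x)"
   hence "?P ((fr ^^ (2 * f)) (fr x))" using Ppow x fr_Sz by blast
   also have "(fr ^^ (2 * f)) (fr x) = (fr ^^ (2 * f + 1)) x" by (simp add: funpow_swap1)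
   finally show False using False fr_pow_D[OF x] by simp
  qed
  thus ?thesis using Wc_zero[OF x False] Wc_zero[OF fr_Sz[OF x]] by simp
 qed
qed

end

section \<open>Characters induced from the Sylow 2-subgroup\<close>

text \<open>Descent: modulo \<open>4\<close> both numbers must be even, and halving them lowers the
  exponent by two.\<close>

lemma sum_two_squares_pow2:
 fixes n y :: int
 shows "n\<^sup>2 + y\<^sup>2 = 2 ^ (2 * m + 1) ==> \<bar>n\<bar> = 2 ^ m & \<bar>y\<bar> = 2 ^ m"
proof (induction m arbitrary: n y)
 case 0
 hence e: "n\<^sup>2 + y\<^sup>2 = 2" by simp
 have b: "\<bar>z\<bar> < 2" if "z\<^sup>2 <= 2" for z :: int
 proof (rule ccontr)
  assume "~ \<bar>z\<bar> < 2"
  hence "2\<^sup>2 <= \<bar>z\<bar>\<^sup>2" by (intro power_mono) auto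
  thus False using that by simp
 qed
 have "n\<^sup>2 <= 2" "y\<^sup>2 <= 2" using e zero_le_power2[of n] zero_le_power2[of y] by linarith+
 hence "n : {-1, 0, 1}" "y : {-1, 0, 1}" using b[of n] b[of y] by auto
 thus ?case using e by auto
next
 case (Suc m)
 have "even (n\<^sup>2 + y\<^sup>2)" unfolding Suc.prems by simp
 hence par: "even n <-> even y" by simp
 have "even n"
 proof (rule ccontr)
  assume "odd n"
  then obtain a b where "n = 2 * a + 1" "y = 2 * b + 1" using par by (meson oddE)
  hence "n\<^sup>2 + y\<^sup>2 = 4 * (a\<^sup>2 + a + b\<^sup>2 + b) + 2" by (simp add: power2_eq_square algebra_simps)
  hence "4 * (a\<^sup>2 + a + b\<^sup>2 + b) + 2 = 4 * (2 * 2 ^ (2 * m))" using Suc.prems by simp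
  thus False by presburger
 qed
 then obtain a b where ab: "n = 2 * a" "y = 2 * b" using par by (meson evenE)
 hence "a\<^sup>2 + b\<^sup>2 = 2 ^ (2 * m + 1)" using Suc.prems by (simp add: power_mult_distrib)
 thus ?case using Suc.IH ab by (simp add: abs_mult)
qed

section \<open>Additive characters of the field and characters of the Sylow subgroup\<close>

context suzuki
begin

text \<open>The absolute trace of \<open>F\<close>, with values in the prime field;
  \<open>\<tau>\<close> is the additive character which it defines.\<close>

definition TrF :: "F2bar => F2bar" where "TrF a = (\<Sum>i<2 * f + 1. a ^ (2 ^ i))"

definition \<tau> :: "F2bar => complex" where "\<tau> a = (if TrF a = 0 then 1 else - 1)"

lemma TrF_add: "TrF (a + b) = TrF a + TrF b"
 by (simp add: TrF_def frob_add sum.distrib)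

lemma TrF_sq: "a : F ==> TrF (a\<^sup>2) = TrF a"
proof -
 assume "a : F"
 hence a: "a ^ (2 ^ (2 * f + 1)) = a" using F_iff by (simp add: Q_def)
 have "TrF (a\<^sup>2) = (\<Sum>i<2 * f + 1. a ^ (2 ^ Suc i))"
  unfolding TrF_def by (simp add: power_mult[symmetric])
 also have "... + a = (\<Sum>i<Suc (2 * f + 1). a ^ (2 ^ i))"
  unfolding sum.lessThan_Suc_shift[of _ "2 * f + 1"] by (simp add: add.commute)
 also have "... = TrF a + a" using a by (simp add: TrF_def)
 finally show ?thesis by simp
qed

lemma TrF_01: "a : F ==> TrF a = 0 | TrF a = 1"
proof -
 assume a: "a : F"
 have "(TrF a)\<^sup>2 = TrF (a\<^sup>2)" unfolding TrF_def sq_sum by (simp add: power_mult[symmetric] mult.commute)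
 hence e: "TrF a * TrF a = TrF a" using TrF_sq[OF a] by (simp add: power2_eq_square)
 have "TrF a * (TrF a + 1) = 0" by (simp add: ring_distribs e)
 thus ?thesis by (auto simp: add_eq_0_iff_eq)
qed

lemma tau_add: "a : F ==> b : F ==> \<tau> (a + b) = \<tau> a * \<tau> b"
 using TrF_01[of a] TrF_01[of b] by (auto simp: \<tau>_def TrF_add)

lemma tau_0 [simp]: "\<tau> 0 = 1" by (simp add: \<tau>_def TrF_def power_0_left)

lemma tau_1: "\<tau> 1 = - 1" by (simp add: \<tau>_def TrF_def two_eq_0)

lemma tau_sq: "\<tau> a * \<tau> a = 1" by (simp add: \<tau>_def)

lemma tau_frob: "a : F ==> \<tau> (a\<^sup>2) = \<tau> a"
 by (simp add: \<tau>_def TrF_sq)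

lemma tau_th: "a : F ==> \<tau> (th a) = \<tau> a"
proof -
 assume a: "a : F"
 have "\<tau> (a ^ (2 ^ n)) = \<tau> a" for n
 proof (induction n)
  case (Suc n)
  have "\<tau> (a ^ (2 ^ Suc n)) = \<tau> ((a ^ (2 ^ n))\<^sup>2)" by (simp add: power_mult[symmetric] mult.commute)
  thus ?case using tau_frob[of "a ^ (2 ^ n)"] a Suc by simp
 qed simp
 thus ?thesis unfolding suzuki_theta_def .
qed

text \<open>Shifting \<open>b\<close> by \<open>inverse c\<close> changes the sign of every term, as
  \<open>\<tau> 1 = - 1\<close>; the latter holds because the degree \<open>2 * f + 1\<close> of
  \<open>F\<close> is odd.\<close>

lemma sum_tau: "c : F ==> (SUM b:F. \<tau> (c * b)) = (if c = 0 then of_nat Q else 0)"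
proof (cases "c = 0")
 case False
 assume c: "c : F"
 let ?S = "SUM b:F. \<tau> (c * b)"
 have "?S = (SUM b:F. \<tau> (c * (b + inverse c)))"
  by (rule sum.reindex_bij_witness[of _ "%b. b + inverse c" "%b. b + inverse c"]) (use c in \<open>auto simp: add.assoc\<close>)
 also have "... = - ?S" using c False by (simp add: ring_distribs tau_add tau_1 sum_negf)
 finally show ?thesis using False by simp
qed (simp add: card_F)

definition al :: "F2bar mat => F2bar" where "al x = x $$ (1, 0)"
definition be :: "F2bar mat => F2bar" where "be x = x $$ (2, 0)"

lemma al_U [simp]: "al (U a b) = a" and be_U [simp]: "be (U a b) = b"
 unfolding al_def be_def U_m4 by (simp_all add: m4_index)

definition lm :: "F2bar mat => complex" where "lm x = \<tau> (al x)"

text \<open>For \<open>e = \<i>\<close> and \<open>e = - \<i>\<close> these are characters of degree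
  \<open>R / 2 = 2 ^ f\<close> of the Sylow subgroup with central character \<open>\<tau>\<close>.
  The condition \<open>e * e = - 1\<close> reflects that \<open>U 1 0\<close> squares to
  \<open>U 0 1\<close>, where \<open>\<tau>\<close> takes the value \<open>- 1\<close>.\<close>

definition ps :: "complex => F2bar mat => complex" where
 "ps e x = (if al x = 0 then of_nat (R div 2) * \<tau> (be x) else if al x = 1 then of_nat (R div 2) * (e * \<tau> (be x)) else 0)"

lemma ps_U: "ps e (U a b) = (if a = 0 then of_nat (R div 2) * \<tau> b else if a = 1 then of_nat (R div 2) * (e * \<tau> b) else 0)"
 by (simp add: ps_def)

abbreviation "GU == Sz(|carrier := Us|)"

lemma fin_group_GU: "fin_group GU" by (rule Sz.sub_fin_group[OF Us_subgroup])

lemma R2: "(of_nat (R div 2) :: complex) * of_nat (R div 2) = of_nat Q / 2"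
proof -
 have "2 * ((R div 2) * (R div 2)) = Q" unfolding R_def Q_def by (simp add: power_add[symmetric] mult_2[symmetric])
 hence "of_nat (2 * ((R div 2) * (R div 2))) = (of_nat Q :: complex)" by (rule arg_cong)
 thus ?thesis by (simp add: field_simps)
qed

lemma R2': "(of_nat (R div 2) :: complex) = of_nat R / 2"
 using even_QR(2) by (auto elim!: evenE)

lemma lm_vchar: "vchar GU lm"
proof -
 interpret GU: fin_group GU by (rule fin_group_GU)
 show ?thesis
 proof (rule GU.linear_vchar)
  fix x y assume "x : carrier GU" "y : carrier GU"
  thus "lm (x \<otimes>\<^bsub>GU\<^esub> y) = lm x * lm y" by (auto simp: Us_def lm_def U_mult tau_add)
 next
  show "lm \<one>\<^bsub>GU\<^esub> = 1" by (simp add: lm_def U00[symmetric])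
 qed
qed

lemma class_fun_UsI:
 assumes "!!a b c d. a : F ==> b : F ==> c : F ==> d : F ==> \<phi> (U a (b + a * th c + c * th a)) = \<phi> (U a b)"
 shows "class_fun GU \<phi>"
 unfolding class_fun_def
proof (intro ballI)
 fix x y assume "x : carrier GU" "y : carrier GU"
 then obtain a b c d where *: "a : F" "b : F" "c : F" "d : F" "x = U a b" "y = U c d" by (auto simp: Us_def)
 have "y \<otimes>\<^bsub>GU\<^esub> x = U (c + a) (d + b + a * th c)" using * by (simp add: U_mult)
 also have "c + a = a + c" by (rule add.commute)
 also have "d + b + a * th c = (b + d + c * th a) + (a + c) * th c + c * th (a + c)" by (simp add: algebra_simps)
 finally have "\<phi> (y \<otimes>\<^bsub>GU\<^esub> x) = \<phi> (U (a + c) (b + d + c * th a))"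
  using assms[of "a + c" "b + d + c * th a" c d] * by simp
 thus "\<phi> (x \<otimes>\<^bsub>GU\<^esub> y) = \<phi> (y \<otimes>\<^bsub>GU\<^esub> x)" using * by (simp add: U_mult)
qed

lemma ps_conj:
 assumes "a : F" "b : F" "c : F"
 shows "ps e (U a (b + a * th c + c * th a)) = ps e (U a b)"
proof -
 have "\<tau> (b + th c + c) = \<tau> b" using assms by (simp add: tau_add tau_th mult.assoc tau_sq)
 thus ?thesis by (simp add: ps_def)
qed

lemma ps_class_fun: "class_fun GU (ps e)" and lm_class_fun: "class_fun GU lm"
 by (rule class_fun_UsI, rule ps_conj, assumption+) (rule class_fun_UsI, simp add: lm_def)

lemma sum_tau1: "(SUM b:F. \<tau> b) = 0" using sum_tau[of 1] by simp

lemma sum_Us01: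
 assumes "!!a b. a : F ==> b : F ==> a ~= 0 ==> a ~= 1 ==> h (U a b) = 0"
 shows "(SUM u:Us. h u) = (SUM b:F. h (U 0 b)) + (SUM b:F. h (U 1 b))"
proof -
 have "(SUM a:F. SUM b:F. h (U a b)) = (SUM a:{0, 1}. SUM b:F. h (U a b))"
  by (rule sum.mono_neutral_right) (auto simp: assms)
 thus ?thesis by (simp add: sum_Us)
qed

text \<open>An irreducible character \<open>\<chi>\<close> of the Sylow subgroup which is not orthogonal to \<open>ps e\<close> has central
 character \<open>\<tau>\<close>, hence vanishes off \<open>C = {U a b. a \<in> {0, 1}}\<close>. With \<open>n = \<chi>(1)\<close> and \<open>y\<close> the suitably
 normalised value at \<open>U 1 0\<close>, the norm of \<open>\<chi>\<close> gives \<open>n\<^sup>2 + y\<^sup>2 = 2\<^sup>2\<^sup>f\<^sup>+\<^sup>1\<close>, so \<open>n = \<bar>y\<bar>\<close>, and the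
 multiplicity \<open>(n + y) / R\<close> is \<open>0\<close> or \<open>1\<close>.\<close>

lemma ps_vchar:
 assumes e: "e * e = - 1"
 shows "vchar GU (ps e)"
 unfolding vchar_def
proof (intro conjI ballI)
 show "class_fun GU (ps e)" by (rule ps_class_fun)
 interpret GU: fin_group GU by (rule fin_group_GU)
 fix \<chi> assume \<chi>: "\<chi> : Irr GU"
 have inv: "inv\<^bsub>GU\<^esub> (U a b) = U a (b + a * th a)" if "a : F" "b : F" for a b
  by (rule GU.inv_equality) (use that UsI in \<open>auto simp: U_inv\<close>)
 have cip: "cip GU g h = (SUM u:Us. g u * h (inv\<^bsub>GU\<^esub> u)) / of_nat (Q * Q)" for g h
  by (simp add: cip_def card_Us)
 show "cip GU (ps e) \<chi> : \<int>"
 proof (cases "cip GU (ps e) \<chi> = 0")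
  case ne: False
  obtain m \<rho> where \<rho>: "irreducible_rep GU m \<rho>" "\<chi> = (\<lambda>g\<in>carrier GU. mat_trace (\<rho> g))"
   using GU.Irr_iff \<chi> by blast
  \<comment> \<open>The matrix of a central \<open>U 0 d\<close> is a scalar \<open>c\<close> by
    Schur's lemma. Translating the sum in the inner product with \<open>ps e\<close> by
    \<open>U 0 d\<close> multiplies it by \<open>\<tau> d * c\<close>, and as it is not zero this
    factor is \<open>1\<close>.\<close>
  have cz: "\<chi> (U a (b + d)) = \<tau> d * \<chi> (U a b)" if "a : F" "b : F" and d: "d : F" for a b d
  proof -
   have zU: "U 0 d : Us" using d UsI by simp
   have zc: "U 0 d * u = u * U 0 d" if "u : Us" for u
    using that d by (auto simp: Us_def U_mult add.commute)
   obtain c where c: "\<rho> (U 0 d) = c *m 1\<^sub>m m"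
   proof (rule GU.schur_scalar[OF \<rho>(1)])
    show "\<rho> (U 0 d) : cmat m m" using GU.rep_mat[OF GU.irr_rep[OF \<rho>(1)]] zU by simp
    fix g assume g: "g : carrier GU"
    show "\<rho> g * \<rho> (U 0 d) = \<rho> (U 0 d) * \<rho> g"
     using GU.rep_mult[OF GU.irr_rep[OF \<rho>(1)], of g "U 0 d"] GU.rep_mult[OF GU.irr_rep[OF \<rho>(1)], of "U 0 d" g] g zU zc
     by simp
   qed
   have sc: "\<chi> (u * U 0 d) = c * \<chi> u" if u: "u : Us" for u
   proof -
    have um: "\<rho> u : cmat m m" using GU.rep_mat[OF GU.irr_rep[OF \<rho>(1)]] u by simp
    have "\<rho> (u * U 0 d) = \<rho> u * \<rho> (U 0 d)" using GU.rep_mult[OF GU.irr_rep[OF \<rho>(1)], of u "U 0 d"] u zU by simp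
    also have "... = c *m \<rho> u" unfolding c using um mult_smult_distrib[OF um one_carrier_mat[of m], of c] by simp
    finally have "mat_trace (\<rho> (u * U 0 d)) = c * mat_trace (\<rho> u)" using um by (simp add: mat_trace_smult)
    thus ?thesis using u zU Us_mult by (simp add: \<rho>(2))
   qed
   have "(SUM u:Us. ps e u * \<chi> (inv\<^bsub>GU\<^esub> u)) = (SUM u:Us. ps e (u * U 0 d) * \<chi> (inv\<^bsub>GU\<^esub> (u * U 0 d)))"
    using GU.sum_mult_right[of "U 0 d" "%u. ps e u * \<chi> (inv\<^bsub>GU\<^esub> u)"] zU by simp
   also have "... = (SUM u:Us. (\<tau> d * c) * (ps e u * \<chi> (inv\<^bsub>GU\<^esub> u)))"
   proof (rule sum.cong)
    fix u assume u: "u : Us"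
    then obtain a b where ab: "a : F" "b : F" "u = U a b" by (auto simp: Us_def)
    have "ps e (u * U 0 d) = \<tau> d * ps e u" using ab d by (simp add: U_mult ps_def tau_add)
    moreover have "inv\<^bsub>GU\<^esub> (u * U 0 d) = inv\<^bsub>GU\<^esub> u * U 0 d" using ab d by (simp add: U_mult inv add_ac)
    moreover have "\<chi> (inv\<^bsub>GU\<^esub> u * U 0 d) = c * \<chi> (inv\<^bsub>GU\<^esub> u)" using sc u GU.inv_closed[of u] by simp
    ultimately show "ps e (u * U 0 d) * \<chi> (inv\<^bsub>GU\<^esub> (u * U 0 d)) = (\<tau> d * c) * (ps e u * \<chi> (inv\<^bsub>GU\<^esub> u))" by simp
   qed simp
   also have "... = (\<tau> d * c) * (SUM u:Us. ps e u * \<chi> (inv\<^bsub>GU\<^esub> u))" by (simp only: sum_distrib_left)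
   finally have "\<tau> d * c = 1" using ne by (simp add: cip)
   hence "c = \<tau> d" using tau_sq[of d] by (metis mult.commute mult.left_commute mult.right_neutral)
   thus ?thesis using sc[OF UsI[OF that(1,2)]] that by (simp add: U_mult)
  qed
  have off: "\<chi> (U a b) = 0" if ab: "a : F" "b : F" "a ~= 0" "a ~= 1" for a b
  proof -
   have "(SUM c:F. \<tau> ((a + a * a) * c)) = 0"
    using sum_tau[of "a + a * a"] ab by (auto simp: add_eq_0_iff_eq)
   moreover have "(SUM c:F. \<tau> ((a + a * a) * c)) = (SUM c:F. 1)" if "ALL c:F. \<tau> ((a + a * a) * c) = 1"
    using that by (intro sum.cong) auto
   ultimately obtain c' where c': "c' : F" "\<tau> ((a + a * a) * c') ~= 1" using card_F Q_ge by fastforce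
   define c where "c = thi c'"
   have c: "c : F" "th c = c'" using c' by (simp_all add: c_def th_thi)
   have "\<tau> (c * th a) = \<tau> (th (c * th a))" using tau_th[of "c * th a"] c ab by simp
   also have "th (c * th a) = a * a * c'" using ab c by (simp add: th_th)
   finally have t: "\<tau> (a * th c + c * th a) = \<tau> ((a + a * a) * c')" using ab c c' by (simp add: tau_add ring_distribs)
   have "\<chi> (U c 0 \<otimes>\<^bsub>GU\<^esub> (inv\<^bsub>GU\<^esub> (U c 0) \<otimes>\<^bsub>GU\<^esub> U a b)) = \<chi> ((inv\<^bsub>GU\<^esub> (U c 0) \<otimes>\<^bsub>GU\<^esub> U a b) \<otimes>\<^bsub>GU\<^esub> U c 0)"
    using GU.class_fun_Irr[OF \<chi>] UsI ab c subgroup.m_inv_closed[OF GU.subgroup_self, of "U c 0"] Us_mult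
    unfolding class_fun_def by simp
   moreover have "U c 0 \<otimes>\<^bsub>GU\<^esub> (inv\<^bsub>GU\<^esub> (U c 0) \<otimes>\<^bsub>GU\<^esub> U a b) = U a b"
    using ab c c' by (simp add: inv U_mult algebra_simps)
   moreover have "(inv\<^bsub>GU\<^esub> (U c 0) \<otimes>\<^bsub>GU\<^esub> U a b) \<otimes>\<^bsub>GU\<^esub> U c 0 = U a (b + (a * th c + c * th a))"
    using ab c c' by (simp add: inv U_mult algebra_simps)
   ultimately have "\<chi> (U a b) = \<tau> ((a + a * a) * c') * \<chi> (U a b)" using cz[of a b "a * th c + c * th a"] ab c c' t by simp
   thus ?thesis using c' by simp
  qed
  obtain n where n: "n > 0" "\<chi> \<one>\<^bsub>GU\<^esub> = of_nat n" using GU.Irr_one[OF \<chi>] by blast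
  define x where "x = \<chi> (U 1 0)"
  have v0: "\<chi> (U 0 b) = \<tau> b * of_nat n" if "b : F" for b using cz[of 0 0 b] that n by (simp add: U00)
  have v1: "\<chi> (U 1 b) = \<tau> b * x" if "b : F" for b using cz[of 1 0 b] that by (simp add: x_def)
  have t1: "\<tau> (b + 1) = - \<tau> b" if "b : F" for b using that by (simp add: tau_add tau_1)
  have ts: "\<tau> b * (\<tau> b * z) = z" for b z by (simp add: tau_sq flip: mult.assoc)
  have Q0: "(of_nat Q :: complex) ~= 0" using Q_ge by simp
  have "1 = cip GU \<chi> \<chi>" using GU.irr_orth[OF \<chi> \<chi>] by simp
  also have "... = ((SUM b:F. of_nat n * of_nat n) + (SUM b:F. - (x * x))) / of_nat (Q * Q)"
   unfolding cip by (subst sum_Us01) (simp_all add: off inv v0 v1 t1 ts mult.left_commute mult.assoc)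
  also have "... = (of_nat n * of_nat n - x * x) / of_nat Q" using Q0 by (simp add: card_F field_simps)
  finally have nx: "of_nat n * of_nat n - x * x = (of_nat Q :: complex)" using Q0 by (simp add: field_simps)
  have "cip GU (ps e) \<chi> = ((SUM b:F. of_nat (R div 2) * of_nat n) + (SUM b:F. - (of_nat (R div 2) * e * x))) / of_nat (Q * Q)"
   unfolding cip by (subst sum_Us01) (simp_all add: off inv v0 v1 t1 ts ps_def mult.left_commute mult.assoc)
  also have "... = of_nat (R div 2) * (of_nat n - e * x) / of_nat Q" using Q0 by (simp add: card_F field_simps)
  finally have cp: "cip GU (ps e) \<chi> = of_nat (R div 2) * (of_nat n - e * x) / of_nat Q" .
  \<comment> \<open>Integrality comes from a linear character \<open>\<omega>\<close> of the
    subgroup \<open>C\<close>, which extends \<open>\<tau>\<close> by the value \<open>e\<close> at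
    \<open>U 1 0\<close>: the number in question is its multiplicity in the restriction of
    \<open>\<chi>\<close>.\<close>
  have "(of_nat n - e * x) / 2 : \<int>"
  proof -
   define C where "C = {U a b | a b. a : {0, 1} & b : F}"
   have CU: "C <= Us" using UsI by (auto simp: C_def)
   have Csub: "subgroup C GU"
   proof (rule GU.finite_subgroupI)
    have CI: "U a b : C" if "a = 0 | a = 1" "b : F" for a b using that by (auto simp: C_def)
    show "C <= carrier GU" using CU by simp
    show "\<one>\<^bsub>GU\<^esub> : C" using CI[of 0 0] by (simp add: U00)
    fix g h assume "g : C" "h : C"
    then obtain a b c d where *: "a = 0 | a = 1" "b : F" "c = 0 | c = 1" "d : F" "g = U a b" "h = U c d"
     by (auto simp: C_def)
    have "U (a + c) (b + d + c * th a) : C" by (rule CI) (use * in auto)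
    moreover have "a : F" "c : F" using * by auto
    ultimately show "g \<otimes>\<^bsub>GU\<^esub> h : C" using * by (simp add: U_mult)
   qed
   interpret C: fin_group "GU(|carrier := C|)" by (rule GU.sub_fin_group[OF Csub])
   define \<omega> where "\<omega> u = (if al u = 0 then \<tau> (be u) else e * \<tau> (be u))" for u
   have \<omega>: "vchar (GU(|carrier := C|)) \<omega>"
   proof (rule C.linear_vchar)
    show "\<omega> \<one>\<^bsub>GU(|carrier := C|)\<^esub> = 1" by (simp add: \<omega>_def U00[symmetric])
    show "\<omega> (x \<otimes>\<^bsub>GU(|carrier := C|)\<^esub> y) = \<omega> x * \<omega> y" if "x : carrier (GU(|carrier := C|))" "y : carrier (GU(|carrier := C|))" for x y
    proof -
     have ee: "e * (e * z) = - z" for z using e by (simp flip: mult.assoc)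
     show ?thesis using that by (auto simp: C_def U_mult \<omega>_def tau_add tau_1 mult.left_commute[of "\<tau> _" e] mult.assoc ee)
    qed
   qed
   obtain xs where xs: "set xs <= Irr (GU(|carrier := C|))" "ALL h:C. \<chi> h = (\<Sum>\<psi>\<leftarrow>xs. \<psi> h)"
    using GU.sub_Irr_decomp[OF Csub \<chi>] by blast
   have "cip (GU(|carrier := C|)) \<omega> \<chi> = cip (GU(|carrier := C|)) (%h. \<Sum>\<psi>\<leftarrow>xs. \<psi> h) \<omega>"
    by (subst C.cip_sym) (rule C.cip_cong, use xs(2) in auto)
   also have "... = (\<Sum>\<psi>\<leftarrow>xs. cip (GU(|carrier := C|)) \<psi> \<omega>)" by (rule C.cip_sum_list)
   also have "... : \<int>"
   proof -
    have "cip (GU(|carrier := C|)) \<psi> \<omega> : \<int>" if "\<psi> : Irr (GU(|carrier := C|))" for \<psi>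
     using \<omega> that unfolding vchar_def C.cip_sym[of \<psi> \<omega>] by blast
    thus ?thesis using xs(1) by (induction xs) auto
   qed
   finally have int: "cip (GU(|carrier := C|)) \<omega> \<chi> : \<int>" .
   have Cim: "C = (%(a, b). U a b) ` ({0, 1} \<times> F)" by (auto simp: C_def)
   have Cinj: "inj_on (%(a, b). U a b) ({0, 1} \<times> F)" by (auto simp: inj_on_def U_inj)
   have cC: "card C = 2 * Q" unfolding Cim using Cinj by (simp add: card_image card_cartesian_product card_F)
   have sC: "(SUM u:C. h u) = (SUM b:F. h (U 0 b)) + (SUM b:F. h (U 1 b))" for h :: "F2bar mat => complex"
   proof -
    have "(SUM u:C. h u) = (SUM a:{0, 1}. SUM b:F. h (U a b))"
     unfolding Cim sum.reindex[OF Cinj] sum.cartesian_product by (rule sum.cong) auto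
    thus ?thesis by simp
   qed
   have "cip (GU(|carrier := C|)) \<omega> \<chi> = (SUM u:C. \<omega> u * \<chi> (inv\<^bsub>GU\<^esub> u)) / of_nat (2 * Q)"
    using GU.sub_cip[OF Csub, of \<omega> \<chi>] by (simp add: cC)
   also have "... = ((SUM b:F. of_nat n) + (SUM b:F. - (e * x))) / of_nat (2 * Q)"
    unfolding sC by (simp add: inv v0 v1 t1 ts \<omega>_def mult.left_commute mult.assoc)
   also have "... = (of_nat n - e * x) / 2" using Q0 by (simp add: card_F field_simps)
   finally have "cip (GU(|carrier := C|)) \<omega> \<chi> = (of_nat n - e * x) / 2" .
   thus ?thesis using int by (simp only:)
  qed
  then obtain k :: int where k: "(of_nat n - e * x) / 2 = of_int k" by (elim Ints_cases)
  define y where "y = 2 * k - int n"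
  have ex: "e * x = - of_int y" using k by (simp add: y_def field_simps)
  have "(e * x) * (e * x) = (e * e) * (x * x)" by (simp add: mult_ac)
  hence "of_int (y * y) = - (x * x)" unfolding ex e by simp
  hence "(of_int ((int n)\<^sup>2 + y\<^sup>2) :: complex) = of_int (int Q)" using nx by (simp add: power2_eq_square)
  hence "(int n)\<^sup>2 + y\<^sup>2 = 2 ^ (2 * f + 1)" unfolding of_int_eq_iff by (simp add: Q_def)
  hence "\<bar>int n\<bar> = 2 ^ f & \<bar>y\<bar> = 2 ^ f" by (rule sum_two_squares_pow2)
  hence ny: "int n = int (R div 2) & (y = int (R div 2) | y = - int (R div 2))" by (auto simp: R_def)
  have "cip GU (ps e) \<chi> = of_nat (R div 2) * of_int (int n + y) / of_nat Q" unfolding cp ex by simp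
  also have "... = 1 | ... = 0" using ny R2 Q0 by (auto simp: field_simps)
  finally show ?thesis by auto
 qed simp
qed

section \<open>Inner products of the characters induced from the Sylow subgroup\<close>

abbreviation "LL == ind Sz Us lm"
abbreviation "PP e == ind Sz Us (ps e)"

text \<open>In Mackey's formula an element of the big cell contributes only through the identity, by
  \<open>TI\<close>. An element \<open>U a b * T k\<close> acts like \<open>T k\<close> on class
  functions of \<open>Us\<close>, so its unipotent part merely gives a factor
  \<open>Q^2\<close>.\<close>

lemma cip_Us:
 assumes cf: "class_fun GU \<phi>'"
 shows "cip Sz (ind Sz Us \<phi>) (ind Sz Us \<phi>') = of_nat (Q - 1) * (\<phi> (I4) * \<phi>' (I4)) +
  (SUM k:tor. SUM a:F. SUM b:F. \<phi> (U a (b + a * th a)) * \<phi>' (U (a / k) (b / (k * th k)))) / of_nat (Q * Q)"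
proof -
 interpret GU: fin_group GU by (rule fin_group_GU)
 define I where "I s = (SUM h:Us. if s * h * iv s : Us then \<phi> (iv h) * \<phi>' (s * h * iv s) else 0)" for s
 have big: "I s = \<phi> (I4) * \<phi>' (I4)" if s: "s : big" for s
 proof -
  have U1: "I4 : Us" using UsI[of 0 0] by (simp add: U00)
  have "I s = (SUM h:{I4}. if s * h * iv s : Us then \<phi> (iv h) * \<phi>' (s * h * iv s) else 0)"
   unfolding I_def
  proof (rule sum.mono_neutral_right)
   have "s * h * iv s ~: Us" if "h : Us - {I4}" for h
    using TI[OF s, of h] Us_Bs that by blast
   thus "ALL h:Us - {I4}. (if s * h * iv s : Us then \<phi> (iv h) * \<phi>' (s * h * iv s) else 0) = 0"
    by (simp del: as4)
  qed (use U1 card_Us(1) in auto)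
  thus ?thesis using big_Sz[OF s] U1 by (simp add: Sz.inv_one[simplified])
 qed
 have bs: "I (U a b * T k) = (SUM a:F. SUM b:F. \<phi> (U a (b + a * th a)) * \<phi>' (U (a / k) (b / (k * th k))))"
  if s: "a : F" "b : F" "k : tor" for a b k
 proof -
  have "(U a b * T k) * U c d * iv (U a b * T k) : Us & \<phi>' ((U a b * T k) * U c d * iv (U a b * T k)) = \<phi>' (U (c / k) (d / (k * th k)))"
   if cd: "c : F" "d : F" for c d
  proof -
   define u where "u = U (c / k) (d / (k * th k))"
   have u: "u : Us" unfolding u_def using s torD[of k] cd by (intro UsI) auto
   have "(U a b * T k) * U c d * iv (U a b * T k) = U a b * (T k * U c d * iv (T k)) * iv (U a b)"
    using conj_conj[of "T k" "U a b" "U c d"] s cd by (simp del: as4)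
   also have "T k * U c d * iv (T k) = u" using T_conj_U s cd by (simp add: u_def)
   finally have e: "(U a b * T k) * U c d * iv (U a b * T k) = U a b * u * iv (U a b)" .
   have "inv\<^bsub>GU\<^esub> (U a b) = iv (U a b)" using Sz.m_inv_consistent[OF Us_subgroup UsI[OF s(1,2)]] .
   hence "\<phi>' (U a b * u * iv (U a b)) = \<phi>' u"
    using GU.class_fun_conj[OF cf, of u "U a b"] u UsI[OF s(1,2)] by simp
   moreover have "U a b * u * iv (U a b) : Us" using Bs_conj_Us[of "U a b" u] Us_Bs UsI s u by blast
   ultimately show ?thesis unfolding e u_def by simp
  qed
  thus ?thesis unfolding I_def sum_Us by (intro sum.cong refl) (simp add: inv_U del: as4)
 qed
 have inj: "inj_on (%(k, a, b). U a b * T k) (tor \<times> F \<times> F)"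
  by (rule inj_onI) (auto dest!: Bs_inj[rotated 2])
 have im: "(%(k, a, b). U a b * T k) ` (tor \<times> F \<times> F) = Bs" by (force simp: Bs_def)
 have "(SUM s:Bs. I s) = (SUM k:tor. SUM a:F. SUM b:F. I (U a b * T k))"
  unfolding im[symmetric] sum.reindex[OF inj] sum.cartesian_product by (rule sum.cong) auto
 also have "... = (SUM k:tor. of_nat (Q * Q) * (SUM a:F. SUM b:F. \<phi> (U a (b + a * th a)) * \<phi>' (U (a / k) (b / (k * th k)))))"
  by (rule sum.cong) (simp_all add: bs card_F del: as4)
 finally have B: "(SUM s:Bs. I s) = of_nat (Q * Q) * (SUM k:tor. SUM a:F. SUM b:F. \<phi> (U a (b + a * th a)) * \<phi>' (U (a / k) (b / (k * th k))))"
  by (simp only: sum_distrib_left)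
 have "(SUM s:Cz. I s) = (SUM s:Bs. I s) + (SUM s:big. I s)"
  unfolding Sz_carrier by (rule sum.union_disjoint) (use card_Bs card_big Bs_big_disj in auto)
 also have "(SUM s:big. I s) = of_nat (Q * Q * (Q - 1) * (Q * Q)) * (\<phi> (I4) * \<phi>' (I4))"
  using big by (simp add: card_big del: as4)
 finally have S: "(SUM s:Cz. I s) = of_nat (Q * Q) * (SUM k:tor. SUM a:F. SUM b:F. \<phi> (U a (b + a * th a)) * \<phi>' (U (a / k) (b / (k * th k))))
   + of_nat (Q * Q * (Q - 1) * (Q * Q)) * (\<phi> (I4) * \<phi>' (I4))" unfolding B .
 have Q0: "(of_nat Q :: complex) ~= 0" using Q_ge by simp
 show ?thesis unfolding Sz.mackey[OF Us_subgroup] Sz_mult I_def[symmetric] S card_Us using Q0 by (simp add: field_simps del: of_nat_diff)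
qed

lemma lm_one [simp]: "lm (I4) = 1" and ps_one [simp]: "ps e (I4) = of_nat (R div 2)"
 by (simp_all add: lm_def ps_def U00[symmetric])

lemma cip_LL: "cip Sz LL LL = of_nat Q"
proof -
 have "(SUM a:F. SUM b:F. lm (U a (b + a * th a)) * lm (U (a / k) (b / (k * th k)))) = (if k = 1 then of_nat (Q * Q) else 0)"
  if k: "k : tor" for k
 proof -
  have "(SUM a:F. SUM b:F. lm (U a (b + a * th a)) * lm (U (a / k) (b / (k * th k)))) = (SUM a:F. of_nat Q * \<tau> ((1 + inverse k) * a))"
   using torD[OF k] by (intro sum.cong) (simp_all add: lm_def card_F tau_add[symmetric] ring_distribs divide_inverse mult.commute)
  also have "... = of_nat Q * (if 1 + inverse k = 0 then of_nat Q else 0)"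
   unfolding sum_distrib_left[symmetric] using torD[OF k] by (subst sum_tau) auto
  also have "1 + inverse k = 0 <-> k = 1" using torD[OF k] by (auto simp: add_eq_0_iff_eq)
  finally show ?thesis by simp
 qed
 hence "(SUM k:tor. SUM a:F. SUM b:F. lm (U a (b + a * th a)) * lm (U (a / k) (b / (k * th k)))) = of_nat (Q * Q)"
  by simp
 thus ?thesis unfolding cip_Us[OF lm_class_fun] using Q_ge by (simp add: of_nat_diff)
qed

lemma sum_tau_k: "k : tor ==> (SUM b:F. \<tau> (b / (k * th k))) = 0"
 using sum_tau[of "inverse (k * th k)"] torD[of k] by (simp add: divide_inverse mult.commute)

lemma cip_LP: "cip Sz LL (PP e) = of_nat (Q - 1) * of_nat (R div 2)"
proof -
 have "(SUM b:F. lm (U a (b + a * th a)) * ps e (U (a / k) (b / (k * th k)))) = 0" if k: "k : tor" for k a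
  using sum_tau_k[OF k] by (cases "a / k = 0"; cases "a / k = 1"; simp add: lm_def ps_U sum_distrib_left[symmetric])
 thus ?thesis unfolding cip_Us[OF ps_class_fun] by (simp del: of_nat_diff)
qed

lemma kthk: "k : tor ==> k * th k = 1 <-> k = 1"
 using mult_th_inj[of k 1] torD by auto

text \<open>Only \<open>k = 1\<close> contributes, since \<open>k * th k = 1\<close> has no other
  solution. For \<open>e\<close> equal to \<open>\<i>\<close> or \<open>- \<i>\<close> the last term
  is \<open>1\<close> if \<open>e' = e\<close> and \<open>0\<close> if \<open>e' = - e\<close>; this
  difference later separates the two characters of degree \<open>R (Q - 1) / 2\<close>.\<close>

lemma cip_PP: "cip Sz (PP e) (PP e') = of_nat (Q - 1) * of_nat Q / 2 + (1 - e * e') / 2"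
proof -
 have Q0: "(of_nat Q :: complex) ~= 0" using Q_ge by simp
 have s: "(SUM a:F. SUM b:F. ps e (U a (b + a * th a)) * ps e' (U (a / k) (b / (k * th k)))) =
   (if k = 1 then of_nat Q * of_nat Q * (1 - e * e') / 2 else 0)" if k: "k : tor" for k
 proof -
  note kF = torD[OF k]
  define r where "r = (of_nat (R div 2) :: complex)"
  have rr: "r * r = of_nat Q / 2" using R2 by (simp add: r_def)
  have "(SUM a:F. SUM b:F. ps e (U a (b + a * th a)) * ps e' (U (a / k) (b / (k * th k))))
    = (SUM u:Us. ps e (U (al u) (be u + al u * th (al u))) * ps e' (U (al u / k) (be u / (k * th k))))"
   unfolding sum_Us by simp
  also have "... = (SUM b:F. ps e (U 0 b) * ps e' (U 0 (b / (k * th k)))) + (SUM b:F. ps e (U 1 (b + 1)) * ps e' (U (1 / k) (b / (k * th k))))"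
   by (subst sum_Us01) (simp_all add: ps_def)
  also have "(SUM b:F. ps e (U 0 b) * ps e' (U 0 (b / (k * th k)))) = (SUM b:F. r * r * \<tau> ((1 + inverse (k * th k)) * b))"
   using kF by (intro sum.cong) (simp_all add: ps_def r_def[symmetric] tau_add ring_distribs divide_inverse mult.commute)
  also have "... = r * r * (if 1 + inverse (k * th k) = 0 then of_nat Q else 0)"
   unfolding sum_distrib_left[symmetric] using kF by (subst sum_tau) auto
  also have "1 + inverse (k * th k) = 0 <-> k = 1"
   unfolding add_eq_0_iff_eq by (metis inverse_1 inverse_inverse_eq kthk[OF k])
  also have "(SUM b:F. ps e (U 1 (b + 1)) * ps e' (U (1 / k) (b / (k * th k)))) = (if k = 1 then - (of_nat Q * (r * r * (e * e'))) else 0)"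
  proof (cases "k = 1")
   case True
   have "(SUM b:F. ps e (U 1 (b + 1)) * ps e' (U (1 / k) (b / (k * th k)))) = (SUM b:F. - (r * r * (e * e')))"
    unfolding True using tau_sq by (intro sum.cong) (simp_all add: ps_def r_def[symmetric] tau_add tau_1 mult.left_commute[of _ "\<tau> _"] mult.assoc)
   thus ?thesis using True by (simp add: card_F)
  next
   case False
   thus ?thesis using kF by (simp add: ps_def)
  qed
  finally show ?thesis unfolding rr by (cases "k = 1") (simp_all add: right_diff_distrib diff_divide_distrib)
 qed
 have "(SUM k:tor. SUM a:F. SUM b:F. ps e (U a (b + a * th a)) * ps e' (U (a / k) (b / (k * th k)))) = of_nat Q * of_nat Q * (1 - e * e') / 2"
  by (subst sum.cong[OF refl s], assumption) simp
 thus ?thesis unfolding cip_Us[OF ps_class_fun] ps_one R2 using Q0 by (simp del: of_nat_diff)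
qed

lemma fr_inj: "inj_on fr (Cz)"
proof (rule inj_onI)
 fix x y assume xy: "x : Cz" "y : Cz" "fr x = fr y"
 hence "(fr ^^ (2 * f)) (fr x) = (fr ^^ (2 * f)) (fr y)" by simp
 thus "x = y" using fr_pow_D[OF xy(1)] fr_pow_D[OF xy(2)] by (simp add: funpow_swap1)
qed

lemma fr_image: "fr ` Cz = Cz"
 by (rule endo_inj_surj) (use fr_inj in auto)

lemma ind_Us_fr:
 assumes x: "x : Cz" and \<phi>: "!!a b. a : F ==> b : F ==> \<phi> (U (a\<^sup>2) (b\<^sup>2)) = \<phi> (U a b)"
 shows "ind Sz Us \<phi> (fr x) = ind Sz Us \<phi> x"
proof -
 note inj = fr_inj and frS = fr_image
 have frU: "fr ` Us = Us"
 proof (rule endo_inj_surj)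
  show "inj_on fr Us" using inj Us_Sz by (meson inj_on_subset subsetI)
 qed (use card_Us UsI in \<open>auto simp: Us_def fr_U\<close>)
 have mem: "fr y : Us <-> y : Us" if "y : Cz" for y
 proof
  assume "fr y : Us"
  then obtain u where "u : Us" "fr u = fr y" using frU by (metis imageE)
  thus "y : Us" using inj_onD[OF inj] that Us_Sz by metis
 qed (use frU in blast)
 have "(SUM s:Cz. if s * fr x * iv s : Us then \<phi> (s * fr x * iv s) else 0)
   = (SUM s:Cz. if fr s * fr x * iv (fr s) : Us then \<phi> (fr s * fr x * iv (fr s)) else 0)"
  by (subst (1) frS[symmetric], subst sum.reindex[OF inj]) simp
 also have "... = (SUM s:Cz. if s * x * iv s : Us then \<phi> (s * x * iv s) else 0)"
 proof (rule sum.cong)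
  fix s assume s: "s : Cz"
  have y: "s * x * iv s : Cz" using s x by simp
  have "\<phi> (fr u) = \<phi> u" if "u : Us" for u using that \<phi> by (auto simp: Us_def fr_U)
  thus "(if fr s * fr x * iv (fr s) : Us then \<phi> (fr s * fr x * iv (fr s)) else 0) =
   (if s * x * iv s : Us then \<phi> (s * x * iv s) else 0)"
   unfolding fr_conj[OF s x, symmetric] mem[OF y] by simp
 qed simp
 finally show ?thesis unfolding ind_def Sz_mult by simp
qed

lemma LL_fr: "x : Cz ==> LL (fr x) = LL x" and PP_fr: "x : Cz ==> PP e (fr x) = PP e x"
proof -
 have sq1: "a\<^sup>2 = 1 <-> a = 1" for a :: F2bar using sq_inj[of a 1] by (simp add: power2_eq_square)
 show "x : Cz ==> LL (fr x) = LL x" "x : Cz ==> PP e (fr x) = PP e x"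
  by (rule ind_Us_fr; simp add: lm_def ps_U tau_frob sq1)+
qed

lemma LL_vchar: "vchar Sz LL" by (rule Sz.vchar_ind[OF Us_subgroup lm_vchar])

lemma PP_vchar: "e * e = - 1 ==> vchar Sz (PP e)" by (rule Sz.vchar_ind[OF Us_subgroup ps_vchar])

lemma LL_one: "LL (I4) = of_nat ((Q - 1) * (Q * Q + 1))"
 and PP_one: "PP e (I4) = of_nat ((Q - 1) * (Q * Q + 1)) * of_nat (R div 2)"
proof -
 have Q0: "(of_nat Q :: complex) ~= 0" using Q_ge by simp
 define n where "n = (Q - 1) * (Q * Q + 1)"
 have c: "card (Cz) = (Q * Q) * n" by (simp only: card_Sz n_def mult.assoc)
 have *: "ind Sz Us \<phi> (I4) = of_nat ((Q - 1) * (Q * Q + 1)) * \<phi> (I4)" for \<phi>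
  using Sz.ind_one[OF Us_subgroup, of \<phi>] Q0 unfolding n_def[symmetric] Sz_one c card_Us by simp
 show "LL (I4) = of_nat ((Q - 1) * (Q * Q + 1))" "PP e (I4) = of_nat ((Q - 1) * (Q * Q + 1)) * of_nat (R div 2)"
  unfolding * by simp_all
qed

lemma one_vchar: "vchar Sz (%x. 1)"
 by (rule Sz.linear_vchar) simp_all

lemma cip_L1: "cip Sz LL (%x. 1) = 0" and cip_P1: "cip Sz (PP e) (%x. 1) = 0"
proof -
 have *: "cip Sz (ind Sz Us \<phi>) (%x. 1) = (SUM a:F. SUM b:F. \<phi> (U a b)) / of_nat (Q * Q)" for \<phi>
  by (subst Sz.frobenius[OF Us_subgroup]) (simp_all add: class_fun_def Sz.sub_cip[OF Us_subgroup] card_Us sum_Us)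
 have b: "(SUM b:F. ps e (U a b)) = 0" for a
  using sum_tau1 by (cases "a = 0"; cases "a = 1"; simp add: ps_U sum_distrib_left[symmetric])
 show "cip Sz LL (%x. 1) = 0" "cip Sz (PP e) (%x. 1) = 0" unfolding *
  by (simp_all add: b lm_def sum_distrib_left[symmetric] sum_tau1)
qed

end

section \<open>Irreducible characters of the Suzuki group\<close>

text \<open>The numerical side of the construction, uniform in the three types: \<open>sg\<close> is
  the sign, \<open>cc\<close> the coefficient of the characters \<open>PP\<close>, \<open>dg\<close>
  the resulting degree. The identities \<open>norm\<close>, \<open>deg\<close> and
  \<open>mlt\<close> make \<open>chi\<close> orthonormal up to \<open>J\<close>, give it the degree
  \<open>dg\<close>, and fix its multiplicity in \<open>PP\<close> as \<open>cc\<close>.\<close>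

locale ktorus = storus f A M lg J for f A M lg J +
 fixes sg cc :: int and dg :: nat
 assumes sg: "sg * sg = 1" and oddM: "odd M" and J1: "1 : J"
  and norm: "(of_nat (Q - 1) * (1 + of_int cc * of_nat R)\<^sup>2 + 1 + 2 * (of_int cc)\<^sup>2
   - 2 * (of_nat (card (Cz)) * (1 + of_int cc * of_nat R) / (of_nat (Q * Q) * of_nat M))
   + of_nat (card (Cz)) / (of_nat M * of_nat M) - of_nat (card J) / of_nat M :: complex) = 0"
  and deg: "(of_int sg * (of_nat (card (Cz)) / of_nat M - of_nat ((Q - 1) * (Q * Q + 1)) * (1 + of_int cc * of_nat R)) :: complex) = of_nat dg"
  and mlt: "(of_int sg * (of_nat (card (Cz)) * of_nat (R div 2) / (of_nat (Q * Q) * of_nat M)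
   - of_nat (Q - 1) * of_nat (R div 2) * (1 + of_int cc * of_nat R) - of_int cc) :: complex) = of_int cc"
begin

text \<open>The subtracted combination does not depend on \<open>k\<close>. It is chosen so that the
  correction terms of \<open>cip_Wc\<close> disappear and the differences inherit the orthogonality
  of the characters of the torus.\<close>

definition chi :: "int => F2bar mat => complex" where
 "chi k x = of_int sg * (Wc k x - (LL x + of_int cc * (PP \<i> x + PP (- \<i>) x)))"

abbreviation "rchi k == restrict (chi k) (Cz)"

definition Xs :: "(F2bar mat => complex) set" where "Xs = (%k. rchi (int k)) ` {1..<M}"

lemma chi_vchar: "vchar Sz (chi k)"
 unfolding chi_def
 by (intro Sz.vchar_scale Sz.vchar_diff Sz.vchar_add Wc_vchar LL_vchar PP_vchar) auto

lemma chi_one: "chi k (I4) = of_nat dg"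
proof -
 have "chi k (I4) = of_int sg * (of_nat (card (Cz)) / of_nat M - of_nat ((Q - 1) * (Q * Q + 1)) * (1 + of_int cc * (2 * of_nat (R div 2))))"
  unfolding chi_def Wc_one LL_one PP_one by (simp add: algebra_simps del: of_nat_diff)
 also have "2 * of_nat (R div 2) = (of_nat R :: complex)" by (simp add: R2')
 finally show ?thesis using deg by simp
qed

lemma cip_PW: "cip Sz (PP e) (Wc k) = of_nat (card (Cz)) * of_nat (R div 2) / (of_nat (Q * Q) * of_nat M)"
 and cip_LW: "cip Sz LL (Wc k) = of_nat (card (Cz)) / (of_nat (Q * Q) * of_nat M)"
 unfolding Sz.cip_sym[of _ "Wc k"] cip_Wc_Us by simp_all

lemma cip_PL: "cip Sz (PP e) LL = of_nat (Q - 1) * of_nat (R div 2)"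
 unfolding Sz.cip_sym[of _ LL] by (rule cip_LP)

lemmas cip_lin = Sz.cip_diff Sz.cip_diff2 Sz.cip_add Sz.cip_add2 Sz.cip_scale Sz.cip_scale2

lemma cip_P_chi:
 assumes e: "e = \<i> | e = - \<i>"
 shows "cip Sz (PP e) (chi k) = of_int cc"
proof -
 define r m where "r = (of_nat (R div 2) :: complex)" and "m = (of_nat (Q - 1) :: complex)"
 have rr: "r * r = of_nat Q / 2" and R: "of_nat R = 2 * r" by (simp_all only: r_def R2) (simp add: R2')
 have p: "cip Sz (PP e) (PP \<i>) + cip Sz (PP e) (PP (- \<i>)) = m * of_nat Q + 1"
  using e by (auto simp: cip_PP m_def)
 have "cip Sz (PP e) (chi k) = of_int sg * (cip Sz (PP e) (Wc k) - (m * r + of_int cc * (cip Sz (PP e) (PP \<i>) + cip Sz (PP e) (PP (- \<i>)))))"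
  unfolding chi_def cip_lin cip_PL r_def m_def by (simp add: algebra_simps)
 also have "... = of_int sg * (cip Sz (PP e) (Wc k) - m * r * (1 + of_int cc * of_nat R) - of_int cc)"
  unfolding p R using rr by (simp add: algebra_simps)
 finally show ?thesis using mlt unfolding cip_PW m_def r_def by simp
qed

lemma cip_chi: "cip Sz (chi k) (chi l) = of_nat (card {j : J. [k = l * j] (mod int M)})"
proof -
 define r m c S where "r = (of_nat (R div 2) :: complex)" and "m = (of_nat (Q - 1) :: complex)" and "c = (of_int cc :: complex)"
  and "S = (of_nat (card (Cz)) / (of_nat (Q * Q) * of_nat M) :: complex)"
 have rr: "r * r = of_nat Q / 2" and R: "of_nat R = 2 * r" by (simp_all only: r_def R2) (simp add: R2')
 have m: "of_nat Q = m + 1" using Q_ge by (simp add: m_def of_nat_diff)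
 have s: "of_int sg * (of_int sg * z) = z" for z :: complex
  using sg by (metis mult.assoc mult_1 of_int_1 of_int_mult)
 have P: "cip Sz (PP \<i>) (PP \<i>) = m * of_nat Q / 2 + 1" "cip Sz (PP (- \<i>)) (PP (- \<i>)) = m * of_nat Q / 2 + 1"
  "cip Sz (PP \<i>) (PP (- \<i>)) = m * of_nat Q / 2" "cip Sz (PP (- \<i>)) (PP \<i>) = m * of_nat Q / 2"
  by (simp_all add: cip_PP m_def)
 have W: "cip Sz (Wc l) LL = S" "cip Sz LL (Wc l) = S" "cip Sz (Wc l) (PP e) = S * r" "cip Sz (PP e) (Wc l) = S * r" for l e
  using cip_LW[of l] cip_PW[of e l] Sz.cip_sym[of "Wc l" LL] Sz.cip_sym[of "Wc l" "PP e"] by (simp_all add: S_def r_def)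
 have L: "cip Sz LL (PP e) = m * r" "cip Sz (PP e) LL = m * r" for e using cip_LP cip_PL by (simp_all add: m_def r_def)
 have "cip Sz (chi k) (chi l) = cip Sz (Wc k) (Wc l) - 2 * (S * (1 + c * (2 * r))) + (of_nat Q + 4 * c * (m * r) + c * c * (2 * (m * of_nat Q) + 2))"
  unfolding chi_def cip_lin c_def[symmetric] P W L cip_LL by (simp add: s algebra_simps)
 also have "of_nat Q + 4 * c * (m * r) + c * c * (2 * (m * of_nat Q) + 2) = m * (1 + c * (2 * r))\<^sup>2 + 1 + 2 * c\<^sup>2"
 proof -
  have "m * (1 + c * (2 * r))\<^sup>2 = m + 4 * c * (m * r) + 4 * (c * c) * (m * (r * r))" by (simp add: power2_eq_square algebra_simps)
  also have "... = m + 4 * c * (m * r) + 4 * (c * c) * (m * ((m + 1) / 2))" unfolding rr m ..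
  also have "... = m + 4 * c * (m * r) + 2 * (c * c) * (m * (m + 1))" by simp
  finally have e: "m * (1 + c * (2 * r))\<^sup>2 = m + 4 * c * (m * r) + 2 * (c * c) * (m * (m + 1))" .
  show ?thesis unfolding e m by (simp add: power2_eq_square algebra_simps)
 qed
 finally have e: "cip Sz (chi k) (chi l) = cip Sz (Wc k) (Wc l) - 2 * (S * (1 + c * of_nat R)) + (m * (1 + c * of_nat R)\<^sup>2 + 1 + 2 * c\<^sup>2)" unfolding R .
 have "m * (1 + c * of_nat R)\<^sup>2 + 1 + 2 * c\<^sup>2 - 2 * (S * (1 + c * of_nat R))
   + of_nat (card (Cz)) / (of_nat M * of_nat M) - of_nat (card J) / of_nat M = 0"
  using norm by (simp add: m_def c_def S_def)
 thus ?thesis unfolding e cip_Wc by (simp add: algebra_simps)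
qed

lemma J_uniq: "~ int M dvd k ==> j : J ==> j' : J ==> [k * j = k * j'] (mod int M) ==> j = j'"
proof -
 assume k: "~ int M dvd k" and j: "j : J" "j' : J" "[k * j = k * j'] (mod int M)"
 define n where "n = nat (k mod int M)"
 have n: "int n = k mod int M" using M0 by (simp add: n_def)
 have "0 < n" using n k by (metis dvd_eq_mod_eq_0 neq0_conv of_nat_0)
 moreover have "n < M" using n M0 by (metis of_nat_0_less_iff of_nat_less_iff pos_mod_bound)
 moreover have "[j * int n = j' * int n] (mod int M)"
  using j(3) unfolding n cong_def by (simp add: mult.commute mod_mult_right_eq)
 ultimately show "j = j'" using J_inj j by blast
qed

lemma chi_Irr: "~ int M dvd k ==> rchi k : Irr Sz"
proof (rule Sz.vchar_norm1[OF chi_vchar])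
 assume k: "~ int M dvd k"
 have "{j : J. [k = k * j] (mod int M)} = {1}" using J_uniq[OF k J1] J1 by auto
 thus "cip Sz (chi k) (chi k) = 1" unfolding cip_chi by simp
 show "chi k \<one>\<^bsub>Sz\<^esub> = of_nat dg" using chi_one by simp
qed

lemma rchi_eq:
 assumes "~ int M dvd k" "~ int M dvd l"
 shows "rchi k = rchi l <-> (EX j:J. [k = l * j] (mod int M))"
proof -
 have "cip Sz (rchi k) (rchi l) = of_nat (card {j : J. [k = l * j] (mod int M)})"
  unfolding cip_chi[symmetric] by (rule Sz.cip_cong) auto
 moreover have "cip Sz (rchi k) (rchi l) = (if rchi k = rchi l then 1 else 0)"
  by (rule Sz.irr_orth) (use chi_Irr assms in auto)
 ultimately have "rchi k = rchi l <-> card {j : J. [k = l * j] (mod int M)} ~= 0" by (auto split: if_splits)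
 thus ?thesis using finJ by auto
qed

lemma rchi_cong: "[k = l] (mod int M) ==> rchi k = rchi l"
proof -
 assume c: "[k = l] (mod int M)"
 have "\<theta> k = \<theta> l" unfolding \<theta>_def using cong_scalar_right[OF c] rt_eq_iff[OF M0] by blast
 thus ?thesis by (simp add: chi_def[abs_def])
qed

lemma Xs_iff: "\<chi> : Xs <-> (EX k. ~ int M dvd k & \<chi> = rchi k)"
proof
 assume "\<chi> : Xs"
 thus "EX k. ~ int M dvd k & \<chi> = rchi k"
 proof -
  obtain n where n: "n : {1..<M}" "\<chi> = rchi (int n)" using \<open>\<chi> : Xs\<close> unfolding Xs_def by blast
  hence "~ int M dvd int n" by (auto dest!: zdvd_imp_le)
  thus ?thesis using n(2) by blast
 qed
next
 assume "EX k. ~ int M dvd k & \<chi> = rchi k"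
 then obtain k where k: "~ int M dvd k" "\<chi> = rchi k" by blast
 define n where "n = nat (k mod int M)"
 have n: "int n = k mod int M" using M0 by (simp add: n_def)
 have "0 < n" using n k by (metis dvd_eq_mod_eq_0 neq0_conv of_nat_0)
 moreover have "n < M" using n M0 by (metis of_nat_0_less_iff of_nat_less_iff pos_mod_bound)
 moreover have "rchi k = rchi (int n)" by (rule rchi_cong) (simp add: n cong_def)
 ultimately show "\<chi> : Xs" unfolding Xs_def k(2) by auto
qed

lemma Xs_Irr: "Xs <= Irr Sz" using chi_Irr by (auto simp: Xs_iff)

lemma Xs_one: "\<chi> : Xs ==> \<chi> (I4) = of_nat dg" by (auto simp: Xs_iff chi_one)

lemma Xs_fin [simp]: "finite Xs" by (simp add: Xs_def)

lemma cip_P_Xs: "e = \<i> | e = - \<i> ==> \<chi> : Xs ==> cip Sz (PP e) \<chi> = of_int cc"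
proof -
 assume e: "e = \<i> | e = - \<i>" and "\<chi> : Xs"
 then obtain k where "\<chi> = rchi k" by (auto simp: Xs_iff)
 hence "cip Sz (PP e) \<chi> = cip Sz (PP e) (chi k)" by (intro Sz.cip_cong) auto
 thus ?thesis using cip_P_chi[OF e] by simp
qed

text \<open>The multipliers \<open>J\<close> act freely on the nonzero residues modulo
  \<open>M\<close>, and their orbits are the fibres of the numbering.\<close>

lemma card_Xs: "card J * card Xs = M - 1"
proof -
 have fib: "card {k : {1..<M}. rchi (int k) = \<chi>} = card J" if hX: "\<chi> : Xs" for \<chi>
 proof -
  obtain l where l: "l : {1..<M}" "\<chi> = rchi (int l)" using hX unfolding Xs_def by blast
  have ldv: "~ int M dvd int l" using l by (auto dest!: zdvd_imp_le)
  let ?g = "%j. nat ((int l * j) mod int M)"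
  have g: "int (?g j) = (int l * j) mod int M" for j using M0 by simp
  have gc: "[int (?g j) = int l * j] (mod int M)" for j unfolding g by (simp add: cong_def)
  have inj: "inj_on ?g J"
  proof (rule inj_onI)
   fix j j' assume j: "j : J" "j' : J" "?g j = ?g j'"
   hence "[int l * j = int l * j'] (mod int M)" using gc by (metis cong_sym cong_trans)
   thus "j = j'" using J_uniq[OF ldv] j by blast
  qed
  have "{k : {1..<M}. rchi (int k) = \<chi>} = ?g ` J"
  proof (intro equalityI subsetI)
   fix k assume k: "k : {k : {1..<M}. rchi (int k) = \<chi>}"
   hence kd: "~ int M dvd int k" by (auto dest!: zdvd_imp_le)
   have "rchi (int k) = rchi (int l)" using k l by simp
   then obtain j where j: "j : J" "[int k = int l * j] (mod int M)" using rchi_eq[OF kd ldv] by blast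
   have "int k = int (?g j)" unfolding g using j(2) k by (simp add: cong_def)
   thus "k : ?g ` J" using j(1) by (metis imageI of_nat_eq_iff)
  next
   fix k assume "k : ?g ` J"
   then obtain j where j: "j : J" "k = ?g j" by blast
   have c: "[int k = int l * j] (mod int M)" unfolding j(2) by (rule gc)
   have kM: "k < M" using M0 unfolding j(2) by (simp add: nat_less_iff)
   \<comment> \<open>Otherwise an element of \<open>A\<close> with logarithm \<open>l\<close> would
     be conjugate to the identity.\<close>
   have "k ~= 0"
   proof
    assume "k = 0"
    hence c0: "[int l * j = 0] (mod int M)" using c by (simp add: cong_sym)
    obtain x where x: "x : A" "lg x = l" using lg_bij l unfolding bij_betw_def by (metis atLeastLessThan_iff imageE lessThan_iff)
    have x1: "x ~= I4" using x l lg_one by auto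
    have "[int (lg (I4)) = j * int (lg x)] (mod int M)" using c0 x by (simp add: lg_one mult.commute cong_sym)
    then obtain s where s: "s : Cz" "s * x * iv s = I4" using conjJ[OF x(1) x1 A_one] j(1) by blast
    have "tr (I4 :: F2bar mat) = 0" using tr_U[of 0 0] by (simp add: U00)
    thus False using tr_conj[OF s(1) A_Sz[OF x(1)]] trA[OF x(1) x1] unfolding s(2) by metis
   qed
   hence kk: "k : {1..<M}" using kM by simp
   have "~ int M dvd int k" using kk by (auto dest!: zdvd_imp_le)
   hence "rchi (int k) = \<chi>" using rchi_eq ldv c j(1) l(2) by blast
   thus "k : {k : {1..<M}. rchi (int k) = \<chi>}" using kk by simp
  qed
  thus ?thesis using inj by (simp add: card_image)
 qed
 have "card {1..<M} = (SUM \<chi>:Xs. card {k : {1..<M}. rchi (int k) = \<chi>})"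
  using sum.image_gen[of "{1..<M}" "%_. 1::nat" "%k. rchi (int k)"] by (simp add: Xs_def)
 also have "... = card J * card Xs" using fib by simp
 finally show ?thesis by simp
qed

lemma chi_fr: "x : Cz ==> chi k (fr x) = chi (2 * k) x"
 by (simp add: chi_def Wc_fr LL_fr PP_fr)

lemma chi_fr_pow: "x : Cz ==> chi k ((fr ^^ i) x) = chi (2 ^ i * k) x"
 by (induction i arbitrary: k) (simp_all add: chi_fr mult_ac)

text \<open>Doubling is invertible modulo the odd number \<open>M\<close>, so \<open>fr\<close>
  permutes the family. This serves the two remaining characters, which are defined by subtracting
  such sums.\<close>

lemma Xs_fr_sum: "x : Cz ==> (SUM \<chi>:Xs. \<chi> (fr x)) = (SUM \<chi>:Xs. \<chi> x)"
proof -
 assume x: "x : Cz"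
 let ?t = "%\<chi>. \<lambda>x\<in>Cz. \<chi> (fr x)"
 have 2: "~ int M dvd 2 * k" if "~ int M dvd k" for k
  using that oddM by (simp add: coprime_dvd_mult_right_iff)
 have tc: "?t (rchi k) = rchi (2 * k)" for k
  by (rule ext) (simp add: chi_fr)
 have sub: "?t ` Xs <= Xs"
 proof (intro subsetI, elim imageE)
  fix \<psi> \<chi> assume a: "\<psi> = ?t \<chi>" "\<chi> : Xs"
  obtain k where k: "~ int M dvd k" "\<chi> = rchi k" using a(2) by (auto simp: Xs_iff)
  have "\<psi> = rchi (2 * k)" unfolding a(1) k(2) by (rule tc)
  thus "\<psi> : Xs" using 2[OF k(1)] Xs_iff by blast
 qed
 have inj: "inj_on ?t Xs"
 proof (rule inj_onI)
  fix \<chi> \<psi> assume a: "\<chi> : Xs" "\<psi> : Xs" "?t \<chi> = ?t \<psi>"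
  have "\<chi> y = \<psi> y" if y: "y : Cz" for y
  proof -
   obtain z where z: "z : Cz" "y = fr z" using y fr_image by blast
   thus ?thesis using fun_cong[OF a(3), of z] by simp
  qed
  thus "\<chi> = \<psi>" using a Xs_Irr Sz.Irr_extensional by (meson extensionalityI subsetD)
 qed
 have im: "?t ` Xs = Xs" by (rule endo_inj_surj[OF Xs_fin sub inj])
 have "(SUM \<chi>:Xs. \<chi> x) = (SUM \<chi>:Xs. ?t \<chi> x)" by (subst (1) im[symmetric], subst sum.reindex[OF inj]) simp
 thus ?thesis using x by simp
qed

lemma cip_chi_1: "cip Sz (chi 0) (%x. 1) = of_int sg"
proof -
 have "cip Sz (Wc 0) (%x. 1) = 1"
  using sum_theta[of 0] M0 by (subst Sz.frobenius[OF A_sub]) (simp_all add: class_fun_def Sz.sub_cip[OF A_sub] cardA)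
 thus ?thesis unfolding chi_def cip_lin cip_L1 cip_P1 by simp
qed

end

section \<open>The numerical identities and the complete list of irreducible characters\<close>

context suzuki
begin

text \<open>With \<open>x = Q\<close> and \<open>r = R\<close> one has \<open>r * r = 2 * x\<close>,
  so the coefficient \<open>r / 2\<close> makes the recurring factor \<open>1 + cc * R\<close> equal
  to \<open>x + 1\<close>; the rest is a computation in \<open>x\<close>.\<close>

lemma ktorus_H:
 assumes "storus f A (Q - 1) lg {1, -1}"
 shows "ktorus f A (Q - 1) lg {1, -1} 1 (2 ^ f) (Q * Q + 1)"
proof (intro ktorus.intro[OF assms] ktorus_axioms.intro)
 define x r :: complex where "x = of_nat Q" and "r = of_nat R"
 have x1: "of_nat (Q - 1) = x - 1" using Q_ge by (simp add: x_def of_nat_diff)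
 have xn: "x - 1 ~= 0" "x ~= 0" using Q_ge unfolding x1[symmetric] by (simp_all add: x_def)
 have r: "r * r = 2 * x" using arg_cong[OF RR, of "of_nat :: nat => complex"] by (simp add: r_def x_def)
 have c: "of_int (2 ^ f) = r / 2" by (simp add: r_def R_def)
 have Rd: "of_nat (R div 2) = r / 2" by (simp add: R2' r_def)
 have S: "of_nat (card (Cz)) = x * x * (x - 1) * (x * x + 1)" unfolding card_Sz of_nat_mult x1 by (simp add: x_def)
 have cr: "1 + r / 2 * r = x + 1" using r by simp
 have cJ: "of_nat (card {1, -1 :: int}) = (2 :: complex)" by simp
 show "(1 :: int) * 1 = 1" "odd (Q - 1)" "1 : {1, -1 :: int}" using odd_Q1 by simp_all
 show "(of_nat (Q - 1) * (1 + of_int (2 ^ f) * of_nat R)\<^sup>2 + 1 + 2 * (of_int (2 ^ f))\<^sup>2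
   - 2 * (of_nat (card (Cz)) * (1 + of_int (2 ^ f) * of_nat R) / (of_nat (Q * Q) * of_nat (Q - 1)))
   + of_nat (card (Cz)) / (of_nat (Q - 1) * of_nat (Q - 1)) - of_nat (card {1, -1 :: int}) / of_nat (Q - 1) :: complex) = 0"
 proof -
  have 1: "S * (x + 1) / (x * x * (x - 1)) = (x * x + 1) * (x + 1)" if "S = x * x * (x - 1) * (x * x + 1)" for S
   unfolding that using xn by (simp add: field_simps)
  have 2: "x * x * (x - 1) * (x * x + 1) / ((x - 1) * (x - 1)) - 2 / (x - 1) = (x * x + 2) * (x + 1)"
  proof -
   have "x * x * (x - 1) * (x * x + 1) / ((x - 1) * (x - 1)) = x * x * (x * x + 1) / (x - 1)" using xn by simp
   moreover have "x * x * (x * x + 1) - 2 = (x * x + 2) * (x + 1) * (x - 1)" by (simp add: algebra_simps)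
   moreover have "x * x * (x * x + 1) / (x - 1) - 2 / (x - 1) = (x * x * (x * x + 1) - 2) / (x - 1)" by (rule diff_divide_distrib[symmetric])
   moreover have "(x * x + 2) * (x + 1) * (x - 1) / (x - 1) = (x * x + 2) * (x + 1)"
    using xn(1) by (rule nonzero_mult_div_cancel_right)
   ultimately show ?thesis by (simp only:)
  qed
  have 3: "(x - 1) * (x + 1)\<^sup>2 + 1 + 2 * (r / 2)\<^sup>2 - 2 * ((x * x + 1) * (x + 1)) + (x * x + 2) * (x + 1) = 0"
   using r by (simp add: power2_eq_square field_simps)
  show ?thesis unfolding S x1 cJ c of_nat_mult x_def[symmetric] r_def[symmetric] cr using 1[OF refl] 2 3 by (simp add: algebra_simps)
 qed
 show "(of_int 1 * (of_nat (card (Cz)) / of_nat (Q - 1) - of_nat ((Q - 1) * (Q * Q + 1)) * (1 + of_int (2 ^ f) * of_nat R)) :: complex) = of_nat (Q * Q + 1)"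
  unfolding S c r_def[symmetric] cr of_nat_mult x1 of_nat_add x_def[symmetric] using xn by (simp add: field_simps)
 show "(of_int 1 * (of_nat (card (Cz)) * of_nat (R div 2) / (of_nat (Q * Q) * of_nat (Q - 1))
   - of_nat (Q - 1) * of_nat (R div 2) * (1 + of_int (2 ^ f) * of_nat R) - of_int (2 ^ f)) :: complex) = of_int (2 ^ f)"
  unfolding S c r_def[symmetric] cr of_nat_mult x1 x_def[symmetric] Rd using xn by (simp add: field_simps)
qed

text \<open>Here \<open>e = 1\<close> and \<open>e = - 1\<close> correspond to the tori of orders \<open>Np\<close> and \<open>Nm\<close>.\<close>

lemma ktorus_N:
 assumes st: "storus f A M lg {1, -1, int Q, - int Q}" and MB: "M * B = Q * Q + 1"
  and e: "e = 1 | e = - 1" and M: "int M = int Q + e * int R + 1"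
 shows "ktorus f A M lg {1, -1, int Q, - int Q} (- 1) (2 ^ f - e) ((Q - 1) * B)"
proof (intro ktorus.intro[OF st] ktorus_axioms.intro)
 define x r \<epsilon> m b :: complex where "x = of_nat Q" and "r = of_nat R" and "\<epsilon> = of_int e" and "m = of_nat M" and "b = of_nat B"
 have x1: "of_nat (Q - 1) = x - 1" using Q_ge by (simp add: x_def of_nat_diff)
 have M0: "M ~= 0" using MB by (cases M) auto
 have xn: "m ~= 0" "x ~= 0" using Q_ge M0 by (simp_all add: x_def m_def)
 have r: "r * r = 2 * x" using arg_cong[OF RR, of "of_nat :: nat => complex"] by (simp add: r_def x_def)
 have ee: "\<epsilon> * \<epsilon> = 1" using e by (auto simp: \<epsilon>_def)
 have c: "of_int (2 ^ f - e) = r / 2 - \<epsilon>" by (simp add: r_def R_def \<epsilon>_def)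
 have Rd: "of_nat (R div 2) = r / 2" by (simp add: R2' r_def)
 have m: "m = x + \<epsilon> * r + 1"
 proof -
  have "m = of_int (int M)" by (simp add: m_def)
  thus ?thesis unfolding M by (simp add: x_def r_def \<epsilon>_def)
 qed
 have mb: "m * b = x * x + 1" using arg_cong[OF MB, of "of_nat :: nat => complex"] by (simp add: m_def b_def x_def)
 have b: "b = x - \<epsilon> * r + 1"
 proof -
  have "m * (x - \<epsilon> * r + 1) = (x + 1) * (x + 1) - (\<epsilon> * \<epsilon>) * (r * r)" unfolding m by (simp add: algebra_simps)
  also have "... = m * b" unfolding mb ee r by (simp add: algebra_simps)
  finally show ?thesis using xn by simp
 qed
 \<comment> \<open>The coefficient \<open>r / 2 - \<epsilon>\<close> is the one for which this
   factor becomes the order \<open>B\<close> of the other nonsplit torus.\<close>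
 have cr: "1 + (r / 2 - \<epsilon>) * r = b" unfolding b using r by (simp add: field_simps)
 have S: "of_nat (card (Cz)) = x * x * (x - 1) * (m * b)" unfolding card_Sz of_nat_mult x1 mb by (simp add: x_def)
 have Q1: "of_nat (Q * Q + 1) = m * b" unfolding mb by (simp add: x_def)
 have cJ: "of_nat (card {1, -1, int Q, - int Q}) = (4 :: complex)" using Q_ge by simp
 show "(- 1 :: int) * - 1 = 1" "1 : {1, -1, int Q, - int Q}" by simp_all
 show "odd M"
 proof -
  have "odd (M * B)" unfolding MB using even_QR by simp
  thus ?thesis by simp
 qed
 have cc: "1 + 2 * (r / 2 - \<epsilon>)\<^sup>2 = x - 2 * \<epsilon> * r + 3"
  using r ee by (simp add: power2_eq_square field_simps)
 show "(of_nat (Q - 1) * (1 + of_int (2 ^ f - e) * of_nat R)\<^sup>2 + 1 + 2 * (of_int (2 ^ f - e))\<^sup>2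
   - 2 * (of_nat (card (Cz)) * (1 + of_int (2 ^ f - e) * of_nat R) / (of_nat (Q * Q) * of_nat M))
   + of_nat (card (Cz)) / (of_nat M * of_nat M) - of_nat (card {1, -1, int Q, - int Q}) / of_nat M :: complex) = 0"
 proof -
  have 1: "x * x * (x - 1) * (m * b) * b / (x * x * m) = (x - 1) * b\<^sup>2" using xn by (simp add: power2_eq_square)
  have 2: "x * x * (x - 1) * (m * b) / (m * m) = (m * b - 1) * (x - 1) * b / m"
  proof -
   have xx: "x * x = m * b - 1" using mb by simp
   show ?thesis unfolding xx using xn by simp
  qed
  have 3: "(x - 1) * b + 4 = m * (1 + 2 * (r / 2 - \<epsilon>)\<^sup>2)"
  proof -
   have "m * (x - 2 * \<epsilon> * r + 3) = x * x + 4 * x + 3 - x * (\<epsilon> * r) + \<epsilon> * r - 2 * (\<epsilon> * \<epsilon>) * (r * r)" unfolding m by (simp add: algebra_simps)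
   also have "... = (x - 1) * b + 4" unfolding ee r b by (simp add: algebra_simps)
   finally show ?thesis unfolding cc ..
  qed
  have 4: "(m * b - 1) * (x - 1) * b / m = (x - 1) * b\<^sup>2 - (x - 1) * b / m" using xn by (simp add: field_simps power2_eq_square)
  have 5: "1 + 2 * (r / 2 - \<epsilon>)\<^sup>2 = ((x - 1) * b + 4) / m" unfolding 3 using xn by simp
  have "(x - 1) * b\<^sup>2 + 1 + 2 * (r / 2 - \<epsilon>)\<^sup>2 - 2 * ((x - 1) * b\<^sup>2) + ((x - 1) * b\<^sup>2 - (x - 1) * b / m) - 4 / m
   = (1 + 2 * (r / 2 - \<epsilon>)\<^sup>2) - ((x - 1) * b + 4) / m" by (simp add: add_divide_distrib)
  also have "... = 0" unfolding 5 by simp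
  finally show ?thesis unfolding S x1 cJ c of_nat_mult x_def[symmetric] r_def[symmetric] m_def[symmetric] cr 1 2 4 .
 qed
 show "(of_int (- 1) * (of_nat (card (Cz)) / of_nat M - of_nat ((Q - 1) * (Q * Q + 1)) * (1 + of_int (2 ^ f - e) * of_nat R)) :: complex) = of_nat ((Q - 1) * B)"
 proof -
  have "- 1 * (x * x * (x - 1) * (m * b) / m - (x - 1) * (m * b) * b) = (x - 1) * b * (m * b - x * x)" using xn by (simp add: field_simps)
  also have "... = (x - 1) * b" unfolding mb by simp
  finally show ?thesis unfolding S c r_def[symmetric] cr of_nat_mult[of "Q - 1"] Q1 x1 m_def[symmetric] b_def[symmetric] by simp
 qed
 show "(of_int (- 1) * (of_nat (card (Cz)) * of_nat (R div 2) / (of_nat (Q * Q) * of_nat M)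
   - of_nat (Q - 1) * of_nat (R div 2) * (1 + of_int (2 ^ f - e) * of_nat R) - of_int (2 ^ f - e)) :: complex) = of_int (2 ^ f - e)"
 proof -
  have "x * x * (x - 1) * (m * b) * (r / 2) / (x * x * m) = (x - 1) * b * (r / 2)" using xn by simp
  thus ?thesis unfolding S c r_def[symmetric] cr of_nat_mult x1 x_def[symmetric] m_def[symmetric] Rd
   by (simp add: algebra_simps)
 qed
qed

text \<open>A summary from which the torus has been eliminated: the degree, the doubling of the
  number under \<open>fr\<close>, and the coincidences up to \<open>J\<close>. This is all that the
  orbit count needs.\<close>

definition fam :: "nat => int set => nat => (F2bar mat => complex) set => bool" where
 "fam M J dg Y <-> (EX c :: int => F2bar mat => complex.
   Y = {restrict (c k) (Cz) | k. ~ int M dvd k} &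
   (ALL k. c k (I4) = of_nat dg) &
   (ALL k i x. x : Cz --> c k ((fr ^^ i) x) = c (2 ^ i * k) x) &
   (ALL k l. ~ int M dvd k --> ~ int M dvd l -->
    ((ALL x:Cz. c k x = c l x) <-> (EX j:J. [k = l * j] (mod int M)))))"

lemma restrict_eq_iff: "restrict g D = restrict h D <-> (ALL x:D. g x = h x)"
 by (auto simp: restrict_def fun_eq_iff)

lemma ktorus_fam: "ktorus f A M lg J sg cc dg ==> fam M J dg (ktorus.Xs f A M lg sg cc)"
proof -
 assume "ktorus f A M lg J sg cc dg"
 then interpret k: ktorus f A M lg J sg cc dg .
 show ?thesis unfolding fam_def
  by (rule exI[of _ k.chi]) (use k.Xs_iff k.chi_one k.chi_fr_pow k.rchi_eq[unfolded restrict_eq_iff] in \<open>auto simp del: as4\<close>)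
qed

text \<open>With \<open>r = R / 2\<close> and \<open>Q = 2 * (r * r)\<close>, this and the next two
  identities give the sum of the squared multiplicities in \<open>PP\<close>, the degree of what
  remains of \<open>PP\<close>, and the sum of all squared degrees. The fractions are the sizes of
  the three families.\<close>

lemma halves1: "r * r + ((2 * (r * r) - 2) / 2 * (r * r) + ((2 * (r * r) + 2 * r) / 4 * ((r - 1) * (r - 1)) + (2 * (r * r) - 2 * r) / 4 * ((r + 1) * (r + 1))))
  = (2 * (r * r) - 1) * (2 * (r * r)) / 2" for r :: complex
proof -
 have *: "(2 * (r * r) - 2) / 2 = r * r - 1" "(2 * (r * r) + 2 * r) / 4 = r * (r + 1) / 2" "(2 * (r * r) - 2 * r) / 4 = r * (r - 1) / 2"
  by (simp_all add: field_simps)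
 show ?thesis unfolding * by (simp add: field_simps)
qed

lemma halves2: "(2 * (r * r) - 1) * (2 * (r * r) * (2 * (r * r)) + 1) * r - (r * (2 * (r * r) * (2 * (r * r))) +
  (r * ((2 * (r * r) - 2) / 2 * (2 * (r * r) * (2 * (r * r)) + 1)) +
   ((r - 1) * ((2 * (r * r) + 2 * r) / 4 * ((2 * (r * r) - 1) * (2 * (r * r) - 2 * r + 1))) +
   (r + 1) * ((2 * (r * r) - 2 * r) / 4 * ((2 * (r * r) - 1) * (2 * (r * r) + 2 * r + 1)))))) = (2 * (r * r) - 1) * r" for r :: complex
proof -
 have *: "(2 * (r * r) - 2) / 2 = r * r - 1" "(2 * (r * r) + 2 * r) / 4 = r * (r + 1) / 2" "(2 * (r * r) - 2 * r) / 4 = r * (r - 1) / 2"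
  by (simp_all add: field_simps)
 show ?thesis unfolding * by (simp add: field_simps)
qed

lemma halves3: "1 + (2 * (r * r) * (2 * (r * r)) * (2 * (r * r) * (2 * (r * r))) + 2 * ((2 * (r * r) - 1) * r * ((2 * (r * r) - 1) * r)) +
  ((2 * (r * r) - 2) / 2 * ((2 * (r * r) * (2 * (r * r)) + 1) * (2 * (r * r) * (2 * (r * r)) + 1)) +
   ((2 * (r * r) + 2 * r) / 4 * ((2 * (r * r) - 1) * (2 * (r * r) - 2 * r + 1) * ((2 * (r * r) - 1) * (2 * (r * r) - 2 * r + 1))) +
   (2 * (r * r) - 2 * r) / 4 * ((2 * (r * r) - 1) * (2 * (r * r) + 2 * r + 1) * ((2 * (r * r) - 1) * (2 * (r * r) + 2 * r + 1))))))
  = 2 * (r * r) * (2 * (r * r)) * (2 * (r * r) - 1) * (2 * (r * r) * (2 * (r * r)) + 1)" for r :: complex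
proof -
 have *: "(2 * (r * r) - 2) / 2 = r * r - 1" "(2 * (r * r) + 2 * r) / 4 = r * (r + 1) / 2" "(2 * (r * r) - 2 * r) / 4 = r * (r - 1) / 2"
  by (simp_all add: field_simps)
 show ?thesis unfolding * by (simp add: field_simps)
qed

text \<open>The constituents known so far have the same multiplicities in \<open>PP \<i>\<close> and
  \<open>PP (- \<i>)\<close>, with squares summing to \<open>Q (Q - 1) / 2\<close>. The norms are
  larger by one, so a single irreducible character remains in each; the remainders are orthogonal
  because the mixed product is not larger.\<close>

theorem Irr_Sz:
 "EX St W1 W2 X0 Xp Xm. Irr Sz = {\<lambda>x\<in>Cz. 1, St, W1, W2} Un (X0 Un (Xp Un Xm)) &
  St (I4) = of_nat (Q * Q) & W1 (I4) = of_nat ((Q - 1) * (R div 2)) & W2 (I4) = of_nat ((Q - 1) * (R div 2)) &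
  (ALL x:Cz. St (fr x) = St x & W1 (fr x) = W1 x & W2 (fr x) = W2 x) &
  fam (Q - 1) {1, -1} (Q * Q + 1) X0 &
  fam Np {1, -1, int Q, - int Q} ((Q - 1) * Nm) Xp & fam Nm {1, -1, int Q, - int Q} ((Q - 1) * Np) Xm"
proof -
 obtain lg0 where "storus f (T ` tor) (Q - 1) lg0 {1, -1}" using storus_H by blast
 moreover obtain M0 d0 :: nat and c0 :: int and J0 :: "int set"
  where e0: "M0 = Q - 1" "d0 = Q * Q + 1" "c0 = 2 ^ f" "J0 = {1, -1}" by blast
 ultimately interpret k0: ktorus f "T ` tor" M0 lg0 J0 1 c0 d0 using ktorus_H by simp
 obtain n1 dp dm :: nat and cp cm :: int and J4 :: "int set"
  where n1: "n1 = Q - 1" and e4: "dp = n1 * Nm" "dm = n1 * Np" "cp = 2 ^ f - 1" "cm = 2 ^ f - (- 1)" "J4 = {1, -1, int Q, - int Q}" by blast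
 obtain Ap lgp where stp: "storus f Ap Np lgp {1, -1, int Q, - int Q}" using storus_N[of Np] by blast
 interpret kp: ktorus f Ap Np lgp J4 "- 1" cp dp
  unfolding e4 n1 by (rule ktorus_N[OF stp NpNm]) (simp_all add: Np_def)
 obtain Am lgm where st: "storus f Am Nm lgm {1, -1, int Q, - int Q}" using storus_N[of Nm] by blast
 have NN: "Nm * Np = Q * Q + 1" using NpNm by (simp add: mult.commute)
 interpret km: ktorus f Am Nm lgm J4 "- 1" cm dm
  unfolding e4 n1 by (rule ktorus_N[OF st NN]) (use Nm_add in simp_all)
 have cJ: "card J0 = 2" "card J4 = 4" using Q_ge by (simp_all add: e0 e4)
 define one where "one = (\<lambda>x\<in>Cz. 1 :: complex)"
 have oneI: "one : Irr Sz" unfolding one_def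
  by (rule Sz.vchar_norm1[OF one_vchar, of 1]) (use Sz.card_ne0 in \<open>simp_all add: cip_def\<close>)
 \<comment> \<open>For the split torus \<open>chi 0\<close> has norm \<open>2\<close>, both elements
   of \<open>J\<close> being counted, and it contains the trivial character once; the rest is the
   Steinberg character.\<close>
 define St where "St = (\<lambda>x\<in>Cz. k0.chi 0 x - 1)"
 have cip11: "cip Sz (%x. 1) (%x. 1) = 1" using Sz.card_ne0 by (simp add: cip_def)
 have StI: "St : Irr Sz" unfolding St_def
 proof (rule Sz.vchar_norm1[of _ "Q * Q"])
  show "vchar Sz (%x. k0.chi 0 x - 1)" by (rule Sz.vchar_diff[OF k0.chi_vchar one_vchar])
  have "cip Sz (%x. 1) (k0.chi 0) = 1" using k0.cip_chi_1 Sz.cip_sym[of "%x. 1"] by simp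
  thus "cip Sz (%x. k0.chi 0 x - 1) (%x. k0.chi 0 x - 1) = 1"
   unfolding k0.cip_lin cip11 k0.cip_chi_1 k0.cip_chi using cJ by simp
  show "k0.chi 0 \<one>\<^bsub>Sz\<^esub> - 1 = of_nat (Q * Q)" using k0.chi_one by (simp add: e0)
 qed
 have St1: "St (I4) = of_nat (Q * Q)" using k0.chi_one by (simp add: St_def e0)
 have Stfr: "St (fr x) = St x" if "x : Cz" for x using that by (simp add: St_def k0.chi_fr)
 have P: "cip Sz (PP e) one = 0" "cip Sz (PP e) St = of_nat (R div 2)" if e: "e = \<i> | e = - \<i>" for e
 proof -
  have "cip Sz (PP e) one = cip Sz (PP e) (%x. 1)" by (rule Sz.cip_cong) (auto simp: one_def)
  thus "cip Sz (PP e) one = 0" using cip_P1 by simp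
  have "cip Sz (PP e) St = cip Sz (PP e) (%x. k0.chi 0 x - 1)" by (rule Sz.cip_cong) (auto simp: St_def)
  thus "cip Sz (PP e) St = of_nat (R div 2)" unfolding k0.cip_lin cip_P1 k0.cip_P_chi[OF e] by (simp add: R_def e0)
 qed
 define Y where "Y = k0.Xs Un (kp.Xs Un km.Xs)"
 have QR: "8 <= Q" "4 <= R" "2 * R <= Q" "Nm < Np" using Q_ge R_ge R_le by (auto simp: Np_def Nm_def)
 define Dg where "Dg A' n <-> (ALL \<chi>:A'. \<chi> (I4) = of_nat n)" for A' :: "(F2bar mat => complex) set" and n
 have Dg: "Dg k0.Xs d0" "Dg kp.Xs dp" "Dg km.Xs dm" "Dg {one} 1" "Dg {St} (Q * Q)"
  using k0.Xs_one kp.Xs_one km.Xs_one St1 by (simp_all add: Dg_def one_def)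
 have dj: "A' Int B' = {}" if "Dg A' a" "Dg B' b" "a ~= b" for A' B' a b
  using that unfolding Dg_def by (metis disjoint_iff of_nat_eq_iff)
 have sX: "(SUM \<chi>:A'. h (\<chi> (I4))) = of_nat (card A') * h (of_nat d)" if "Dg A' d" for A' d and h :: "complex => complex"
 proof -
  have "(SUM \<chi>:A'. h (\<chi> (I4))) = (SUM \<chi>:A'. h (of_nat d))" using that by (intro sum.cong refl) (simp add: Dg_def)
  thus ?thesis by simp
 qed
 have odd1: "odd n1" "odd Np" "odd Nm" "8 <= n1 + 1" "Q = n1 + 1" using odd_Q1 odd_N Q_ge by (simp_all add: n1)
 have odds: "odd d0" "odd dp" "odd dm" using odd1 even_QR by (simp_all add: e0 e4)
 have disj: "k0.Xs Int (kp.Xs Un km.Xs) = {}" "kp.Xs Int km.Xs = {}" "one ~: Y" "St ~: Y" "one ~= St"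
 proof -
  have 1: "dp < dm" using QR odd1 by (simp add: e4)
  have "dm + R + 1 = Q * Q + Q * R" unfolding e4 Np_def odd1(5) by (simp add: algebra_simps)
  moreover have "8 * R <= Q * R" using QR by simp
  ultimately have 2: "d0 < dm" using QR e0 by linarith
  have "dp + n1 * R = n1 * (Q + 1)" unfolding e4 Nm_add[symmetric] by (simp add: algebra_simps)
  moreover have "n1 * (Q + 1) <= Q * Q" unfolding odd1(5) by (simp add: algebra_simps)
  ultimately have 3: "dp < d0" using e0 by linarith
  have "1 < Nm" using Ms_pos[of Nm] by (simp add: Ms_def)
  hence "1 < dp" unfolding e4 using odd1 by (intro less_1_mult) auto
  hence ne: "dp ~= dm" "d0 ~= dm" "d0 ~= dp" "1 ~= d0" "1 ~= dp" "1 ~= dm" using 1 2 3 by auto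
  have ev: "Q * Q ~= n" if "odd n" for n using that even_QR by auto
  show "k0.Xs Int (kp.Xs Un km.Xs) = {}" "kp.Xs Int km.Xs = {}"
   using dj[OF Dg(1) Dg(2) ne(3)] dj[OF Dg(1) Dg(3) ne(2)] dj[OF Dg(2) Dg(3) ne(1)] by blast+
  show "one ~: Y" unfolding Y_def
   using dj[OF Dg(4) Dg(1) ne(4)] dj[OF Dg(4) Dg(2) ne(5)] dj[OF Dg(4) Dg(3) ne(6)] by blast
  show "St ~: Y" unfolding Y_def
   using dj[OF Dg(5) Dg(1) ev[OF odds(1)]] dj[OF Dg(5) Dg(2) ev[OF odds(2)]] dj[OF Dg(5) Dg(3) ev[OF odds(3)]] by blast
  show "one ~= St" using dj[OF Dg(4) Dg(5)] ev[of 1] by auto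
 qed
 have sumY: "(SUM \<chi>:Y. g \<chi>) = (SUM \<chi>:k0.Xs. g \<chi>) + ((SUM \<chi>:kp.Xs. g \<chi>) + (SUM \<chi>:km.Xs. g \<chi>))" for g :: "(F2bar mat => complex) => complex"
  unfolding Y_def using disj(1,2) by (simp add: sum.union_disjoint)
 have YI: "insert St Y <= Irr Sz" using k0.Xs_Irr kp.Xs_Irr km.Xs_Irr StI by (auto simp: Y_def)
 have finY: "finite Y" by (simp add: Y_def)
 define q r where "q = (of_nat Q :: complex)" and "r = (of_nat (R div 2) :: complex)"
 have rr: "r * r = q / 2" using R2 by (simp add: q_def r_def)
 have c0: "2 * of_nat (card k0.Xs) = q - 2" "4 * of_nat (card kp.Xs) = q + 2 * r" "4 * of_nat (card km.Xs) = q - 2 * r"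
 proof -
  have "2 * card k0.Xs + 2 = Q" using k0.card_Xs Q_ge cJ by (simp add: e0)
  from arg_cong[OF this, of "of_nat :: nat => complex"] show "2 * of_nat (card k0.Xs) = q - 2" by (simp add: q_def algebra_simps)
  have "4 * card kp.Xs = Q + R" using kp.card_Xs cJ by (simp add: Np_def)
  from arg_cong[OF this, of "of_nat :: nat => complex"] show "4 * of_nat (card kp.Xs) = q + 2 * r" by (simp add: q_def r_def R2')
  have "4 * card km.Xs + R = Q" using km.card_Xs R_le cJ by (simp add: Nm_def)
  from arg_cong[OF this, of "of_nat :: nat => complex"] show "4 * of_nat (card km.Xs) = q - 2 * r" by (simp add: q_def r_def R2' algebra_simps)
 qed
 have cX: "of_nat (card k0.Xs) = (q - 2) / 2" "of_nat (card kp.Xs) = (q + 2 * r) / 4" "of_nat (card km.Xs) = (q - 2 * r) / 4"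
  using c0 by (simp_all add: field_simps)
 have q2: "q = 2 * (r * r)" unfolding rr by simp
 have cc: "of_int c0 = r" "of_int cp = r - 1" "of_int cm = r + 1" by (simp_all add: r_def R_def e0 e4)
 have Q1: "of_nat n1 = q - 1" using odd1(5) by (simp add: q_def)
 have np: "of_nat Np = q + 2 * r + 1" by (simp add: Np_def q_def r_def R2')
 have nm: "of_nat Nm = q - 2 * r + 1" using arg_cong[OF Nm_add, of "of_nat :: nat => complex"] by (simp add: q_def r_def R2' algebra_simps)
 have dd: "of_nat d0 = q * q + 1" "of_nat dp = (q - 1) * (q - 2 * r + 1)" "of_nat dm = (q - 1) * (q + 2 * r + 1)"
  by (simp_all add: e0 e4 Q1 np nm) (simp add: q_def)
 \<comment> \<open>What is left of \<open>PP\<close> after removing every known constituent with its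
   multiplicity: \<open>r\<close> for the Steinberg character and the split family,
   \<open>r - 1\<close> and \<open>r + 1\<close> for the other two families.\<close>
 define Wf where "Wf e x = PP e x - (r * St x + (r * (SUM \<chi>:k0.Xs. \<chi> x) + ((r - 1) * (SUM \<chi>:kp.Xs. \<chi> x) + (r + 1) * (SUM \<chi>:km.Xs. \<chi> x))))" for e x
 define m where "m \<chi> = cip Sz (PP \<i>) \<chi>" for \<chi>
 have me: "cip Sz (PP e) \<chi> = m \<chi>" if "e = \<i> | e = - \<i>" "\<chi> : insert St Y" for e \<chi>
  using that P k0.cip_P_Xs kp.cip_P_Xs km.cip_P_Xs unfolding m_def Y_def by auto
 have mval: "m St = r" "\<chi> : k0.Xs ==> m \<chi> = r" "\<chi> : kp.Xs ==> m \<chi> = r - 1" "\<chi> : km.Xs ==> m \<chi> = r + 1" for \<chi>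
  unfolding m_def using P k0.cip_P_Xs kp.cip_P_Xs km.cip_P_Xs cc by (simp_all add: r_def)
 have Wf: "Wf e x = PP e x - (SUM \<chi>:insert St Y. m \<chi> * \<chi> x)" for e x
 proof -
  have "(SUM \<chi>:insert St Y. m \<chi> * \<chi> x) = m St * St x + (SUM \<chi>:Y. m \<chi> * \<chi> x)" using disj finY by (intro sum.insert) auto
  thus ?thesis unfolding Wf_def sumY sum_distrib_left using mval by simp
 qed
 have mr: "m \<chi> : \<int>" if "\<chi> : insert St Y" for \<chi> using that mval by (auto simp: Y_def r_def)
 have WV: "vchar Sz (Wf e)" if e: "e = \<i> | e = - \<i>" for e
 proof -
  have "vchar Sz (%x. PP e x - (SUM \<chi>:insert St Y. m \<chi> * \<chi> x))"
   by (rule Sz.vchar_diff[OF PP_vchar Sz.vchar_sum[OF Sz.vchar_scale[OF Sz.vchar_Irr]]])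
    (use e YI mr in auto)
  thus ?thesis unfolding Wf .
 qed
 have msum: "(SUM \<chi>:insert St Y. m \<chi> * m \<chi>) = (q - 1) * q / 2"
 proof -
  have "(SUM \<chi>:insert St Y. m \<chi> * m \<chi>) = m St * m St + (SUM \<chi>:Y. m \<chi> * m \<chi>)" using disj finY by (intro sum.insert) auto
  also have "... = r * r + (of_nat (card k0.Xs) * (r * r) + (of_nat (card kp.Xs) * ((r - 1) * (r - 1)) + of_nat (card km.Xs) * ((r + 1) * (r + 1))))"
   unfolding sumY using mval by simp
  also have "... = r * r + ((q - 2) / 2 * (r * r) + ((q + 2 * r) / 4 * ((r - 1) * (r - 1)) + (q - 2 * r) / 4 * ((r + 1) * (r + 1))))"
   unfolding cX ..
  also have "... = (q - 1) * q / 2" unfolding q2 by (rule halves1)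
  finally show ?thesis .
 qed
 have cipW: "cip Sz (Wf e) (Wf e') = cip Sz (PP e) (PP e') - (q - 1) * q / 2"
  if e: "e = \<i> | e = - \<i>" "e' = \<i> | e' = - \<i>" for e e'
 proof -
  let ?s = "%x. SUM \<chi>:insert St Y. m \<chi> * \<chi> x"
  have 1: "cip Sz (PP e) ?s = (q - 1) * q / 2" if e: "e = \<i> | e = - \<i>" for e
  proof -
   have "cip Sz (PP e) ?s = (SUM \<chi>:insert St Y. m \<chi> * cip Sz (PP e) \<chi>)"
    unfolding Sz.cip_sum2 Sz.cip_scale2 ..
   also have "... = (SUM \<chi>:insert St Y. m \<chi> * m \<chi>)" using me[OF e] by (intro sum.cong) auto
   finally show ?thesis unfolding msum .
  qed
  have "cip Sz ?s ?s = (SUM \<chi>:insert St Y. SUM \<psi>:insert St Y. m \<chi> * (m \<psi> * cip Sz \<chi> \<psi>))"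
   unfolding Sz.cip_sum Sz.cip_scale Sz.cip_sum2 Sz.cip_scale2 sum_distrib_left ..
  also have "... = (SUM \<chi>:insert St Y. SUM \<psi>:insert St Y. if \<chi> = \<psi> then m \<chi> * m \<chi> else 0)"
  proof (intro sum.cong refl)
   fix \<chi> \<psi> assume "\<chi> : insert St Y" "\<psi> : insert St Y"
   hence "cip Sz \<chi> \<psi> = (if \<chi> = \<psi> then 1 else 0)" using Sz.irr_orth YI by blast
   thus "m \<chi> * (m \<psi> * cip Sz \<chi> \<psi>) = (if \<chi> = \<psi> then m \<chi> * m \<chi> else 0)" by simp
  qed
  also have "... = (SUM \<chi>:insert St Y. m \<chi> * m \<chi>)" using finY by (intro sum.cong refl) (simp only: sum.delta' finite_insert simp_thms if_True)
  also have "... = (q - 1) * q / 2" by (rule msum)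
  finally have 2: "cip Sz ?s ?s = (q - 1) * q / 2" .
  have "Wf e = (%x. PP e x - ?s x)" for e by (rule ext) (rule Wf)
  hence "cip Sz (Wf e) (Wf e') = cip Sz (%x. PP e x - ?s x) (%x. PP e' x - ?s x)" by simp
  also have "... = cip Sz (PP e) (PP e') - cip Sz (PP e) ?s - (cip Sz ?s (PP e') - cip Sz ?s ?s)"
   unfolding Sz.cip_diff Sz.cip_diff2 by simp
  also have "cip Sz ?s (PP e') = (q - 1) * q / 2" using 1[OF e(2)] Sz.cip_sym[of ?s] by simp
  finally show ?thesis unfolding 1[OF e(1)] 2 by simp
 qed
 have W1: "Wf e (I4) = of_nat (n1 * (R div 2))" for e
 proof -
  have s: "(SUM \<chi>:k0.Xs. \<chi> (I4)) = (q - 2) / 2 * (q * q + 1)" "(SUM \<chi>:kp.Xs. \<chi> (I4)) = (q + 2 * r) / 4 * ((q - 1) * (q - 2 * r + 1))"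
   "(SUM \<chi>:km.Xs. \<chi> (I4)) = (q - 2 * r) / 4 * ((q - 1) * (q + 2 * r + 1))"
   using sX[OF Dg(1), of "%z. z"] sX[OF Dg(2), of "%z. z"] sX[OF Dg(3), of "%z. z"] by (simp_all only: cX dd)
  have p: "PP e (I4) = (q - 1) * (q * q + 1) * r" unfolding PP_one of_nat_mult of_nat_add n1[symmetric] Q1 q_def[symmetric] r_def[symmetric] by simp
  have st: "St (I4) = q * q" using St1 by (simp add: q_def)
  have "Wf e (I4) = (q - 1) * r" unfolding Wf_def s p st unfolding q2 by (rule halves2)
  thus ?thesis unfolding of_nat_mult Q1 r_def .
 qed
 have WI: "restrict (Wf e) (Cz) : Irr Sz" if e: "e = \<i> | e = - \<i>" for e
 proof (rule Sz.vchar_norm1[OF WV[OF e]])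
  show "cip Sz (Wf e) (Wf e) = 1" unfolding cipW[OF e e] cip_PP n1[symmetric] Q1 q_def[symmetric] using e by auto
  show "Wf e \<one>\<^bsub>Sz\<^esub> = of_nat (n1 * (R div 2))" using W1 by simp
 qed
 define V1 where "V1 = restrict (Wf \<i>) (Cz)"
 define V2 where "V2 = restrict (Wf (- \<i>)) (Cz)"
 have V: "V1 : Irr Sz" "V2 : Irr Sz" using WI by (auto simp: V1_def V2_def)
 have V1: "V1 (I4) = of_nat (n1 * (R div 2))" "V2 (I4) = of_nat (n1 * (R div 2))"
  by (simp_all add: V1_def V2_def W1 del: of_nat_mult)
 have V12: "V1 ~= V2"
 proof
  assume "V1 = V2"
  hence "cip Sz V1 V2 = 1" using Sz.irr_orth V by simp
  moreover have "cip Sz V1 V2 = cip Sz (Wf \<i>) (Wf (- \<i>))" by (rule Sz.cip_cong) (auto simp: V1_def V2_def)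
  moreover have "cip Sz (Wf \<i>) (Wf (- \<i>)) = 0" unfolding cipW[of "\<i>" "- \<i>", simplified] cip_PP n1[symmetric] Q1 q_def[symmetric] by simp
  ultimately show False by simp
 qed
 have Vn: "{V1, V2} Int ({one, St} Un Y) = {}"
 proof -
  \<comment> \<open>Here \<open>f >= 1\<close> is used: the new degree is even, so only the
    Steinberg character could coincide, and its degree is larger.\<close>
  have "even (R div 2)" using f1 by (simp add: R_def)
  hence ev: "even (n1 * (R div 2))" by simp
  have "R div 2 < Q" using QR by linarith
  hence "n1 * (R div 2) < Q * Q" using odd1 by (intro mult_strict_mono) auto
  hence n5: "n1 * (R div 2) ~= Q * Q" by simp
  have ne: "v ~= u" if v: "v : {V1, V2}" and u: "u : {one, St} Un Y" for u v
  proof -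
   have v1: "v (I4) = of_nat (n1 * (R div 2))" using v V1 by auto
   have v1': "Dg {v} (n1 * (R div 2))" using v1 by (simp add: Dg_def)
   have n: "n1 * (R div 2) ~= n" if "odd n" for n using ev that by auto
   have "u = one | u = St | u : k0.Xs | u : kp.Xs | u : km.Xs" using u by (auto simp: Y_def)
   thus ?thesis using dj[OF v1' Dg(5) n5] dj[OF v1' Dg(4) n[of 1]] dj[OF v1' Dg(1) n[OF odds(1)]]
     dj[OF v1' Dg(2) n[OF odds(2)]] dj[OF v1' Dg(3) n[OF odds(3)]] n[of 1] by auto
  qed
  thus ?thesis by blast
 qed
 have Wfr: "Wf e (fr x) = Wf e x" if "x : Cz" for e x
  unfolding Wf_def using that by (simp add: PP_fr Stfr k0.Xs_fr_sum kp.Xs_fr_sum km.Xs_fr_sum)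
 let ?Z = "{one, St, V1, V2} Un (k0.Xs Un (kp.Xs Un km.Xs))"
 have "Irr Sz = ?Z"
 proof (rule Sz.Irr_eqI)
  show "?Z <= Irr Sz" using oneI YI V unfolding Y_def by blast
  have Z: "?Z = insert one (insert St (insert V1 (insert V2 Y)))" by (auto simp: Y_def)
  have "(SUM \<chi>:?Z. g \<chi>) = g one + (g St + (g V1 + (g V2 + (SUM \<chi>:Y. g \<chi>))))" for g :: "(F2bar mat => complex) => complex"
   unfolding Z using finY disj(3,4,5) V12 Vn by (subst sum.insert, simp, blast)+ simp
  from this[of "%\<chi>. \<chi> (I4) * \<chi> (I4)"]
  have "(SUM \<chi>:?Z. \<chi> (I4) * \<chi> (I4)) = of_nat 1 * of_nat 1 + (of_nat (Q * Q) * of_nat (Q * Q) + (of_nat (n1 * (R div 2)) * of_nat (n1 * (R div 2)) + (of_nat (n1 * (R div 2)) * of_nat (n1 * (R div 2))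
    + (of_nat (card k0.Xs) * (of_nat d0 * of_nat d0) + (of_nat (card kp.Xs) * (of_nat dp * of_nat dp) + of_nat (card km.Xs) * (of_nat dm * of_nat dm))))))"
   unfolding sumY sX[OF Dg(1), of "%z. z * z"] sX[OF Dg(2), of "%z. z * z"] sX[OF Dg(3), of "%z. z * z"] St1 V1
   by (simp only: one_def restrict_apply' Sz_one_closed of_nat_1)
  also have "... = 1 + ((q * q) * (q * q) + 2 * (((q - 1) * r) * ((q - 1) * r))
    + ((q - 2) / 2 * ((q * q + 1) * (q * q + 1)) + ((q + 2 * r) / 4 * (((q - 1) * (q - 2 * r + 1)) * ((q - 1) * (q - 2 * r + 1)))
    + (q - 2 * r) / 4 * (((q - 1) * (q + 2 * r + 1)) * ((q - 1) * (q + 2 * r + 1))))))"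
   unfolding cX dd by (simp add: q_def[symmetric] r_def[symmetric] Q1)
  also have "... = q * q * (q - 1) * (q * q + 1)" unfolding q2 by (rule halves3)
  also have "... = of_nat (card (Cz))" unfolding card_Sz of_nat_mult of_nat_add n1[symmetric] Q1 q_def by simp
  finally show "(SUM \<chi>:?Z. \<chi> \<one>\<^bsub>Sz\<^esub> * \<chi> \<one>\<^bsub>Sz\<^esub>) = of_nat (card (Cz))" unfolding Sz_one .
 qed
 hence a: "Irr Sz = {\<lambda>x\<in>Cz. 1, St, V1, V2} Un (k0.Xs Un (kp.Xs Un km.Xs))" unfolding one_def .
 have b: "fam (Q - 1) {1, -1} (Q * Q + 1) k0.Xs" "fam Np {1, -1, int Q, - int Q} ((Q - 1) * Nm) kp.Xs"
  "fam Nm {1, -1, int Q, - int Q} ((Q - 1) * Np) km.Xs"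
  using ktorus_fam[OF k0.ktorus_axioms] ktorus_fam[OF kp.ktorus_axioms] ktorus_fam[OF km.ktorus_axioms]
  by (simp_all only: e0 e4 n1)
 have c: "ALL x:Cz. St (fr x) = St x & V1 (fr x) = V1 x & V2 (fr x) = V2 x"
  using Stfr Wfr by (simp add: V1_def V2_def)
 show ?thesis
  by (rule exI[of _ St], rule exI[of _ V1], rule exI[of _ V2], rule exI[of _ k0.Xs], rule exI[of _ kp.Xs], rule exI[of _ km.Xs])
   (intro conjI a b c St1 V1[unfolded n1])
qed

end

section \<open>Automorphisms\<close>

context suzuki
begin

definition aut :: "(F2bar mat => F2bar mat) => bool" where
 "aut \<alpha> <-> (ALL x:Cz. ALL y:Cz. \<alpha> (x * y) = \<alpha> x * \<alpha> y) & bij_betw \<alpha> (Cz) (Cz)"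

lemma aut_mult: "aut \<alpha> ==> x : Cz ==> y : Cz ==> \<alpha> (x * y) = \<alpha> x * \<alpha> y"
 and aut_closed: "aut \<alpha> ==> x : Cz ==> \<alpha> x : Cz"
 and aut_inj: "aut \<alpha> ==> x : Cz ==> y : Cz ==> \<alpha> x = \<alpha> y <-> x = y"
 and aut_surj: "aut \<alpha> ==> y : Cz ==> EX x:Cz. y = \<alpha> x"
 unfolding aut_def bij_betw_def inj_on_def by blast+

lemma aut_one: "aut \<alpha> ==> \<alpha> (I4) = I4"
proof -
 assume a: "aut \<alpha>"
 have c: "\<alpha> (I4) : Cz" using aut_closed[OF a] by simp
 have "\<alpha> (I4) * \<alpha> (I4) = \<alpha> (I4)" using aut_mult[OF a, of "I4" "I4"] by simp
 thus ?thesis using Sz.l_cancel_one[OF c c] by simp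
qed

lemma aut_inv: "aut \<alpha> ==> x : Cz ==> \<alpha> (iv x) = iv (\<alpha> x)"
 using aut_mult[of \<alpha> "iv x" x] aut_one[of \<alpha>] aut_closed[of \<alpha>] by (intro Sz_invI[symmetric]) auto

lemma aut_conj: "aut \<alpha> ==> s : Cz ==> x : Cz ==> \<alpha> (s * x * iv s) = \<alpha> s * \<alpha> x * iv (\<alpha> s)"
 by (simp add: aut_mult aut_inv aut_closed)

lemma conj_mult: "s : Cz ==> x : Cz ==> y : Cz ==>
 s * (x * y) * iv s = (s * x * iv s) * (s * y * iv s)"
 using Sz.inv_mult_cancel[of s] by simp

lemma conj_undo: "s : Cz ==> x : Cz ==> iv s * (s * x * iv s) * s = x"
 "s : Cz ==> x : Cz ==> s * (iv s * x * s) * iv s = x"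
 using Sz.inv_mult_cancel[of s] Sz.mult_inv_cancel[of s] by simp_all

lemma aut_comp_conj:
 assumes a: "aut \<alpha>" and s: "s : Cz"
 shows "aut (%x. s * \<alpha> x * iv s)"
proof -
 have "bij_betw (%x. s * x * iv s) (Cz) (Cz)"
  by (rule bij_betw_byWitness[where f' = "%x. iv s * x * s"]) (use s conj_undo in \<open>auto simp del: as4\<close>)
 hence "bij_betw ((%x. s * x * iv s) \<circ> \<alpha>) (Cz) (Cz)"
  using a unfolding aut_def by (blast intro: bij_betw_trans)
 thus ?thesis using a aut_mult[OF a] aut_closed[OF a] conj_mult[OF s] unfolding aut_def by (simp add: comp_def del: as4)
qed

lemma T_w_T: "k : tor ==> w * T k * w = T (inverse k)"
 using w_T[of k] torD[of k] ww by simp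

lemma big_T: "x : big ==> k : tor ==> x * T k : big"
proof -
 assume "x : big" and k: "k : tor"
 then obtain a b l c d where *: "a : F" "b : F" "l : tor" "c : F" "d : F" "x = U a b * (T l * (w * U c d))" by (auto simp: big_def)
 have "x * T k = U a b * (T l * (w * (T k * U (c * k) (d * (k * th k)))))" using * k by (simp add: U_T)
 also have "... = U a b * (T (l * inverse k) * (w * U (c * k) (d * (k * th k))))" using * k torD[OF k] by (simp add: wT' TT')
 also have "... : big" using * k torD[OF k] by (intro bigI) auto
 finally show ?thesis .
qed

lemma wuTw_big: "u : Us ==> u ~= I4 ==> k : tor ==> w * (u * T k) * w : big"
proof -
 assume u: "u : Us" "u ~= I4" and k: "k : tor"
 have um: "u : cmat 4 4" using Us_Sz[OF u(1)] by simp
 have "w * (u * T k) * w = (w * u * w) * (w * T k * w)" using um by (simp add: ww')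
 thus ?thesis using big_T[OF w_conj_Us[OF u], of "inverse k"] k unfolding T_w_T[OF k] by simp
qed

text \<open>Some conjugate has the form \<open>w * U a b\<close>. If its square is the identity,
  then \<open>w * U a b * w\<close> is the inverse of \<open>U a b\<close> and lies in
  \<open>Bs\<close>, which \<open>w_conj_Us\<close> allows only for trivial
  \<open>U a b\<close>.\<close>

lemma involution_conj_w:
 assumes x: "x : Cz" "x ~= I4" "x * x = I4"
 shows "EX s:Cz. s * x * iv s = w"
proof -
 obtain s where s: "s : Cz" "s * x * iv s : big" using conj_big[OF x(1,2)] by blast
 obtain t a b where t: "t : Cz" "a : F" "b : F" "t * (s * x * iv s) * iv t = w * U a b"
  using big_conj_wU[OF s(2)] by blast
 hence ts: "(t * s) * x * iv (t * s) = w * U a b" using conj_conj[OF s(1) t(1) x(1)] by simp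
 have tS: "t * s : Cz" using s t by simp
 have "(w * U a b) * (w * U a b) = (t * s) * (x * x) * iv (t * s)"
  unfolding ts[symmetric] by (rule conj_mult[OF tS x(1) x(1), symmetric])
 hence e: "(w * U a b * w) * U a b = I4" unfolding x(3) using tS t by simp
 have "iv (U a b) = w * U a b * w" by (rule Sz_invI) (use e t in auto)
 hence "w * U a b * w : Bs" using subgroup.m_inv_closed[OF Us_subgroup UsI[OF t(2,3)]] Us_Bs by simp
 hence "U a b = I4" using w_conj_Us[OF UsI[OF t(2,3)]] Bs_big_disj by blast
 thus ?thesis using ts tS by (intro bexI[of _ "t * s"]) simp_all
qed

lemma U01: "U 0 1 : Cz" "U 0 1 ~= I4" "U 0 1 * U 0 1 = I4"
 using U_inj[of 0 1 0 0] by (auto simp: U_mult U00)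

lemma w_ne: "w ~: Bs" "w ~= I4"
proof -
 have "U 0 0 * (T 1 * (w * U 0 0)) : big" by (intro bigI) auto
 hence "w : big" by (simp add: U00 T1)
 thus "w ~: Bs" using Bs_big_disj by blast
 thus "w ~= I4" using Us_Bs[OF UsI[of 0 0]] by (auto simp: U00)
qed

text \<open>By \<open>TI\<close> the centraliser lies in \<open>Bs\<close>, and there the torus part
  must satisfy \<open>k * th k = 1\<close>. The point is that an automorphism fixing
  \<open>U 0 1\<close> preserves \<open>Us\<close>.\<close>

lemma centralizer_U01: "s : Cz ==> s * U 0 1 * iv s = U 0 1 <-> s : Us"
proof
 assume s: "s : Cz" and e: "s * U 0 1 * iv s = U 0 1"
 have "s ~: big"
 proof
  assume "s : big"
  thus False using TI[of s "U 0 1"] e U01 UsI[of 0 1] Us_Bs by simp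
 qed
 then obtain a b k where *: "a : F" "b : F" "k : tor" "s = U a b * T k" using s by (auto simp: Sz_carrier Bs_def)
 have "U a b * (T k * U 0 1 * iv (T k)) * iv (U a b) = U 0 1"
  using e * conj_conj[of "T k" "U a b" "U 0 1"] by simp
 hence "U 0 (1 / (k * th k)) = U 0 1"
  using T_conj_U[OF *(3) F_0 F_1] U_conj_U[of 0 "1 / (k * th k)" a b] * torD[of k] by simp
 hence "k = 1" using kthk[OF *(3)] by (simp add: U_inj divide_eq_eq split: if_splits)
 thus "s : Us" using * UsI by (simp add: T1)
next
 assume "s : Us"
 then obtain a b where "a : F" "b : F" "s = U a b" by (auto simp: Us_def)
 thus "s * U 0 1 * iv s = U 0 1" using U_conj_U[of 0 1 a b] by simp
qed

lemma F_sum: "(!!i. i : I ==> h i : F) ==> (SUM i:I. h i) : F"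
 by (induction I rule: infinite_finite_induct) auto

text \<open>The polynomial with the roots \<open>\<zeta> ^ (2 ^ i)\<close> is unchanged when its
  coefficients are squared, since that only rotates the roots; so its coefficients are
  \<open>0\<close> or \<open>1\<close> and are fixed by \<open>g\<close>. Hence
  \<open>g \<zeta>\<close> is one of these roots, and \<open>\<zeta>\<close> generates the
  multiplicative group.\<close>

lemma field_aut_frob:
 assumes add: "!!x y. x : F ==> y : F ==> g (x + y) = g x + g y"
  and mul: "!!x y. x : F ==> y : F ==> g (x * y) = g x * g y"
  and one: "g 1 = 1"
 shows "EX i. ALL x:F. g x = x ^ (2 ^ i)"
proof -
 define D where "D = 2 * f + 1"
 obtain \<zeta> :: F2bar where \<zeta>: "!!i. \<zeta> ^ i = 1 <-> (Q - 1) dvd i" using primitive_root_exists[OF odd_Q1] by blast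
 have z0: "\<zeta> ~= 0" using \<zeta>[of "Q - 1"] Q_ge by (auto simp: power_0_left)
 have zF: "\<zeta> : F" using F_minus_0[OF z0] \<zeta> by simp
 have g0: "g 0 = 0" using add[of 0 0] by simp
 have gp: "g (\<zeta> ^ n) = g \<zeta> ^ n" for n by (induction n) (simp_all add: one mul zF)
 have gs: "g (SUM i:I. h i) = (SUM i:I. g (h i))" if "!!i. i : I ==> h i : F" for I :: "nat set" and h
  using that
 proof (induction I rule: infinite_finite_induct)
  case (insert i I)
  have "(SUM i:I. h i) : F" using insert by (intro F_sum) auto
  thus ?case using insert by (simp add: add)
 qed (simp_all add: g0)
 define p where "p = (\<Prod>i<D. [:\<zeta> ^ (2 ^ i), 1:])"
 have "map_poly (%c. c\<^sup>2) p = p"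
 proof -
  have mp: "map_poly (%c. c\<^sup>2) (\<Prod>i\<in>I. [:h i, 1:]) = (\<Prod>i\<in>I. [:(h i)\<^sup>2, 1 :: F2bar:])" for I :: "nat set" and h
  proof (induction I rule: infinite_finite_induct)
   case (insert i I)
   have hom: "map_poly (%c. c\<^sup>2) (a * b) = map_poly (%c. c\<^sup>2) a * map_poly (%c. c\<^sup>2) b" for a b :: "F2bar poly"
    by (rule poly_eqI) (simp add: coeff_map_poly coeff_mult sq_sum power_mult_distrib)
   show ?case unfolding prod.insert[OF insert(1,2)] hom insert(3) by (simp add: map_poly_pCons)
  qed (simp_all add: map_poly_1)
  have "map_poly (%c. c\<^sup>2) p = (\<Prod>i<D. [:\<zeta> ^ (2 ^ Suc i), 1:])"
   unfolding p_def mp by (simp add: power_mult[symmetric] mult.commute)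
  moreover have "[:\<zeta> ^ (2 ^ 0), 1:] * (\<Prod>i<D. [:\<zeta> ^ (2 ^ Suc i), 1:]) = [:\<zeta> ^ (2 ^ 0), 1:] * p"
  proof -
   have "[:\<zeta> ^ (2 ^ 0), 1:] * (\<Prod>i<D. [:\<zeta> ^ (2 ^ Suc i), 1:]) = (\<Prod>i<Suc D. [:\<zeta> ^ (2 ^ i), 1:])"
    by (simp only: prod.lessThan_Suc_shift)
   also have "... = p * [:\<zeta> ^ (2 ^ D), 1:]" by (simp add: p_def)
   also have "\<zeta> ^ (2 ^ D) = \<zeta> ^ (2 ^ 0)" using zF F_iff by (simp add: Q_def D_def)
   finally show ?thesis by (simp only: mult.commute)
  qed
  ultimately have "[:\<zeta> ^ (2 ^ 0), 1:] * map_poly (%c. c\<^sup>2) p = [:\<zeta> ^ (2 ^ 0), 1:] * p" by (simp only:)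
  moreover have "[:\<zeta> ^ (2 ^ 0), 1:] ~= 0" by simp
  ultimately show ?thesis using mult_left_cancel[of "[:\<zeta> ^ (2 ^ 0), 1:]" "map_poly (%c. c\<^sup>2) p" p] by blast
 qed
 hence c2: "(coeff p n)\<^sup>2 = coeff p n" for n by (metis coeff_map_poly zero_power2)
 have c: "coeff p n = 0 | coeff p n = 1" for n
 proof -
  have "coeff p n * (coeff p n + 1) = 0" using c2[of n] unfolding power2_eq_square by (simp only: ring_distribs mult_1_right add_self)
  thus ?thesis by (auto simp: add_eq_0_iff_eq)
 qed
 have gc: "g (coeff p n) = coeff p n" "coeff p n : F" for n using c[of n] g0 one by auto
 have "poly p (g \<zeta>) = (\<Sum>n\<le>degree p. g (coeff p n * \<zeta> ^ n))"
  unfolding poly_altdef by (intro sum.cong refl) (simp add: mul gc zF gp)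
 also have "... = g (poly p \<zeta>)" unfolding poly_altdef by (rule gs[symmetric]) (simp add: gc zF)
 also have "poly p \<zeta> = 0" unfolding p_def poly_prod by (rule prod_zero) (auto intro!: bexI[of _ 0] simp: D_def)
 finally have "poly p (g \<zeta>) = 0" using g0 by simp
 then obtain i where i: "g \<zeta> = \<zeta> ^ (2 ^ i)" unfolding p_def poly_prod by (auto simp: add_eq_0_iff_eq dest!: sym[of _ "g \<zeta>"])
 have "g x = x ^ (2 ^ i)" if x: "x : F" for x
 proof (cases "x = 0")
  case True thus ?thesis by (simp add: g0 power_0_left)
 next
  case False
  hence "x ^ (Q - 1) = 1" using F_minus_0 x by blast
  then obtain n where "x = \<zeta> ^ n" using primitive_root[OF odd_Q1 \<zeta>] by blast
  thus ?thesis using gp i by (simp add: power_mult[symmetric] mult.commute)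
 qed
 thus ?thesis by blast
qed

lemma aut_Us:
 assumes a: "aut \<alpha>" and t: "\<alpha> (U 0 1) = U 0 1" and u: "u : Cz"
 shows "\<alpha> u : Us <-> u : Us"
 using centralizer_U01[OF u] centralizer_U01[OF aut_closed[OF a u]] aut_conj[OF a u U01(1)] t
  aut_inj[OF a, of "u * U 0 1 * iv u" "U 0 1"] u U01 by simp

text \<open>As \<open>U 1 0\<close> squares to \<open>U 0 1\<close>, its image is
  \<open>U 1 d\<close> for some \<open>d\<close>. Applying \<open>\<alpha>\<close> to the relation
  \<open>rel\<close> and comparing coordinates in the big cell gives \<open>d = 0\<close> and
  \<open>th \<beta> = \<beta>\<close> for \<open>\<beta> = k * th k\<close>, so
  \<open>\<beta> = 1\<close>.\<close>

lemma aut_normal_form1: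
 assumes a: "aut \<alpha>" and t: "\<alpha> (U 0 1) = U 0 1" and k: "k : tor" and tw: "\<alpha> w = T k * w"
 shows "k = 1" "\<alpha> (U 1 0) = U 1 0"
proof -
 note tU = aut_Us[OF a t]
 obtain c d where cd: "c : F" "d : F" "\<alpha> (U 1 0) = U c d" using tU[of "U 1 0"] UsI by (auto simp: Us_def)
 have "U 1 0 * U 1 0 = U 0 1" by (simp add: U_mult)
 hence "\<alpha> (U 0 1) = \<alpha> (U 1 0) * \<alpha> (U 1 0)" using aut_mult[OF a, of "U 1 0" "U 1 0"] by simp
 hence "U 0 1 = U 0 (c * th c)" unfolding t cd(3) using cd by (simp add: U_mult)
 hence cth: "c * th c = 1 * th 1" by (simp add: U_inj)
 hence c1: "c = 1" using mult_th_inj[OF cd(1) F_1] by simp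
 define \<beta> where "\<beta> = k * th k"
 note kF = torD[OF k]
 have \<beta>: "\<beta> : F" "\<beta> ~= 0" using kF by (simp_all add: \<beta>_def)
 define n where "n = N 0 \<beta>"
 have n: "n = th \<beta>" by (simp add: n_def N_def)
 have rel: "w * U 0 1 * w = U 1 0 * (w * U 1 1)"
  using wUw[of 0 1] by (simp add: N_def T1)
 have i10: "U 1 1 = iv (U 1 0)" by (simp add: inv_U)
 have "\<alpha> w * \<alpha> (U 0 1) * \<alpha> w = \<alpha> (U 1 0) * (\<alpha> w * iv (\<alpha> (U 1 0)))"
  using arg_cong[OF rel, of \<alpha>] unfolding i10 by (simp add: aut_mult[OF a] aut_inv[OF a] aut_closed[OF a])
 hence "T k * w * U 0 1 * (T k * w) = U c d * (T k * w * U c (d + c * th c))"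
  unfolding tw t cd(3) inv_U[OF cd(1,2)] .
 moreover have "T k * w * U 0 1 * (T k * w) = w * U 0 \<beta> * w"
 proof -
  have "T k * w = w * T (inverse k)" using w_T[of "inverse k"] kF by simp
  hence "T k * w * U 0 1 * (T k * w) = w * (T (inverse k) * U 0 1 * T k) * w" using kF by simp
  also have "T (inverse k) * U 0 1 * T k = U 0 \<beta>"
   using T_conj_U[of "inverse k" 0 1] k kF by (simp add: inv_T \<beta>_def divide_inverse del: as4)
  finally show ?thesis .
 qed
 moreover have "w * U 0 \<beta> * w = U (\<beta> / n) 0 * (T (inverse (th n / (n * n))) * (w * U (\<beta> / n) (\<beta> / n * th (\<beta> / n))))"
 proof -
  have "th n / (n * n) ~= 0" using n \<beta> by simp
  thus ?thesis using wUw[OF F_0 \<beta>(1)] \<beta>(2) w_T[of "th n / (n * n)"] unfolding n_def[symmetric] by (simp flip: as4)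
 qed
 ultimately have "U (\<beta> / n) 0 * (T (inverse (th n / (n * n))) * (w * U (\<beta> / n) (\<beta> / n * th (\<beta> / n)))) = U c d * (T k * (w * U c (d + c * th c)))"
  by simp
 moreover have "inverse (th n / (n * n)) : tor" using n \<beta> by (auto simp: tor_def)
 ultimately have "\<beta> / n = c" "0 = d" using big_inj[OF _ k] by blast+
 hence "\<beta> = th \<beta>" using c1 n \<beta> by (simp add: field_simps)
 hence "\<beta> * \<beta> = \<beta>" using th_th[OF \<beta>(1)] by simp
 hence "\<beta> = 1" using \<beta> by simp
 thus "k = 1" using kthk[OF k] by (simp add: \<beta>_def)
 show "\<alpha> (U 1 0) = U 1 0" using cd(3) c1 \<open>0 = d\<close> by simp
qed

text \<open>The action on the central elements \<open>U 0 b\<close> is additive, and conjugation by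
  the torus makes it multiplicative, because every nonzero field element has the form
  \<open>k * th k\<close>. So it is a power of Frobenius; this determines the images of the torus
  and, by conjugating \<open>U 1 0\<close>, those of all \<open>U a 0\<close>.\<close>

lemma aut_normal_form2:
 assumes a: "aut \<alpha>" and t: "\<alpha> (U 0 1) = U 0 1" and tw: "\<alpha> w = w" and t1: "\<alpha> (U 1 0) = U 1 0"
 shows "EX i. ALL x:Cz. \<alpha> x = (fr ^^ i) x"
proof -
 note tU = aut_Us[OF a t]
 have tZ: "EX b':F. \<alpha> (U 0 b) = U 0 b'" if b: "b : F" for b
 proof -
  obtain c d where *: "c : F" "d : F" "\<alpha> (U 0 b) = U c d" using tU[of "U 0 b"] UsI[OF F_0 b] b by (auto simp: Us_def)
  have "\<alpha> (U 0 b) * \<alpha> (U 0 b) = U 0 0" using aut_mult[OF a, of "U 0 b" "U 0 b"] b aut_one[OF a] by (simp add: U_mult U00)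
  hence "c = 0" using * by (simp add: U_mult U_inj)
  thus ?thesis using * by blast
 qed
 have tB: "\<alpha> s : Bs" if s: "s : Bs" for s
 proof (rule ccontr)
  assume "\<alpha> s ~: Bs"
  hence big: "\<alpha> s : big" using aut_closed[OF a Bs_Sz[OF s]] by (auto simp: Sz_carrier)
  have "s * U 0 1 * iv s : Us" using Bs_conj_Us[OF s UsI[of 0 1]] by simp
  hence "\<alpha> (s * U 0 1 * iv s) : Us" using tU Us_Sz by blast
  hence "\<alpha> s * U 0 1 * iv (\<alpha> s) : Bs" using aut_conj[OF a Bs_Sz[OF s] U01(1)] t Us_Bs by simp
  thus False using TI[OF big UsI[of 0 1]] U01 by simp
 qed
 \<comment> \<open>A torus element lies in \<open>Bs\<close> together with its conjugate by
   \<open>w\<close>; by \<open>wuTw_big\<close> no element of \<open>Bs\<close> with a nontrivial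
   unipotent part has this property.\<close>
 have tT: "EX k':tor. \<alpha> (T k) = T k'" if k: "k : tor" for k
 proof -
  obtain x y k' where *: "x : F" "y : F" "k' : tor" "\<alpha> (T k) = U x y * T k'"
   using tB[OF T_Bs[OF k]] by (auto simp: Bs_def)
  have "\<alpha> (w * T k * w) = w * \<alpha> (T k) * w" using k by (simp add: aut_mult[OF a] tw del: as4)
  hence "w * (U x y * T k') * w : Bs" unfolding T_w_T[OF k] *(4) using tB[OF T_Bs[of "inverse k"]] k by simp
  hence "U x y = I4" using wuTw_big[OF UsI[OF *(1,2)] _ *(3)] Bs_big_disj by blast
  thus ?thesis using * by auto
 qed
 define g where "g b = (SOME b'. b' : F & \<alpha> (U 0 b) = U 0 b')" for b
 have g: "g b : F & \<alpha> (U 0 b) = U 0 (g b)" if "b : F" for b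
  unfolding g_def by (rule someI_ex) (use tZ[OF that] in blast)
 have gadd: "g (x + y) = g x + g y" if "x : F" "y : F" for x y
  using aut_mult[OF a, of "U 0 x" "U 0 y"] g[of x] g[of y] g[of "x + y"] that by (simp add: U_mult U_inj)
 have gT: "g (b / (k * th k)) = g b / (k' * th k')" if b: "b : F" and k: "k : tor" "k' : tor" "\<alpha> (T k) = T k'" for b k k'
 proof -
  have "\<alpha> (T k * U 0 b * iv (T k)) = T k' * U 0 (g b) * iv (T k')"
   using aut_conj[OF a, of "T k" "U 0 b"] b k g by simp
  thus ?thesis using T_conj_U[OF k(1) F_0 b] T_conj_U[OF k(2) F_0, of "g b"] g[of b] g[of "b / (k * th k)"] b k torD[of k]
   by (simp add: U_inj)
 qed
 have g1: "g 1 = 1" using g[of 1] t by (simp add: U_inj)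
 have gmul: "g (x * y) = g x * g y" if x: "x : F" and y: "y : F" for x y
 proof (cases "y = 0")
  case True
  thus ?thesis using gadd[of 0 0] by simp
 next
  case False
  obtain k where k: "k : tor" "k * th k = inverse y" using mult_th_surj[of "inverse y"] y False by (auto simp: tor_def)
  obtain k' where k': "k' : tor" "\<alpha> (T k) = T k'" using tT[OF k(1)] by blast
  have "g y = 1 / (k' * th k')" using gT[OF F_1 k(1) k'] k(2) g1 by (simp add: divide_inverse)
  moreover have "g (x * y) = g x / (k' * th k')" using gT[OF x k(1) k'] k(2) by (simp add: divide_inverse)
  ultimately show ?thesis by simp
 qed
 obtain i where i: "!!x. x : F ==> g x = x ^ (2 ^ i)" using field_aut_frob[OF gadd gmul g1] by blast
 have T: "\<alpha> (T k) = T (k ^ (2 ^ i))" if k: "k : tor" for k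
 proof -
  obtain k' where k': "k' : tor" "\<alpha> (T k) = T k'" using tT[OF k] by blast
  note F' = torD[OF k] torD[OF k'(1)]
  have "g (1 / (k * th k)) = 1 / (k' * th k')" using gT[OF F_1 k k'] g1 by simp
  hence "1 / (k * th k) ^ (2 ^ i) = 1 / (k' * th k')" using i[of "1 / (k * th k)"] F' by (simp add: power_one_over)
  hence "k ^ (2 ^ i) * th (k ^ (2 ^ i)) = k' * th k'" using F' by (simp add: power_mult_distrib)
  thus ?thesis using mult_th_inj[of "k ^ (2 ^ i)" k'] F' k'(2) by simp
 qed
 have Ua: "\<alpha> (U x 0) = U (x ^ (2 ^ i)) 0" if x: "x : F" for x
 proof (cases "x = 0")
  case True
  thus ?thesis using g[of 0] i[of 0] by (simp add: power_0_left)
 next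
  case False
  define k where "k = inverse x"
  have k: "k : tor" "k ^ (2 ^ i) : tor" using False x by (auto simp: k_def tor_def)
  have "\<alpha> (T k * U 1 0 * iv (T k)) = T (k ^ (2 ^ i)) * U 1 0 * iv (T (k ^ (2 ^ i)))"
   using aut_conj[OF a, of "T k" "U 1 0"] k T t1 by simp
  thus ?thesis unfolding T_conj_U[OF k(1) F_1 F_0] T_conj_U[OF k(2) F_1 F_0] by (simp add: k_def power_inverse divide_inverse)
 qed
 have Uab: "\<alpha> (U x y) = (fr ^^ i) (U x y)" if "x : F" "y : F" for x y
 proof -
  have "\<alpha> (U x y) = \<alpha> (U x 0) * \<alpha> (U 0 y)" using aut_mult[OF a, of "U x 0" "U 0 y"] that by (simp add: U_mult)
  thus ?thesis using Ua[OF that(1)] g[OF that(2)] i[OF that(2)] that by (simp add: U_mult fr_pow)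
 qed
 have "\<alpha> x = (fr ^^ i) x" if "x : Cz" for x
 proof -
  have tm: "\<alpha> (T k) = (fr ^^ i) (T k)" if "k : tor" for k using T[OF that] by (simp add: fr_pow)
  have tww: "\<alpha> w = (fr ^^ i) w" using tw by (simp add: fr_pow)
  consider "x : Bs" | "x : big" using \<open>x : Cz\<close> by (auto simp: Sz_carrier)
  thus ?thesis
  proof cases
   case 1
   then obtain u v k where *: "u : F" "v : F" "k : tor" "x = U u v * T k" by (auto simp: Bs_def)
   thus ?thesis by (simp only: *(4) aut_mult[OF a] U_Sz T_Sz Uab tm fr_pow_mult)
  next
   case 2
   then obtain u v k c d where *: "u : F" "v : F" "k : tor" "c : F" "d : F" "x = U u v * (T k * (w * U c d))" by (auto simp: big_def)
   thus ?thesis by (simp only: *(6) aut_mult[OF a] U_Sz T_Sz w_Sz Sz_closed Uab tm tww fr_pow_mult)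
  qed
 qed
 thus ?thesis by blast
qed

text \<open>The involution \<open>\<alpha> w\<close> is outside \<open>Bs\<close>: involutions of
  \<open>Bs\<close> lie in \<open>Us\<close>, but \<open>w\<close> does not commute with
  \<open>U 0 1\<close>. Conjugating its left unipotent factor away leaves
  \<open>T k * (w * e)\<close> with \<open>e\<close> in \<open>Us\<close>, and squaring to the
  identity forces \<open>e\<close> to be trivial.\<close>

lemma aut_tw:
 assumes a: "aut \<alpha>" and t: "\<alpha> (U 0 1) = U 0 1"
 shows "EX u:Us. EX k:tor. u * \<alpha> w * iv u = T k * w"
proof -
 define x where "x = \<alpha> w"
 have xS: "x : Cz" using aut_closed[OF a] by (simp add: x_def)
 have xx: "x * x = I4" using aut_mult[OF a, of w w] aut_one[OF a] by (simp add: x_def ww)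
 have "x ~: Us"
 proof
  assume "x : Us"
  hence "\<alpha> w * \<alpha> (U 0 1) * iv (\<alpha> w) = U 0 1" using centralizer_U01[OF xS] by (simp add: x_def t)
  hence "\<alpha> (w * U 0 1 * iv w) = \<alpha> (U 0 1)" using aut_conj[OF a, of w "U 0 1"] U01 t by simp
  hence "w * U 0 1 * iv w = U 0 1" using aut_inj[OF a] U01 by simp
  thus False using centralizer_U01[of w] w_ne Us_Bs by auto
 qed
 have "x ~: Bs"
 proof
  assume "x : Bs"
  then obtain u v k where *: "u : F" "v : F" "k : tor" "x = U u v * T k" by (auto simp: Bs_def)
  note kF = torD[OF *(3)]
  have "x * x = U u v * (T k * (U u v * T k))" using * by simp
  also have "... = U u v * (U (u / k) (v / (k * th k)) * T (k * k))" using * kF by (simp add: TU' T_mult)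
  also have "... = U (u + u / k) (v + v / (k * th k) + u / k * th u) * T (k * k)" using * kF by (simp add: UU')
  finally have e: "x * x = U (u + u / k) (v + v / (k * th k) + u / k * th u) * T (k * k)" .
  have "U (u + u / k) (v + v / (k * th k) + u / k * th u) * T (k * k) = U 0 0 * T 1" unfolding e[symmetric] xx by (simp add: U00 T1)
  hence "k * k = 1" using Bs_inj[of "k * k" 1] *(3) by simp
  hence "k = 1" using sq_inj[of k 1] by simp
  thus False using \<open>x ~: Us\<close> * UsI by (simp add: T1)
 qed
 then obtain u v k c d where *: "u : F" "v : F" "k : tor" "c : F" "d : F" "x = U u v * (T k * (w * U c d))"
  using xS by (auto simp: Sz_carrier big_def)
 define s where "s = iv (U u v)"
 have s: "s : Us" "s : Cz" "iv s = U u v"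
  using * subgroup.m_inv_closed[OF Us_subgroup UsI[OF *(1,2)]] by (simp_all add: s_def)
 define y where "y = s * x * iv s"
 obtain e where e: "e : Us" "e = U c d * U u v" using Us_mult UsI * by simp
 have em: "e : cmat 4 4" using Us_Sz[OF e(1)] by simp
 have "s * x = (s * U u v) * (T k * (w * U c d))" unfolding *(6) using * s by simp
 hence y: "y = T k * (w * e)" unfolding y_def s(3) e(2) using * s by (simp add: s_def)
 have "y * y = s * (x * x) * iv s" unfolding y_def by (rule conj_mult[OF s(2) xS xS, symmetric])
 hence "y * y = I4" unfolding xx by (simp only: one4[OF Sz_mat[OF s(2)]] Sz_inv(1)[OF s(2)])
 hence "T k * (w * (e * (T k * (w * e)))) = I4" unfolding y using em by simp
 hence e1: "(T k * (w * (e * T k) * w)) * e = I4" using em by simp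
 have "e = I4"
 proof (rule ccontr)
  assume ne: "e ~= I4"
  have big: "T k * (w * (e * T k) * w) : big" by (rule T_left(2)[OF *(3) wuTw_big[OF e(1) ne *(3)]])
  have "iv e = T k * (w * (e * T k) * w)"
   by (rule Sz_invI) (use e1 Us_Sz[OF e(1)] big_Sz[OF big] in auto)
  thus False using big subgroup.m_inv_closed[OF Us_subgroup e(1)] Us_Bs Bs_big_disj by auto
 qed
 thus ?thesis using y y_def x_def s(1) *(3) by auto
qed

theorem aut_classification:
 assumes a: "aut \<alpha>"
 shows "EX s:Cz. EX i. ALL x:Cz. \<alpha> x = s * (fr ^^ i) x * iv s"
proof -
 have "\<alpha> (U 0 1) ~= I4" using aut_inj[OF a U01(1) Sz_one_closed] U01(2) aut_one[OF a] by simp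
 moreover have "\<alpha> (U 0 1) * \<alpha> (U 0 1) = I4" using aut_mult[OF a U01(1) U01(1)] U01(3) aut_one[OF a] by simp
 ultimately obtain s where s: "s : Cz" "s * \<alpha> (U 0 1) * iv s = w"
  using involution_conj_w aut_closed[OF a U01(1)] by blast
 obtain t where t: "t : Cz" "t * U 0 1 * iv t = w" using involution_conj_w[OF U01] by blast
 define v where "v = iv t * s"
 have v: "v : Cz" using s t by (simp add: v_def)
 have it: "iv t : Cz" "iv (iv t) = t" using t by simp_all
 have "v * \<alpha> (U 0 1) * iv v = iv t * (t * U 0 1 * iv t) * t"
  unfolding v_def t(2) using conj_conj[OF s(1) it(1) aut_closed[OF a U01(1)]] unfolding s(2) it(2) by simp
 hence v1: "v * \<alpha> (U 0 1) * iv v = U 0 1" using conj_undo(1)[OF t(1) U01(1)] by simp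
 define \<alpha>1 where "\<alpha>1 x = v * \<alpha> x * iv v" for x
 have a1: "aut \<alpha>1" unfolding \<alpha>1_def using aut_comp_conj[OF a v] .
 obtain u k where u: "u : Us" "k : tor" "u * \<alpha>1 w * iv u = T k * w" using aut_tw[OF a1] v1 \<alpha>1_def by metis
 have uS: "u : Cz" using Us_Sz u by blast
 define \<alpha>2 where "\<alpha>2 x = u * \<alpha>1 x * iv u" for x
 have a2: "aut \<alpha>2" unfolding \<alpha>2_def using aut_comp_conj[OF a1 uS] .
 have t2: "\<alpha>2 (U 0 1) = U 0 1" using centralizer_U01[OF uS] u(1) v1 by (simp add: \<alpha>2_def \<alpha>1_def)
 have w2: "\<alpha>2 w = T k * w" using u(3) by (simp add: \<alpha>2_def)
 have "k = 1" "\<alpha>2 (U 1 0) = U 1 0" using aut_normal_form1[OF a2 t2 u(2) w2] by auto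
 moreover hence "\<alpha>2 w = w" using w2 by (simp add: T1)
 ultimately obtain i where i: "!!x. x : Cz ==> \<alpha>2 x = (fr ^^ i) x" using aut_normal_form2[OF a2 t2] by blast
 define z where "z = u * v"
 have z: "z : Cz" using uS v by (simp add: z_def)
 have "\<alpha> x = iv z * (fr ^^ i) x * iv (iv z)" if x: "x : Cz" for x
 proof -
  have "(fr ^^ i) x = z * \<alpha> x * iv z"
   using i[OF x] conj_conj[OF v uS aut_closed[OF a x]] by (simp add: \<alpha>2_def \<alpha>1_def z_def)
  thus ?thesis using conj_undo(1)[OF z aut_closed[OF a x]] z by simp
 qed
 thus ?thesis using z by (intro bexI[of _ "iv z"] exI[of _ i]) auto
qed

end

section \<open>The automorphism group and its subgroups containing the inner automorphisms\<close>

lemma pow2_minus1_dvd: "0 < D ==> (2 ^ D - 1 :: nat) dvd 2 ^ i - 1 ==> D dvd i"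
proof (induction i rule: less_induct)
 case (less i)
 show ?case
 proof (cases "D <= i")
  case True
  have "(2 ^ i - 1 :: nat) = 2 ^ (i - D) * (2 ^ D - 1) + (2 ^ (i - D) - 1)"
  proof -
   have "(2 ^ i :: nat) = 2 ^ (i - D) * 2 ^ D" using True by (simp flip: power_add)
   moreover have "(1 :: nat) <= 2 ^ (i - D)" "(1 :: nat) <= 2 ^ D" by simp_all
   ultimately show ?thesis by (simp add: diff_mult_distrib2)
  qed
  hence "(2 ^ D - 1 :: nat) dvd 2 ^ (i - D) - 1" using less.prems(2) by (metis dvd_add_right_iff dvd_triv_right)
  hence "D dvd i - D" using less.IH[of "i - D"] less.prems(1) True by simp
  thus ?thesis using True by (metis dvd_diffD dvd_refl)
 next
  case False
  show ?thesis
  proof (cases "i = 0")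
   case False
   hence "0 < (2 ^ i - 1 :: nat)" by (metis one_less_numeral_iff one_less_power semiring_norm(76) zero_less_diff neq0_conv)
   hence "(2 ^ D - 1 :: nat) <= 2 ^ i - 1" using less.prems(2) by (rule dvd_imp_le[rotated])
   moreover have "(2 ^ i :: nat) < 2 ^ D" using \<open>~ D <= i\<close> by simp
   moreover have "(1 :: nat) <= 2 ^ i" by simp
   ultimately show ?thesis by linarith
  qed simp
 qed
qed

context suzuki
begin

definition DD :: nat where "DD = 2 * f + 1"

lemma fr_pow_mod: "x : Cz ==> (fr ^^ i) x = (fr ^^ (i mod DD)) x"
proof -
 assume x: "x : Cz"
 have *: "(fr ^^ (DD * n)) y = y" if "y : Cz" for n y
  using that by (induction n) (simp_all add: funpow_add fr_pow_D[folded DD_def])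
 have "(fr ^^ i) x = (fr ^^ (DD * (i div DD) + i mod DD)) x" by simp
 also have "... = (fr ^^ (DD * (i div DD))) ((fr ^^ (i mod DD)) x)" by (simp only: funpow_add comp_apply)
 also have "... = (fr ^^ (i mod DD)) x" by (rule *) (use x in simp)
 finally show ?thesis .
qed

lemma tr_fr_pow: "x : cmat n n ==> mat_trace ((fr ^^ i) x) = (mat_trace x) ^ (2 ^ i)"
proof (induction i)
 case (Suc i)
 have "(fr ^^ i) x : cmat n n" using Suc.prems by (induction i) auto
 thus ?case using Suc by (simp add: tr_fr power_mult[symmetric] mult.commute)
qed simp

text \<open>Inner automorphisms preserve traces, whereas \<open>fr ^^ i\<close> raises them to the
  power \<open>2 ^ i\<close>; the trace of \<open>ga \<zeta>\<close> is a generator of the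
  multiplicative group of \<open>F\<close>.\<close>

lemma fr_inner:
 assumes s: "s : Cz" and e: "!!x. x : Cz ==> (fr ^^ i) x = s * x * iv s"
 shows "DD dvd i"
proof -
 obtain \<zeta> :: F2bar where \<zeta>: "!!i. \<zeta> ^ i = 1 <-> (Q - 1) dvd i" using primitive_root_exists[OF odd_Q1] by blast
 have z0: "\<zeta> ~= 0" using \<zeta>[of "Q - 1"] Q_ge by (auto simp: power_0_left)
 have zF: "\<zeta> : F" using F_minus_0[OF z0] \<zeta> by simp
 have g: "ga \<zeta> : Cz" "tr (ga \<zeta>) = \<zeta>" using zF tr_ga by auto
 have "\<zeta> ^ (2 ^ i) = tr ((fr ^^ i) (ga \<zeta>))" using tr_fr_pow[of "ga \<zeta>" 4 i] g by simp
 also have "... = \<zeta>" using e[OF g(1)] tr_conj[OF s g(1)] g(2) by simp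
 finally have "\<zeta> ^ (2 ^ i) = \<zeta>" .
 moreover have "\<zeta> ^ (2 ^ i) = \<zeta> * \<zeta> ^ (2 ^ i - 1)" by (simp flip: power_Suc)
 ultimately have "\<zeta> ^ (2 ^ i - 1) = 1" using z0 by simp
 hence "(Q - 1) dvd 2 ^ i - 1" using \<zeta> by blast
 thus ?thesis using pow2_minus1_dvd[of DD i] by (simp add: Q_def DD_def)
qed

text \<open>The quotient \<open>z\<close> commutes with \<open>U 0 1\<close>, so it lies in
  \<open>Us\<close>, and with \<open>w\<close>, so it is trivial by
  \<open>w_conj_Us\<close>.\<close>

lemma center_trivial:
 assumes s: "s : Cz" "t : Cz"
  and e: "!!x. x : Cz ==> s * x * iv s = t * x * iv t"
 shows "s = t"
proof -
 define z where "z = iv t * s"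
 have z: "z : Cz" using s by (simp add: z_def)
 have it: "iv t : Cz" "iv (iv t) = t" using s by auto
 have zx: "z * x * iv z = x" if x: "x : Cz" for x
 proof -
  have "z * x * iv z = iv t * (s * x * iv s) * t"
   unfolding z_def conj_conj[OF s(1) it(1) x, symmetric] it(2) ..
  thus ?thesis unfolding e[OF x] conj_undo(1)[OF s(2) x] .
 qed
 have zU: "z : Us" using zx[OF U01(1)] centralizer_U01[OF z] by simp
 have "z * w * iv z * z = w * z" using zx[of w] by simp
 hence zw: "z * w = w * z" using z by simp
 have "w * z * w = z" unfolding zw[symmetric] using z by (simp add: ww)
 hence "z = I4" using w_conj_Us[OF zU] zU Us_Bs Bs_big_disj by fastforce
 moreover have "t * z = s" unfolding z_def using s Sz.mult_inv_cancel[of t s] by simp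
 ultimately show ?thesis using s by simp
qed

definition inn :: "F2bar mat => F2bar mat => F2bar mat" where
 "inn s = (\<lambda>h\<in>Cz. s * h * iv s)"

definition frr :: "nat => F2bar mat => F2bar mat" where "frr i = restrict (fr ^^ i) (Cz)"

lemma Inn_eq: "Inn Sz = inn ` Cz" by (auto simp: Inn_def inn_def)

lemma auto_aut: "\<alpha> : auto Sz ==> aut \<alpha>" and aut_auto: "aut \<alpha> ==> restrict \<alpha> (Cz) : auto Sz"
 and auto_ext: "\<alpha> : auto Sz ==> \<alpha> : extensional (Cz)"
proof -
 show "\<alpha> : auto Sz ==> aut \<alpha>" by (auto simp: auto_def hom_def Bij_def aut_def)
 show "\<alpha> : auto Sz ==> \<alpha> : extensional (Cz)" by (auto simp: auto_def Bij_def)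
 assume a: "aut \<alpha>"
 have "bij_betw (restrict \<alpha> (Cz)) (Cz) (Cz)"
  using a unfolding aut_def by (subst bij_betw_cong[where g = \<alpha>]) simp_all
 thus "restrict \<alpha> (Cz) : auto Sz"
  using aut_mult[OF a] aut_closed[OF a] by (auto simp: auto_def hom_def Bij_def)
qed

lemma id_aut: "aut (%x. x)" using bij_betw_id[of "Cz"] by (simp add: aut_def id_def)

lemma inn_auto: "s : Cz ==> inn s : auto Sz"
 unfolding inn_def by (rule aut_auto[OF aut_comp_conj[OF id_aut]])

lemma frr_auto: "frr i : auto Sz"
proof -
 have "bij_betw fr (Cz) (Cz)" using fr_inj fr_image by (simp add: bij_betw_def)
 note bf = this
 have "bij_betw (fr ^^ i) (Cz) (Cz)"
 proof (induction i)
  case 0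
  thus ?case by (simp add: bij_betw_def)
 next
  case (Suc i)
  thus ?case using bij_betw_trans[OF Suc bf] by (simp only: funpow.simps)
 qed
 thus ?thesis unfolding frr_def by (intro aut_auto) (simp add: aut_def fr_pow_mult)
qed

abbreviation "AG == AutoGroup Sz"

lemma AG_mult: "g : auto Sz ==> h : auto Sz ==> monoid.mult AG g h = compose (Cz) g h"
 by (simp add: AutoGroup_def BijGroup_def auto_def)

lemma AG_one: "one AG = (\<lambda>x\<in>Cz. x)" and AG_carrier: "carrier AG = auto Sz"
 by (simp_all add: AutoGroup_def BijGroup_def)

lemma frr_add: "monoid.mult AG (frr i) (frr k) = frr (i + k)"
 unfolding AG_mult[OF frr_auto frr_auto] by (auto simp: compose_def frr_def funpow_add)

lemma frr_mod: "frr i = frr (i mod DD)"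
 unfolding frr_def using fr_pow_mod by (intro restrict_ext) blast

lemma frr_DD: "DD dvd i ==> frr i = one AG"
 unfolding AG_one by (subst frr_mod) (simp add: frr_def id_def)

lemma inn_frr: "s : Cz ==> x : Cz ==> monoid.mult AG (inn s) (frr i) x = s * (fr ^^ i) x * iv s"
 unfolding AG_mult[OF inn_auto frr_auto] by (simp add: compose_def frr_def inn_def)

lemma inn_mult: "s : Cz ==> t : Cz ==> inn (s * t) = monoid.mult AG (inn s) (inn t)"
proof -
 assume s: "s : Cz" and t: "t : Cz"
 show ?thesis unfolding AG_mult[OF inn_auto[OF s] inn_auto[OF t]]
  unfolding compose_def inn_def by (rule restrict_ext) (use conj_conj[OF t s] s t in \<open>simp del: as4\<close>)
qed

lemma auto_decomp:
 assumes g: "g : auto Sz"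
 obtains s i where "s : Cz" "g = monoid.mult AG (inn s) (frr i)"
proof -
 obtain s i where si: "s : Cz" "!!x. x : Cz ==> g x = s * (fr ^^ i) x * iv s"
  using aut_classification[OF auto_aut[OF g]] by blast
 have "g = monoid.mult AG (inn s) (frr i)"
 proof (rule extensionalityI[OF auto_ext[OF g]])
  show "monoid.mult AG (inn s) (frr i) : extensional (Cz)"
   unfolding AG_mult[OF inn_auto[OF si(1)] frr_auto] by (simp add: compose_def)
 qed (simp only: si(2) inn_frr[OF si(1)])
 thus thesis using that si(1) by blast
qed

text \<open>Let \<open>j\<close> be the least positive exponent with \<open>frr j\<close> in
  \<open>G\<close>. The inner factor of an element of \<open>G\<close> can be removed inside
  \<open>G\<close>, so what remains is a power of \<open>frr j\<close>. This gives a split extension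
  by a cyclic group of order \<open>DD / j\<close>, and Lagrange's theorem identifies this order
  with \<open>d\<close>.\<close>

theorem aut_structure:
 assumes G: "subgroup G AG" and Inn: "Inn Sz <= G" and d: "d = group_index (AG(|carrier := G|)) (Inn Sz)"
 shows "EX j. d * j = DD & (G = auto Sz <-> j = 1) & cyc_ext (AG(|carrier := G|)) Sz inn (frr j) (fr ^^ j) d"
proof -
 let ?G = "AG(|carrier := G|)"
 have grp: "group AG" by (rule Sz.AutoGroup)
 have Gauto: "G <= auto Sz" using subgroup.subset[OF G] by (simp add: AG_carrier)
 have "auto Sz <= Cz \<rightarrow>\<^sub>E Cz" using auto_aut aut_closed auto_ext by (auto simp: PiE_def)
 hence "finite (auto Sz)" by (rule finite_subset) (simp add: finite_PiE)
 hence fG: "finite G" using Gauto by (rule finite_subset[rotated])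
 have Ggrp: "group ?G" by (rule subgroup.subgroup_is_group[OF G grp])
 interpret G: fin_group ?G by (intro fin_group.intro Ggrp fin_group_axioms.intro) (simp add: fG)
 have Gm: "monoid.mult AG g h : G" if "g : G" "h : G" for g h using subgroup.m_closed[OF G that] .
 have G1: "one AG : G" using subgroup.one_closed[OF G] .
 have innG: "inn s : G" if "s : Cz" for s using Inn that by (auto simp: Inn_eq)
 have DD0: "0 < DD" by (simp add: DD_def)
 define j where "j = (LEAST i. 0 < i & frr i : G)"
 have ex: "0 < DD & frr DD : G" using DD0 G1 frr_DD[of DD] by simp
 have j: "0 < j" "frr j : G" using LeastI[where P = "%i. 0 < i & frr i : G", OF ex] by (auto simp: j_def)
 have frrm: "frr (k * i) : G" if "frr i : G" for i k
 proof (induction k)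
  case 0 thus ?case using G1 frr_DD[of 0] by simp
 next
  case (Suc k) thus ?case using Gm[OF that Suc] by (simp add: frr_add)
 qed
 have jd: "frr i : G <-> j dvd i" for i
 proof
  assume i: "frr i : G"
  define m where "m = i div j * j"
  \<comment> \<open>Multiplication by \<open>DD - 1\<close> plays the role of a sign: modulo
    \<open>DD\<close> the exponent is \<open>i - m = i mod j\<close>.\<close>
  have "frr (i + m * (DD - 1)) : G" using Gm[OF i frrm[OF frrm[OF j(2)], of "DD - 1" "i div j"]] unfolding frr_add m_def by (simp add: mult_ac)
  also have "i + m * (DD - 1) = i mod j + m * DD" using DD0 by (cases DD) (simp_all add: m_def algebra_simps)
  also have "frr (i mod j + m * DD) = frr (i mod j)" by (subst frr_mod, subst (2) frr_mod) simp
  finally have "~ 0 < i mod j" using not_less_Least[where P = "%i. 0 < i & frr i : G", of "i mod j"] j(1) by (auto simp: j_def)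
  thus "j dvd i" by (simp add: dvd_eq_mod_eq_0)
 next
  assume "j dvd i"
  thus "frr i : G" using frrm[OF j(2)] by (metis dvd_def mult.commute)
 qed
 have "j dvd DD" using jd ex by blast
 then obtain e where e: "DD = e * j" by (metis dvd_def mult.commute)
 have e0: "0 < e" using e DD0 by (cases e) auto
 have pow: "frr j [^]\<^bsub>?G\<^esub> i = frr (j * i)" for i :: nat
 proof (induction i)
  case 0 thus ?case using frr_DD[of 0] by simp
 next
  case (Suc i) thus ?case by (simp add: frr_add add.commute)
 qed
 have decomp: "EX s:Cz. EX i. g = monoid.mult AG (inn s) (frr i) & j dvd i" if g: "g : G" for g
 proof -
  obtain s i where si: "s : Cz" and geq: "g = monoid.mult AG (inn s) (frr i)" using auto_decomp g Gauto by blast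
  have "monoid.mult AG (inn (iv s)) g = frr i"
  proof -
   have ic: "inn (iv s) : carrier AG" "inn s : carrier AG" "frr i : carrier AG"
    using inn_auto si frr_auto by (auto simp: AG_carrier)
   have "monoid.mult AG (inn (iv s)) g = monoid.mult AG (monoid.mult AG (inn (iv s)) (inn s)) (frr i)"
    unfolding geq using monoid.m_assoc[OF group.is_monoid[OF grp] ic] by simp
   also have "monoid.mult AG (inn (iv s)) (inn s) = frr 0"
    using inn_mult[of "iv s" s] si by (simp add: inn_def frr_def Sz.inv_one[simplified] cong: restrict_cong)
   finally show ?thesis by (simp add: frr_add)
  qed
  hence "frr i : G" using Gm[OF innG g, of "iv s"] si by simp
  thus ?thesis using geq si jd by blast
 qed
 have cyc: "cyc_ext ?G Sz inn (frr j) (fr ^^ j) e"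
 proof (intro cyc_ext.intro cyc_ext_axioms.intro)
  show "fin_group ?G" "fin_group Sz" by unfold_locales
  show "0 < e" by (rule e0)
  show "inn : hom Sz ?G" using innG inn_mult by (auto simp: hom_def)
  show "frr j : carrier ?G" using j by simp
  show "frr j [^]\<^bsub>?G\<^esub> e = \<one>\<^bsub>?G\<^esub>" unfolding pow using frr_DD[of "j * e"] e by (simp add: mult.commute)
  show "(fr ^^ j) s : Cz" if "s : Cz" for s using that by simp
  show "frr j \<otimes>\<^bsub>?G\<^esub> inn s = inn ((fr ^^ j) s) \<otimes>\<^bsub>?G\<^esub> frr j" if s: "s : Cz" for s
  proof -
   have fs: "(fr ^^ j) s : Cz" using s by simp
   have fc: "(fr ^^ j) (s * x * iv s) = (fr ^^ j) s * (fr ^^ j) x * iv ((fr ^^ j) s)" if "x : Cz" for x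
    using that s by (induction j) (simp_all add: fr_conj del: as4)
   show ?thesis using AG_mult[OF frr_auto inn_auto[OF s]] AG_mult[OF inn_auto[OF fs] frr_auto] s fc
    by (auto simp: compose_def frr_def inn_def fun_eq_iff simp del: as4)
  qed
  show "s = s' & i = k" if s: "s : Cz" "s' : Cz" and ik: "i < e" "k < e"
   and eq: "inn s \<otimes>\<^bsub>?G\<^esub> frr j [^]\<^bsub>?G\<^esub> i = inn s' \<otimes>\<^bsub>?G\<^esub> frr j [^]\<^bsub>?G\<^esub> k" for s s' i k
  proof -
   have eqx: "s * (fr ^^ (j * i)) x * iv s = s' * (fr ^^ (j * k)) x * iv s'" if "x : Cz" for x
    using fun_cong[OF eq, of x] inn_frr[OF s(1) that] inn_frr[OF s(2) that] unfolding pow by simp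
   \<comment> \<open>The exponent \<open>j * i - j * k\<close> modulo \<open>DD\<close>, written
     without subtraction.\<close>
   define n where "n = j * i + j * k * (DD - 1)"
   let ?u = "iv s * s'"
   have v: "iv s : Cz" "?u : Cz" using s by auto
   have "(fr ^^ n) y = ?u * y * iv ?u" if y: "y : Cz" for y
   proof -
    have "j * k + j * k * (DD - 1) = DD * (j * k)" using DD0 by (cases DD) auto
    hence "(fr ^^ (j * k)) ((fr ^^ (j * k * (DD - 1))) y) = y"
     using fr_pow_mod[OF y, of "DD * (j * k)"] funpow_add[of "j * k" "j * k * (DD - 1)" fr] by simp
    hence "s * (fr ^^ n) y * iv s = s' * y * iv s'"
     using eqx[of "(fr ^^ (j * k * (DD - 1))) y"] y by (simp add: n_def funpow_add)
    hence "iv s * (s * (fr ^^ n) y * iv s) * s = iv s * (s' * y * iv s') * iv (iv s)" using s by simp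
    thus ?thesis unfolding conj_undo(1)[OF s(1) fr_pow_Sz[OF y]] conj_conj[OF s(2) v(1) y] .
   qed
   from fr_inner[OF v(2) this] have "j * e dvd j * (i + k * (DD - 1))" by (simp add: n_def e ring_distribs mult_ac)
   then obtain p where "i + k * (DD - 1) = e * p" using j(1) by (auto elim: dvdE)
   moreover have "k * (DD - 1) + k = k * DD" using DD0 by (cases DD) auto
   ultimately have "e * p + k = i + e * (j * k)" by (simp add: e mult_ac)
   hence "(e * p + k) mod e = (i + e * (j * k)) mod e" by (rule arg_cong)
   hence "i = k" using ik by simp
   moreover have "s = s'"
   proof (rule center_trivial[OF s])
    fix y assume y: "y : Cz"
    then obtain x where x: "x : Cz" "y = (fr ^^ (j * i)) x"
     using aut_surj[OF auto_aut[OF frr_auto[of "j * i"]] y] by (auto simp: frr_def)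
    thus "s * y * iv s = s' * y * iv s'" using eqx[OF x(1)] \<open>i = k\<close> by simp
   qed
   ultimately show ?thesis by simp
  qed
  show "EX s:Cz. EX i<e. g = inn s \<otimes>\<^bsub>?G\<^esub> frr j [^]\<^bsub>?G\<^esub> i" if g: "g : carrier ?G" for g
  proof -
   have gG: "g : G" using g by simp
   obtain s i where si: "s : Cz" "g = monoid.mult AG (inn s) (frr i)" "j dvd i" using decomp[OF gG] by blast
   obtain k where k: "i = j * k" using si(3) by (elim dvdE)
   have "frr i = frr (i mod DD)" by (rule frr_mod)
   also have "i mod DD = j * (k mod e)" unfolding k e mult.commute[of e] by (rule mult_mod_right[symmetric])
   finally have "frr i = frr (j * (k mod e))" .
   thus ?thesis using si(1,2) e0 by (intro bexI[of _ s] exI[of _ "k mod e"]) (simp_all add: pow)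
  qed
 qed
 interpret C: cyc_ext ?G Sz inn "frr j" "fr ^^ j" e by (rule cyc)
 have "subgroup (Inn Sz) ?G" unfolding Inn_eq
  using group_hom.img_is_subgroup[OF C.iota_hom] by simp
 hence "card (rcosets\<^bsub>?G\<^esub> (Inn Sz)) * card (Inn Sz) = Coset.order ?G" by (rule G.lagrange)
 also have "... = card (Cz) * e" using C.card_G by (simp add: Coset.order_def)
 also have "card (Inn Sz) = card (Cz)" unfolding Inn_eq
  by (rule card_image) (auto intro!: inj_onI dest: C.iota_inj)
 finally have "d = e" unfolding d group_index_def using Sz.card_pos by simp
 moreover have "G = auto Sz <-> j = 1"
 proof
  assume "G = auto Sz"
  hence "j dvd 1" using jd[of 1] frr_auto by simp
  thus "j = 1" by simp
 next
  assume j1: "j = 1"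
  have "g : G" if g: "g : auto Sz" for g
  proof -
   obtain s i where "s : Cz" "g = monoid.mult AG (inn s) (frr i)" using auto_decomp[OF g] .
   thus ?thesis using Gm[OF innG] jd[of i] j1 by simp
  qed
  thus "G = auto Sz" using Gauto by blast
 qed
 ultimately show ?thesis using e cyc by (intro exI[of _ j]) simp
qed

end

section \<open>Orbits of the Frobenius automorphism on characters\<close>

text \<open>With \<open>b\<^sup>2 = 2 a\<close> one has \<open>a\<^sup>2 + 1 = (a + b + 1) (a - b + 1)\<close>; modulo the first factor
 \<open>a\<^sup>4 = 1\<close>, so only the residue of \<open>e\<close> modulo \<open>4\<close> matters.\<close>

lemma aurifeuillian:
 fixes a b :: int
 assumes b: "b * b = 2 * a"
 shows "e mod 4 : {0, 3} ==> a + b + 1 dvd a ^ (2 * e + 1) + b * a ^ e + 1"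
  and "e mod 4 : {1, 2} ==> a + b + 1 dvd a ^ (2 * e + 1) - b * a ^ e + 1"
proof -
 define X' where "X' = a + b + 1"
 have X2: "X' * (a - b + 1) = a * a + 1" using b by (simp add: X'_def algebra_simps)
 hence d2: "X' dvd a * a + 1" by (metis dvd_triv_left)
 have "a ^ 4 - 1 = (a * a + 1) * (a * a - 1)" by (simp add: algebra_simps power4_eq_xxxx)
 hence "X' dvd a ^ 4 - 1" using d2 by (metis dvd_mult2)
 hence a4: "[a ^ 4 = 1] (mod X')" by (simp add: cong_iff_dvd_diff)
 define u v where "u = e div 4" and "v = e mod 4"
 have e: "e = 4 * u + v" by (simp add: u_def v_def)
 have "[(a ^ 4) ^ u = 1 ^ u] (mod X')" "[(a ^ 4) ^ (2 * u) = 1 ^ (2 * u)] (mod X')" using a4 cong_pow by blast+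
 hence "[(a ^ 4) ^ u * a ^ v = 1 * a ^ v] (mod X')" "[(a ^ 4) ^ (2 * u) * a ^ (2 * v + 1) = 1 * a ^ (2 * v + 1)] (mod X')"
  unfolding power_one by (blast intro: cong_scalar_right)+
 hence ce: "[a ^ e = a ^ v] (mod X')" "[a ^ (2 * e + 1) = a ^ (2 * v + 1)] (mod X')"
  unfolding e by (simp_all add: power_add power_mult[symmetric] mult.commute mult.left_commute) (simp_all add: mult.assoc)
 have red: "X' dvd a ^ (2 * e + 1) + s * (b * a ^ e) + 1 <-> X' dvd a ^ (2 * v + 1) + s * (b * a ^ v) + 1" for s
 proof -
  have "[a ^ (2 * e + 1) + s * (b * a ^ e) + 1 = a ^ (2 * v + 1) + s * (b * a ^ v) + 1] (mod X')"
   by (intro cong_add cong_mult cong_refl ce)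
  thus ?thesis by (rule cong_dvd_iff)
 qed
 have m: "X' dvd y" if "y = X' * s + (a * a + 1) * t" for y s t using that d2 by simp
 show "a + b + 1 dvd a ^ (2 * e + 1) + b * a ^ e + 1" if "e mod 4 : {0, 3}"
 proof -
  have "v = 0 | v = 3" using that by (auto simp: v_def)
  hence "X' dvd a ^ (2 * v + 1) + 1 * (b * a ^ v) + 1"
  proof
   assume "v = 3"
   thus ?thesis by (intro m[of _ "- a" "a ^ 5 - a ^ 3 + a + a * b + 1"]) (simp add: X'_def algebra_simps numeral_eq_Suc)
  qed (simp add: X'_def add_ac)
  thus ?thesis using red[of 1] by (simp add: X'_def)
 qed
 show "a + b + 1 dvd a ^ (2 * e + 1) - b * a ^ e + 1" if "e mod 4 : {1, 2}"
 proof -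
  have "v = 1 | v = 2" using that by (auto simp: v_def)
  hence "X' dvd a ^ (2 * v + 1) + - 1 * (b * a ^ v) + 1"
  proof
   assume "v = 1"
   thus ?thesis by (intro m[of _ "- a" "a + 1"]) (simp add: X'_def algebra_simps numeral_eq_Suc)
  next
   assume "v = 2"
   thus ?thesis by (intro m[of _ 1 "a ^ 3 - a - b"]) (simp add: X'_def algebra_simps numeral_eq_Suc)
  qed
  thus ?thesis using red[of "- 1"] by (simp add: X'_def)
 qed
qed

section \<open>Divisibility of the torus orders\<close>

context suzuki
begin

text \<open>Both factors of the odd number \<open>DD\<close> are odd. With \<open>a = 2 ^ m\<close>
  and \<open>b = 2 ^ (p + 1)\<close> the numbers \<open>Q\<close> and \<open>R\<close> become
  \<open>a ^ (2 * e + 1)\<close> and \<open>b * a ^ e\<close>, the shape required by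
  \<open>aurifeuillian\<close>.\<close>

lemma DD_factor:
 assumes "DD = m * c"
 obtains p e where "m = 2 * p + 1" "c = 2 * e + 1" "f = 2 * p * e + p + e" "int Q = (2 ^ m) ^ c" "int R = 2 ^ (p + 1) * (2 ^ m) ^ e"
proof -
 have "odd m" "odd c" using assms by (metis DD_def even_mult_iff odd_two_times_div_two_succ even_plus_one_iff dvd_triv_left)+
 then obtain p e where pe: "m = 2 * p + 1" "c = 2 * e + 1" by (meson oddE)
 have f: "f = 2 * p * e + p + e" using assms unfolding pe DD_def by (simp add: algebra_simps)
 have "int Q = (2 ^ m) ^ c" using assms by (simp add: Q_def DD_def power_mult[symmetric])
 moreover have "f + 1 = (p + 1) + m * e" unfolding f pe by (simp add: algebra_simps)
 hence "int R = 2 ^ (p + 1) * (2 ^ m) ^ e" by (simp only: R_def power_add power_mult of_nat_power of_nat_mult of_nat_numeral)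
 ultimately show ?thesis using that pe f by blast
qed

lemma int_N: "int Np = int Q + int R + 1" "int Nm = int Q - int R + 1"
 using R_le by (simp_all add: Np_def Nm_def of_nat_diff)

lemma pow_bb: "2 ^ (p + 1) * 2 ^ (p + 1) = 2 * (2 ^ (2 * p + 1) :: int)"
 by (simp add: power_add power_mult_distrib power2_eq_square mult_2[of p])

text \<open>The torus orders belonging to the subfield with \<open>2 ^ m\<close> elements divide
  those belonging to \<open>F\<close>, and the residue of \<open>e\<close> decides which divides
  which. Both signs of \<open>b\<close> are used in \<open>aurifeuillian\<close>.\<close>

lemma AB_dvd:
 assumes "DD = m * c" "m = 2 * p + 1" "c = 2 * e + 1"
 shows "e mod 4 : {0, 3} ==> 2 ^ m + 2 ^ (p + 1) + 1 dvd int Np" "e mod 4 : {0, 3} ==> 2 ^ m - 2 ^ (p + 1) + 1 dvd int Nm"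
  "e mod 4 : {1, 2} ==> 2 ^ m + 2 ^ (p + 1) + 1 dvd int Nm" "e mod 4 : {1, 2} ==> 2 ^ m - 2 ^ (p + 1) + 1 dvd int Np"
proof -
 obtain p' e' where pe: "m = 2 * p' + 1" "c = 2 * e' + 1" and Q: "int Q = (2 ^ m) ^ c" and R: "int R = 2 ^ (p' + 1) * (2 ^ m) ^ e'"
  using DD_factor[OF assms(1)] by metis
 have p: "p' = p" "e' = e" using pe assms by simp_all
 have bb: "2 ^ (p + 1) * 2 ^ (p + 1) = 2 * (2 ^ m :: int)" "- (2 ^ (p + 1)) * - (2 ^ (p + 1)) = 2 * (2 ^ m :: int)"
  unfolding assms(2) using pow_bb[of p] by simp_all
 note a1 = aurifeuillian[OF bb(1), of e] and a2 = aurifeuillian[OF bb(2), of e]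
 show "e mod 4 : {0, 3} ==> 2 ^ m + 2 ^ (p + 1) + 1 dvd int Np" "e mod 4 : {0, 3} ==> 2 ^ m - 2 ^ (p + 1) + 1 dvd int Nm"
  "e mod 4 : {1, 2} ==> 2 ^ m + 2 ^ (p + 1) + 1 dvd int Nm" "e mod 4 : {1, 2} ==> 2 ^ m - 2 ^ (p + 1) + 1 dvd int Np"
  using a1 a2 unfolding int_N Q R p assms(3) by (simp_all only: minus_mult_left[symmetric] add_uminus_conv_diff diff_minus_eq_add)
qed

lemma xor_iff: "A --> B ==> A' --> B' ==> ~ (B & B') ==> A | A' ==> ~ (A & A') ==> (B <-> A) & (B' <-> A')"
 by blast

text \<open>The case \<open>m = 1\<close>, \<open>p = 0\<close>, where \<open>2 + 2 + 1 = 5\<close>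
  and \<open>e = f\<close>. As \<open>Np\<close> and \<open>Nm\<close> are coprime, the two
  implications become equivalences.\<close>

lemma five_dvd: "5 dvd Np <-> f mod 4 : {0, 3}" "5 dvd Nm <-> f mod 4 : {1, 2}"
proof -
 have "DD = 1 * DD" by simp
 note ab = AB_dvd[OF this, of 0 f]
 have 1: "f mod 4 : {0, 3} --> 5 dvd Np" "f mod 4 : {1, 2} --> 5 dvd Nm"
  using ab(1,3) int_dvd_int_iff[of 5] by (simp_all add: DD_def)
 have 2: "~ (5 dvd Np & 5 dvd Nm)" using coprime_common_divisor[OF coprime_NpNm, of 5] by auto
 have "f mod 4 < 4" by simp
 hence 3: "f mod 4 : {0, 3} | f mod 4 : {1, 2}" "~ (f mod 4 : {0, 3} & f mod 4 : {1, 2})" by auto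
 show "5 dvd Np <-> f mod 4 : {0, 3}" by (rule conjunct1[OF xor_iff[OF 1 2 3]])
 show "5 dvd Nm <-> f mod 4 : {1, 2}" by (rule conjunct2[OF xor_iff[OF 1 2 3]])
qed

text \<open>The case \<open>m = 3\<close>, \<open>p = 1\<close>, where
  \<open>8 + 4 + 1 = 13\<close>. Here \<open>f = 3 * e + 1\<close>, which exchanges the residues
  \<open>0, 3\<close> with \<open>1, 2\<close> modulo \<open>4\<close>; hence the opposite
  conditions to those for \<open>5\<close>.\<close>

lemma thirteen_dvd:
 assumes "3 dvd DD"
 shows "13 dvd Np <-> f mod 4 : {1, 2}" "13 dvd Nm <-> f mod 4 : {0, 3}"
proof -
 obtain c where c: "DD = 3 * c" using assms by (elim dvdE)
 obtain p e where pe: "3 = 2 * p + 1" "c = 2 * e + 1" "f = 2 * p * e + p + e" using DD_factor[OF c] by metis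
 have p: "p = 1" using pe(1) by simp
 have ab: "e mod 4 : {0, 3} --> 13 dvd Np" "e mod 4 : {1, 2} --> 13 dvd Nm"
  using AB_dvd(1,3)[OF c pe(1,2)] int_dvd_int_iff[of 13] by (simp_all add: p)
 have f: "f = 3 * e + 1" using pe(3) p by simp
 have "f mod 4 = 1 | f mod 4 = 2 <-> e mod 4 = 0 | e mod 4 = 3" "f mod 4 = 0 | f mod 4 = 3 <-> e mod 4 = 1 | e mod 4 = 2"
 proof -
  define v where "v = e mod 4"
  have "f = 4 * (3 * (e div 4)) + (3 * v + 1)" unfolding f v_def by presburger
  hence "f mod 4 = (3 * v + 1) mod 4" by (simp only: mod_mult_self4)
  moreover have "v < 4" by (simp add: v_def)
  hence "v = 0 | v = 1 | v = 2 | v = 3" by auto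
  ultimately show "f mod 4 = 1 | f mod 4 = 2 <-> e mod 4 = 0 | e mod 4 = 3" "f mod 4 = 0 | f mod 4 = 3 <-> e mod 4 = 1 | e mod 4 = 2"
   unfolding v_def[symmetric] by auto
 qed
 hence fe: "f mod 4 : {1, 2} <-> e mod 4 : {0, 3}" "f mod 4 : {0, 3} <-> e mod 4 : {1, 2}" by auto
 have 2: "~ (13 dvd Np & 13 dvd Nm)" using coprime_common_divisor[OF coprime_NpNm, of 13] by auto
 have "e mod 4 < 4" by simp
 hence 3: "e mod 4 : {0, 3} | e mod 4 : {1, 2}" "~ (e mod 4 : {0, 3} & e mod 4 : {1, 2})" by auto
 show "13 dvd Np <-> f mod 4 : {1, 2}" unfolding fe by (rule conjunct1[OF xor_iff[OF ab 2 3]])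
 show "13 dvd Nm <-> f mod 4 : {0, 3}" unfolding fe by (rule conjunct2[OF xor_iff[OF ab 2 3]])
qed

text \<open>Says that \<open>fr ^^ n\<close> fixes the character with number \<open>k\<close>; it is
  unrelated to the induced characters \<open>PP\<close>.\<close>

definition PP' :: "nat => int set => nat => int => bool" where
 "PP' M J n k <-> (EX t:J. [2 ^ n * k = k * t] (mod int M))"

abbreviation "J4 == {1, -1, int Q, - int Q}"

text \<open>The witness is \<open>k = M / N'\<close>, for which \<open>PP'\<close> becomes
  divisibility of some \<open>2 ^ n - t\<close> by \<open>N'\<close>. As \<open>c\<close> is odd and
  \<open>2 ^ (2 * m)\<close> is \<open>- 1\<close> modulo \<open>N'\<close>, there \<open>Q\<close>
  is \<open>2 ^ m\<close> up to sign; so an \<open>n < m\<close> would lead to an exponent excluded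
  by \<open>no\<close>.\<close>

lemma occ_N:
 assumes D: "DD = m * c" and N': "1 < N'" "odd N'" "N' dvd int M" "N' dvd 2 ^ (2 * m) + 1" and M: "0 < M"
  and no: "!!i. 0 < i ==> i < m ==> ~ N' dvd 2 ^ i - 1 & ~ N' dvd 2 ^ i + 1"
 obtains k where "~ int M dvd k" "PP' M J4 m k" "!!n. 0 < n ==> n < m ==> ~ PP' M J4 n k"
proof -
 obtain k where k: "int M = N' * k" using N'(3) by (elim dvdE)
 have "0 < N' * k" unfolding k[symmetric] using M by simp
 hence k0: "0 < k" using N'(1) zero_less_mult_pos[of N' k] by linarith
 have P: "PP' M J4 n k <-> (EX t:J4. N' dvd 2 ^ n - t)" for n
 proof -
  have "[2 ^ n * k = k * t] (mod int M) <-> N' dvd 2 ^ n - t" for t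
  proof -
   have "2 ^ n * k - k * t = (2 ^ n - t) * k" by (simp add: algebra_simps)
   thus ?thesis unfolding cong_iff_dvd_diff k using k0 by simp
  qed
  thus ?thesis by (simp add: PP'_def)
 qed
 obtain e where c: "c = 2 * e + 1" and Q: "int Q = (2 ^ m) ^ c" using DD_factor[OF D] by metis
 have "[(2 ^ (2 * m)) ^ e = (- 1) ^ e] (mod N')" using N'(4) by (intro cong_pow) (simp add: cong_iff_dvd_diff)
 hence "[2 ^ m * (2 ^ (2 * m)) ^ e = 2 ^ m * (- 1) ^ e] (mod N')" by (rule cong_scalar_left)
 also have "2 ^ m * (2 ^ (2 * m)) ^ e = int Q" unfolding Q c by (simp add: power_mult[symmetric] power_add[symmetric] algebra_simps)
 finally have Qc: "[int Q = 2 ^ m * (- 1) ^ e] (mod N')" .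
 have Qpm: "N' dvd 2 ^ m - int Q | N' dvd 2 ^ m + int Q"
  using Qc unfolding cong_iff_dvd_diff
  by (cases "even e") (auto simp: dvd_diff_commute add.commute)
 have "~ int M dvd k" unfolding k using N'(1) k0 by (auto dest!: zdvd_imp_le)
 moreover have "PP' M J4 m k" unfolding P using Qpm by auto
 moreover have "~ PP' M J4 n k" if n: "0 < n" "n < m" for n
 proof
  assume "PP' M J4 n k"
  hence "N' dvd 2 ^ n - int Q | N' dvd 2 ^ n + int Q" unfolding P using no[OF n] by auto
  hence "N' dvd 2 ^ n - 2 ^ m | N' dvd 2 ^ n + 2 ^ m"
   using Qpm by (smt (verit) dvd_add dvd_diff)
  moreover have "2 ^ n - 2 ^ m = - (2 ^ n * (2 ^ (m - n) - 1 :: int))" "2 ^ n + 2 ^ m = (2 ^ n * (2 ^ (m - n) + 1 :: int))"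
   using n by (simp_all add: algebra_simps flip: power_add)
  moreover have "coprime N' (2 ^ n)" using N'(2) by simp
  ultimately have "N' dvd 2 ^ (m - n) - 1 | N' dvd 2 ^ (m - n) + 1"
   by (metis coprime_dvd_mult_right_iff dvd_minus_iff)
  thus False using no[of "m - n"] n by simp
 qed
 ultimately show ?thesis using that by blast
qed

section \<open>Orbit lengths that occur and orbit lengths that do not\<close>

lemma N_dvd_Q2: "M : {Np, Nm} ==> int M dvd int Q * int Q + 1"
proof -
 have "int Q * int Q + 1 = int Np * int Nm" using arg_cong[OF NpNm, of int] by simp
 thus "M : {Np, Nm} ==> int M dvd int Q * int Q + 1" by auto
qed

lemma Q_mod: "int Q mod 3 = 2" "int Q mod 5 = 2 | int Q mod 5 = 3" "3 dvd DD ==> int Q mod 7 = 1"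
proof -
 have "int Q = 2 * 4 ^ f" by (simp add: Q_def power_mult)
 moreover have "(4 ^ f :: int) mod 3 = 1" by (induction f) (auto simp: mod_mult_eq[symmetric])
 ultimately show "int Q mod 3 = 2" by (simp add: mod_mult_right_eq[symmetric])
 have "(2 * 4 ^ f :: int) mod 5 = 2 | (2 * 4 ^ f :: int) mod 5 = 3"
 proof (induction f)
  case (Suc f)
  have "(2 * 4 ^ Suc f :: int) mod 5 = 4 * ((2 * 4 ^ f) mod 5) mod 5" by (simp add: mod_mult_right_eq)
  thus ?case using Suc by auto
 qed simp
 thus "int Q mod 5 = 2 | int Q mod 5 = 3" by (simp add: Q_def power_mult)
 assume "3 dvd DD"
 then obtain c where "DD = 3 * c" by (elim dvdE)
 hence "int Q = 8 ^ c" by (simp add: Q_def DD_def power_mult)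
 moreover have "(8 ^ c :: int) mod 7 = 1" by (induction c) (auto simp: mod_mult_eq[symmetric])
 ultimately show "int Q mod 7 = 1" by simp
qed

text \<open>Removes the factors \<open>3\<close> and \<open>7\<close>, which come from
  \<open>2 + 1\<close>, \<open>2 ^ 3 + 1\<close> and \<open>2 ^ 3 - 1\<close>.\<close>

lemma not_dvd_Q2: "~ 3 dvd int Q * int Q + 1" "3 dvd DD ==> ~ 7 dvd int Q * int Q + 1"
proof -
 have "[int Q * int Q + 1 = 2 * 2 + 1] (mod 3)" using Q_mod(1) by (intro cong_add cong_mult) (simp_all add: cong_def)
 from cong_dvd_iff[OF this] show "~ 3 dvd int Q * int Q + 1" by simp
 assume "3 dvd DD"
 hence "[int Q * int Q + 1 = 1 * 1 + 1] (mod 7)" using Q_mod(3) by (intro cong_add cong_mult) (simp_all add: cong_def)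
 from cong_dvd_iff[OF this] show "~ 7 dvd int Q * int Q + 1" by simp
qed

lemma primes_small: "prime (3 :: int)" "prime (5 :: int)" "prime (7 :: int)" "prime (13 :: int)"
 by (simp_all only: prime_int_numeral_eq) simp_all

lemma coprime_primeI: "prime p ==> ~ p dvd M ==> coprime M (p :: int)"
 using prime_imp_coprime[of p M] coprime_commute[of p M] by blast

lemma coprime_M:
 assumes M: "M : {Np, Nm}" and p: "prime (p :: int)" "~ p dvd int Q * int Q + 1"
 shows "coprime (int M) p"
 using coprime_primeI[OF p(1)] N_dvd_Q2[OF M] p(2) dvd_trans by blast

text \<open>For \<open>t = Q\<close> or \<open>t = - Q\<close> the square of \<open>t\<close> is
  \<open>- 1\<close> modulo \<open>M\<close>, so multiplying \<open>2 ^ n - t\<close> by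
  \<open>2 ^ n + t\<close> gives \<open>4 ^ n + 1\<close>.\<close>

lemma PP'_square:
 assumes M: "M : {Np, Nm}" and P: "PP' M J4 n k"
 shows "int M dvd (2 ^ n - 1) * k | int M dvd (2 ^ n + 1) * k | int M dvd (4 ^ n + 1) * k"
proof -
 obtain t where t: "t : J4" "int M dvd 2 ^ n * k - k * t" using P unfolding PP'_def cong_iff_dvd_diff by blast
 have *: "2 ^ n * k - k * t = (2 ^ n - t) * k" by (simp add: algebra_simps)
 show ?thesis
 proof (cases "t = 1 | t = - 1")
  case True
  thus ?thesis using t(2) unfolding * by auto
 next
  case False
  hence "t * t = int Q * int Q" using t(1) by auto
  hence "(4 ^ n + 1) * k = (2 ^ n + t) * ((2 ^ n - t) * k) + (int Q * int Q + 1) * k"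
   by (simp add: algebra_simps flip: power_mult_distrib)
  thus ?thesis using t(2) N_dvd_Q2[OF M] unfolding * by (metis dvd_add dvd_mult dvd_mult2)
 qed
qed

lemma non_occ_1:
 assumes M: "M : {Np, Nm}" and k: "~ int M dvd k" and 5: "~ 5 dvd M"
 shows "~ PP' M J4 1 k"
proof
 assume "PP' M J4 1 k"
 from PP'_square[OF M this] have *: "int M dvd k | int M dvd 3 * k | int M dvd 5 * k" by simp
 have "coprime (int M) 3" using coprime_M[OF M primes_small(1)] not_dvd_Q2 by simp
 moreover have "coprime (int M) 5" using 5 int_dvd_int_iff[of 5 M] by (intro coprime_primeI primes_small(2)) simp
 ultimately show False using * k by (simp add: coprime_dvd_mult_right_iff)
qed

text \<open>The three numbers of \<open>PP'_square\<close> are \<open>7\<close>, \<open>9\<close>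
  and \<open>65 = 5 * 13\<close>. Only the factor \<open>5\<close> can survive, and since
  \<open>Q\<close> is \<open>2\<close> or \<open>- 2\<close> modulo \<open>5\<close>, the character
  is then already fixed by \<open>fr\<close>.\<close>

lemma non_occ_3:
 assumes M: "M : {Np, Nm}" and D: "3 dvd DD" and k: "~ int M dvd k" and 13: "~ 13 dvd M" and P: "PP' M J4 3 k"
 shows "PP' M J4 1 k"
proof -
 have "(2 ^ 3 - 1) * k = 7 * k" "(2 ^ 3 + 1) * k = 3 * (3 * k)" "(4 ^ 3 + 1) * k = 13 * (5 * k)" by simp_all
 with PP'_square[OF M P] have *: "int M dvd 7 * k | int M dvd 3 * (3 * k) | int M dvd 13 * (5 * k)" by (simp only:)
 have c3: "coprime (int M) 3" using coprime_M[OF M primes_small(1)] not_dvd_Q2 by simp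
 have c7: "coprime (int M) 7" using coprime_M[OF M primes_small(3)] not_dvd_Q2 D by simp
 have c13: "coprime (int M) 13" using 13 int_dvd_int_iff[of 13 M] by (intro coprime_primeI primes_small(4)) simp
 have 5: "int M dvd 5 * k" using * k
  by (simp only: coprime_dvd_mult_right_iff[OF c3] coprime_dvd_mult_right_iff[OF c7] coprime_dvd_mult_right_iff[OF c13]) simp
 have "5 dvd 2 - int Q | 5 dvd 2 + int Q" using Q_mod(2) by presburger
 hence "int M dvd (2 - int Q) * k | int M dvd (2 + int Q) * k"
  using 5 by (metis dvd_def dvd_trans mult.assoc mult.commute dvd_triv_left)
 hence "int M dvd 2 ^ 1 * k - k * int Q | int M dvd 2 ^ 1 * k - k * (- int Q)" by (simp add: algebra_simps)
 thus ?thesis unfolding PP'_def cong_iff_dvd_diff by blast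
qed

text \<open>For \<open>m >= 5\<close> one of the two factors in \<open>AB_dvd\<close> divides
  \<open>M\<close>, and both exceed \<open>2 ^ (m - 1) + 1\<close>, so no smaller exponent occurs.
  For \<open>m = 1\<close> and \<open>m = 3\<close> the factors \<open>1\<close> and
  \<open>5\<close> are too small, and the other ones, \<open>5\<close> and \<open>13\<close>, are
  required to divide \<open>M\<close>.\<close>

lemma occ_N_all:
 assumes M: "M : {Np, Nm}" and m: "m dvd DD" "m = 1 --> 5 dvd M" "m = 3 --> 13 dvd M"
 obtains k where "~ int M dvd k" "PP' M J4 m k" "!!n. 0 < n ==> n < m ==> ~ PP' M J4 n k"
proof -
 obtain c where c: "DD = m * c" using m(1) by (elim dvdE)
 obtain p e where pe: "m = 2 * p + 1" "c = 2 * e + 1" using DD_factor[OF c] by metis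
 have M0: "0 < M" using M R_le by (auto simp: Np_def Nm_def)
 consider "p = 0" | "p = 1" | "2 <= p" by linarith
 thus ?thesis
 proof cases
  case 1
  hence m1: "m = 1" using pe by simp
  hence "5 dvd int M" using m(2) int_dvd_int_iff[of 5 M] by simp
  note d = this
  show ?thesis
  proof (rule occ_N[OF c _ _ d _ M0])
   show "~ 5 dvd 2 ^ i - (1 :: int) & ~ 5 dvd 2 ^ i + (1 :: int)" if "0 < i" "i < m" for i using that m1 by simp
   fix k assume "~ int M dvd k" "PP' M J4 m k" "!!n. 0 < n ==> n < m ==> ~ PP' M J4 n k"
   thus thesis by (rule that)
  qed (simp_all add: m1)
 next
  case 2
  hence m3: "m = 3" using pe by simp
  hence d: "13 dvd int M" using m(3) int_dvd_int_iff[of 13 M] by simp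
  have no: "~ 13 dvd 2 ^ i - (1 :: int) & ~ 13 dvd 2 ^ i + (1 :: int)" if "0 < i" "i < m" for i
  proof -
   have "i = 1 | i = 2" using that m3 by auto
   thus ?thesis by auto
  qed
  show ?thesis
  proof (rule occ_N[OF c _ _ d _ M0 no])
   fix k assume "~ int M dvd k" "PP' M J4 m k" "!!n. 0 < n ==> n < m ==> ~ PP' M J4 n k"
   thus thesis by (rule that)
  qed (simp_all add: m3)
 next
  case 3
  define a b :: int where "a = 2 ^ m" and "b = 2 ^ (p + 1)"
  have bb: "b * b = 2 * a" unfolding a_def b_def pe(1) by (rule pow_bb)
  have "e mod 4 < 4" by simp
  hence "e mod 4 : {0, 3} | e mod 4 : {1, 2}" by auto
  hence "a + b + 1 dvd int M | a - b + 1 dvd int M"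
  proof
   assume "e mod 4 : {0, 3}"
   thus ?thesis using AB_dvd(1,2)[OF c pe, folded a_def b_def] M by (elim insertE emptyE) simp_all
  next
   assume "e mod 4 : {1, 2}"
   thus ?thesis using AB_dvd(3,4)[OF c pe, folded a_def b_def] M by (elim insertE emptyE) simp_all
  qed
  then obtain N' where N': "N' = a + b + 1 | N' = a - b + 1" "N' dvd int M" by blast
  have e: "even a" "even b" by (simp_all add: a_def b_def pe)
  have big: "2 ^ (m - 1) + 1 < N'"
  proof -
   have "p + 1 < 2 * p" using 3 by simp
   hence "b < 2 ^ (2 * p)" unfolding b_def by (intro power_strict_increasing) auto
   moreover have "a = 2 * 2 ^ (2 * p)" by (simp add: a_def pe)
   moreover have "2 ^ (m - 1) = (2 ^ (2 * p) :: int)" by (simp add: pe)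
   moreover have "0 < b" by (simp add: b_def)
   ultimately show ?thesis using N'(1) by auto
  qed
  have "0 < (2 ^ (m - 1) :: int)" by simp
  hence N1: "1 < N'" using big by linarith
  have "(a + b + 1) * (a - b + 1) = a * a + 1" using bb by (simp add: algebra_simps)
  also have "... = 2 ^ (2 * m) + 1" by (simp add: a_def power_mult power2_eq_square mult.commute[of 2] power_mult_distrib flip: power_mult) (simp add: power_add mult_2_right)
  finally have d: "N' dvd 2 ^ (2 * m) + 1" using N'(1) by (metis dvd_triv_left dvd_triv_right)
  have no: "~ N' dvd 2 ^ i - 1 & ~ N' dvd 2 ^ i + 1" if i: "0 < i" "i < m" for i
  proof -
   have "(2 ^ i :: int) <= 2 ^ (m - 1)" using i by (intro power_increasing) auto
   moreover have "(2 :: int) <= 2 ^ i" using power_increasing[of 1 i "2 :: int"] i by simp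
   ultimately have "(0 :: int) < 2 ^ i - 1" "2 ^ i - 1 < N'" "(0 :: int) < 2 ^ i + 1" "2 ^ i + 1 < N'" using big by linarith+
   thus ?thesis using zdvd_not_zless by blast
  qed
  have "odd N'" using N'(1) e by auto
  thus ?thesis using occ_N[OF c N1 _ N'(2) d M0 no] that by blast
 qed
qed

text \<open>The witness is \<open>k = (Q - 1) / (2 ^ m - 1)\<close>; for \<open>n < m\<close> both
  \<open>2 ^ n - 1\<close> and \<open>2 ^ n + 1\<close> are positive and smaller than
  \<open>2 ^ m - 1\<close>.\<close>

lemma occ_0:
 assumes m: "m dvd DD" "m ~= 1"
 obtains k where "~ int (Q - 1) dvd k" "PP' (Q - 1) {1, -1} m k" "!!n. 0 < n ==> n < m ==> ~ PP' (Q - 1) {1, -1} n k"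
proof -
 obtain c where c: "DD = m * c" using m(1) by (elim dvdE)
 obtain p e where pe: "m = 2 * p + 1" "c = 2 * e + 1" and Q: "int Q = (2 ^ m) ^ c" using DD_factor[OF c] by metis
 have m3: "3 <= m" using pe m(2) by simp
 define N' :: int where "N' = 2 ^ m - 1"
 have "[(2 ^ m) ^ c = 1 ^ c] (mod N')" by (intro cong_pow) (simp add: cong_iff_dvd_diff N'_def)
 hence "N' dvd int Q - 1" by (simp add: Q cong_iff_dvd_diff)
 moreover have Q1: "int (Q - 1) = int Q - 1" using Q_ge by (simp add: of_nat_diff)
 ultimately obtain k where k: "int (Q - 1) = N' * k" by (metis dvdE)
 have mm: "(2 ^ m :: int) = 2 * 2 ^ (m - 1)" "(4 :: int) <= 2 ^ (m - 1)"
 proof -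
  show "(2 ^ m :: int) = 2 * 2 ^ (m - 1)" using m3 by (simp flip: power_Suc)
  have "(2 ^ 2 :: int) <= 2 ^ (m - 1)" using m3 by (intro power_increasing) auto
  thus "(4 :: int) <= 2 ^ (m - 1)" by simp
 qed
 have N1: "1 < N'" using mm by (simp add: N'_def)
 have "0 < N' * k" unfolding k[symmetric] Q1 using Q_ge by simp
 hence k0: "0 < k" using N1 zero_less_mult_pos[of N' k] by linarith
 have P: "PP' (Q - 1) {1, -1} n k <-> N' dvd 2 ^ n - 1 | N' dvd 2 ^ n + 1" for n
 proof -
  have "[2 ^ n * k = k * t] (mod int (Q - 1)) <-> N' dvd 2 ^ n - t" for t
  proof -
   have "2 ^ n * k - k * t = (2 ^ n - t) * k" by (simp add: algebra_simps)
   thus ?thesis unfolding cong_iff_dvd_diff k using k0 by simp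
  qed
  thus ?thesis by (simp add: PP'_def)
 qed
 have "~ int (Q - 1) dvd k" unfolding k using N1 k0 by (auto dest!: zdvd_imp_le)
 moreover have "PP' (Q - 1) {1, -1} m k" unfolding P by (simp add: N'_def)
 moreover have "~ PP' (Q - 1) {1, -1} n k" if n: "0 < n" "n < m" for n
 proof -
  have "(2 ^ n :: int) <= 2 ^ (m - 1)" using n by (intro power_increasing) auto
  moreover have "(2 :: int) <= 2 ^ n" using power_increasing[of 1 n "2 :: int"] n by simp
  ultimately have "(0 :: int) < 2 ^ n - 1" "2 ^ n - 1 < N'" "(0 :: int) < 2 ^ n + 1" "2 ^ n + 1 < N'" using mm N'_def by linarith+
  thus ?thesis unfolding P using zdvd_not_zless by blast
 qed
 ultimately show ?thesis using that by blast
qed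

text \<open>If doubling fixes \<open>k\<close> up to sign, then \<open>Q - 1\<close> divides
  \<open>k\<close> or \<open>3 * k\<close>; but \<open>Q\<close> is \<open>2\<close> modulo
  \<open>3\<close>, so \<open>3\<close> can be cancelled.\<close>

lemma non_occ_0: "~ int (Q - 1) dvd k ==> ~ PP' (Q - 1) {1, -1} 1 k"
proof
 assume k: "~ int (Q - 1) dvd k" and "PP' (Q - 1) {1, -1} 1 k"
 hence "int (Q - 1) dvd k | int (Q - 1) dvd 3 * k" by (auto simp: PP'_def cong_iff_dvd_diff)
 moreover have "coprime (int (Q - 1)) 3"
 proof -
  have "(int Q - 1) mod 3 = 1" using Q_mod(1) by presburger
  hence "~ 3 dvd int (Q - 1)" using Q_ge by (simp add: of_nat_diff dvd_eq_mod_eq_0)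
  thus ?thesis using primes_small(1) by (simp add: coprime_commute prime_imp_coprime)
 qed
 ultimately show False using k by (simp add: coprime_dvd_mult_right_iff)
qed

section \<open>From the orbits of \<open>fr\<close> to the degrees of \<open>G\<close>\<close>

definition EE :: "(F2bar mat => complex) => nat => bool" where
 "EE \<chi> n <-> (ALL x:Cz. \<chi> ((fr ^^ n) x) = \<chi> x)"

abbreviation "per0 == cyc_ext.per Sz fr"

text \<open>The case \<open>j = 1\<close>, which makes the facts about \<open>per\<close> available
  for \<open>fr\<close> itself; the other groups are compared with it in
  \<open>per_eq\<close>.\<close>

lemma auto_cyc: "cyc_ext (AG(|carrier := auto Sz|)) Sz inn (frr 1) fr DD"
proof -
 have "subgroup (auto Sz) AG" using group.subgroup_self[OF Sz.AutoGroup] by (simp add: AG_carrier)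
 moreover have "Inn Sz <= auto Sz" using inn_auto by (auto simp: Inn_eq)
 ultimately show ?thesis using aut_structure[OF _ _ refl, of "auto Sz"] by auto
qed

lemmas per0_pos = cyc_ext.per(1)[OF auto_cyc] and per0_DD = cyc_ext.per_dvd_d[OF auto_cyc]

lemma EE_iff: "EE \<chi> n <-> per0 \<chi> dvd n"
 unfolding EE_def using cyc_ext.per_dvd[OF auto_cyc, of \<chi> n] cyc_ext.per_mult[OF auto_cyc, of _ \<chi>] by (auto elim!: dvdE)

lemma per0_eqI: "EE \<chi> m ==> 0 < m ==> (!!n. 0 < n ==> n < m ==> ~ EE \<chi> n) ==> per0 \<chi> = m"
 unfolding cyc_ext.per_def[OF auto_cyc] EE_def[symmetric] by (rule Least_equality) (auto simp: not_less[symmetric])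

lemma gcd_factor:
 assumes "0 < (j::nat)"
 obtains m' j' where "m = gcd m j * m'" "j = gcd m j * j'" "coprime m' j'"
 using gcd_coprime_exists[of m j] assms by (metis gcd_eq_0_iff mult.commute neq0_conv)

text \<open>After division by the greatest common divisor, \<open>per0 \<chi>\<close> and
  \<open>j\<close> become coprime, so \<open>per0 \<chi>\<close> divides \<open>j * k\<close> just
  when the reduced period divides \<open>k\<close>.\<close>

lemma per_eq:
 assumes "cyc_ext G Sz \<iota> x (fr ^^ j) d" and j: "0 < j"
 shows "cyc_ext.per Sz (fr ^^ j) \<chi> = per0 \<chi> div gcd (per0 \<chi>) j"
proof -
 interpret C: cyc_ext G Sz \<iota> x "fr ^^ j" d by (rule assms(1))
 obtain m' j' where mj: "per0 \<chi> = gcd (per0 \<chi>) j * m'" "j = gcd (per0 \<chi>) j * j'" and cop: "coprime m' j'"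
  using gcd_factor[OF j] .
 define g where "g = gcd (per0 \<chi>) j"
 have g0: "0 < g" using j by (simp add: g_def)
 note mj = mj[folded g_def]
 have E: "(ALL s:Cz. \<chi> (((fr ^^ j) ^^ k) s) = \<chi> s) <-> m' dvd k" for k
 proof -
  have "(ALL s:Cz. \<chi> (((fr ^^ j) ^^ k) s) = \<chi> s) <-> EE \<chi> (j * k)" unfolding EE_def funpow_mult by (simp add: mult.commute)
  also have "... <-> g * m' dvd g * (j' * k)" unfolding EE_iff by (subst (1) mj(1), subst (1) mj(2)) (simp only: mult.assoc)
  also have "... <-> m' dvd k" using g0 cop by (simp add: coprime_dvd_mult_right_iff)
  finally show ?thesis .
 qed
 have "C.per \<chi> = m'" unfolding C.per_def E
  by (rule Least_equality) (use per0_pos[of \<chi>] mj(1) in \<open>auto dest: dvd_imp_le\<close>)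
 also have "m' = per0 \<chi> div g" by (subst mj(1)) (use g0 in simp)
 finally show ?thesis by (simp add: g_def)
qed

lemma fam_periods:
 assumes "fam M J dg Y" and odd: "odd M"
 shows "(EX \<chi>:Y. per0 \<chi> = m) <-> 0 < m & (EX k. ~ int M dvd k & PP' M J m k & (ALL n. 0 < n --> n < m --> ~ PP' M J n k))"
proof -
 obtain c :: "int => F2bar mat => complex" where
  Y: "Y = {restrict (c k) (Cz) | k. ~ int M dvd k}"
  and fr: "!!k i x. x : Cz ==> c k ((fr ^^ i) x) = c (2 ^ i * k) x"
  and eq: "!!k l. ~ int M dvd k ==> ~ int M dvd l ==> (ALL x:Cz. c k x = c l x) <-> (EX j:J. [k = l * j] (mod int M))"
  using assms(1) unfolding fam_def by (elim exE conjE) (rule that, assumption, blast+)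
 have E: "EE (restrict (c k) (Cz)) n <-> PP' M J n k" if k: "~ int M dvd k" for k n
 proof -
  have "coprime (int M) (2 ^ n)" using odd by simp
  hence k2: "~ int M dvd 2 ^ n * k" using k by (simp add: coprime_dvd_mult_right_iff)
  have "EE (restrict (c k) (Cz)) n <-> (ALL x:Cz. c (2 ^ n * k) x = c k x)" by (simp add: EE_def fr)
  thus ?thesis unfolding eq[OF k2 k] PP'_def .
 qed
 show ?thesis
 proof
  assume "EX \<chi>:Y. per0 \<chi> = m"
  then obtain k where k: "~ int M dvd k" "per0 (restrict (c k) (Cz)) = m" unfolding Y by blast
  have "0 < m" using per0_pos k(2) by blast
  moreover have "PP' M J n k <-> m dvd n" for n using E[OF k(1)] EE_iff k(2) by simp
  ultimately show "0 < m & (EX k. ~ int M dvd k & PP' M J m k & (ALL n. 0 < n --> n < m --> ~ PP' M J n k))"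
   using k(1) by (intro conjI exI[of _ k]) (auto dest: dvd_imp_le)
 next
  assume "0 < m & (EX k. ~ int M dvd k & PP' M J m k & (ALL n. 0 < n --> n < m --> ~ PP' M J n k))"
  then obtain k where k: "0 < m" "~ int M dvd k" "PP' M J m k" "!!n. 0 < n ==> n < m ==> ~ PP' M J n k" by blast
  have "per0 (restrict (c k) (Cz)) = m"
   by (rule per0_eqI) (use k E[OF k(2)] in auto)
  thus "EX \<chi>:Y. per0 \<chi> = m" unfolding Y using k(2) by blast
 qed
qed

lemma DD_pos: "0 < DD" by (simp add: DD_def)

lemma periods_0:
 assumes "fam (Q - 1) {1, -1} dg Y"
 shows "(EX \<chi>:Y. per0 \<chi> = m) <-> m dvd DD & m ~= 1"
proof
 assume l: "EX \<chi>:Y. per0 \<chi> = m"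
 hence "m dvd DD" using per0_DD by blast
 moreover have "m ~= 1" using l non_occ_0 unfolding fam_periods[OF assms odd_Q1] by blast
 ultimately show "m dvd DD & m ~= 1" by simp
next
 assume m: "m dvd DD & m ~= 1"
 hence "0 < m" using DD_pos by (metis dvd_0_left_iff neq0_conv)
 moreover obtain k where "~ int (Q - 1) dvd k" "PP' (Q - 1) {1, -1} m k" "!!n. 0 < n ==> n < m ==> ~ PP' (Q - 1) {1, -1} n k"
  using occ_0 m by blast
 ultimately show "EX \<chi>:Y. per0 \<chi> = m" unfolding fam_periods[OF assms odd_Q1] by blast
qed

lemma periods_N:
 assumes M: "M : {Np, Nm}" and fam: "fam M J4 dg Y"
 shows "(EX \<chi>:Y. per0 \<chi> = m) <-> m dvd DD & (m = 1 --> 5 dvd M) & (m = 3 --> 13 dvd M)"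
proof -
 have odd: "odd M" using M odd_N by auto
 show ?thesis
 proof
  assume l: "EX \<chi>:Y. per0 \<chi> = m"
  hence d: "m dvd DD" using per0_DD by blast
  obtain k where k: "~ int M dvd k" "PP' M J4 m k" "!!n. 0 < n ==> n < m ==> ~ PP' M J4 n k"
   using l unfolding fam_periods[OF fam odd] by blast
  have "5 dvd M" if "m = 1" using non_occ_1[OF M k(1)] k(2) that by blast
  moreover have "13 dvd M" if "m = 3"
  proof (rule ccontr)
   assume "~ 13 dvd M"
   hence "PP' M J4 1 k" using non_occ_3[OF M _ k(1)] d k(2) that by blast
   thus False using k(3)[of 1] that by simp
  qed
  ultimately show "m dvd DD & (m = 1 --> 5 dvd M) & (m = 3 --> 13 dvd M)" using d by blast
 next
  assume m: "m dvd DD & (m = 1 --> 5 dvd M) & (m = 3 --> 13 dvd M)"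
  hence "0 < m" using DD_pos by (metis dvd_0_left_iff neq0_conv)
  moreover obtain k where "~ int M dvd k" "PP' M J4 m k" "!!n. 0 < n ==> n < m ==> ~ PP' M J4 n k"
   using occ_N_all[OF M] m by metis
  ultimately show "EX \<chi>:Y. per0 \<chi> = m" unfolding fam_periods[OF fam odd] by blast
 qed
qed

text \<open>A divisor \<open>b\<close> of \<open>d\<close> is an orbit length of
  \<open>fr ^^ j\<close> as soon as \<open>b * j\<close> is one of \<open>fr\<close>. Hypothesis
  \<open>big\<close> covers the situation where it is not: then \<open>b = 1\<close>, and a
  character fixed by \<open>fr\<close> takes its place. Only for \<open>j = 1\<close> do the
  exceptions expressed by \<open>Pr\<close> remain visible.\<close>

lemma degree_multiples:
 assumes dj: "d * j = DD" and C: "cyc_ext G Sz \<iota> x (fr ^^ j) d"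
  and Pr: "!!m. (EX \<chi>:Y. per0 \<chi> = m) <-> m dvd DD & Pr m"
  and big: "!!b. j ~= 1 ==> b dvd d ==> Pr (b * j) | (b = 1 & Pr 1)"
  and one: "!!\<chi>. \<chi> : Y ==> \<chi> (I4) = of_nat dg"
 shows "{of_nat (cyc_ext.per Sz (fr ^^ j) \<chi>) * \<chi> (I4) | \<chi>. \<chi> : Y} = {of_nat dg * of_nat b | b. b dvd d & (j = 1 --> Pr b)}"
proof -
 have j0: "0 < j" using dj DD_pos by (cases j) auto
 note pe = per_eq[OF C j0]
 have div: "m div gcd m j dvd d" if "m dvd DD" for m
 proof -
  obtain m' j' where mj: "m = gcd m j * m'" "j = gcd m j * j'" and cop: "coprime m' j'"
   using gcd_factor[OF j0] .
  define g where "g = gcd m j"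
  have g0: "0 < g" using j0 by (simp add: g_def)
  note mj = mj[folded g_def]
  have "g * m' dvd g * (d * j')" using that unfolding dj[symmetric] by (subst (asm) mj(1), subst (asm) mj(2)) (simp only: mult_ac)
  hence "m' dvd d * j'" using g0 by simp
  hence "m' dvd d" using cop by (simp add: coprime_dvd_mult_left_iff)
  moreover have "m div g = m'" by (subst mj(1)) (use g0 in simp)
  ultimately show ?thesis by (simp add: g_def)
 qed
 have occ: "(EX \<chi>:Y. per0 \<chi> div gcd (per0 \<chi>) j = b) <-> b dvd d & (j = 1 --> Pr b)" for b
 proof
  assume "EX \<chi>:Y. per0 \<chi> div gcd (per0 \<chi>) j = b"
  then obtain m where m: "m dvd DD" "Pr m" "m div gcd m j = b" using Pr by blast
  thus "b dvd d & (j = 1 --> Pr b)" using div[OF m(1)] by auto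
 next
  assume b: "b dvd d & (j = 1 --> Pr b)"
  have "EX m. m dvd DD & Pr m & m div gcd m j = b"
  proof (cases "Pr (b * j)")
   case True
   have "b * j dvd DD" unfolding dj[symmetric] using b by (simp add: mult_dvd_mono)
   moreover have "b * j div gcd (b * j) j = b" using j0 by simp
   ultimately show ?thesis using True by blast
  next
   case False
   hence "j ~= 1" using b by auto
   hence "b = 1 & Pr 1" using big[of b] b False by blast
   thus ?thesis by (intro exI[of _ 1]) simp
  qed
  then obtain m where m: "m dvd DD" "Pr m" "m div gcd m j = b" by blast
  thus "EX \<chi>:Y. per0 \<chi> div gcd (per0 \<chi>) j = b" using Pr[of m] by blast
 qed
 show ?thesis
 proof (intro equalityI subsetI)
  fix z assume "z : {of_nat (cyc_ext.per Sz (fr ^^ j) \<chi>) * \<chi> (I4) | \<chi>. \<chi> : Y}"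
  then obtain \<chi> where \<chi>: "\<chi> : Y" "z = of_nat (per0 \<chi> div gcd (per0 \<chi>) j) * of_nat dg" using one unfolding pe by auto
  hence "z = of_nat dg * of_nat (per0 \<chi> div gcd (per0 \<chi>) j)" by (simp only: mult.commute)
  thus "z : {of_nat dg * of_nat b | b. b dvd d & (j = 1 --> Pr b)}" using occ \<chi>(1) by blast
 next
  fix z :: complex assume "z : {of_nat dg * of_nat b | b. b dvd d & (j = 1 --> Pr b)}"
  then obtain b where b: "z = of_nat dg * of_nat b" "b dvd d & (j = 1 --> Pr b)" by blast
  then obtain \<chi> where \<chi>: "\<chi> : Y" "per0 \<chi> div gcd (per0 \<chi>) j = b" using occ by blast
  have "z = of_nat (cyc_ext.per Sz (fr ^^ j) \<chi>) * \<chi> (I4)" unfolding pe \<chi>(2) one[OF \<chi>(1)] b(1) by (rule mult.commute)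
  thus "z : {of_nat (cyc_ext.per Sz (fr ^^ j) \<chi>) * \<chi> (I4) | \<chi>. \<chi> : Y}" using \<chi>(1) by blast
 qed
qed

lemma fam_one: "fam M J dg Y ==> \<chi> : Y ==> \<chi> (I4) = of_nat dg"
 by (auto simp: fam_def)

theorem cd_Suzuki_extension:
 assumes G: "subgroup G AG" and Inn: "Inn Sz <= G" and d: "d = group_index (AG(|carrier := G|)) (Inn Sz)"
 shows "cd (AG(|carrier := G|)) = {1, of_nat (Q * Q), of_nat ((Q - 1) * (R div 2))} Un
  ({of_nat (Q * Q + 1) * of_nat a | a. a dvd d & (G = auto Sz --> a ~= 1)} Un
  ({of_nat ((Q - 1) * Nm) * of_nat b | b. b dvd d & (G = auto Sz --> (b = 1 --> f mod 4 : {0, 3}) & (b = 3 --> f mod 4 : {1, 2}))} Un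
  {of_nat ((Q - 1) * Np) * of_nat c | c. c dvd d & (G = auto Sz --> (c = 1 --> f mod 4 : {1, 2}) & (c = 3 --> f mod 4 : {0, 3}))}))"
proof -
 obtain j where dj: "d * j = DD" and Gj: "G = auto Sz <-> j = 1" and C: "cyc_ext (AG(|carrier := G|)) Sz inn (frr j) (fr ^^ j) d"
  using aut_structure[OF assms] by blast
 interpret C: cyc_ext "AG(|carrier := G|)" Sz inn "frr j" "fr ^^ j" d by (rule C)
 obtain St W1 W2 X0 Xp Xm where Irr: "Irr Sz = {\<lambda>x\<in>Cz. 1, St, W1, W2} Un (X0 Un (Xp Un Xm))"
  and deg: "St (I4) = of_nat (Q * Q)" "W1 (I4) = of_nat ((Q - 1) * (R div 2))" "W2 (I4) = of_nat ((Q - 1) * (R div 2))"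
  and fr: "!!x. x : Cz ==> St (fr x) = St x & W1 (fr x) = W1 x & W2 (fr x) = W2 x"
  and fam: "fam (Q - 1) {1, -1} (Q * Q + 1) X0" "fam Np J4 ((Q - 1) * Nm) Xp" "fam Nm J4 ((Q - 1) * Np) Xm"
  using Irr_Sz by (elim exE conjE) (rule that, (assumption | (drule (1) bspec, assumption))+)
 have j0: "0 < j" using dj DD_pos by (cases j) auto
 have fix1: "C.per \<chi> = 1" if "!!x. x : Cz ==> \<chi> (fr x) = \<chi> x" for \<chi>
 proof -
  have "EE \<chi> 1" using that by (simp add: EE_def)
  hence "per0 \<chi> = 1" by (simp add: EE_iff)
  thus ?thesis unfolding per_eq[OF C j0] by simp
 qed
 have p: "C.per (\<lambda>x\<in>Cz. 1) = 1" "C.per St = 1" "C.per W1 = 1" "C.per W2 = 1"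
  by (rule fix1, simp add: fr)+
 have jodd: "3 <= j" if "j ~= 1"
 proof -
  have "odd (d * j)" unfolding dj by (simp add: DD_def)
  hence "odd j" by simp
  thus ?thesis using that j0 by (cases "j = 2") auto
 qed
 have d0: "0 < d" using dj DD_pos by (cases d) auto
 have bj: "b * j ~= 1 & (b * j = 3 --> b = 1 & 3 dvd DD)" if b: "b dvd d" and j: "j ~= 1" for b
 proof -
  have b0: "0 < b" using b d0 by (metis dvd_0_left_iff neq0_conv)
  have "b * 3 <= b * j" using jodd[OF j] by simp
  moreover have "b * j dvd DD" unfolding dj[symmetric] using b by (simp add: mult_dvd_mono)
  moreover have "b <= 1" if "b * j = 3" using \<open>b * 3 <= b * j\<close> that by linarith
  ultimately show ?thesis using b0 by (metis One_nat_def le_antisym less_eq_Suc_le mult_le_cancel2 numeral_One numeral_le_iff semiring_norm(69) mult_1 order_trans that not_less zero_less_numeral le_numeral_extra(4) nat_mult_1_right mult_eq_1_iff)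
 qed
 have 1: "{of_nat (C.per \<chi>) * \<chi> (I4) | \<chi>. \<chi> : X0} = {of_nat (Q * Q + 1) * of_nat a | a. a dvd d & (G = auto Sz --> a ~= 1)}"
  unfolding Gj by (rule degree_multiples[where Pr = "%a. a ~= 1" and Y = X0, OF dj C periods_0[OF fam(1)]], use bj in blast, rule fam_one[OF fam(1)])
 have N: "{of_nat (C.per \<chi>) * \<chi> (I4) | \<chi>. \<chi> : Y} =
   {of_nat dg * of_nat b | b. b dvd d & (G = auto Sz --> (b = 1 --> 5 dvd M) & (b = 3 --> 13 dvd M))}"
  if M: "M : {Np, Nm}" and fam: "fam M J4 dg Y" for M dg Y
  unfolding Gj
 proof (rule degree_multiples[where Pr = "%b. (b = 1 --> 5 dvd M) & (b = 3 --> 13 dvd M)" and Y = Y, OF dj C periods_N[OF M fam]])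
  fix b assume j: "j ~= 1" and b: "b dvd d"
  \<comment> \<open>Without \<open>13\<close> the residue of \<open>f\<close> is the one for which
    \<open>5\<close> divides \<open>M\<close>; so when the length \<open>3\<close> is missing, which
    matters for \<open>j = 3\<close> and \<open>b = 1\<close>, the length \<open>1\<close> is
    available.\<close>
  have five: "5 dvd M" if "3 dvd DD" "~ 13 dvd M"
  proof -
   have "f mod 4 < 4" by simp
   hence "f mod 4 : {0, 3} | f mod 4 : {1, 2}" by auto
   moreover have "M = Np | M = Nm" using M by simp
   ultimately show ?thesis using that(2) five_dvd thirteen_dvd[OF that(1)] by metis
  qed
  show "((b * j = 1 --> 5 dvd M) & (b * j = 3 --> 13 dvd M)) | b = 1 & (1 = 1 --> 5 dvd M) & (1 = (3::nat) --> 13 dvd M)"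
  proof (cases "b * j = 3 & ~ 13 dvd M")
   case True
   thus ?thesis using bj[OF b j] five by simp
  qed (use bj[OF b j] in blast)
 qed (rule fam_one[OF fam])
 have dd: "d = DD" if "G = auto Sz" using that Gj dj by simp
 \<comment> \<open>The criterion for \<open>13\<close> needs \<open>3 dvd DD\<close>. This holds
   whenever the criterion matters, since for \<open>G = auto Sz\<close> one has
   \<open>d = DD\<close>, and \<open>b = 3\<close> divides \<open>d\<close>.\<close>
 have cond: "(b dvd d & (G = auto Sz --> (b = 1 --> A) & (b = 3 --> B))) = (b dvd d & (G = auto Sz --> (b = 1 --> A') & (b = 3 --> B')))"
  if "A = A'" "3 dvd DD --> B = B'" for A A' B B' and b :: nat
  using that dd by blast
 have 2: "{of_nat (C.per \<chi>) * \<chi> (I4) | \<chi>. \<chi> : Xp} =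
   {of_nat ((Q - 1) * Nm) * of_nat b | b. b dvd d & (G = auto Sz --> (b = 1 --> f mod 4 : {0, 3}) & (b = 3 --> f mod 4 : {1, 2}))}"
  unfolding N[OF insertI1 fam(2)] by (simp only: cond[OF five_dvd(1) impI[OF thirteen_dvd(1)]])
 have 3: "{of_nat (C.per \<chi>) * \<chi> (I4) | \<chi>. \<chi> : Xm} =
   {of_nat ((Q - 1) * Np) * of_nat c | c. c dvd d & (G = auto Sz --> (c = 1 --> f mod 4 : {1, 2}) & (c = 3 --> f mod 4 : {0, 3}))}"
  unfolding N[OF insertI2[OF singletonI] fam(3)] by (simp only: cond[OF five_dvd(2) impI[OF thirteen_dvd(2)]])
 define h where "h \<chi> = of_nat (C.per \<chi>) * \<chi> (I4)" for \<chi>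
 have im: "{of_nat (C.per \<chi>) * \<chi> (I4) | \<chi>. \<chi> : Y} = h ` Y" for Y by (auto simp: h_def)
 have "cd (AG(|carrier := G|)) = h ` Irr Sz" unfolding C.cd_cyc im[symmetric] by simp
 also have "... = {h (\<lambda>x\<in>Cz. 1), h St, h W1, h W2} Un (h ` X0 Un (h ` Xp Un h ` Xm))" unfolding Irr by (simp add: image_Un)
 also have "h (\<lambda>x\<in>Cz. 1) = 1" unfolding h_def p by simp
 finally show ?thesis unfolding im[symmetric] 1 2 3 by (simp only: h_def p deg insert_absorb2 of_nat_1 mult_1)
qed

end

theorem theoremA:
  fixes f d :: nat
    and q2 r :: complex
    and S :: "F2bar mat monoid"
    and G :: "(F2bar mat \<Rightarrow> F2bar mat) set"
  assumes "f \<ge> 1"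
    and "q2 = 2 ^ (2 * f + 1)"
    and "r = 2 ^ (f + 1)"
    and "S = suzuki_group f"
    and "subgroup G (AutoGroup S)"
    and "Inn S \<subseteq> G"
    and "d = group_index ((AutoGroup S)\<lparr>carrier := G\<rparr>) (Inn S)"
  shows "cd ((AutoGroup S)\<lparr>carrier := G\<rparr>) =
    {1, q2\<^sup>2, r * (q2 - 1) / 2} \<union>
    {(q2\<^sup>2 + 1) * of_nat a | a.
       a dvd d \<and> \<not> (G = auto S \<and> a = 1)} \<union>
    {(q2 - r + 1) * (q2 - 1) * of_nat b | b.
       b dvd d \<and>
       \<not> (f mod 4 \<in> {1, 2} \<and> G = auto S \<and> b = 1) \<and>
       \<not> (f mod 4 \<in> {0, 3} \<and> G = auto S \<and> b = 3)} \<union>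
    {(q2 + r + 1) * (q2 - 1) * of_nat c | c.
       c dvd d \<and>
       \<not> (f mod 4 \<in> {1, 2} \<and> G = auto S \<and> c = 3) \<and>
       \<not> (f mod 4 \<in> {0, 3} \<and> G = auto S \<and> c = 1)}"
proof -
 interpret suzuki f by unfold_locales (rule assms(1))
 have S: "S = Sz" by (simp add: Sz_def assms(4))
 have q: "q2 = of_nat Q" and r: "r = of_nat R" by (simp_all add: assms(2,3) Q_def R_def)
 have Q1: "of_nat (Q - 1) = q2 - 1" using Q_ge by (simp add: q of_nat_diff)
 have np: "of_nat Np = q2 + r + 1" by (simp add: Np_def q r)
 have nm: "of_nat Nm = q2 - r + 1" using arg_cong[OF Nm_add, of "of_nat :: nat => complex"] by (simp add: q r algebra_simps)
 have degs: "of_nat (Q * Q) = q2\<^sup>2" "of_nat ((Q - 1) * (R div 2)) = r * (q2 - 1) / 2" "of_nat (Q * Q + 1) = q2\<^sup>2 + 1"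
  "of_nat ((Q - 1) * Nm) = (q2 - r + 1) * (q2 - 1)" "of_nat ((Q - 1) * Np) = (q2 + r + 1) * (q2 - 1)"
  unfolding of_nat_mult Q1 np nm by (simp_all add: q r R2' power2_eq_square)
 have "f mod 4 < 4" by simp
 hence f4: "f mod 4 : {0, 3} <-> f mod 4 ~: {1, 2}" by auto
 have c1: "(G = auto S --> a ~= 1) <-> ~ (G = auto S & a = 1)" for a :: nat by blast
 have c2: "(G = auto S --> (b = 1 --> f mod 4 : {0, 3}) & (b = 3 --> f mod 4 : {1, 2})) <->
   ~ (f mod 4 : {1, 2} & G = auto S & b = 1) & ~ (f mod 4 : {0, 3} & G = auto S & b = 3)" for b :: nat
  unfolding f4 by blast
 have c3: "(G = auto S --> (c = 1 --> f mod 4 : {1, 2}) & (c = 3 --> f mod 4 : {0, 3})) <->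
   ~ (f mod 4 : {1, 2} & G = auto S & c = 3) & ~ (f mod 4 : {0, 3} & G = auto S & c = 1)" for c :: nat
  unfolding f4 by blast
 show ?thesis
  using cd_Suzuki_extension[folded S, OF assms(5-7)]
  unfolding degs c1 c2 c3 Un_assoc .
qed

end
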